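(* Let $\Omega$, $\Gamma$, $B_1,B_2$ and $R_0$ be as described in the context, and let $\Omega(R_0,\Gamma)=\overline{\Omega\setminus T_{R_0}(\Gamma)}$. There is a positive constant $C$ depending only on $n$, $\Omega$ and the boundary operators $B_1,B_2$ such that for every eigenfunction $u$, i.e. nonzero solution of $\triangle^2u=\lambda^2u$ in $\Omega$ with $B_ju=0$ on $\partial\Omega$, $j=1,2$, $$\mathcal{H}^{n-1}\left(\{x\in\Omega(R_0,\Gamma): u(x)=0\}\right)\le C\sqrt\lambda.$$
   Context: Let $n\ge2$; $\Omega\subseteq\mathbb{R}^n$ is a bounded domain with $C^\infty$, piecewise analytic boundary; $\Gamma\subseteq\partial\Omega$ is a finite union of compact $(n-2)$-dimensional submanifolds of $\partial\Omega$, and $\partial\Omega\setminus\Gamma$ is (real) analytic. $B_ju=\sum_{|\alpha|\le3}a_{\alpha,j}(x)D^\alpha u(x)$ on $\partial\Omega$, $j=1,2$, with $a_{\alpha,j}$ all $C^\infty$ and piecewise analytic on $\partial\Omega$ and analytic on $\partial\Omega\setminus\Gamma$. $\lambda>0$. $T_r(\Gamma)=\{x\in\overline\Omega: \mathrm{dist}(x,\Gamma)\le r\}$; $\mathcal{H}^{n-1}$ is Hausdorff measure. The eigenfunction $u$ is regarded as analytically extended across $\partial\Omega$ away from $\Gamma$. With $v=\triangle u-\lambda u$, $g(x,x_{n+1})=u(x)e^{\sqrt\lambda x_{n+1}}$, $h(x,x_{n+1})=v(x)e^{\sqrt\lambda x_{n+1}}$, the frequency function on balls $B_r(y_0)\subset\mathbb{R}^{n+1}$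 is $$N(y_0,r)=r\,\frac{\int_{B_r(y_0)}\left(|\nabla g|^2+|\nabla h|^2+gh+2\lambda g^2\right)dy}{\int_{\partial B_r(y_0)}(g^2+h^2)\,d\sigma}.$$ $R_0$ is a fixed (suitably small) positive constant depending only on $n$ and $\Omega$ with the property: there is a constant $C'>0$ depending only on $n,\Omega,B_1,B_2$ such that $N((x,0),r)\le C'\sqrt\lambda$ for every eigenfunction $u$, i.e. every nonzero solution of $\triangle^2u=\lambda^2u$ in $\Omega$ with $B_ju=0$ on $\partial\Omega$, $j=1,2$ (analytically extended across $\partial\Omega$ away from $\Gamma$), every $x\in\overline{\Omega\setminus T_{R_0}(\Gamma)}$ and every $0<r<R_0/2$. *)

theory Defs
  imports "HOL-Analysis.Analysis"
begin

section \<open>Partial derivatives, smoothness and real analyticity\<close>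

definition partial_deriv :: "'n \<Rightarrow> (real^'n \<Rightarrow> real) \<Rightarrow> real^'n \<Rightarrow> real" where
  "partial_deriv i f x = frechet_derivative f (at x) (axis i 1)"

fun iterated_partial :: "'n list \<Rightarrow> (real^'n \<Rightarrow> real) \<Rightarrow> real^'n \<Rightarrow> real" where
  "iterated_partial [] f = f"
| "iterated_partial (i # is) f = partial_deriv i (iterated_partial is f)"

definition mi_order :: "('n::finite \<Rightarrow> nat) \<Rightarrow> nat" where
  "mi_order \<alpha> = (\<Sum>i\<in>UNIV. \<alpha> i)"

text \<open>
  The operator \<open>D\<^sup>\<alpha>\<close> takes \<open>\<alpha> i\<close> derivatives in direction \<open>i\<close>.  The order in which they are taken is
  left unspecified; it is irrelevant for functions of class \<open>C\<^sup>k\<close> with \<open>k \<ge> mi_order \<alpha>\<close>, and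
  the operator is only applied to such functions.
\<close>
definition mi_deriv :: "('n \<Rightarrow> nat) \<Rightarrow> (real^'n \<Rightarrow> real) \<Rightarrow> real^'n \<Rightarrow> real" where
  "mi_deriv \<alpha> f = iterated_partial (SOME is. \<forall>i. count_list is i = \<alpha> i) f"

definition gradient :: "(real^'n \<Rightarrow> real) \<Rightarrow> real^'n \<Rightarrow> real^'n" where
  "gradient f x = (\<chi> i. partial_deriv i f x)"

definition laplacian :: "(real^'n \<Rightarrow> real) \<Rightarrow> real^'n \<Rightarrow> real" where
  "laplacian f x = (\<Sum>i\<in>UNIV. iterated_partial [i, i] f x)"

text \<open>The following three notions are meant for open sets \<open>S\<close>.\<close>

definition Ck_on :: "nat \<Rightarrow> (real^'n) set \<Rightarrow> (real^'n \<Rightarrow> real) \<Rightarrow> bool" where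
  "Ck_on k S f \<longleftrightarrow>
     (\<forall>is. length is < k \<longrightarrow> iterated_partial is f differentiable_on S) \<and>
     (\<forall>is. length is \<le> k \<longrightarrow> continuous_on S (iterated_partial is f))"

definition smooth_on :: "(real^'n) set \<Rightarrow> (real^'n \<Rightarrow> real) \<Rightarrow> bool" where
  "smooth_on S f \<longleftrightarrow> (\<forall>k. Ck_on k S f)"

definition real_analytic_on :: "(real^'n) set \<Rightarrow> (real^'n \<Rightarrow> real) \<Rightarrow> bool" where
  "real_analytic_on S f \<longleftrightarrow>
     (\<forall>x\<in>S. \<exists>r>0. \<exists>c :: ('n \<Rightarrow> nat) \<Rightarrow> real. \<forall>y\<in>ball x r.
        ((\<lambda>\<alpha>. c \<alpha> * (\<Prod>i\<in>UNIV. (y $ i - x $ i) ^ \<alpha> i)) has_sum f y) UNIV)"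


section \<open>Boundary regularity, submanifolds and functions on them\<close>

text \<open>
  The parameter \<open>reg\<close> is a regularity class, below either \<^const>\<open>smooth_on\<close> or
  \<^const>\<open>real_analytic_on\<close>.
\<close>

definition boundary_of_class ::
  "((real^'n) set \<Rightarrow> (real^'n \<Rightarrow> real) \<Rightarrow> bool) \<Rightarrow> (real^'n) set \<Rightarrow> (real^'n) set \<Rightarrow> bool" where
  "boundary_of_class reg \<Omega> S \<longleftrightarrow>
     (\<forall>p\<in>S. \<exists>V \<rho>. open V \<and> p \<in> V \<and> reg V \<rho> \<and> (\<forall>y\<in>V. gradient \<rho> y \<noteq> 0) \<and>
        \<Omega> \<inter> V = {y\<in>V. \<rho> y < 0} \<and> frontier \<Omega> \<inter> V = {y\<in>V. \<rho> y = 0})"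

definition function_of_class ::
  "((real^'n) set \<Rightarrow> (real^'n \<Rightarrow> real) \<Rightarrow> bool) \<Rightarrow> (real^'n) set \<Rightarrow> (real^'n \<Rightarrow> real) \<Rightarrow> bool" where
  "function_of_class reg S f \<longleftrightarrow>
     (\<forall>p\<in>S. \<exists>V F. open V \<and> p \<in> V \<and> reg V F \<and> (\<forall>y\<in>S \<inter> V. F y = f y))"

text \<open>Embedded \<open>C\<^sup>\<infinity>\<close> submanifolds (without boundary) of \<open>\<real>\<^sup>n\<close> of codimension \<open>k\<close>.\<close>

definition submanifold_codim :: "nat \<Rightarrow> (real^'n) set \<Rightarrow> bool" where
  "submanifold_codim k M \<longleftrightarrow>
     (\<forall>p\<in>M. \<exists>V (F :: nat \<Rightarrow> real^'n \<Rightarrow> real). open V \<and> p \<in> V \<and> (\<forall>j<k. smooth_on V (F j)) \<and>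
        (\<forall>y\<in>V. \<forall>c. (\<Sum>j<k. c j *\<^sub>R gradient (F j) y) = 0 \<longrightarrow> (\<forall>j<k. c j = 0)) \<and>
        M \<inter> V = {y\<in>V. \<forall>j<k. F j y = 0})"

text \<open>
  Codimension 2 in \<open>\<real>\<^sup>n\<close> is dimension \<open>n - 2\<close>; an embedded submanifold of \<open>\<real>\<^sup>n\<close> that is contained in
  the embedded hypersurface \<open>\<partial>\<Omega>\<close> is the same as an embedded submanifold of \<open>\<partial>\<Omega>\<close>.
\<close>
definition admissible_singular_set :: "(real^'n) set \<Rightarrow> (real^'n) set \<Rightarrow> bool" where
  "admissible_singular_set \<Omega> \<Gamma> \<longleftrightarrow>
     (\<exists>\<M>. finite \<M> \<and> (\<forall>M\<in>\<M>. compact M \<and> M \<subseteq> frontier \<Omega> \<and> submanifold_codim 2 M) \<and> \<Gamma> = \<Union>\<M>)"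

text \<open>
  \<open>T\<^sub>r(\<Gamma>)\<close>.  The distance to the empty set is infinite, whereas \<^term>\<open>infdist x {} = 0\<close>; the
  first conjunct makes the tube around the empty set empty.
\<close>
definition tube :: "(real^'n) set \<Rightarrow> (real^'n) set \<Rightarrow> real \<Rightarrow> (real^'n) set" where
  "tube \<Omega> \<Gamma> r = {x \<in> closure \<Omega>. \<Gamma> \<noteq> {} \<and> infdist x \<Gamma> \<le> r}"

definition inner_domain :: "(real^'n) set \<Rightarrow> (real^'n) set \<Rightarrow> real \<Rightarrow> (real^'n) set" where
  "inner_domain \<Omega> \<Gamma> r = closure (\<Omega> - tube \<Omega> \<Gamma> r)"


section \<open>The eigenvalue problem\<close>

text \<open>\<open>C\<^sup>k\<close> up to the boundary: all derivatives of order at most \<open>k\<close> extend continuously.\<close>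

definition Ck_up_to_boundary :: "nat \<Rightarrow> (real^'n) set \<Rightarrow> (real^'n \<Rightarrow> real) \<Rightarrow> bool" where
  "Ck_up_to_boundary k \<Omega> u \<longleftrightarrow>
     Ck_on k \<Omega> u \<and> continuous_on (closure \<Omega>) u \<and>
     (\<forall>is. length is \<le> k \<longrightarrow>
        (\<exists>w. continuous_on (closure \<Omega>) w \<and> (\<forall>x\<in>\<Omega>. w x = iterated_partial is u x)))"

text \<open>
  A boundary operator is given by its coefficients \<open>a \<alpha>\<close>, of which only those with
  \<open>mi_order \<alpha> \<le> 3\<close> matter.  At a boundary point \<open>D\<^sup>\<alpha> u\<close> is the value of the continuous extension.
\<close>
definition boundary_op ::
  "(('n \<Rightarrow> nat) \<Rightarrow> real^'n \<Rightarrow> real) \<Rightarrow> (real^'n) set \<Rightarrow> (real^'n \<Rightarrow> real) \<Rightarrow> real^'n \<Rightarrow> real" where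
  "boundary_op a \<Omega> u x =
     (\<Sum>\<alpha> | mi_order \<alpha> \<le> 3. a \<alpha> x * Lim (at x within \<Omega>) (mi_deriv \<alpha> u))"

definition admissible_coefficients ::
  "(real^'n) set \<Rightarrow> (real^'n) set \<Rightarrow> (('n \<Rightarrow> nat) \<Rightarrow> real^'n \<Rightarrow> real) \<Rightarrow> bool" where
  "admissible_coefficients \<Omega> \<Gamma> a \<longleftrightarrow>
     (\<forall>\<alpha>. mi_order \<alpha> \<le> 3 \<longrightarrow>
        function_of_class smooth_on (frontier \<Omega>) (a \<alpha>) \<and>
        function_of_class real_analytic_on (frontier \<Omega> - \<Gamma>) (a \<alpha>))"

definition eigenfunction ::
  "(real^'n) set \<Rightarrow> (('n \<Rightarrow> nat) \<Rightarrow> real^'n \<Rightarrow> real) \<Rightarrow> (('n \<Rightarrow> nat) \<Rightarrow> real^'n \<Rightarrow> real) \<Rightarrow>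
   real \<Rightarrow> (real^'n \<Rightarrow> real) \<Rightarrow> bool" where
  "eigenfunction \<Omega> a1 a2 lam u \<longleftrightarrow>
     Ck_on 4 \<Omega> u \<and> Ck_up_to_boundary 3 \<Omega> u \<and> (\<exists>x\<in>\<Omega>. u x \<noteq> 0) \<and>
     (\<forall>x\<in>\<Omega>. laplacian (laplacian u) x = lam\<^sup>2 * u x) \<and>
     (\<forall>x\<in>frontier \<Omega>. boundary_op a1 \<Omega> u x = 0 \<and> boundary_op a2 \<Omega> u x = 0)"

lemma finite_mi_order_le: "finite {\<alpha> :: 'n::finite \<Rightarrow> nat. mi_order \<alpha> \<le> k}"
proof (rule finite_subset)
  show "{\<alpha> :: 'n \<Rightarrow> nat. mi_order \<alpha> \<le> k} \<subseteq> PiE UNIV (\<lambda>_. {..k})"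
  proof
    fix \<alpha> :: "'n \<Rightarrow> nat"
    assume a: "\<alpha> \<in> {\<alpha>. mi_order \<alpha> \<le> k}"
    have "\<alpha> i \<le> mi_order \<alpha>" for i
      unfolding mi_order_def by (rule member_le_sum) auto
    with a show "\<alpha> \<in> PiE UNIV (\<lambda>_. {..k})"
      by (auto intro: order_trans)
  qed
qed (auto intro: finite_PiE)


section \<open>Hausdorff measure\<close>

text \<open>
  The normalisation (volume of the \<open>d\<close>-dimensional ball of diameter \<open>diameter C\<close>) makes
  \<open>H\<^sup>d\<close> coincide with the surface measure on \<open>d\<close>-dimensional submanifolds.
  The case distinction matters only for \<open>d = 0\<close>.
\<close>
definition hausdorff_weight :: "nat \<Rightarrow> 'a::metric_space set \<Rightarrow> ennreal" where
  "hausdorff_weight d C =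
     (if C = {} then 0 else ennreal (unit_ball_vol (real d) * (diameter C / 2) ^ d))"

definition hausdorff_pre :: "nat \<Rightarrow> real \<Rightarrow> 'a::metric_space set \<Rightarrow> ennreal" where
  "hausdorff_pre d \<delta> A =
     (INF C \<in> {C :: nat \<Rightarrow> 'a set. A \<subseteq> (\<Union>i. C i) \<and> (\<forall>i. bounded (C i) \<and> diameter (C i) \<le> \<delta>)}.
        \<Sum>i. hausdorff_weight d (C i))"

definition hausdorff :: "nat \<Rightarrow> 'a::metric_space set \<Rightarrow> ennreal" where
  "hausdorff d A = (SUP \<delta>\<in>{0<..}. hausdorff_pre d \<delta> A)"

text \<open>
  As a measure on the Borel sets; see \<open>emeasure_hausdorff_measure\<close> below.
\<close>
definition hausdorff_measure :: "nat \<Rightarrow> 'a::metric_space measure" where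
  "hausdorff_measure d = measure_of UNIV (sets borel) (hausdorff d)"

lemma hausdorff_pre_le:
  assumes "A \<subseteq> (\<Union>i. C i)" "\<And>i. bounded (C i)" "\<And>i. diameter (C i) \<le> \<delta>"
  shows "hausdorff_pre d \<delta> A \<le>
    (\<Sum>i. hausdorff_weight d (C i))"
  unfolding hausdorff_pre_def by (rule INF_lower) (use assms in auto)

lemma hausdorff_pre_mono: "A \<subseteq> B \<Longrightarrow> hausdorff_pre d \<delta> A \<le> hausdorff_pre d \<delta> B"
  unfolding hausdorff_pre_def by (rule INF_superset_mono) auto

lemma hausdorff_pre_antimono: "\<delta> \<le> \<delta>' \<Longrightarrow> hausdorff_pre d \<delta>' A \<le> hausdorff_pre d \<delta> A"
  unfolding hausdorff_pre_def by (rule INF_superset_mono) (auto intro: order_trans)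

lemma hausdorff_pre_le_hausdorff: "\<delta> > 0 \<Longrightarrow> hausdorff_pre d \<delta> A \<le> hausdorff d A"
  unfolding hausdorff_def by (rule SUP_upper) auto

lemma hausdorff_mono: "A \<subseteq> B \<Longrightarrow> hausdorff d A \<le> hausdorff d B"
  unfolding hausdorff_def by (intro SUP_mono) (auto intro: hausdorff_pre_mono)

lemma hausdorff_empty: "hausdorff d {} = 0"
proof -
  have "hausdorff_pre d \<delta> {} \<le> 0" if "\<delta> > 0" for \<delta>
    using hausdorff_pre_le[of "{}" "\<lambda>_. {}" \<delta> d] that by (simp add: hausdorff_weight_def)
  then have "hausdorff d {} \<le> 0"
    unfolding hausdorff_def by (intro SUP_least) auto
  then show ?thesis by simp
qed

lemma hausdorff_pre_UN:
  fixes A :: "nat \<Rightarrow> 'a::metric_space set"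
  shows "hausdorff_pre d \<delta> (\<Union>n. A n) \<le> (\<Sum>n. hausdorff_pre d \<delta> (A n))"
proof (rule ennreal_le_epsilon)
  fix e :: real
  assume e: "0 < e" and fin: "(\<Sum>n. hausdorff_pre d \<delta> (A n)) < top"
  have *: "hausdorff_pre d \<delta> (A n) < hausdorff_pre d \<delta> (A n) + e * (1/2)^Suc n" for n
    using fin e by (auto simp add: less_top dest!: ennreal_suminf_lessD)
  have "\<exists>C. A n \<subseteq> (\<Union>i. C i) \<and> (\<forall>i. bounded (C i) \<and> diameter (C i) \<le> \<delta>) \<and>
      (\<Sum>i. hausdorff_weight d (C i)) \<le> hausdorff_pre d \<delta> (A n) + e * (1/2)^Suc n" for n
  proof -
    obtain C where "A n \<subseteq> (\<Union>i. C i)" "\<forall>i. bounded (C i) \<and> diameter (C i) \<le> \<delta>"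
        "(\<Sum>i. hausdorff_weight d (C i)) < hausdorff_pre d \<delta> (A n) + e * (1/2)^Suc n"
      using *[of n] by (subst (asm) (1) hausdorff_pre_def) (auto simp only: INF_less_iff mem_Collect_eq)
    then show ?thesis by (intro exI[of _ C]) (simp add: less_imp_le)
  qed
  then obtain B where B: "\<And>n. A n \<subseteq> (\<Union>i. B n i)"
      "\<And>n i. bounded (B n i)" "\<And>n i. diameter (B n i) \<le> \<delta>"
      "\<And>n. (\<Sum>i. hausdorff_weight d (B n i)) \<le> hausdorff_pre d \<delta> (A n) + e * (1/2)^Suc n"
    by metis
  define C where "C = case_prod B o prod_decode"
  have "(\<Union>i. A i) \<subseteq> (\<Union>i. C i)"
    using B(1) by (auto simp add: C_def subset_eq) (metis prod.case prod_encode_inverse)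
  then have "hausdorff_pre d \<delta> (\<Union>n. A n) \<le> (\<Sum>i. hausdorff_weight d (C i))"
    by (rule hausdorff_pre_le) (auto simp: C_def split_def B)
  also have "\<dots> = (\<Sum>i. (\<lambda>p. hausdorff_weight d (case_prod B p)) (prod_decode i))"
    by (simp add: C_def)
  also have "\<dots> = (\<Sum>n. \<Sum>i. hausdorff_weight d (B n i))"
    by (rule suminf_ennreal_2dimen) simp
  also have "\<dots> \<le> (\<Sum>n. hausdorff_pre d \<delta> (A n) + e * (1/2) ^ Suc n)"
    by (intro suminf_le allI B(4)) auto
  also have "... = (\<Sum>n. hausdorff_pre d \<delta> (A n)) + (\<Sum>n. ennreal e * ennreal ((1/2) ^ Suc n))"
    using \<open>0 < e\<close> by (subst suminf_add[symmetric])
                     (auto simp del: ennreal_suminf_cmult simp add: ennreal_mult[symmetric])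
  also have "\<dots> = (\<Sum>n. hausdorff_pre d \<delta> (A n)) + e"
    unfolding ennreal_suminf_cmult
    by (subst suminf_ennreal_eq[OF zero_le_power power_half_series]) auto
  finally show "hausdorff_pre d \<delta> (\<Union>n. A n) \<le> (\<Sum>n. hausdorff_pre d \<delta> (A n)) + e" .
qed

lemma hausdorff_UN: "hausdorff d (\<Union>n :: nat. A n) \<le> (\<Sum>n. hausdorff d (A n))"
proof -
  have "hausdorff_pre d \<delta> (\<Union>n. A n) \<le> (\<Sum>n. hausdorff d (A n))" if "\<delta> > 0" for \<delta>
    using hausdorff_pre_UN[of d \<delta> A]
    by (rule order_trans) (intro suminf_le allI hausdorff_pre_le_hausdorff that, auto)
  then show ?thesis
    unfolding hausdorff_def[of d "\<Union>n. A n"] by (intro SUP_least) auto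
qed

lemma outer_measure_space_hausdorff: "outer_measure_space UNIV (hausdorff d)"
  unfolding outer_measure_space_def positive_def increasing_def countably_subadditive_def
  using hausdorff_empty hausdorff_mono hausdorff_UN by blast

lemma hausdorff_Un: "hausdorff d (A \<union> B) \<le> hausdorff d A + hausdorff d B"
proof -
  have "hausdorff d (\<Union>n. binaryset A B n) \<le> (\<Sum>n. hausdorff d (binaryset A B n))"
    by (rule hausdorff_UN)
  also have "\<dots> = hausdorff d A + hausdorff d B"
    by (rule suminf_binaryset_eq) (simp add: hausdorff_empty)
  finally show ?thesis by (simp add: UN_binaryset_eq)
qed

lemma hausdorff_separated:
  fixes A B :: "'a::metric_space set"
  assumes \<epsilon>: "\<epsilon> > 0" and sep: "\<And>x y. x \<in> A \<Longrightarrow> y \<in> B \<Longrightarrow> \<epsilon> \<le> dist x y"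
  shows "hausdorff d A + hausdorff d B \<le> hausdorff d (A \<union> B)"
proof -
  have pre: "hausdorff_pre d \<delta> A + hausdorff_pre d \<delta> B \<le> hausdorff_pre d \<delta> (A \<union> B)"
    if \<delta>: "0 < \<delta>" "\<delta> < \<epsilon>" for \<delta>
    unfolding hausdorff_pre_def[of d \<delta> "A \<union> B"]
  proof (rule INF_greatest)
    fix C :: "nat \<Rightarrow> 'a set"
    assume "C \<in> {C. A \<union> B \<subseteq> (\<Union>i. C i) \<and> (\<forall>i. bounded (C i) \<and> diameter (C i) \<le> \<delta>)}"
    then have C: "A \<union> B \<subseteq> (\<Union>i. C i)" "\<And>i. bounded (C i)" "\<And>i. diameter (C i) \<le> \<delta>"
      by auto
    define CA where "CA i = (if C i \<inter> A = {} then {} else C i)" for i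
    define CB where "CB i = (if C i \<inter> B = {} then {} else C i)" for i
    have "hausdorff_pre d \<delta> A \<le> (\<Sum>i. hausdorff_weight d (CA i))"
    proof (rule hausdorff_pre_le)
      show "A \<subseteq> (\<Union>i. CA i)"
      proof
        fix x assume "x \<in> A"
        moreover from this obtain i where "x \<in> C i" using C(1) by blast
        ultimately have "x \<in> CA i" by (auto simp: CA_def)
        then show "x \<in> (\<Union>i. CA i)" by blast
      qed
    qed (use C \<delta> in \<open>auto simp: CA_def\<close>)
    moreover have "hausdorff_pre d \<delta> B \<le> (\<Sum>i. hausdorff_weight d (CB i))"
    proof (rule hausdorff_pre_le)
      show "B \<subseteq> (\<Union>i. CB i)"
      proof
        fix x assume "x \<in> B"
        moreover from this obtain i where "x \<in> C i" using C(1) by blast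
        ultimately have "x \<in> CB i" by (auto simp: CB_def)
        then show "x \<in> (\<Union>i. CB i)" by blast
      qed
    qed (use C \<delta> in \<open>auto simp: CB_def\<close>)
    ultimately have "hausdorff_pre d \<delta> A + hausdorff_pre d \<delta> B \<le> (\<Sum>i. hausdorff_weight d (CA i)) + (\<Sum>i. hausdorff_weight d (CB i))"
      by (rule add_mono)
    also have "\<dots> = (\<Sum>i. hausdorff_weight d (CA i) + hausdorff_weight d (CB i))"
      by (rule suminf_add) auto
    also have "\<dots> \<le> (\<Sum>i. hausdorff_weight d (C i))"
    proof (rule suminf_le)
      fix i
      have "C i \<inter> A = {} \<or> C i \<inter> B = {}"
      proof (rule ccontr)
        assume "\<not> ?thesis"
        then obtain x y where xy: "x \<in> C i" "x \<in> A" "y \<in> C i" "y \<in> B" by blast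
        have "dist x y \<le> diameter (C i)"
          using xy C(2) by (intro diameter_bounded_bound) auto
        with sep[of x y] xy C(3)[of i] \<delta> show False by auto
      qed
      then show "hausdorff_weight d (CA i) + hausdorff_weight d (CB i) \<le> hausdorff_weight d (C i)"
        by (auto simp: CA_def CB_def hausdorff_weight_def)
    qed auto
    finally show "hausdorff_pre d \<delta> A + hausdorff_pre d \<delta> B \<le> (\<Sum>i. hausdorff_weight d (C i))" .
  qed
  have "hausdorff d A + hausdorff d B =
      (SUP \<delta>\<in>{0<..}. hausdorff_pre d \<delta> A + hausdorff_pre d \<delta> B)"
    unfolding hausdorff_def
  proof (rule SUP_add_directed_ennreal[symmetric])
    fix i j :: real assume "i \<in> {0<..}" "j \<in> {0<..}"
    then show "\<exists>k\<in>{0<..}. hausdorff_pre d i A + hausdorff_pre d j B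
        \<le> hausdorff_pre d k A + hausdorff_pre d k B"
      by (intro bexI[of _ "min i j"] add_mono hausdorff_pre_antimono) auto
  qed
  also have "\<dots> \<le> hausdorff d (A \<union> B)"
  proof (rule SUP_least)
    fix \<delta> :: real assume "\<delta> \<in> {0<..}"
    define \<eta> where "\<eta> = min \<delta> (\<epsilon> / 2)"
    have \<eta>: "0 < \<eta>" "\<eta> < \<epsilon>" "\<eta> \<le> \<delta>"
      using \<epsilon> \<open>\<delta> \<in> {0<..}\<close> by (auto simp: \<eta>_def)
    have "hausdorff_pre d \<delta> A + hausdorff_pre d \<delta> B \<le> hausdorff_pre d \<eta> A + hausdorff_pre d \<eta> B"
      by (intro add_mono hausdorff_pre_antimono \<eta>)
    also have "\<dots> \<le> hausdorff_pre d \<eta> (A \<union> B)"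
      by (rule pre[OF \<eta>(1,2)])
    also have "\<dots> \<le> hausdorff d (A \<union> B)"
      by (rule hausdorff_pre_le_hausdorff[OF \<eta>(1)])
    finally show "hausdorff_pre d \<delta> A + hausdorff_pre d \<delta> B \<le> hausdorff d (A \<union> B)" .
  qed
  finally show ?thesis .
qed

lemma hausdorff_separated_sum:
  fixes A :: "nat \<Rightarrow> 'a::metric_space set"
  assumes "\<And>i j. i < j \<Longrightarrow> \<exists>\<epsilon>>0. \<forall>x\<in>A i. \<forall>y\<in>A j. \<epsilon> \<le> dist x y"
  shows "(\<Sum>i<n. hausdorff d (A i)) \<le> hausdorff d (\<Union>i<n. A i)"
proof (induction n)
  case 0
  then show ?case by simp
next
  case (Suc n)
  have "\<exists>\<epsilon>>0. \<forall>i<m. \<forall>x\<in>A i. \<forall>y\<in>A n. \<epsilon> \<le> dist x y" if "m \<le> n" for m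
    using that
  proof (induction m)
    case 0
    then show ?case by (intro exI[of _ 1]) auto
  next
    case (Suc m)
    then obtain \<epsilon> where \<epsilon>: "\<epsilon> > 0" "\<forall>i<m. \<forall>x\<in>A i. \<forall>y\<in>A n. \<epsilon> \<le> dist x y"
      by auto
    obtain \<epsilon>' where \<epsilon>': "\<epsilon>' > 0" "\<forall>x\<in>A m. \<forall>y\<in>A n. \<epsilon>' \<le> dist x y"
      using assms[of m n] Suc.prems by auto
    have "\<forall>i<Suc m. \<forall>x\<in>A i. \<forall>y\<in>A n. min \<epsilon> \<epsilon>' \<le> dist x y"
      using \<epsilon>(2) \<epsilon>'(2) by (auto simp: less_Suc_eq min_le_iff_disj)
    then show ?case using \<epsilon>(1) \<epsilon>'(1) by (intro exI[of _ "min \<epsilon> \<epsilon>'"]) auto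
  qed
  then obtain \<epsilon> where "\<epsilon> > 0" "\<forall>i<n. \<forall>x\<in>A i. \<forall>y\<in>A n. \<epsilon> \<le> dist x y" by blast
  then have "hausdorff d (\<Union>i<n. A i) + hausdorff d (A n) \<le> hausdorff d ((\<Union>i<n. A i) \<union> A n)"
    by (intro hausdorff_separated[of \<epsilon>]) auto
  also have "(\<Union>i<n. A i) \<union> A n = (\<Union>i<Suc n. A i)"
    by (auto simp: less_Suc_eq)
  finally have "hausdorff d (\<Union>i<n. A i) + hausdorff d (A n) \<le> hausdorff d (\<Union>i<Suc n. A i)" .
  moreover have "(\<Sum>i<Suc n. hausdorff d (A i)) \<le> hausdorff d (\<Union>i<n. A i) + hausdorff d (A n)"
    using Suc.IH by (simp add: add_right_mono)
  ultimately show ?case by (rule order_trans[rotated])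
qed

lemma hausdorff_closed_additive:
  fixes F X :: "'a::metric_space set"
  assumes "closed F"
  shows "hausdorff d (X \<inter> F) + hausdorff d (X - F) \<le> hausdorff d X"
proof (cases "F = {} \<or> hausdorff d X = top")
  case True
  then show ?thesis by (auto simp: hausdorff_empty)
next
  case False
  define t where "t k = 1 / real (Suc k)" for k
  have t_pos: "t k > 0" for k by (simp add: t_def)
  have t_mono: "t j \<le> t i" if "i \<le> j" for i j
    using that by (simp add: t_def field_simps)
  have t_strict: "t j < t i" if "i < j" for i j
    using that by (simp add: t_def field_simps)
  define A where "A k = {y \<in> X - F. t k \<le> infdist y F}" for k
  define R where "R k = {y \<in> X - F. t (Suc k) \<le> infdist y F \<and> infdist y F < t k}" for k
  have sepR: "\<exists>\<epsilon>>0. \<forall>x\<in>R i. \<forall>y\<in>R j. \<epsilon> \<le> dist x y" if "Suc i < j" for i j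
  proof (intro exI conjI ballI)
    show "t (Suc i) - t j > 0" using t_strict[OF that] by simp
    fix x y assume "x \<in> R i" "y \<in> R j"
    then show "t (Suc i) - t j \<le> dist x y"
      using infdist_triangle[of x F y] by (auto simp: R_def)
  qed
  have half: "(\<Sum>i<n. hausdorff d (R (2 * i + c))) \<le> hausdorff d X" for n c
  proof -
    have "(\<Sum>i<n. hausdorff d (R (2 * i + c))) \<le> hausdorff d (\<Union>i<n. R (2 * i + c))"
      by (rule hausdorff_separated_sum) (rule sepR, simp)
    also have "\<dots> \<le> hausdorff d X"
      by (rule hausdorff_mono) (auto simp: R_def)
    finally show ?thesis .
  qed
  have split: "(\<Sum>i<2 * n. f i) = (\<Sum>i<n. f (2 * i + 0)) + (\<Sum>i<n. f (2 * i + 1))"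
    for f :: "nat \<Rightarrow> ennreal" and n
    by (induction n) (auto simp: algebra_simps)
  have "(\<Sum>i. hausdorff d (R i)) \<le> hausdorff d X + hausdorff d X"
  proof (rule suminf_le_const[OF summableI])
    fix n
    have "(\<Sum>i<n. hausdorff d (R i)) \<le> (\<Sum>i<2 * n. hausdorff d (R i))"
      by (rule sum_mono2) auto
    also have "\<dots> \<le> hausdorff d X + hausdorff d X"
      unfolding split by (intro add_mono half)
    finally show "(\<Sum>i<n. hausdorff d (R i)) \<le> hausdorff d X + hausdorff d X" .
  qed
  with False have S: "(\<Sum>i. hausdorff d (R i)) \<noteq> top"
    by (metis ennreal_add_eq_top neq_top_trans)
  show ?thesis
  proof (rule ennreal_le_epsilon)
    fix e :: real
    assume "e > 0"
    let ?S = "\<Sum>i. hausdorff d (R i)"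
    have "\<exists>k. (\<Sum>i. hausdorff d (R (i + k))) < e"
    proof (cases "?S = 0")
      case True
      then show ?thesis using \<open>e > 0\<close> by (intro exI[of _ 0]) simp
    next
      case False
      then have "?S - e < ?S"
        using S \<open>e > 0\<close> by (intro ennreal_between) (auto simp: less_top zero_less_iff_neq_zero)
      then obtain k where k: "?S - e < (\<Sum>i<k. hausdorff d (R i))"
        unfolding suminf_eq_SUP[of "\<lambda>i. hausdorff d (R i)"] less_SUP_iff by auto
      have eq: "?S = (\<Sum>i. hausdorff d (R (i + k))) + (\<Sum>i<k. hausdorff d (R i))"
        by (rule suminf_offset) auto
      then have fin: "(\<Sum>i<k. hausdorff d (R i)) \<noteq> top" "(\<Sum>i. hausdorff d (R (i + k))) \<noteq> top"
        using S by (auto simp: ennreal_add_eq_top)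
      have "?S < (\<Sum>i<k. hausdorff d (R i)) + e"
      proof (rule ccontr)
        assume "\<not> ?thesis"
        then have "((\<Sum>i<k. hausdorff d (R i)) + e) - e \<le> ?S - e"
          by (intro ennreal_minus_mono) auto
        with k show False by simp
      qed
      then show ?thesis
        unfolding eq using fin
        by (metis add.commute ennreal_add_left_cancel_less)
    qed
    then obtain k where k: "(\<Sum>i. hausdorff d (R (i + k))) < e" by blast
    have "X - F \<subseteq> A k \<union> (\<Union>i. R (i + k))"
    proof
      fix y assume y: "y \<in> X - F"
      then have pos: "infdist y F > 0"
        using False \<open>closed F\<close> by (metis DiffD2 in_closed_iff_infdist_zero infdist_nonneg less_eq_real_def)
      show "y \<in> A k \<union> (\<Union>i. R (i + k))"
      proof (cases "t k \<le> infdist y F")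
        case True
        then show ?thesis using y by (auto simp: A_def)
      next
        case False
        define m where "m = (LEAST m. t m \<le> infdist y F)"
        have ex: "\<exists>m. t m \<le> infdist y F"
          using pos reals_Archimedean[of "infdist y F"]
          by (auto simp: t_def inverse_eq_divide intro: less_imp_le)
        have m: "t m \<le> infdist y F"
          unfolding m_def using ex by (rule LeastI_ex)
        with False t_mono[of m k] have "k < m" by (meson leI order_trans)
        then obtain i where i: "m = Suc (i + k)"
          by (metis add.commute less_iff_Suc_add)
        have "\<not> t (i + k) \<le> infdist y F"
          using not_less_Least[of "i + k" "\<lambda>m. t m \<le> infdist y F"] i m_def by simp
        with m i y have "y \<in> R (i + k)" by (auto simp: R_def)
        then show ?thesis by blast
      qed
    qed
    then have "hausdorff d (X - F) \<le> hausdorff d (A k) + hausdorff d (\<Union>i. R (i + k))"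
      by (intro order_trans[OF hausdorff_mono hausdorff_Un])
    also have "\<dots> \<le> hausdorff d (A k) + e"
      using order_trans[OF hausdorff_UN[of d "\<lambda>i. R (i + k)"] less_imp_le[OF k]]
      by (rule add_left_mono)
    finally have "hausdorff d (X \<inter> F) + hausdorff d (X - F) \<le>
        (hausdorff d (X \<inter> F) + hausdorff d (A k)) + e"
      by (metis add.assoc add_left_mono)
    also have "hausdorff d (X \<inter> F) + hausdorff d (A k) \<le> hausdorff d ((X \<inter> F) \<union> A k)"
    proof (rule hausdorff_separated[OF t_pos[of k]])
      fix x y assume "x \<in> X \<inter> F" "y \<in> A k"
      then show "t k \<le> dist x y"
        using infdist_le[of x F y] by (auto simp: A_def dist_commute)
    qed
    also have "\<dots> \<le> hausdorff d X"
      by (rule hausdorff_mono) (auto simp: A_def)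
    finally show "hausdorff d (X \<inter> F) + hausdorff d (X - F) \<le> hausdorff d X + e"
      by (simp add: add_right_mono)
  qed
qed

text \<open>\<^const>\<open>hausdorff\<close> is a metric outer measure, hence countably additive on Borel sets.\<close>

lemma measure_space_hausdorff:
  "measure_space UNIV (sets borel) (hausdorff d :: 'a::metric_space set \<Rightarrow> ennreal)"
proof -
  interpret P: sigma_algebra "UNIV :: 'a set" UNIV
    using sigma_algebra_Pow[of "UNIV :: 'a set"] by simp
  let ?L = "lambda_system UNIV UNIV (hausdorff d :: 'a set \<Rightarrow> ennreal)"
  have L: "measure_space UNIV ?L (hausdorff d)"
    by (rule P.caratheodory_lemma[OF outer_measure_space_hausdorff])
  then interpret L: sigma_algebra UNIV ?L
    by (simp add: measure_space_def)
  have "F \<in> ?L" if "closed F" for F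
  proof -
    have "hausdorff d (X \<inter> F) + hausdorff d (X - F) = hausdorff d X" for X
    proof (rule antisym[OF hausdorff_closed_additive[OF that]])
      show "hausdorff d X \<le> hausdorff d (X \<inter> F) + hausdorff d (X - F)"
        using hausdorff_Un[of d "X \<inter> F" "X - F"] by (simp add: Int_Diff_Un)
    qed
    then show ?thesis by (simp add: P.lambda_system_eq)
  qed
  then have "sets (borel :: 'a measure) \<subseteq> ?L"
    using L.sigma_sets_subset[of "Collect closed"] unfolding borel_eq_closed by auto
  then show ?thesis
    using L sets.sigma_algebra_axioms[of "borel :: 'a measure"]
    by (auto simp: measure_space_def positive_def countably_additive_def)
qed

lemma sets_hausdorff_measure: "sets (hausdorff_measure d) = sets borel"
  using sets.sigma_sets_eq[of borel] by (simp add: hausdorff_measure_def)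

lemma emeasure_hausdorff_measure:
  "A \<in> sets borel \<Longrightarrow> emeasure (hausdorff_measure d) A = hausdorff d A"
  using measure_space_hausdorff[of d] sets.sigma_algebra_axioms[of borel]
  unfolding hausdorff_measure_def
  by (intro emeasure_measure_of_sigma) (auto simp: measure_space_def)


section \<open>The frequency function\<close>

text \<open>\<open>\<real>\<^sup>n\<^sup>+\<^sup>1\<close> is \<^typ>\<open>(real^'n) \<times> real\<close>.\<close>

definition grad_norm_sq :: "('a::euclidean_space \<Rightarrow> real) \<Rightarrow> 'a \<Rightarrow> real" where
  "grad_norm_sq f y = (\<Sum>b\<in>Basis. (frechet_derivative f (at y) b)\<^sup>2)"

definition exp_lift :: "real \<Rightarrow> (real^'n \<Rightarrow> real) \<Rightarrow> (real^'n) \<times> real \<Rightarrow> real" where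
  "exp_lift lam w y = w (fst y) * exp (sqrt lam * snd y)"

definition frequency :: "real \<Rightarrow> (real^'n \<Rightarrow> real) \<Rightarrow> (real^'n) \<times> real \<Rightarrow> real \<Rightarrow> real" where
  "frequency lam u y0 r =
     (let g = exp_lift lam u;
          h = exp_lift lam (\<lambda>x. laplacian u x - lam * u x)
      in r * (LINT y:ball y0 r|lborel.
                grad_norm_sq g y + grad_norm_sq h y + g y * h y + 2 * lam * (g y)\<^sup>2)
           / (LINT y:sphere y0 r|hausdorff_measure CARD('n). (g y)\<^sup>2 + (h y)\<^sup>2))"

definition analytic_extension ::
  "(real^'n) set \<Rightarrow> (real^'n) set \<Rightarrow> (real^'n \<Rightarrow> real) \<Rightarrow> (real^'n) set \<Rightarrow> (real^'n \<Rightarrow> real) \<Rightarrow> bool" where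
  "analytic_extension \<Omega> \<Gamma> u W U \<longleftrightarrow>
     open W \<and> closure \<Omega> - \<Gamma> \<subseteq> W \<and> real_analytic_on W U \<and> (\<forall>x\<in>closure \<Omega> - \<Gamma>. U x = u x)"

text \<open>
  The defining property of \<open>R\<^sub>0\<close>.  The frequency of \<open>u\<close> is that of its analytic extension \<open>U\<close>, which
  has to live on the balls \<open>B\<^sub>r(x)\<close>, \<open>r < R\<^sub>0 / 2\<close>; there it is uniquely determined by \<open>u\<close>.
\<close>
definition frequency_radius ::
  "(real^'n) set \<Rightarrow> (real^'n) set \<Rightarrow> (('n \<Rightarrow> nat) \<Rightarrow> real^'n \<Rightarrow> real) \<Rightarrow>
   (('n \<Rightarrow> nat) \<Rightarrow> real^'n \<Rightarrow> real) \<Rightarrow> real \<Rightarrow> bool" where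
  "frequency_radius \<Omega> \<Gamma> a1 a2 R0 \<longleftrightarrow>
     R0 > 0 \<and>
     (\<exists>C'>0. \<forall>lam>0. \<forall>u. eigenfunction \<Omega> a1 a2 lam u \<longrightarrow>
        (\<exists>W U. analytic_extension \<Omega> \<Gamma> u W U \<and>
           (\<forall>x\<in>inner_domain \<Omega> \<Gamma> R0. ball x (R0 / 2) \<subseteq> W \<and>
              (\<forall>r. 0 < r \<and> r < R0 / 2 \<longrightarrow> frequency lam U (x, 0) r \<le> C' * sqrt lam))))"

end

theory Submission
  imports Defs "HOL-Complex_Analysis.Conformal_Mappings"
begin

text \<open>
  Let \<open>U\<close> be the analytic extension of \<open>u\<close> and \<open>V = \<triangle>U - \<lambda>U\<close>, with lifts \<open>g\<close> and \<open>h\<close>.  Both \<open>h\<close> and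
  \<open>G = U cos (\<surd>\<lambda> t) + V (cos (\<surd>\<lambda> t) - cosh (\<surd>\<lambda> t)) / (2\<lambda>)\<close> are
  harmonic in \<open>n + 1\<close> variables, \<open>G\<close> equals \<open>U\<close> on \<open>t = 0\<close>, and \<open>|G|\<^sup>2 \<le> C exp (C\<surd>\<lambda>) (g\<^sup>2 + h\<^sup>2)\<close>.
  The frequency bound makes the weighted averages of \<open>g\<^sup>2 + h\<^sup>2\<close> grow at most like \<open>R\<close> to the power
  \<open>C\<surd>\<lambda>\<close>, so \<open>U\<close> is not smaller than \<open>exp (- C (1 + \<surd>\<lambda>))\<close> times its supremum everywhere near a
  point.  Interior estimates for \<open>G\<close> extend \<open>U\<close> holomorphically along real lines to discs of fixed
  radius, and Jensen-type zero counting bounds the number of zeros on every line through a point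
  where \<open>U\<close> is not small by \<open>C (1 + \<surd>\<lambda>)\<close>.  Centrally projecting the zero set from \<open>n\<close> such points
  turns this into \<open>H\<^sup>n\<^sup>-\<^sup>1 \<le> C (1 + \<surd>\<lambda>)\<close> on small balls.  For \<open>\<lambda>\<close> below a threshold, a Poincare
  inequality for \<open>g\<close> and \<open>h\<close> shows that \<open>U\<close> has no zeros at all, which removes the \<open>1\<close>.
\<close>

section \<open>Hausdorff measure\<close>

text \<open>The energy \<open>g ^ 2 + h ^ 2\<close> is averaged because its Laplacian is exactly
  twice the integrand in the numerator of the frequency. Since \<open>g\<close> is not harmonic,
  interior estimates need the other lift \<open>G\<close>. Weighted averages replace sphere
  integrals: differentiating one in the radius and integrating by parts raises the exponent of the
  weight by one and rests only on translation invariance of Lebesgue measure. The sphere integral in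
  the denominator of the frequency is then needed as an upper bound up to a constant, which packing
  provides at the price of a constant factor in the growth exponent, and as a positive number.
  Projection is central rather than orthogonal because lower bounds on \<open>U\<close> are
  available at selected points, not along whole families of parallel lines. There is one such point
  for each coordinate direction: at every zero some component of the normal of a level set through
  it dominates, and rays from the matching point cross that level set transversally.\<close>

lemma hausdorff_lipschitz_image:
  fixes f :: "'a::metric_space \<Rightarrow> 'b::metric_space"
  assumes L: "L > 0" and lip: "\<And>x y. x \<in> A \<Longrightarrow> y \<in> A \<Longrightarrow> dist (f x) (f y) \<le> L * dist x y"
  shows "hausdorff d (f ` A) \<le> ennreal (L ^ d) * hausdorff d A"
  unfolding hausdorff_def[of d "f ` A"]
proof (rule SUP_least)
  fix \<delta> :: real assume "\<delta> \<in> {0<..}"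
  then have \<delta>: "\<delta> > 0" by simp
  \<comment> \<open>Dividing by L^d leaves a lower bound for an infimum, so one cover at a time can
    be treated. Its members are cut down to \<open>A\<close>, where the Lipschitz bound is
    available.\<close>
  have "ennreal (1 / L ^ d) * hausdorff_pre d \<delta> (f ` A) \<le> hausdorff_pre d (\<delta> / L) A"
    unfolding hausdorff_pre_def[of d "\<delta> / L"]
  proof (rule INF_greatest)
    fix C :: "nat \<Rightarrow> 'a set"
    assume "C \<in> {C. A \<subseteq> (\<Union>i. C i) \<and> (\<forall>i. bounded (C i) \<and> diameter (C i) \<le> \<delta> / L)}"
    then have C: "A \<subseteq> (\<Union>i. C i)" "\<And>i. bounded (C i)" "\<And>i. diameter (C i) \<le> \<delta> / L"
      by auto
    define D where "D i = f ` (C i \<inter> A)" for i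
    have d: "dist x y \<le> L * diameter (C i)" if "x \<in> D i" "y \<in> D i" for x y i
    proof -
      obtain x' y' where xy: "x' \<in> C i" "x' \<in> A" "y' \<in> C i" "y' \<in> A" "x = f x'" "y = f y'"
        using \<open>x \<in> D i\<close> \<open>y \<in> D i\<close> unfolding D_def by blast
      have "dist x y \<le> L * dist x' y'" using lip[of x' y'] xy by simp
      also have "\<dots> \<le> L * diameter (C i)"
        using diameter_bounded_bound[OF C(2) xy(1,3)] L by simp
      finally show ?thesis .
    qed
    have diam: "diameter (D i) \<le> L * diameter (C i)" for i
    proof (cases "D i = {}")
      case True
      then show ?thesis using diameter_ge_0[OF C(2)] L by (simp add: diameter_def)
    next
      case False
      then show ?thesis unfolding diameter_def[of "D i"] using d
        by (auto intro!: cSUP_least simp del: dist_eq_0_iff)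
    qed
    have "hausdorff_pre d \<delta> (f ` A) \<le> (\<Sum>i. hausdorff_weight d (D i))"
    proof (rule hausdorff_pre_le)
      show "f ` A \<subseteq> (\<Union>i. D i)" using C(1) unfolding D_def by blast
      show "bounded (D i)" for i
        unfolding bounded_def by (metis d empty_iff)
      show "diameter (D i) \<le> \<delta>" for i
        using diam[of i] mult_left_mono[OF C(3)[of i], of L] L by simp
    qed
    also have "\<dots> \<le> (\<Sum>i. ennreal (L ^ d) * hausdorff_weight d (C i))"
    proof (rule suminf_le)
      fix i
      show "hausdorff_weight d (D i) \<le> ennreal (L ^ d) * hausdorff_weight d (C i)"
      proof (cases "D i = {}")
        case False
        then have ne: "C i \<noteq> {}" by (auto simp: D_def)
        have b: "bounded (D i)" unfolding bounded_def by (metis d empty_iff)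
        have "unit_ball_vol (real d) * (diameter (D i) / 2) ^ d
            \<le> unit_ball_vol (real d) * (L * (diameter (C i) / 2)) ^ d"
          using diam[of i] diameter_ge_0[OF b] by (intro mult_left_mono power_mono) auto
        then show ?thesis
          using ne False L diameter_ge_0[OF C(2), of i]
          by (simp add: hausdorff_weight_def ennreal_mult[symmetric] power_mult_distrib power_divide mult_ac)
      qed (simp add: hausdorff_weight_def)
    qed auto
    also have "\<dots> = ennreal (L ^ d) * (\<Sum>i. hausdorff_weight d (C i))" by simp
    finally have "ennreal (1 / L ^ d) * hausdorff_pre d \<delta> (f ` A)
        \<le> ennreal (1 / L ^ d) * (ennreal (L ^ d) * (\<Sum>i. hausdorff_weight d (C i)))"
      by (rule mult_left_mono) simp
    also have "\<dots> = (\<Sum>i. hausdorff_weight d (C i))"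
      using L by (simp add: mult.assoc[symmetric] ennreal_mult[symmetric])
    finally show "ennreal (1 / L ^ d) * hausdorff_pre d \<delta> (f ` A) \<le> (\<Sum>i. hausdorff_weight d (C i))" .
  qed
  also have "\<dots> \<le> hausdorff d A" using \<delta> L by (intro hausdorff_pre_le_hausdorff) simp
  finally have "ennreal (L ^ d) * (ennreal (1 / L ^ d) * hausdorff_pre d \<delta> (f ` A)) \<le> ennreal (L ^ d) * hausdorff d A"
    by (rule mult_left_mono) simp
  then show "hausdorff_pre d \<delta> (f ` A) \<le> ennreal (L ^ d) * hausdorff d A"
    using L by (simp add: mult.assoc[symmetric] ennreal_mult[symmetric])
qed

section \<open>Packing estimates for the Hausdorff measure\<close>

lemma compact_separated_net:
  fixes E :: "'a::metric_space set"
  assumes "compact E" "\<delta> > 0"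
  obtains X where "finite X" "X \<subseteq> E" "\<And>x y. x \<in> X \<Longrightarrow> y \<in> X \<Longrightarrow> x \<noteq> y \<Longrightarrow> \<delta> < dist x y"
    "E \<subseteq> (\<Union>x\<in>X. cball x \<delta>)"
proof -
  obtain F where F: "finite F" "E \<subseteq> (\<Union>x\<in>F. ball x (\<delta> / 2))"
    using compactE_image[OF assms(1), of E "\<lambda>x. ball x (\<delta> / 2)"] assms(2)
    by (metis (no_types, lifting) UN_I centre_in_ball half_gt_zero open_ball subsetI)
  define sep where "sep X \<longleftrightarrow> X \<subseteq> E \<and> (\<forall>x\<in>X. \<forall>y\<in>X. x \<noteq> y \<longrightarrow> \<delta> < dist x y)" for X :: "'a set"
  \<comment> \<open>Different points of a separated set lie in different balls of the finite cover,
    so separated sets have bounded size and one of maximal size exists; maximality makes it a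
    net.\<close>
  have card: "finite X \<and> card X \<le> card F" if X: "sep X" for X
  proof -
    have "\<forall>x\<in>X. \<exists>c\<in>F. x \<in> ball c (\<delta> / 2)" using X F(2) by (fastforce simp: sep_def)
    then obtain c where c: "\<And>x. x \<in> X \<Longrightarrow> c x \<in> F \<and> dist (c x) x < \<delta> / 2"
      by (metis mem_ball)
    have "inj_on c X"
    proof (rule inj_onI)
      fix x y assume xy: "x \<in> X" "y \<in> X" "c x = c y"
      have "dist x y \<le> dist (c x) x + dist (c x) y" by (metis dist_commute dist_triangle)
      also have "\<dots> < \<delta>" using c[of x] c[of y] xy by simp
      finally show "x = y" using X xy unfolding sep_def by (metis not_less_iff_gr_or_eq)
    qed
    then show ?thesis using F(1) c
      by (metis card_inj_on_le finite_imageD finite_subset image_subsetI)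
  qed
  have "sep {}" by (simp add: sep_def)
  then obtain X where X: "sep X" and max: "\<And>Y. sep Y \<Longrightarrow> card Y \<le> card X"
    using ex_has_greatest_nat[of sep "{}" card "Suc (card F)"] card by (metis le_imp_less_Suc)
  have "E \<subseteq> (\<Union>x\<in>X. cball x \<delta>)"
  proof
    fix e assume e: "e \<in> E"
    show "e \<in> (\<Union>x\<in>X. cball x \<delta>)"
    proof (rule ccontr)
      assume n: "\<not> ?thesis"
      then have far: "\<delta> < dist x e" if "x \<in> X" for x using that by auto
      have "e \<notin> X" using n assms(2) by force
      moreover have "sep (insert e X)" using X e far unfolding sep_def by (auto simp: dist_commute)
      ultimately show False using max[of "insert e X"] card[OF X] by simp
    qed
  qed
  then show ?thesis using that[of X] X card[OF X] unfolding sep_def by blast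
qed

lemma hausdorff_pre_finite_cover:
  fixes E :: "'a::metric_space set"
  assumes "finite X" "E \<subseteq> (\<Union>x\<in>X. cball x \<delta>)" "\<delta> > 0"
  shows "hausdorff_pre d (2 * \<delta>) E \<le> of_nat (card X) * ennreal (unit_ball_vol (real d) * \<delta> ^ d)"
proof -
  obtain xs where xs: "set xs = X" "length xs = card X"
    using assms(1) by (metis distinct_card finite_distinct_list)
  define C where "C i = (if i < length xs then cball (xs ! i) \<delta> else {})" for i
  have diam: "diameter (C i) \<le> 2 * \<delta>" for i
    unfolding diameter_def C_def using assms(3)
    by (auto intro!: cSUP_least) (metis dist_commute dist_triangle_le add_mono mult_2 order_refl)+
  have b: "bounded (C i)" for i by (simp add: C_def)
  have "hausdorff_pre d (2 * \<delta>) E \<le> (\<Sum>i. hausdorff_weight d (C i))"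
  proof (rule hausdorff_pre_le[OF _ b diam])
    show "E \<subseteq> (\<Union>i. C i)"
    proof
      fix e assume "e \<in> E"
      then obtain x where "x \<in> X" "e \<in> cball x \<delta>" using assms(2) by auto
      then obtain i where "i < length xs" "xs ! i = x" using xs by (metis in_set_conv_nth)
      then have "e \<in> C i" using \<open>e \<in> cball x \<delta>\<close> by (simp add: C_def)
      then show "e \<in> (\<Union>i. C i)" by blast
    qed
  qed
  also have "\<dots> = (\<Sum>i<length xs. hausdorff_weight d (C i))"
    by (rule suminf_finite) (auto simp: C_def hausdorff_weight_def)
  also have "\<dots> \<le> (\<Sum>i<length xs. ennreal (unit_ball_vol (real d) * \<delta> ^ d))"
  proof (rule sum_mono)
    fix i
    have "(diameter (C i) / 2) ^ d \<le> \<delta> ^ d"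
      using diam[of i] diameter_ge_0[OF b[of i]] by (intro power_mono) auto
    then show "hausdorff_weight d (C i) \<le> ennreal (unit_ball_vol (real d) * \<delta> ^ d)"
      by (auto simp: hausdorff_weight_def intro!: ennreal_leI mult_left_mono)
  qed
  also have "\<dots> = of_nat (card X) * ennreal (unit_ball_vol (real d) * \<delta> ^ d)"
    by (simp add: xs)
  finally show ?thesis .
qed

text \<open>Balls about a separated net cover \<open>E\<close>, and the net has at most as many
  points as there is room in \<open>T\<close> for disjoint pieces of measure \<open>q\<close>. The
  pieces are balls in a spherical shell in one use and boxes over a hyperplane in the other.\<close>

lemma hausdorff_pre_packing:
  fixes E :: "'a::metric_space set"
  assumes "compact E" "\<delta> > 0"
    and Q: "\<And>x. x \<in> E \<Longrightarrow> Q x \<in> sets M \<and> Q x \<subseteq> T \<and> q \<le> emeasure M (Q x)"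
    and disj: "\<And>x y. x \<in> E \<Longrightarrow> y \<in> E \<Longrightarrow> \<delta> < dist x y \<Longrightarrow> Q x \<inter> Q y = {}"
    and T: "T \<in> sets M"
  shows "q * hausdorff_pre d (2 * \<delta>) E \<le> ennreal (unit_ball_vol (real d) * \<delta> ^ d) * emeasure M T"
proof -
  obtain X where X: "finite X" "X \<subseteq> E" "\<And>x y. x \<in> X \<Longrightarrow> y \<in> X \<Longrightarrow> x \<noteq> y \<Longrightarrow> \<delta> < dist x y"
    "E \<subseteq> (\<Union>x\<in>X. cball x \<delta>)"
    using compact_separated_net[OF assms(1,2)] by metis
  have "of_nat (card X) * q = (\<Sum>x\<in>X. q)" by simp
  also have "\<dots> \<le> (\<Sum>x\<in>X. emeasure M (Q x))" using Q X(2) by (intro sum_mono) auto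
  also have "\<dots> = emeasure M (\<Union>x\<in>X. Q x)"
  proof (rule sum_emeasure)
    show "Q ` X \<subseteq> sets M" using Q X(2) by blast
    show "disjoint_family_on Q X" unfolding disjoint_family_on_def using disj X(2,3) by blast
  qed (rule X(1))
  also have "\<dots> \<le> emeasure M T" using Q X(2) by (intro emeasure_mono[OF _ T]) blast
  finally have *: "of_nat (card X) * q \<le> emeasure M T" .
  have "q * hausdorff_pre d (2 * \<delta>) E \<le> q * (of_nat (card X) * ennreal (unit_ball_vol (real d) * \<delta> ^ d))"
    by (intro mult_left_mono hausdorff_pre_finite_cover X assms(2)) simp
  also have "\<dots> = ennreal (unit_ball_vol (real d) * \<delta> ^ d) * (of_nat (card X) * q)"
    by (simp add: mult_ac)
  also have "\<dots> \<le> ennreal (unit_ball_vol (real d) * \<delta> ^ d) * emeasure M T"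
    by (intro mult_left_mono *) simp
  finally show ?thesis .
qed

lemma emeasure_closed_nbhds_INF:
  fixes K :: "'a::metric_space set"
  assumes "closed K" "K \<noteq> {}" and M: "sets M = sets borel"
    and fin: "\<And>n. emeasure M {y. infdist y K \<le> c / real (Suc n)} \<noteq> \<infinity>" and "c > 0"
  shows "(INF n. emeasure M {y. infdist y K \<le> c / real (Suc n)}) = emeasure M K"
proof -
  let ?A = "\<lambda>n. {y. infdist y K \<le> c / real (Suc n)}"
  have cl: "closed (?A n)" for n
    by (intro closed_Collect_le continuous_intros)
  have "(INF n. emeasure M (?A n)) = emeasure M (\<Inter>n. ?A n)"
  proof (rule INF_emeasure_decseq)
    show "range ?A \<subseteq> sets M" using cl M by auto
    show "decseq ?A"
    proof (unfold decseq_def, intro allI impI subsetI)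
      fix k l :: nat and y assume "k \<le> l" and y: "y \<in> ?A l"
      then have "c / real (Suc l) \<le> c / real (Suc k)"
        using \<open>c > 0\<close> by (intro divide_left_mono) auto
      with y show "y \<in> ?A k" by (auto simp only: mem_Collect_eq intro: order_trans)
    qed
  qed (use fin in auto)
  also have "(\<Inter>n. ?A n) = K"
  proof -
    have "y \<in> K" if "\<And>n. infdist y K \<le> c / real (Suc n)" for y
    proof -
      have "(\<lambda>n. c / real (Suc n)) \<longlonglongrightarrow> 0"
        by (rule LIMSEQ_Suc[OF lim_const_over_n])
      then have "infdist y K \<le> 0"
        using that by (intro LIMSEQ_le_const[of _ 0]) auto
      then show ?thesis
        using in_closed_iff_infdist_zero[OF assms(1,2)] infdist_nonneg[of y K] by auto
    qed
    then show ?thesis using \<open>c > 0\<close> by (auto simp: infdist_zero)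
  qed
  finally show ?thesis .
qed

lemma nn_integral_le_measure_mult:
  assumes [measurable]: "f \<in> borel_measurable N" and s: "sets M = sets N"
    and le: "\<And>A. A \<in> sets N \<Longrightarrow> emeasure M A \<le> c * emeasure N A"
  shows "(\<integral>\<^sup>+x. f x \<partial>M) \<le> c * (\<integral>\<^sup>+x. f x \<partial>N)"
  using assms(1)
proof (induction rule: borel_measurable_induct)
  case (cong f g)
  then show ?case using sets_eq_imp_space_eq[OF s] by (metis nn_integral_cong)
next
  case (set A)
  then show ?case using le s by simp
next
  case (mult v u)
  have [measurable]: "v \<in> borel_measurable M" using mult s measurable_cong_sets by blast
  have [measurable]: "v \<in> borel_measurable N" using mult by simp
  have "u * (\<integral>\<^sup>+x. v x \<partial>M) \<le> u * (c * (\<integral>\<^sup>+x. v x \<partial>N))"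
    using mult by (intro mult_left_mono) auto
  then show ?case by (simp add: nn_integral_cmult mult_ac)
next
  case (add u v)
  have [measurable]: "v \<in> borel_measurable M" "u \<in> borel_measurable M" using add s measurable_cong_sets by blast+
  have [measurable]: "v \<in> borel_measurable N" "u \<in> borel_measurable N" using add by simp_all
  show ?case using add.IH by (simp add: nn_integral_add distrib_left add_mono)
next
  case (seq U)
  have [measurable]: "\<And>i. U i \<in> borel_measurable M" using seq s measurable_cong_sets by blast
  have [measurable]: "\<And>i. U i \<in> borel_measurable N" using seq by simp
  have "(\<integral>\<^sup>+x. (SUP i. U i) x \<partial>M) = (SUP i. \<integral>\<^sup>+x. U i x \<partial>M)"
    using seq by (simp add: image_comp nn_integral_monotone_convergence_SUP)
  also have "\<dots> \<le> c * (SUP i. \<integral>\<^sup>+x. U i x \<partial>N)"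
    using seq by (intro SUP_least order_trans[OF seq.IH] mult_left_mono SUP_upper) auto
  also have "(SUP i. \<integral>\<^sup>+x. U i x \<partial>N) = (\<integral>\<^sup>+x. (SUP i. U i) x \<partial>N)"
    using seq by (simp add: image_comp nn_integral_monotone_convergence_SUP)
  finally show ?case .
qed

lemma ennreal_mult_le_imp_le_divide:
  assumes "q > 0" "ennreal q * X \<le> ennreal a * Y" "a \<ge> 0"
  shows "X \<le> ennreal (a / q) * Y"
proof -
  have "ennreal (1 / q) * (ennreal q * X) \<le> ennreal (1 / q) * (ennreal a * Y)"
    by (rule mult_left_mono[OF assms(2)]) simp
  moreover have "ennreal (1 / q) * ennreal q = 1" "ennreal (1 / q) * ennreal a = ennreal (a / q)"
    using assms(1,3) by (simp_all add: ennreal_mult[symmetric])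
  ultimately show ?thesis by (simp only: mult.assoc[symmetric] mult_1)
qed

lemma emeasure_lborel_affine_image:
  fixes S :: "'a::euclidean_space set"
  assumes "S \<in> sets borel" "c \<noteq> 0"
  shows "emeasure lborel ((\<lambda>x. t + c *\<^sub>R x) ` S) = ennreal (\<bar>c\<bar> ^ DIM('a)) * emeasure lborel S"
    "(\<lambda>x. t + c *\<^sub>R x) ` S \<in> sets borel"
proof -
  have eq: "(\<lambda>x. t + c *\<^sub>R x) ` S = (\<lambda>y. (1 / c) *\<^sub>R (y - t)) -` S \<inter> space borel"
    using assms(2) by (force simp: image_iff)
  show b: "(\<lambda>x. t + c *\<^sub>R x) ` S \<in> sets borel"
    unfolding eq by (rule measurable_sets[OF _ assms(1)]) simp
  show "emeasure lborel ((\<lambda>x. t + c *\<^sub>R x) ` S) = ennreal (\<bar>c\<bar> ^ DIM('a)) * emeasure lborel S"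
    using emeasure_lebesgue_affine[of c t S] assms b by (simp add: add.commute)
qed

section \<open>Hausdorff measure on spheres\<close>

definition radial_proj :: "'a::euclidean_space \<Rightarrow> real \<Rightarrow> 'a \<Rightarrow> 'a" where
  "radial_proj z r w = z + (r / norm w) *\<^sub>R w"

text \<open>The volume of the cone over a set, cut off at radius 1; in dimension d + 1 it is the
  surface measure up to the factor (d + 1) r^d. Unlike Hausdorff measure it can be handled by
  Fubini. The point w = 0 is sent to \<open>z\<close> and forms a null set.\<close>

definition cone_measure :: "'a::euclidean_space \<Rightarrow> real \<Rightarrow> 'a measure" where
  "cone_measure z r = distr (restrict_space lborel (ball 0 1)) borel (radial_proj z r)"

lemma radial_proj_measurable[measurable]: "radial_proj z r \<in> borel_measurable borel"
  unfolding radial_proj_def by measurable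

lemma sets_cone_measure[simp]: "sets (cone_measure z r) = sets borel"
  by (simp add: cone_measure_def)

lemma emeasure_cone_measure:
  assumes "A \<in> sets borel"
  shows "emeasure (cone_measure z r) A = emeasure lborel {w \<in> ball 0 1. radial_proj z r w \<in> A}"
proof -
  have m: "radial_proj z r \<in> restrict_space lborel (ball 0 1) \<rightarrow>\<^sub>M borel"
    by (rule measurable_restrict_space1) simp
  have "{w \<in> ball 0 1. radial_proj z r w \<in> A} = radial_proj z r -` A \<inter> space (restrict_space lborel (ball 0 1))"
    by (auto simp: space_restrict_space)
  then show ?thesis
    unfolding cone_measure_def using m assms
    by (subst emeasure_distr) (auto simp: emeasure_restrict_space space_restrict_space)
qed

lemma finite_cone_measure: "emeasure (cone_measure z r) A < \<infinity>"
proof (cases "A \<in> sets borel")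
  case True
  have "emeasure (cone_measure z r) A \<le> emeasure lborel (ball (0::'a) 1)"
    unfolding emeasure_cone_measure[OF True] by (rule emeasure_mono) auto
  also have "\<dots> < \<infinity>" by (simp add: emeasure_ball)
  finally show ?thesis .
qed (simp add: emeasure_notin_sets)

lemma emeasure_cone:
  fixes z :: "'a::euclidean_space"
  assumes B: "B \<in> sets borel" and "\<rho> > 0"
  shows "emeasure lborel {y \<in> ball z \<rho>. radial_proj z r (y - z) \<in> B}
      = ennreal (\<rho> ^ DIM('a)) * emeasure (cone_measure z r) B"
    "{y \<in> ball z \<rho>. radial_proj z r (y - z) \<in> B} \<in> sets borel"
proof -
  let ?S = "{w \<in> ball 0 1. radial_proj z r w \<in> B}"
  have S: "?S \<in> sets borel" using B by measurable
  have eq: "{y \<in> ball z \<rho>. radial_proj z r (y - z) \<in> B} = (\<lambda>w. z + \<rho> *\<^sub>R w) ` ?S"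
  proof (intro set_eqI iffI)
    fix y assume "y \<in> {y \<in> ball z \<rho>. radial_proj z r (y - z) \<in> B}"
    then have y: "norm (y - z) < \<rho>" "radial_proj z r (y - z) \<in> B" by (auto simp: dist_norm norm_minus_commute)
    have "radial_proj z r ((1 / \<rho>) *\<^sub>R (y - z)) = radial_proj z r (y - z)"
      using \<open>\<rho> > 0\<close> by (simp add: radial_proj_def)
    moreover have "norm ((1 / \<rho>) *\<^sub>R (y - z)) < 1" using y(1) \<open>\<rho> > 0\<close> by (simp add: divide_simps)
    ultimately have "(1 / \<rho>) *\<^sub>R (y - z) \<in> ?S" using y(2) by simp
    moreover have "y = z + \<rho> *\<^sub>R ((1 / \<rho>) *\<^sub>R (y - z))" using \<open>\<rho> > 0\<close> by simp
    ultimately show "y \<in> (\<lambda>w. z + \<rho> *\<^sub>R w) ` ?S" by blast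
  next
    fix y assume "y \<in> (\<lambda>w. z + \<rho> *\<^sub>R w) ` ?S"
    then obtain w where w: "norm w < 1" "radial_proj z r w \<in> B" "y = z + \<rho> *\<^sub>R w" by auto
    have "radial_proj z r (\<rho> *\<^sub>R w) = radial_proj z r w"
      using \<open>\<rho> > 0\<close> by (simp add: radial_proj_def)
    then show "y \<in> {y \<in> ball z \<rho>. radial_proj z r (y - z) \<in> B}"
      using w \<open>\<rho> > 0\<close> by (simp add: dist_norm)
  qed
  show "emeasure lborel {y \<in> ball z \<rho>. radial_proj z r (y - z) \<in> B}
      = ennreal (\<rho> ^ DIM('a)) * emeasure (cone_measure z r) B"
    unfolding eq using emeasure_lborel_affine_image(1)[OF S, of \<rho> z] \<open>\<rho> > 0\<close>
    by (simp add: emeasure_cone_measure[OF B])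
  show "{y \<in> ball z \<rho>. radial_proj z r (y - z) \<in> B} \<in> sets borel"
    unfolding eq using emeasure_lborel_affine_image(2)[OF S, of \<rho> z] \<open>\<rho> > 0\<close> by simp
qed

lemma power_diff_le_mult:
  fixes a b :: real
  assumes "0 \<le> a" "a \<le> b"
  shows "b ^ Suc d - a ^ Suc d \<le> (b - a) * (real (Suc d) * b ^ d)"
proof -
  have "b ^ Suc d - a ^ Suc d = (b - a) * (\<Sum>p<Suc d. b ^ p * a ^ (d - p))"
    by (rule diff_power_eq_sum)
  also have "\<dots> \<le> (b - a) * (\<Sum>p<Suc d. b ^ d)"
  proof (intro mult_left_mono sum_mono)
    fix p assume "p \<in> {..<Suc d}"
    then have "b ^ d = b ^ p * b ^ (d - p)" by (simp add: power_add[symmetric])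
    moreover have "b ^ p * a ^ (d - p) \<le> b ^ p * b ^ (d - p)"
      using assms by (intro mult_left_mono power_mono) auto
    ultimately show "b ^ p * a ^ (d - p) \<le> b ^ d" by simp
  qed (use assms in auto)
  finally show ?thesis by simp
qed

text \<open>What remains of packing balls of radius e into a shell of thickness 4 e: the numerator
  comes from the cover of the sphere and from the volume of the shell, the denominator from a single
  ball. It is not sharp.\<close>

definition sphere_const :: "nat \<Rightarrow> real" where
  "sphere_const d = unit_ball_vol (real d) * 2 ^ d * (4 * real (Suc d) * 2 ^ d) / unit_ball_vol (real (Suc d))"

lemma sphere_const_pos: "sphere_const d > 0"
  unfolding sphere_const_def by (intro divide_pos_pos mult_pos_pos) auto

text \<open>Common last step for spheres and slabs. The packing estimate at scale \<open>e\<close>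
  involves the measure of a neighbourhood of \<open>K\<close>; as \<open>e\<close> tends to 0 these
  measures decrease to that of \<open>K\<close>, by closedness and finiteness.\<close>

lemma hausdorff_le_of_nbhds:
  fixes A :: "'a::metric_space set" and K :: "'b::metric_space set"
  assumes K: "closed K" "K \<noteq> {}" and M: "sets M = sets borel"
    and fin: "\<And>c. emeasure M {y. infdist y K \<le> c} \<noteq> \<infinity>" and k: "k > 0" and rad: "rad > 0"
    and step: "\<And>e. 0 < e \<Longrightarrow> e < rad \<Longrightarrow>
      hausdorff_pre d (4 * e) A \<le> ennreal k * emeasure M {y. infdist y K \<le> 2 * e}"
  shows "hausdorff d A \<le> ennreal k * emeasure M K"
proof -
  let ?N = "\<lambda>c. {y. infdist y K \<le> c}"
  have bN: "?N c \<in> sets M" for c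
    unfolding M by (intro borel_closed closed_Collect_le continuous_intros)
  have "hausdorff_pre d \<delta> A \<le> ennreal k * emeasure M (?N (rad / real (Suc n)))"
    if \<delta>: "\<delta> > 0" for \<delta> n
  proof -
    define w where "w = rad / real (Suc n)"
    \<comment> \<open>Small enough for covers of mesh 4 e to be admissible for
      \<open>\<delta>\<close> and for the neighbourhood of radius 2 e to lie in the one of radius
      \<open>w\<close>.\<close>
    define e where "e = min (\<delta> / 4) (w / 2)"
    have w: "w > 0" "w \<le> rad" using rad by (simp_all add: w_def field_simps)
    have e: "0 < e" "4 * e \<le> \<delta>" "2 * e \<le> w" using \<delta> w by (auto simp: e_def)
    have "hausdorff_pre d \<delta> A \<le> hausdorff_pre d (4 * e) A" by (rule hausdorff_pre_antimono) (rule e)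
    also have "\<dots> \<le> ennreal k * emeasure M (?N (2 * e))"
      by (rule step) (use e w in auto)
    also have "\<dots> \<le> ennreal k * emeasure M (?N w)"
      using e by (intro mult_left_mono emeasure_mono bN) auto
    finally show ?thesis by (simp only: w_def)
  qed
  then have H: "hausdorff d A \<le> ennreal k * emeasure M (?N (rad / real (Suc n)))" for n
    unfolding hausdorff_def by (intro SUP_least) simp
  have "ennreal (1 / k) * hausdorff d A \<le> emeasure M (?N (rad / real (Suc n)))" for n
  proof -
    have "ennreal (1 / k) * hausdorff d A \<le> ennreal (1 / k) * (ennreal k * emeasure M (?N (rad / real (Suc n))))"
      using H[of n] by (intro mult_left_mono) auto
    also have "\<dots> = emeasure M (?N (rad / real (Suc n)))"
      using k by (simp only: mult.assoc[symmetric]) (simp add: ennreal_mult[symmetric])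
    finally show ?thesis .
  qed
  then have "ennreal (1 / k) * hausdorff d A \<le> emeasure M K"
    unfolding emeasure_closed_nbhds_INF[OF K M fin rad, symmetric] by (intro INF_greatest) auto
  then show ?thesis
    using ennreal_mult_le_imp_le_divide[of "1 / k" "hausdorff d A" 1 "emeasure M K"] k by simp
qed

text \<open>Balls of radius \<open>e\<close> about points of \<open>A\<close> lie in the part, over
  the 2 e neighbourhood of \<open>A\<close>, of the shell of radii between r - 2 e and r + 2 e. Its
  volume is O(e) times the cone measure, and this \<open>e\<close> cancels against the quotient e^d
  / e^(d + 1) of the packing estimate.\<close>

lemma hausdorff_sphere_le_compact:
  fixes z :: "'a::euclidean_space"
  assumes A: "compact A" "A \<subseteq> sphere z r" and r: "r > 0" and m: "DIM('a) = Suc d"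
  shows "hausdorff d A \<le> ennreal (sphere_const d * r ^ d) * emeasure (cone_measure z r) A"
proof (cases "A = {}")
  case True
  then show ?thesis by (simp add: hausdorff_empty)
next
  case False
  let ?M = "cone_measure z r"
  define N where "N c = {y. infdist y A \<le> c}" for c :: real
  have clN: "closed (N c)" for c unfolding N_def by (intro closed_Collect_le continuous_intros)
  have bN: "N c \<in> sets borel" for c using clN by (rule borel_closed)
  have infz: "infdist y A \<le> dist y a" if "a \<in> A" for y a using that by (rule infdist_le)
  have step: "hausdorff_pre d (4 * e) A \<le> ennreal (sphere_const d * r ^ d) * emeasure ?M (N (2 * e))"
    if e: "0 < e" "2 * e < r" for e
  proof -
    define K where "K \<rho> = {y \<in> ball z \<rho>. radial_proj z r (y - z) \<in> N (2 * e)}" for \<rho>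
    define T where "T = K (r + 2 * e) - K (r - 2 * e)"
    have K: "emeasure lborel (K \<rho>) = ennreal (\<rho> ^ DIM('a)) * emeasure ?M (N (2 * e))"
      "K \<rho> \<in> sets borel" if "\<rho> > 0" for \<rho>
      unfolding K_def using emeasure_cone[OF bN that] by auto
    have T: "T \<in> sets lborel" unfolding T_def using K e by simp
    have Ttop: "emeasure ?M (N (2 * e)) \<noteq> top" using finite_cone_measure[of z r "N (2 * e)"] by simp
    have "K (r - 2 * e) \<subseteq> K (r + 2 * e)" using e by (auto simp: K_def)
    then have "emeasure lborel T = emeasure lborel (K (r + 2 * e)) - emeasure lborel (K (r - 2 * e))"
      unfolding T_def using K e Ttop by (intro emeasure_Diff) (auto simp: ennreal_mult_eq_top_iff)
    also have "\<dots> = ennreal ((r + 2 * e) ^ Suc d - (r - 2 * e) ^ Suc d) * emeasure ?M (N (2 * e))"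
    proof -
      obtain x where x: "emeasure ?M (N (2 * e)) = ennreal x" "x \<ge> 0" using Ttop by (metis enn2real_nonneg ennreal_enn2real_if infinity_ennreal_def)
      have "(r - 2 * e) ^ Suc d \<le> (r + 2 * e) ^ Suc d" using e by (intro power_mono) auto
      then show ?thesis
        using K e m x
        by (simp add: ennreal_mult[symmetric] ennreal_minus left_diff_distrib mult_right_mono del: power_Suc)
    qed
    also have "\<dots> \<le> ennreal (4 * e * (real (Suc d) * (2 * r) ^ d)) * emeasure ?M (N (2 * e))"
    proof (intro mult_right_mono ennreal_leI)
      have "(r + 2 * e) ^ Suc d - (r - 2 * e) ^ Suc d
          \<le> ((r + 2 * e) - (r - 2 * e)) * (real (Suc d) * (r + 2 * e) ^ d)"
        using e by (intro power_diff_le_mult) auto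
      also have "\<dots> \<le> ((r + 2 * e) - (r - 2 * e)) * (real (Suc d) * (2 * r) ^ d)"
        using e by (intro mult_left_mono power_mono) auto
      finally show "(r + 2 * e) ^ Suc d - (r - 2 * e) ^ Suc d \<le> 4 * e * (real (Suc d) * (2 * r) ^ d)"
        by simp
    qed simp
    finally have eT: "emeasure lborel T \<le> ennreal (4 * e * (real (Suc d) * (2 * r) ^ d)) * emeasure ?M (N (2 * e))" .
    define q where "q = unit_ball_vol (real (Suc d)) * e ^ Suc d"
    have qpos: "q > 0" using e by (simp add: q_def)
    have "ennreal q * hausdorff_pre d (2 * (2 * e)) A
        \<le> ennreal (unit_ball_vol (real d) * (2 * e) ^ d) * emeasure lborel T"
    proof (rule hausdorff_pre_packing[where Q = "\<lambda>x. cball x e"])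
      show "compact A" by (rule A)
      show "0 < 2 * e" using e by simp
      fix x assume x: "x \<in> A"
      then have nx: "norm (x - z) = r" using A(2) by (auto simp: dist_norm norm_minus_commute)
      \<comment> \<open>Radial projection moves \<open>y\<close> by the difference between
        \<open>r\<close> and its distance to \<open>z\<close>, which is at most \<open>e\<close>,
        and \<open>y\<close> is within \<open>e\<close> of \<open>x\<close>.\<close>
      have "cball x e \<subseteq> T"
      proof
        fix y assume "y \<in> cball x e"
        then have yx: "dist x y \<le> e" by simp
        define \<rho> where "\<rho> = norm (y - z)"
        have "\<bar>\<rho> - r\<bar> \<le> e" using norm_triangle_ineq3[of "y - z" "x - z"] nx yx
          by (simp add: \<rho>_def dist_norm norm_minus_commute)
        then have \<rho>: "\<rho> > 0" "r - e \<le> \<rho>" "\<rho> \<le> r + e" using e by auto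
        have "radial_proj z r (y - z) - y = (r / \<rho> - 1) *\<^sub>R (y - z)"
          by (simp add: radial_proj_def \<rho>_def algebra_simps)
        then have "norm (radial_proj z r (y - z) - y) = \<bar>r / \<rho> - 1\<bar> * \<rho>"
          by (simp add: \<rho>_def)
        also have "\<dots> = \<bar>r - \<rho>\<bar>"
        proof -
          have "\<bar>r / \<rho> - 1\<bar> * \<rho> = \<bar>(r / \<rho> - 1) * \<rho>\<bar>" using \<rho>(1) by (simp add: abs_mult)
          also have "(r / \<rho> - 1) * \<rho> = r - \<rho>" using \<rho>(1) by (simp add: field_simps)
          finally show ?thesis .
        qed
        finally have "dist (radial_proj z r (y - z)) y \<le> e" using \<rho> by (simp add: dist_norm)
        then have "dist (radial_proj z r (y - z)) x \<le> 2 * e"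
          using yx dist_triangle[of "radial_proj z r (y - z)" x y] by (simp add: dist_commute)
        then have "infdist (radial_proj z r (y - z)) A \<le> 2 * e"
          using infz[OF x, of "radial_proj z r (y - z)"] by linarith
        then show "y \<in> T"
          using \<rho> e by (auto simp: T_def K_def N_def \<rho>_def dist_norm norm_minus_commute)
      qed
      then show "cball x e \<in> sets lborel \<and> cball x e \<subseteq> T \<and> ennreal q \<le> emeasure lborel (cball x e)"
        using e m by (simp add: q_def emeasure_cball del: power_Suc)
    next
      fix x y assume "2 * e < dist x y"
      then show "cball x e \<inter> cball y e = {}" by (simp add: disjoint_cballI)
    qed (rule T)
    also have "\<dots> \<le> ennreal (unit_ball_vol (real d) * (2 * e) ^ d)
        * (ennreal (4 * e * (real (Suc d) * (2 * r) ^ d)) * emeasure ?M (N (2 * e)))"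
      by (rule mult_left_mono[OF eT]) simp
    finally have le: "ennreal q * hausdorff_pre d (2 * (2 * e)) A \<le>
        ennreal ((unit_ball_vol (real d) * (2 * e) ^ d) * (4 * e * (real (Suc d) * (2 * r) ^ d))) * emeasure ?M (N (2 * e))"
      using e r by (simp add: ennreal_mult mult.assoc)
    have "hausdorff_pre d (2 * (2 * e)) A \<le>
        ennreal ((unit_ball_vol (real d) * (2 * e) ^ d) * (4 * e * (real (Suc d) * (2 * r) ^ d)) / q) * emeasure ?M (N (2 * e))"
      by (rule ennreal_mult_le_imp_le_divide[OF qpos le]) (use e r in auto)
    also have "(unit_ball_vol (real d) * (2 * e) ^ d) * (4 * e * (real (Suc d) * (2 * r) ^ d)) / q = sphere_const d * r ^ d"
      using e by (simp add: q_def sphere_const_def power_mult_distrib)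
    finally have "hausdorff_pre d (2 * (2 * e)) A \<le> ennreal (sphere_const d * r ^ d) * emeasure ?M (N (2 * e))" .
    then show ?thesis by simp
  qed
  show ?thesis
  proof (rule hausdorff_le_of_nbhds[where rad = "r / 2"])
    show "hausdorff_pre d (4 * e) A \<le> ennreal (sphere_const d * r ^ d) * emeasure ?M {y. infdist y A \<le> 2 * e}"
      if "0 < e" "e < r / 2" for e using step[of e] that by (simp add: N_def)
    show "emeasure ?M {y. infdist y A \<le> c} \<noteq> \<infinity>" for c
      using finite_cone_measure[of z r "{y. infdist y A \<le> c}"] by simp
  qed (use A(1) False r sphere_const_pos[of d] in \<open>auto simp: compact_imp_closed\<close>)
qed

text \<open>Inner regularity passes from compact to Borel sets, and then to functions. An upper
  bound is the right direction because the Hausdorff integral stands in the denominator of a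
  frequency that is bounded above.\<close>

lemma nn_integral_sphere_le:
  fixes z :: "'a::euclidean_space"
  assumes r: "r > 0" and m: "DIM('a) = Suc d" and f[measurable]: "f \<in> borel_measurable borel"
  shows "(\<integral>\<^sup>+y. f y * indicator (sphere z r) y \<partial>hausdorff_measure d)
     \<le> ennreal (sphere_const d * r ^ d) * (\<integral>\<^sup>+w. f (radial_proj z r w) * indicator (ball 0 1) w \<partial>lborel)"
    "emeasure (hausdorff_measure d) (sphere z r) < \<infinity>"
proof -
  let ?M = "density (hausdorff_measure d) (indicator (sphere z r) :: 'a \<Rightarrow> ennreal)"
  let ?N = "cone_measure z r"
  let ?k = "ennreal (sphere_const d * r ^ d)"
  have sH: "sets (hausdorff_measure d :: 'a measure) = sets borel" by (rule sets_hausdorff_measure)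
  have [measurable_cong]: "sets (hausdorff_measure d :: 'a measure) = sets borel" by (rule sets_hausdorff_measure)
  have sM: "sets ?M = sets borel" by (simp add: sH)
  have em: "emeasure ?M A = hausdorff d (sphere z r \<inter> A)" if "A \<in> sets borel" for A
    using that by (subst emeasure_restricted) (auto simp: sH emeasure_hausdorff_measure)
  \<comment> \<open>The whole sphere is compact; this gives the finiteness that inner regularity
    asks for.\<close>
  have sp: "hausdorff d (sphere z r) \<le> ?k * emeasure ?N (sphere z r)"
    by (rule hausdorff_sphere_le_compact) (use assms in auto)
  also have "\<dots> < \<infinity>" using finite_cone_measure[of z r "sphere z r"] by (simp add: ennreal_mult_less_top)
  finally have fin: "hausdorff d (sphere z r) < \<infinity>" .
  then show "emeasure (hausdorff_measure d) (sphere z r) < \<infinity>"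
    by (subst emeasure_hausdorff_measure) auto
  have spM: "space ?M = UNIV" using sets_eq_imp_space_eq[OF sM] by simp
  have le: "emeasure ?M A \<le> ?k * emeasure ?N A" if A: "A \<in> sets borel" for A
  proof -
    have "emeasure ?M A = (SUP K\<in>{K. K \<subseteq> A \<and> compact K}. emeasure ?M K)"
    proof (rule inner_regular[OF sM _ A])
      show "emeasure ?M (space ?M) \<noteq> \<infinity>" unfolding spM using fin by (subst em) auto
    qed
    also have "\<dots> \<le> ?k * emeasure ?N A"
    proof (rule SUP_least)
      fix K assume "K \<in> {K. K \<subseteq> A \<and> compact K}"
      then have K: "K \<subseteq> A" "compact K" by auto
      have "emeasure ?M K = hausdorff d (sphere z r \<inter> K)" using K(2) by (intro em) (auto simp: borel_compact)
      also have "\<dots> \<le> ?k * emeasure ?N (sphere z r \<inter> K)"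
        using K(2) by (intro hausdorff_sphere_le_compact[OF _ _ r m]) auto
      also have "\<dots> \<le> ?k * emeasure ?N A" using K(1) A by (intro mult_left_mono emeasure_mono) auto
      finally show "emeasure ?M K \<le> ?k * emeasure ?N A" .
    qed
    finally show ?thesis .
  qed
  have "(\<integral>\<^sup>+y. f y * indicator (sphere z r) y \<partial>hausdorff_measure d) = (\<integral>\<^sup>+y. f y \<partial>?M)"
    by (subst nn_integral_density)
      (auto simp: mult.commute measurable_cong_sets[OF sH refl] intro: borel_measurable_indicator)
  also have "\<dots> \<le> ?k * (\<integral>\<^sup>+y. f y \<partial>?N)"
    by (rule nn_integral_le_measure_mult) (use le sM in \<open>auto simp: measurable_cong_sets[OF sets_cone_measure refl]\<close>)
  also have "(\<integral>\<^sup>+y. f y \<partial>?N) = (\<integral>\<^sup>+w. f (radial_proj z r w) \<partial>restrict_space lborel (ball 0 1))"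
    unfolding cone_measure_def by (rule nn_integral_distr) (auto intro: measurable_restrict_space1)
  also have "\<dots> = (\<integral>\<^sup>+w. f (radial_proj z r w) * indicator (ball 0 1) w \<partial>lborel)"
    by (rule nn_integral_restrict_space) auto
  finally show "(\<integral>\<^sup>+y. f y * indicator (sphere z r) y \<partial>hausdorff_measure d)
     \<le> ?k * (\<integral>\<^sup>+w. f (radial_proj z r w) * indicator (ball 0 1) w \<partial>lborel)" .
qed

text \<open>A set of diameter D lies in a ball of radius D about any of its points, twice the radius
  in \<open>hausdorff_weight\<close>, so Lebesgue measure is at most 2^n times the content. The
  purpose is positivity of the denominator of the frequency.\<close>

lemma hausdorff_open_pos:
  fixes V :: "(real^'n) set"
  assumes "open V" "V \<noteq> {}"
  shows "hausdorff CARD('n) V \<noteq> 0"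
proof
  assume "hausdorff CARD('n) V = 0"
  then have z: "hausdorff_pre CARD('n) 1 V = 0"
    using hausdorff_pre_le_hausdorff[of 1 "CARD('n)" V] by simp
  have "emeasure lborel V \<le> 2 ^ CARD('n) * hausdorff_pre CARD('n) 1 V"
  proof -
    have "ennreal (1 / 2 ^ CARD('n)) * emeasure lborel V \<le> hausdorff_pre CARD('n) 1 V"
      unfolding hausdorff_pre_def
    proof (rule INF_greatest)
      fix C :: "nat \<Rightarrow> (real^'n) set"
      assume "C \<in> {C. V \<subseteq> (\<Union>i. C i) \<and> (\<forall>i. bounded (C i) \<and> diameter (C i) \<le> 1)}"
      then have C: "V \<subseteq> (\<Union>i. C i)" "\<And>i. bounded (C i)" by auto
      define D where "D i = (if C i = {} then {} else cball (SOME x. x \<in> C i) (diameter (C i)))" for i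
      have CD: "C i \<subseteq> D i" for i
      proof
        fix y assume y: "y \<in> C i"
        then have "(SOME x. x \<in> C i) \<in> C i" by (rule someI)
        then show "y \<in> D i" using y diameter_bounded_bound[OF C(2) _ y] by (auto simp: D_def)
      qed
      have "emeasure lborel V \<le> emeasure lborel (\<Union>i. D i)"
        using C(1) CD assms(1) by (intro emeasure_mono) (fastforce, auto simp: D_def)
      also have "\<dots> \<le> (\<Sum>i. emeasure lborel (D i))"
        by (rule emeasure_subadditive_countably) (auto simp: D_def)
      also have "\<dots> \<le> (\<Sum>i. ennreal (2 ^ CARD('n)) * hausdorff_weight CARD('n) (C i))"
      proof (rule suminf_le)
        fix i
        show "emeasure lborel (D i) \<le> ennreal (2 ^ CARD('n)) * hausdorff_weight CARD('n) (C i)"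
          using diameter_ge_0[OF C(2)[of i]]
          by (auto simp: D_def hausdorff_weight_def emeasure_cball ennreal_mult[symmetric] power_divide)
      qed auto
      also have "\<dots> = ennreal (2 ^ CARD('n)) * (\<Sum>i. hausdorff_weight CARD('n) (C i))" by simp
      finally have "ennreal (1 / 2 ^ CARD('n)) * emeasure lborel V
          \<le> ennreal (1 / 2 ^ CARD('n)) * (ennreal (2 ^ CARD('n)) * (\<Sum>i. hausdorff_weight CARD('n) (C i)))"
        by (rule mult_left_mono) simp
      then show "ennreal (1 / 2 ^ CARD('n)) * emeasure lborel V \<le> (\<Sum>i. hausdorff_weight CARD('n) (C i))"
        by (simp add: mult.assoc[symmetric] ennreal_mult[symmetric])
    qed
    then have "ennreal (1 / 2 ^ CARD('n)) * emeasure lborel V = 0" using z by simp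
    then show ?thesis by simp
  qed
  then have "emeasure lborel V = 0" using z by simp
  moreover obtain x e where "e > 0" "ball x e \<subseteq> V" using assms by (meson ex_in_conv openE)
  then have "emeasure lborel (ball x e) \<le> emeasure lborel V" using assms(1) by (intro emeasure_mono) auto
  moreover have "emeasure lborel (ball x e) > 0" using \<open>e > 0\<close> by (simp add: emeasure_ball ennreal_zero_less_mult_iff)
  ultimately show False by simp
qed

text \<open>Points of \<open>V\<close> under the ball lift to the upper half of the sphere, and
  \<open>fst\<close>, having Lipschitz constant 1, cannot raise the Hausdorff measure.\<close>

lemma hausdorff_sphere_pos:
  fixes z :: "(real^'n) \<times> real" and V :: "(real^'n) set"
  assumes V: "open V" "V \<inter> ball (fst z) r \<noteq> {}"
  shows "hausdorff CARD('n) (sphere z r \<inter> fst -` V) \<noteq> 0"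
proof
  assume *: "hausdorff CARD('n) (sphere z r \<inter> fst -` V) = 0"
  have "V \<inter> ball (fst z) r \<subseteq> fst ` (sphere z r \<inter> fst -` V)"
  proof
    fix x assume x: "x \<in> V \<inter> ball (fst z) r"
    define t where "t = snd z + sqrt (r\<^sup>2 - (dist (fst z) x)\<^sup>2)"
    have "dist (fst z) x < r" using x by simp
    then have "(dist (fst z) x)\<^sup>2 \<le> r\<^sup>2" by (intro power_mono) auto
    moreover have "dist z (x, t) = sqrt ((dist (fst z) x)\<^sup>2 + (dist (snd z) t)\<^sup>2)"
      by (simp add: dist_prod_def)
    ultimately have "dist z (x, t) = sqrt (r\<^sup>2)" by (simp add: t_def dist_real_def)
    also have "\<dots> = r" using \<open>dist (fst z) x < r\<close> zero_le_dist[of "fst z" x] by (smt (verit) real_sqrt_abs)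
    finally have "(x, t) \<in> sphere z r \<inter> fst -` V" using x by simp
    then show "x \<in> fst ` (sphere z r \<inter> fst -` V)" by force
  qed
  then have "hausdorff CARD('n) (V \<inter> ball (fst z) r) \<le> hausdorff CARD('n) (fst ` (sphere z r \<inter> fst -` V))"
    by (rule hausdorff_mono)
  also have "\<dots> \<le> ennreal (1 ^ CARD('n)) * hausdorff CARD('n) (sphere z r \<inter> fst -` V)"
    by (rule hausdorff_lipschitz_image) (auto simp: dist_fst_le)
  finally have "hausdorff CARD('n) (V \<inter> ball (fst z) r) = 0" using * by simp
  then show False using hausdorff_open_pos[of "V \<inter> ball (fst z) r"] V by auto
qed

section \<open>Hausdorff measure of hypersurfaces by central projection\<close>

definition slab :: "'n \<Rightarrow> (real^'n) set \<Rightarrow> (real^'n) set" where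
  "slab j E = (\<lambda>(e, t). e - t *\<^sub>R axis j 1) ` (E \<times> {0..1})"

lemma compact_slab: "compact E \<Longrightarrow> compact (slab j E)"
  unfolding slab_def split_beta
  by (intro compact_continuous_image compact_Times continuous_intros) auto

lemma slab_iff:
  fixes E :: "(real^'n) set"
  assumes "\<And>e. e \<in> E \<Longrightarrow> e $ j = 1"
  shows "y \<in> slab j E \<longleftrightarrow> 0 \<le> y $ j \<and> y $ j \<le> 1 \<and> y + (1 - y $ j) *\<^sub>R axis j 1 \<in> E"
proof
  assume "y \<in> slab j E"
  then obtain e t where e: "e \<in> E" "0 \<le> t" "t \<le> 1" "y = e - t *\<^sub>R axis j 1" by (auto simp: slab_def)
  have "y $ j = 1 - t" using e assms[of e] by (simp add: axis_def)
  then show "0 \<le> y $ j \<and> y $ j \<le> 1 \<and> y + (1 - y $ j) *\<^sub>R axis j 1 \<in> E" using e by simp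
next
  assume y: "0 \<le> y $ j \<and> y $ j \<le> 1 \<and> y + (1 - y $ j) *\<^sub>R axis j 1 \<in> E"
  then show "y \<in> slab j E"
    unfolding slab_def by (intro image_eqI[of _ _ "(y + (1 - y $ j) *\<^sub>R axis j 1, 1 - y $ j)"]) auto
qed

lemma norm_le_sqrt_card_mult:
  fixes v :: "real^'n"
  assumes "\<And>i. \<bar>v $ i\<bar> \<le> c" "c \<ge> 0"
  shows "norm v \<le> sqrt (real CARD('n)) * c"
proof -
  have "norm v \<le> sqrt (\<Sum>i\<in>(UNIV::'n set). c\<^sup>2)"
    unfolding norm_vec_def L2_set_def using assms
    by (intro real_sqrt_le_mono sum_mono) (auto simp: abs_le_square_iff[symmetric])
  also have "\<dots> = sqrt (real CARD('n)) * c" using assms by (simp add: real_sqrt_mult)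
  finally show ?thesis .
qed

text \<open>Thickening by a unit segment makes Lebesgue measure on \<open>real^'n\<close> a
  substitute for the (n - 1)-dimensional measure of a set in a hyperplane. The packing uses boxes
  that have height 1 in direction \<open>j\<close> and small cubes as base.\<close>

lemma hausdorff_hyperplane_le:
  fixes E :: "(real^'n) set"
  assumes E: "compact E" "\<And>e. e \<in> E \<Longrightarrow> e $ j = 1"
  shows "hausdorff (CARD('n) - 1) E \<le>
    ennreal (unit_ball_vol (real (CARD('n) - 1)) * sqrt (real CARD('n)) ^ (CARD('n) - 1)) * emeasure lborel (slab j E)"
proof (cases "E = {}")
  case True
  then show ?thesis by (simp add: hausdorff_empty)
next
  case False
  let ?n = "CARD('n)" and ?T = "slab j E"
  let ?d = "?n - 1"
  have cT: "compact ?T" by (rule compact_slab[OF E(1)])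
  have Tne: "?T \<noteq> {}" using False by (auto simp: slab_def)
  show ?thesis
  proof (rule hausdorff_le_of_nbhds[where rad = 1])
    show "closed ?T" using cT by (rule compact_imp_closed)
    show "emeasure lborel {y. infdist y ?T \<le> c} \<noteq> \<infinity>" for c
    proof -
      obtain B where B: "\<And>x. x \<in> ?T \<Longrightarrow> norm x \<le> B" using compact_imp_bounded[OF cT] bounded_iff by blast
      have "{y. infdist y ?T \<le> c} \<subseteq> cball 0 (B + c)"
      proof
        fix y assume "y \<in> {y. infdist y ?T \<le> c}"
        moreover obtain t where "t \<in> ?T" "infdist y ?T = dist y t"
          using infdist_attains_inf[OF compact_imp_closed[OF cT] Tne] by metis
        ultimately show "y \<in> cball 0 (B + c)"
          using B[of t] norm_triangle_ineq2[of y t] by (simp add: dist_norm)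
      qed
      then have "bounded {y. infdist y ?T \<le> c}" by (rule bounded_subset[OF bounded_cball])
      then show ?thesis using emeasure_bounded_finite by force
    qed
    show "0 < unit_ball_vol (real ?d) * sqrt (real ?n) ^ ?d" by (intro mult_pos_pos) auto
    fix e :: real assume e: "0 < e" "e < 1"
    \<comment> \<open>A cube of half side \<open>\<eta>\<close> has half diagonal at most
      \<open>e\<close>, so boxes over points at distance more than 2 e are disjoint and each box
      stays within \<open>e\<close> of the slab.\<close>
    define \<eta> where "\<eta> = e / sqrt (real ?n)"
    have \<eta>: "\<eta> > 0" using e by (simp add: \<eta>_def)
    have ne: "sqrt (real ?n) * \<eta> = e" by (simp add: \<eta>_def)
    define Q where "Q x = cbox (\<chi> l. if l = j then 0 else x $ l - \<eta>) (\<chi> l. if l = j then 1 else x $ l + \<eta>)" for x :: "real^'n"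
    let ?N = "{y. infdist y ?T \<le> 2 * e}"
    have "ennreal ((2 * \<eta>) ^ ?d) * hausdorff_pre ?d (2 * (2 * e)) E
      \<le> ennreal (unit_ball_vol (real ?d) * (2 * e) ^ ?d) * emeasure lborel ?N"
    proof (rule hausdorff_pre_packing[where Q = Q])
      fix x assume x: "x \<in> E"
      have vol: "emeasure lborel (Q x) = ennreal ((2 * \<eta>) ^ ?d)"
      proof -
        have ne: "Q x \<noteq> {}" using \<eta> by (auto simp: Q_def interval_ne_empty_cart)
        have "measure lborel (Q x) = (\<Prod>i\<in>UNIV. if i = j then 1 else 2 * \<eta>)"
          using content_cbox_cart[OF ne[unfolded Q_def]] unfolding Q_def by (auto intro!: prod.cong)
        also have "\<dots> = (\<Prod>i\<in>UNIV - {j}. 2 * \<eta>)"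
          by (subst prod.remove[of _ j]) (auto intro!: prod.cong)
        also have "\<dots> = (2 * \<eta>) ^ ?d" by (simp add: card_Diff_subset)
        finally show ?thesis
          using emeasure_eq_ennreal_measure[of lborel "Q x"] emeasure_lborel_cbox_finite by (auto simp: Q_def less_top)
      qed
      have "Q x \<subseteq> ?N"
      proof
        fix y assume y: "y \<in> Q x"
        have yj: "0 \<le> y $ j" "y $ j \<le> 1" using y by (auto simp: Q_def mem_box_cart dest: spec[of _ j])
        have yl: "\<bar>y $ l - x $ l\<bar> \<le> \<eta>" if "l \<noteq> j" for l
          using y that by (auto simp: Q_def mem_box_cart abs_le_iff dest!: spec[of _ l])
        define t where "t = x - (1 - y $ j) *\<^sub>R axis j 1"
        have "t \<in> ?T" unfolding slab_def t_def using x yj by (intro image_eqI[of _ _ "(x, 1 - y $ j)"]) auto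
        moreover have "\<bar>(y - t) $ l\<bar> \<le> \<eta>" for l
          using yl[of l] E(2)[OF x] \<eta> by (cases "l = j") (auto simp: t_def axis_def)
        then have "norm (y - t) \<le> e" using norm_le_sqrt_card_mult[of "y - t" \<eta>] \<eta> ne by simp
        ultimately show "y \<in> ?N" using infdist_le[of t ?T y] e by (simp add: dist_norm)
      qed
      then show "Q x \<in> sets lborel \<and> Q x \<subseteq> ?N \<and> ennreal ((2 * \<eta>) ^ ?d) \<le> emeasure lborel (Q x)"
        using vol by (simp add: Q_def)
    next
      fix x y assume xy: "x \<in> E" "y \<in> E" "2 * e < dist x y"
      show "Q x \<inter> Q y = {}"
      proof (rule ccontr)
        assume "Q x \<inter> Q y \<noteq> {}"
        then obtain w where w: "w \<in> Q x" "w \<in> Q y" by blast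
        have "\<bar>(x - y) $ l\<bar> \<le> 2 * \<eta>" for l
        proof (cases "l = j")
          case False
          then have "\<bar>w $ l - x $ l\<bar> \<le> \<eta>" "\<bar>w $ l - y $ l\<bar> \<le> \<eta>"
            using w by (auto simp: Q_def mem_box_cart abs_le_iff dest!: spec[of _ l])
          then show ?thesis by simp
        qed (use E(2) xy \<eta> in auto)
        then have "norm (x - y) \<le> sqrt (real ?n) * (2 * \<eta>)" using \<eta> by (intro norm_le_sqrt_card_mult) auto
        then show False using xy(3) ne by (simp add: dist_norm)
      qed
    qed (use E e in \<open>auto intro!: borel_closed closed_Collect_le continuous_intros\<close>)
    from ennreal_mult_le_imp_le_divide[OF _ this]
    have "hausdorff_pre ?d (2 * (2 * e)) E \<le> ennreal (unit_ball_vol (real ?d) * (2 * e) ^ ?d / (2 * \<eta>) ^ ?d) * emeasure lborel ?N"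
      using \<eta> e by simp
    also have "unit_ball_vol (real ?d) * (2 * e) ^ ?d / (2 * \<eta>) ^ ?d = unit_ball_vol (real ?d) * sqrt (real ?n) ^ ?d"
    proof -
      have "(2 * e) ^ ?d / (2 * \<eta>) ^ ?d = (2 * e / (2 * \<eta>)) ^ ?d" by (rule power_divide[symmetric])
      also have "2 * e / (2 * \<eta>) = sqrt (real ?n)" using ne \<eta> by (simp add: field_simps)
      finally have "(2 * e) ^ ?d / (2 * \<eta>) ^ ?d = sqrt (real ?n) ^ ?d" .
      then show ?thesis by (simp only: times_divide_eq_right[symmetric])
    qed
    finally show "hausdorff_pre ?d (4 * e) E
      \<le> ennreal (unit_ball_vol (real ?d) * sqrt (real ?n) ^ ?d) * emeasure lborel ?N" by simp
  qed (use Tne in auto)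
qed

text \<open>The direction from \<open>p\<close> to \<open>x\<close>, normalised to have component 1
  in direction \<open>j\<close>. Points with \<open>x $ j \<noteq> p $ j\<close> have the same image
  exactly when they lie on one line through \<open>p\<close>.\<close>

definition central_proj :: "'n \<Rightarrow> real^'n \<Rightarrow> real^'n \<Rightarrow> real^'n" where
  "central_proj j p x = (1 / (x $ j - p $ j)) *\<^sub>R (x - p)"

lemma central_proj_j: "x $ j \<noteq> p $ j \<Longrightarrow> central_proj j p x $ j = 1"
  by (simp add: central_proj_def)

lemma central_proj_inverse: "x $ j \<noteq> p $ j \<Longrightarrow> x = p + (x $ j - p $ j) *\<^sub>R central_proj j p x"
  by (simp add: central_proj_def)

lemma continuous_on_central_proj:
  "(\<And>x. x \<in> C \<Longrightarrow> x $ j \<noteq> p $ j) \<Longrightarrow> continuous_on C (central_proj j p)"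
  unfolding central_proj_def by (intro continuous_intros) auto

definition crofton_const :: "'n::finite itself \<Rightarrow> real" where
  "crofton_const _ = unit_ball_vol (real (CARD('n) - 1)) * sqrt (real CARD('n)) ^ (CARD('n) - 1)"

lemma crofton_const_pos: "crofton_const TYPE('n::finite) > 0"
  unfolding crofton_const_def by (intro mult_pos_pos) auto

text \<open>The bound \<open>bi\<close> makes the projection injective on \<open>K\<close> with
  Lipschitz inverse, and this inverse carries the image in the hyperplane back to
  \<open>K\<close>.\<close>

lemma hausdorff_le_slab_compact:
  fixes K :: "(real^'n) set"
  assumes K: "compact K" "\<And>x. x \<in> K \<Longrightarrow> x $ j \<noteq> p $ j" and L: "L > 0"
    and bi: "\<And>x y. x \<in> K \<Longrightarrow> y \<in> K \<Longrightarrow> dist x y \<le> L * dist (central_proj j p x) (central_proj j p y)"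
  shows "hausdorff (CARD('n) - 1) K \<le> ennreal (L ^ (CARD('n) - 1) * crofton_const TYPE('n)) * emeasure lborel (slab j (central_proj j p ` K))"
proof -
  let ?P = "central_proj j p" and ?d = "CARD('n) - 1"
  define f where "f = inv_into K ?P"
  have inj: "inj_on ?P K" using bi by (intro inj_onI) force
  have fK: "f ` (?P ` K) = K" unfolding f_def using inj by (simp add: image_image cong: image_cong_simp)
  have "hausdorff ?d K = hausdorff ?d (f ` (?P ` K))" by (simp add: fK)
  also have "\<dots> \<le> ennreal (L ^ ?d) * hausdorff ?d (?P ` K)"
  proof (rule hausdorff_lipschitz_image[OF L])
    fix u v assume "u \<in> ?P ` K" "v \<in> ?P ` K"
    then obtain x y where "x \<in> K" "y \<in> K" "u = ?P x" "v = ?P y" by blast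
    then show "dist (f u) (f v) \<le> L * dist u v" using bi inj by (simp add: f_def)
  qed
  also have "\<dots> \<le> ennreal (L ^ ?d) * (ennreal (crofton_const TYPE('n)) * emeasure lborel (slab j (?P ` K)))"
    unfolding crofton_const_def
  proof (intro mult_left_mono hausdorff_hyperplane_le)
    show "compact (?P ` K)" using K by (intro compact_continuous_image continuous_on_central_proj) auto
    show "e $ j = 1" if "e \<in> ?P ` K" for e using that K(2) central_proj_j by blast
  qed simp
  also have "\<dots> = ennreal (L ^ ?d * crofton_const TYPE('n)) * emeasure lborel (slab j (?P ` K))"
    using L by (simp add: ennreal_mult' mult.assoc)
  finally show ?thesis .
qed

text \<open>Differences of this kind arise when compact pieces are made disjoint. They need not be
  compact, but they are Borel of finite Hausdorff measure, so compact subsets exhaust them.\<close>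

lemma hausdorff_le_slab_diff:
  fixes C :: "(real^'n) set"
  assumes C: "compact C" "\<And>x. x \<in> C \<Longrightarrow> x $ j \<noteq> p $ j" and F: "closed F" and L: "L > 0"
    and bi: "\<And>x y. x \<in> C \<Longrightarrow> y \<in> C \<Longrightarrow> dist x y \<le> L * dist (central_proj j p x) (central_proj j p y)"
  shows "hausdorff (CARD('n) - 1) (C - F) \<le> ennreal (L ^ (CARD('n) - 1) * crofton_const TYPE('n)) * emeasure lborel (slab j (central_proj j p ` (C - F)))"
    and "slab j (central_proj j p ` (C - F)) \<in> sets borel"
proof -
  let ?P = "central_proj j p" and ?d = "CARD('n) - 1"
  let ?k = "ennreal (L ^ ?d * crofton_const TYPE('n))"
  have inj: "inj_on ?P C" using bi by (intro inj_onI) force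
  have one: "e $ j = 1" if "e \<in> ?P ` K" "K \<subseteq> C" for e K using that C(2) central_proj_j by blast
  \<comment> \<open>Injectivity turns the image of a difference into a difference of compact images,
    whence measurability.\<close>
  have Pd: "?P ` (C - F) = ?P ` C - ?P ` (C \<inter> F)"
    using inj by (auto dest: inj_onD)
  have "slab j (?P ` (C - F)) = slab j (?P ` C) - slab j (?P ` (C \<inter> F))"
  proof (rule set_eqI)
    fix y
    have 1: "y \<in> slab j (?P ` (C - F)) \<longleftrightarrow> 0 \<le> y $ j \<and> y $ j \<le> 1 \<and> y + (1 - y $ j) *\<^sub>R axis j 1 \<in> ?P ` (C - F)"
      by (rule slab_iff, erule one) blast
    have 2: "y \<in> slab j (?P ` C) \<longleftrightarrow> 0 \<le> y $ j \<and> y $ j \<le> 1 \<and> y + (1 - y $ j) *\<^sub>R axis j 1 \<in> ?P ` C"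
      by (rule slab_iff, erule one) blast
    have 3: "y \<in> slab j (?P ` (C \<inter> F)) \<longleftrightarrow> 0 \<le> y $ j \<and> y $ j \<le> 1 \<and> y + (1 - y $ j) *\<^sub>R axis j 1 \<in> ?P ` (C \<inter> F)"
      by (rule slab_iff, erule one) blast
    show "y \<in> slab j (?P ` (C - F)) \<longleftrightarrow> y \<in> slab j (?P ` C) - slab j (?P ` (C \<inter> F))"
      unfolding Diff_iff 1 2 3 unfolding Pd by blast
  qed
  moreover have "compact (slab j (?P ` C))" "compact (slab j (?P ` (C \<inter> F)))"
    using C F by (auto intro!: compact_slab compact_continuous_image continuous_on_central_proj compact_Int_closed)
  ultimately show B: "slab j (?P ` (C - F)) \<in> sets borel" by (simp add: borel_compact sets.Diff)
  have sH: "sets (hausdorff_measure d :: (real^'n) measure) = sets borel" for d by (rule sets_hausdorff_measure)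
  let ?M = "density (hausdorff_measure ?d) (indicator C :: (real^'n) \<Rightarrow> ennreal)"
  have sM: "sets ?M = sets borel" by (simp add: sH)
  have spM: "space ?M = UNIV" using sets_eq_imp_space_eq[OF sM] by simp
  have Cb: "C \<in> sets borel" using C(1) by (rule borel_compact)
  have em: "emeasure ?M A = hausdorff ?d (C \<inter> A)" if "A \<in> sets borel" for A
    using that Cb by (subst emeasure_restricted) (auto simp: sH emeasure_hausdorff_measure)
  have "hausdorff ?d C \<le> ?k * emeasure lborel (slab j (?P ` C))"
    by (rule hausdorff_le_slab_compact[OF C L bi])
  also have "\<dots> < \<infinity>"
    using emeasure_bounded_finite[OF compact_imp_bounded[OF \<open>compact (slab j (?P ` C))\<close>]]
    by (simp add: ennreal_mult_less_top)
  finally have fin: "hausdorff ?d C < \<infinity>" .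
  have CF: "C - F \<in> sets borel" using Cb F by auto
  have "hausdorff ?d (C - F) = emeasure ?M (C - F)" unfolding em[OF CF] by (simp add: Int_absorb1)
  also have "\<dots> = (SUP K\<in>{K. K \<subseteq> C - F \<and> compact K}. emeasure ?M K)"
  proof (rule inner_regular[OF sM _ CF])
    show "emeasure ?M (space ?M) \<noteq> \<infinity>" unfolding spM using fin by (subst em) auto
  qed
  also have "\<dots> \<le> ?k * emeasure lborel (slab j (?P ` (C - F)))"
  proof (rule SUP_least)
    fix K assume "K \<in> {K. K \<subseteq> C - F \<and> compact K}"
    then have K: "K \<subseteq> C - F" "compact K" by auto
    have "emeasure ?M K = hausdorff ?d (C \<inter> K)" using K(2) by (intro em borel_compact)
    also have "C \<inter> K = K" using K(1) by blast
    also have "hausdorff ?d K \<le> ?k * emeasure lborel (slab j (?P ` K))"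
    proof (rule hausdorff_le_slab_compact[OF K(2) _ L])
      fix x assume "x \<in> K"
      then show "x $ j \<noteq> p $ j" using K(1) C(2) by blast
      fix y assume "y \<in> K"
      show "dist x y \<le> L * dist (?P x) (?P y)"
        by (rule bi) (use K(1) \<open>x \<in> K\<close> \<open>y \<in> K\<close> in auto)
    qed
    also have "\<dots> \<le> ?k * emeasure lborel (slab j (?P ` (C - F)))"
    proof (intro mult_left_mono emeasure_mono)
      show "slab j (?P ` K) \<subseteq> slab j (?P ` (C - F))" unfolding slab_def using K(1) by blast
    qed (use B in auto)
    finally show "emeasure ?M K \<le> ?k * emeasure lborel (slab j (?P ` (C - F)))" .
  qed
  finally show "hausdorff ?d (C - F) \<le> ?k * emeasure lborel (slab j (?P ` (C - F)))" .
qed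

text \<open>
  Each point of the cube lies in at most \<open>M\<close> of the disjointified slabs, since their points
  correspond to the points of \<open>Z\<close> on a line through \<open>p\<close>.
\<close>

lemma hausdorff_Union_le_central_proj:
  fixes C :: "nat \<Rightarrow> (real^'n) set"
  assumes C: "\<And>m. compact (C m)" "\<And>m. C m \<subseteq> Z" and L: "L > 0"
    and bi: "\<And>m x y. x \<in> C m \<Longrightarrow> y \<in> C m \<Longrightarrow> dist x y \<le> L * dist (central_proj j p x) (central_proj j p y)"
    and Z: "\<And>x. x \<in> Z \<Longrightarrow> x $ j \<noteq> p $ j" "\<And>x i. x \<in> Z \<Longrightarrow> \<bar>x $ i - p $ i\<bar> \<le> \<bar>x $ j - p $ j\<bar>"
    and mult: "\<And>v. v $ j = 1 \<Longrightarrow> finite {t. p + t *\<^sub>R v \<in> Z} \<and> card {t. p + t *\<^sub>R v \<in> Z} \<le> M"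
  shows "hausdorff (CARD('n) - 1) (\<Union>m. C m) \<le> ennreal (L ^ (CARD('n) - 1) * crofton_const TYPE('n) * (2 ^ CARD('n) * real M))"
proof -
  let ?P = "central_proj j p" and ?d = "CARD('n) - 1"
  let ?k = "ennreal (L ^ ?d * crofton_const TYPE('n))"
  define D where "D m = C m - (\<Union>l<m. C l)" for m
  define T where "T m = slab j (?P ` D m)" for m
  have clF: "closed (\<Union>l<m. C l)" for m by (intro closed_UN ballI compact_imp_closed C) simp
  have H: "hausdorff ?d (D m) \<le> ?k * emeasure lborel (T m)" and Tb: "T m \<in> sets borel" for m
  proof -
    have nz: "x $ j \<noteq> p $ j" if "x \<in> C m" for x using that Z(1) C(2) by blast
    show "hausdorff ?d (D m) \<le> ?k * emeasure lborel (T m)" unfolding D_def T_def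
      by (rule hausdorff_le_slab_diff(1)[OF C(1) nz clF L bi])
    show "T m \<in> sets borel" unfolding D_def T_def
      by (rule hausdorff_le_slab_diff(2)[OF C(1) nz clF L bi])
  qed
  have one: "e $ j = 1" if "e \<in> ?P ` D m" for e m
    using that Z(1) C(2) central_proj_j unfolding D_def by blast
  \<comment> \<open>The second condition on \<open>Z\<close> says that component \<open>j\<close> of
    \<open>x - p\<close> dominates, so all projections, and with them all slabs, lie in this cube of
    volume 2^n.\<close>
  define Q :: "(real^'n) set" where "Q = cbox (\<chi> i. - 1) (\<chi> i. 1)"
  have TQ: "T m \<subseteq> Q" for m
  proof
    fix y assume "y \<in> T m"
    then have y: "0 \<le> y $ j" "y $ j \<le> 1" "y + (1 - y $ j) *\<^sub>R axis j 1 \<in> ?P ` D m"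
      unfolding T_def using slab_iff[of "?P ` D m" j y] one by auto
    obtain x where x: "x \<in> D m" "y + (1 - y $ j) *\<^sub>R axis j 1 = ?P x" using y(3) by blast
    have xZ: "x \<in> Z" using x C(2) by (auto simp: D_def)
    have "\<bar>y $ i\<bar> \<le> 1" for i
    proof (cases "i = j")
      case False
      then have "y $ i = ?P x $ i" using x(2)[symmetric] by (simp add: axis_def)
      then show ?thesis using Z(1)[OF xZ] Z(2)[OF xZ, of i] by (simp add: central_proj_def divide_le_eq_1)
    qed (use y in auto)
    then show "y \<in> Q" by (auto simp: Q_def mem_box_cart abs_le_iff minus_le_iff)
  qed
  have cnt: "(\<Sum>m. indicator (T m) y) \<le> of_nat M * (indicator Q y :: ennreal)" for y
  proof (cases "y \<in> Q")
    case False
    then have "indicator (T m) y = (0::ennreal)" for m using TQ[of m] by (auto simp: indicator_def)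
    then show ?thesis by simp
  next
    case True
    define v where "v = y + (1 - y $ j) *\<^sub>R axis j 1"
    have vj: "v $ j = 1" by (simp add: v_def axis_def)
    have "(\<Sum>m. indicator (T m) y) \<le> (of_nat M :: ennreal)"
    proof (rule suminf_le_const[OF summableI])
      fix N
      let ?A = "{m. m < N \<and> y \<in> T m}"
      have "\<forall>m\<in>?A. \<exists>x. x \<in> D m \<and> v = ?P x"
        using slab_iff[of "?P ` D _" j y] one unfolding T_def v_def by (auto simp: image_iff)
      then obtain x where x: "\<And>m. m \<in> ?A \<Longrightarrow> x m \<in> D m \<and> v = ?P (x m)" by (auto simp: bchoice_iff)
      have xm: "x m = p + (x m $ j - p $ j) *\<^sub>R v" "x m \<in> Z" if "m \<in> ?A" for m
      proof -
        show "x m \<in> Z" using x[OF that] C(2) by (auto simp: D_def)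
        then show "x m = p + (x m $ j - p $ j) *\<^sub>R v" using x[OF that] central_proj_inverse[of "x m" j p] Z(1) by auto
      qed
      \<comment> \<open>\<open>x m $ j - p $ j\<close> is the parameter of \<open>x m\<close> on the
        line through \<open>p\<close> in direction \<open>v\<close>; equal parameters would put one
        point into two of the disjoint sets \<open>D m\<close>.\<close>
      have inj: "inj_on (\<lambda>m. x m $ j - p $ j) ?A"
      proof (rule inj_onI)
        fix m m' assume m: "m \<in> ?A" "m' \<in> ?A" "x m $ j - p $ j = x m' $ j - p $ j"
        then have "x m = x m'" using xm(1)[OF m(1)] xm(1)[OF m(2)] by metis
        then have "x m \<in> D m \<inter> D m'" using x[OF m(1)] x[OF m(2)] by auto
        then show "m = m'" unfolding D_def by (cases m m' rule: linorder_cases) auto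
      qed
      have "(\<lambda>m. x m $ j - p $ j) ` ?A \<subseteq> {t. p + t *\<^sub>R v \<in> Z}"
      proof
        fix t assume "t \<in> (\<lambda>m. x m $ j - p $ j) ` ?A"
        then obtain m where m: "m \<in> ?A" "t = x m $ j - p $ j" by blast
        then have "p + t *\<^sub>R v = x m" using xm(1)[OF m(1)] by simp
        then show "t \<in> {t. p + t *\<^sub>R v \<in> Z}" using xm(2)[OF m(1)] by simp
      qed
      then have "card ?A \<le> M"
        using mult[OF vj] card_inj_on_le[OF inj] by (meson order_trans)
      moreover have "(\<Sum>m<N. indicator (T m) y) = (of_nat (card ?A) :: ennreal)"
        by (simp add: indicator_def sum.If_cases Int_def)
      ultimately show "(\<Sum>m<N. indicator (T m) y) \<le> (of_nat M :: ennreal)" by simp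
    qed
    then show ?thesis using True by simp
  qed
  have "(\<Union>m. C m) = (\<Union>m. D m)"
  proof
    show "(\<Union>m. C m) \<subseteq> (\<Union>m. D m)"
    proof
      fix x assume "x \<in> (\<Union>m. C m)"
      then have ex: "\<exists>m. x \<in> C m" by blast
      have "x \<in> D (LEAST m. x \<in> C m)"
        unfolding D_def using LeastI_ex[OF ex] not_less_Least by blast
      then show "x \<in> (\<Union>m. D m)" by blast
    qed
  qed (auto simp: D_def)
  then have "hausdorff ?d (\<Union>m. C m) \<le> (\<Sum>m. hausdorff ?d (D m))" using hausdorff_UN[of ?d D] by simp
  also have "\<dots> \<le> (\<Sum>m. ?k * emeasure lborel (T m))" by (intro suminf_le H) auto
  also have "\<dots> = ?k * (\<Sum>m. emeasure lborel (T m))" by simp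
  also have "(\<Sum>m. emeasure lborel (T m)) = (\<Sum>m. \<integral>\<^sup>+y. indicator (T m) y \<partial>lborel)" using Tb by simp
  also have "\<dots> = (\<integral>\<^sup>+y. (\<Sum>m. indicator (T m) y) \<partial>lborel)"
    using Tb by (intro nn_integral_suminf[symmetric]) auto
  also have "\<dots> \<le> (\<integral>\<^sup>+y. of_nat M * indicator Q y \<partial>lborel)" by (intro nn_integral_mono cnt)
  also have "\<dots> = of_nat M * emeasure lborel Q" by (rule nn_integral_cmult_indicator) (simp add: Q_def)
  also have "emeasure lborel Q = ennreal (2 ^ CARD('n))"
  proof -
    have ne: "Q \<noteq> {}" by (simp add: Q_def interval_ne_empty_cart)
    have "measure lborel Q = 2 ^ CARD('n)" using content_cbox_cart[OF ne[unfolded Q_def]] by (simp add: Q_def)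
    then show ?thesis
      using emeasure_eq_ennreal_measure[of lborel Q] emeasure_lborel_cbox_finite by (auto simp: Q_def less_top)
  qed
  finally have "hausdorff ?d (\<Union>m. C m) \<le> ?k * (of_nat M * ennreal (2 ^ CARD('n)))"
    by (simp add: mult_left_mono)
  also have "\<dots> = ennreal (L ^ ?d * crofton_const TYPE('n) * (2 ^ CARD('n) * real M))"
    using L crofton_const_pos[where ?'n = 'n]
    by (simp add: ennreal_of_nat_eq_real_of_nat ennreal_mult[symmetric] mult_ac)
  finally show ?thesis .
qed

section \<open>Real analytic functions\<close>

definition has_power_series :: "(('n::finite \<Rightarrow> nat) \<Rightarrow> real) \<Rightarrow> real^'n \<Rightarrow> (real^'n \<Rightarrow> real) \<Rightarrow> real \<Rightarrow> bool" where
  "has_power_series c x f r \<longleftrightarrow> r > 0 \<and>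
     (\<forall>y\<in>ball x r. ((\<lambda>\<alpha>. c \<alpha> * (\<Prod>i\<in>UNIV. (y $ i - x $ i) ^ \<alpha> i)) has_sum f y) UNIV)"

lemma real_analytic_on_iff_power_series:
  "real_analytic_on S f \<longleftrightarrow> (\<forall>x\<in>S. \<exists>r c. has_power_series c x f r)"
  unfolding real_analytic_on_def has_power_series_def by blast

definition shift_coeff :: "'n \<Rightarrow> (('n \<Rightarrow> nat) \<Rightarrow> real) \<Rightarrow> ('n \<Rightarrow> nat) \<Rightarrow> real" where
  "shift_coeff i c \<beta> = real (\<beta> i + 1) * c (\<beta>(i := \<beta> i + 1))"

text \<open>Unconditional summability of reals is absolute. At the point x + (s, ..., s), whose
  distance from \<open>x\<close> is \<open>s\<close> times the root of the dimension, every monomial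
  becomes a power of \<open>s\<close>.\<close>

lemma has_power_series_summable_abs:
  fixes x :: "real^'n"
  assumes "has_power_series c x f r" "0 < s" "s * sqrt (real CARD('n)) < r"
  shows "(\<lambda>\<alpha>. \<bar>c \<alpha>\<bar> * s ^ mi_order \<alpha>) summable_on UNIV"
proof -
  define y where "y = (\<chi> i. x $ i + s)"
  have "dist x y = sqrt (\<Sum>i\<in>(UNIV::'n set). s\<^sup>2)"
    by (simp add: dist_vec_def L2_set_def y_def dist_real_def)
  also have "\<dots> = s * sqrt (real CARD('n))" using assms(2) by (simp add: real_sqrt_mult)
  finally have "y \<in> ball x r" using assms(3) by simp
  then have "(\<lambda>\<alpha>. c \<alpha> * (\<Prod>i\<in>UNIV. (y $ i - x $ i) ^ \<alpha> i)) summable_on UNIV"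
    using assms(1) by (auto simp: has_power_series_def summable_on_def)
  then have "(\<lambda>\<alpha>. c \<alpha> * s ^ mi_order \<alpha>) summable_on UNIV"
    by (simp add: y_def mi_order_def power_sum)
  then have "(\<lambda>\<alpha>. norm (c \<alpha> * s ^ mi_order \<alpha>)) summable_on UNIV"
    by (rule summable_on_iff_abs_summable_on_real[THEN iffD1])
  then show ?thesis using assms(2) by (simp add: abs_mult)
qed

lemma infinite_multi_indices: "infinite (UNIV :: ('n::finite \<Rightarrow> nat) set)"
proof
  assume "finite (UNIV :: ('n \<Rightarrow> nat) set)"
  then have "finite (range (\<lambda>(k::nat) (_::'n). k))" by (rule rev_finite_subset) simp
  moreover have "inj (\<lambda>(k::nat) (_::'n). k)" by (rule injI) (metis)
  ultimately show False using finite_imageD infinite_UNIV_nat by blast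
qed

lemma power_series_term_derivative:
  fixes x y :: "real^'n"
  shows "((\<lambda>y. c * (\<Prod>i\<in>UNIV. (y $ i - x $ i) ^ \<alpha> i)) has_derivative
     (\<lambda>h. c * (\<Sum>i\<in>UNIV. real (\<alpha> i) * (y $ i - x $ i) ^ (\<alpha> i - 1) * h $ i *
        (\<Prod>j\<in>UNIV - {i}. (y $ j - x $ j) ^ \<alpha> j)))) (at y)"
proof -
  have "((\<lambda>y. (y $ i - x $ i) ^ \<alpha> i) has_derivative
      (\<lambda>h. real (\<alpha> i) * (y $ i - x $ i) ^ (\<alpha> i - 1) * h $ i)) (at y)" for i
  proof -
    have "((\<lambda>y. y $ i - x $ i) has_derivative (\<lambda>h. h $ i - 0)) (at y)"
      by (intro has_derivative_diff has_derivative_const bounded_linear_imp_has_derivative bounded_linear_vec_nth)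
    from has_derivative_power[OF this, of "\<alpha> i"] show ?thesis by (simp add: mult_ac)
  qed
  then have "((\<lambda>y. \<Prod>i\<in>UNIV. (y $ i - x $ i) ^ \<alpha> i) has_derivative
     (\<lambda>h. (\<Sum>i\<in>UNIV. real (\<alpha> i) * (y $ i - x $ i) ^ (\<alpha> i - 1) * h $ i *
        (\<Prod>j\<in>UNIV - {i}. (y $ j - x $ j) ^ \<alpha> j)))) (at y)"
    by (rule has_derivative_prod)
  then show ?thesis by (rule has_derivative_mult_right)
qed

text \<open>Halving the radius pays for one derivative: the factor \<open>mi_order \<alpha>\<close>
  that it produces is at most \<open>2 ^ mi_order \<alpha>\<close>.\<close>

lemma power_series_term_bound:
  fixes x y :: "real^'n"
  assumes "s > 0" "norm (y - x) < s / 2"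
  shows "\<bar>\<Sum>i\<in>UNIV. real (\<alpha> i) * (y $ i - x $ i) ^ (\<alpha> i - 1) * h $ i *
        (\<Prod>j\<in>UNIV - {i}. (y $ j - x $ j) ^ \<alpha> j)\<bar> \<le> (2 / s) * s ^ mi_order \<alpha> * norm h"
proof -
  have b: "\<bar>y $ i - x $ i\<bar> \<le> s / 2" for i
    using component_le_norm_cart[of "y - x" i] assms(2) by simp
  have "\<bar>real (\<alpha> i) * (y $ i - x $ i) ^ (\<alpha> i - 1) * h $ i *
        (\<Prod>j\<in>UNIV - {i}. (y $ j - x $ j) ^ \<alpha> j)\<bar> \<le> real (\<alpha> i) * ((2 / s) * (s / 2) ^ mi_order \<alpha>) * norm h" for i
  proof (cases "\<alpha> i = 0")
    case False
    have "\<bar>real (\<alpha> i) * (y $ i - x $ i) ^ (\<alpha> i - 1) * h $ i * (\<Prod>j\<in>UNIV - {i}. (y $ j - x $ j) ^ \<alpha> j)\<bar>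
      = real (\<alpha> i) * (\<bar>y $ i - x $ i\<bar> ^ (\<alpha> i - 1) * (\<Prod>j\<in>UNIV - {i}. \<bar>y $ j - x $ j\<bar> ^ \<alpha> j)) * \<bar>h $ i\<bar>"
      by (simp add: abs_mult abs_prod power_abs mult_ac)
    also have "\<dots> \<le> real (\<alpha> i) * ((s / 2) ^ (\<alpha> i - 1) * (\<Prod>j\<in>UNIV - {i}. (s / 2) ^ \<alpha> j)) * norm h"
      using assms b by (intro mult_mono power_mono prod_mono component_le_norm_cart conjI prod_nonneg
         mult_nonneg_nonneg) auto
    also have "(s / 2) ^ (\<alpha> i - 1) * (\<Prod>j\<in>UNIV - {i}. (s / 2) ^ \<alpha> j) = (2 / s) * (s / 2) ^ mi_order \<alpha>"
    proof -
      have "mi_order \<alpha> = \<alpha> i + (\<Sum>j\<in>UNIV - {i}. \<alpha> j)"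
        unfolding mi_order_def by (rule sum.remove) auto
      then have "mi_order \<alpha> = Suc ((\<alpha> i - 1) + (\<Sum>j\<in>UNIV - {i}. \<alpha> j))" using False by simp
      then show ?thesis using assms(1) by (simp add: power_add power_sum)
    qed
    finally show ?thesis .
  qed simp
  then have "\<bar>\<Sum>i\<in>UNIV. real (\<alpha> i) * (y $ i - x $ i) ^ (\<alpha> i - 1) * h $ i *
        (\<Prod>j\<in>UNIV - {i}. (y $ j - x $ j) ^ \<alpha> j)\<bar>
      \<le> (\<Sum>i\<in>UNIV. real (\<alpha> i) * ((2 / s) * (s / 2) ^ mi_order \<alpha>) * norm h)"
    by (intro order_trans[OF sum_abs] sum_mono)
  also have "\<dots> = real (mi_order \<alpha>) * ((2 / s) * (s / 2) ^ mi_order \<alpha>) * norm h"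
    unfolding mi_order_def by (simp add: sum_distrib_right[symmetric] del: times_divide_eq_left times_divide_eq_right)
  also have "\<dots> = (real (mi_order \<alpha>) / 2 ^ mi_order \<alpha>) * ((2 / s) * s ^ mi_order \<alpha> * norm h)"
    by (simp add: power_divide mult_ac)
  also have "\<dots> \<le> 1 * ((2 / s) * s ^ mi_order \<alpha> * norm h)"
  proof (intro mult_right_mono)
    have "real k \<le> 2 ^ k" for k :: nat using less_exp[of k] by (metis less_imp_le of_nat_le_iff of_nat_numeral of_nat_power)
    then show "real (mi_order \<alpha>) / 2 ^ mi_order \<alpha> \<le> 1" by simp
  qed (use assms in auto)
  finally show ?thesis by simp
qed

text \<open>Termwise differentiation. On the ball of radius s / 2 the derivatives of the terms are
  dominated, relative to \<open>norm h\<close>, by a summable sequence, so the differentiated series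
  converges uniformly. The loss of radius is harmless because analyticity asks for some positive
  radius at each point.\<close>

lemma has_power_series_derivative:
  fixes x :: "real^'n"
  assumes ps: "has_power_series c x f r" and s: "0 < s" "s * sqrt (real CARD('n)) < r"
  shows "\<And>y. y \<in> ball x (s / 2) \<Longrightarrow> (f has_derivative (\<lambda>h. \<Sum>i\<in>UNIV. h $ i * partial_deriv i f y)) (at y)"
    and "has_power_series (shift_coeff i c) x (partial_deriv i f) (s / 2)"
proof -
  define T where "T \<alpha> y h = c \<alpha> * (\<Sum>i\<in>UNIV. real (\<alpha> i) * (y $ i - x $ i) ^ (\<alpha> i - 1) * h $ i *
        (\<Prod>j\<in>UNIV - {i}. (y $ j - x $ j) ^ \<alpha> j))" for \<alpha> and y h :: "real^'n"
  define P where "P \<alpha> y = c \<alpha> * (\<Prod>i\<in>UNIV. (y $ i - x $ i) ^ \<alpha> i)" for \<alpha> and y :: "real^'n"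
  have abs: "(\<lambda>\<alpha>. \<bar>c \<alpha>\<bar> * s ^ mi_order \<alpha>) summable_on UNIV"
    by (rule has_power_series_summable_abs[OF ps s])
  then have absK: "(\<lambda>\<alpha>. (2 / s) * (\<bar>c \<alpha>\<bar> * s ^ mi_order \<alpha>)) summable_on UNIV"
    by (rule summable_on_cmult_right)
  have Tb: "\<bar>T \<alpha> y h\<bar> \<le> (2 / s) * (\<bar>c \<alpha>\<bar> * s ^ mi_order \<alpha>) * norm h" if "y \<in> ball x (s / 2)" for \<alpha> y h
  proof -
    have "\<bar>T \<alpha> y h\<bar> \<le> \<bar>c \<alpha>\<bar> * ((2 / s) * s ^ mi_order \<alpha> * norm h)"
      unfolding T_def abs_mult using that s
      by (intro mult_left_mono power_series_term_bound) (auto simp: dist_norm norm_minus_commute)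
    then show ?thesis by (simp add: mult_ac)
  qed
  have Tsum: "(\<lambda>\<alpha>. T \<alpha> y h) summable_on UNIV" if "y \<in> ball x (s / 2)" for y h
  proof (rule summable_on_iff_abs_summable_on_real[THEN iffD2], rule Infinite_Sum.abs_summable_on_comparison_test')
    show "(\<lambda>\<alpha>. (2 / s) * (\<bar>c \<alpha>\<bar> * s ^ mi_order \<alpha>) * norm h) summable_on UNIV"
      by (rule summable_on_cmult_left[OF absK])
    show "norm (T \<alpha> y h) \<le> (2 / s) * (\<bar>c \<alpha>\<bar> * s ^ mi_order \<alpha>) * norm h" for \<alpha>
      using Tb[OF that, of \<alpha> h] by simp
  qed
  have Psum: "((\<lambda>\<alpha>. P \<alpha> y) has_sum f y) UNIV" if "y \<in> ball x (s / 2)" for y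
  proof -
    have "1 \<le> real CARD('n)" by simp
    then have "s * 1 \<le> s * sqrt (real CARD('n))" using s(1) by (intro mult_left_mono) auto
    moreover have "dist x y < s / 2" using that by simp
    ultimately have "y \<in> ball x r" using s unfolding mem_ball by linarith
    then show ?thesis using ps unfolding has_power_series_def P_def by blast
  qed
  \<comment> \<open>\<open>has_derivative_series\<close> is about sequences, so the multi-indices
    are enumerated; absolute summability makes the order irrelevant.\<close>
  define e where "e = (from_nat_into UNIV :: nat \<Rightarrow> ('n \<Rightarrow> nat))"
  have e: "bij_betw e UNIV UNIV"
    unfolding e_def by (rule bij_betw_from_nat_into) (rule countableI_type, rule infinite_multi_indices)
  have sums: "(\<lambda>k. F (e k)) sums infsum F UNIV" if "F summable_on UNIV" for F :: "('n \<Rightarrow> nat) \<Rightarrow> real"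
    using has_sum_reindex_bij_betw[OF e, of F "infsum F UNIV"] that
    by (intro has_sum_imp_sums) auto
  define g' where "g' y h = infsum (\<lambda>\<alpha>. T \<alpha> y h) UNIV" for y h
  have unif: "\<forall>\<^sub>F n in sequentially. \<forall>y\<in>ball x (s / 2). \<forall>h. norm ((\<Sum>k<n. T (e k) y h) - g' y h) \<le> \<epsilon> * norm h"
    if "\<epsilon> > 0" for \<epsilon>
  proof -
    define M where "M k = (2 / s) * (\<bar>c (e k)\<bar> * s ^ mi_order (e k))" for k
    have M: "summable M" using sums[OF absK] unfolding M_def by (rule sums_summable)
    have "\<forall>\<^sub>F n in sequentially. norm (\<Sum>k. M (k + n)) < \<epsilon>"
      using suminf_exist_split[OF that M] by (auto simp: eventually_sequentially)
    then show ?thesis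
    proof eventually_elim
      case (elim n)
      show ?case
      proof (intro ballI allI)
        fix y h assume y: "y \<in> ball x (s / 2)"
        have S: "(\<lambda>k. T (e k) y h) sums g' y h" unfolding g'_def by (rule sums[OF Tsum[OF y]])
        then have "g' y h = (\<Sum>k. T (e (k + n)) y h) + (\<Sum>k<n. T (e k) y h)"
          using suminf_split_initial_segment[OF sums_summable[OF S], of n] by (simp add: sums_iff)
        then have "norm ((\<Sum>k<n. T (e k) y h) - g' y h) = norm (\<Sum>k. T (e (k + n)) y h)" by simp
        also have "\<dots> \<le> (\<Sum>k. M (k + n) * norm h)"
        proof (rule summable_norm[THEN order_trans])
          have Ms: "summable (\<lambda>k. M (k + n) * norm h)"
            using summable_ignore_initial_segment[OF M] by (rule summable_mult2)
          have le: "norm (T (e (k + n)) y h) \<le> M (k + n) * norm h" for k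
            using Tb[OF y, of "e (k + n)" h] by (simp add: M_def)
          show sT: "summable (\<lambda>k. norm (T (e (k + n)) y h))"
            by (rule summable_comparison_test'[OF Ms]) (use le in auto)
          show "(\<Sum>k. norm (T (e (k + n)) y h)) \<le> (\<Sum>k. M (k + n) * norm h)"
            by (rule suminf_le[OF le sT Ms])
        qed
        also have "\<dots> = (\<Sum>k. M (k + n)) * norm h"
          using suminf_mult2[OF summable_ignore_initial_segment[OF M], of n "norm h"] by simp
        also have "\<dots> \<le> \<epsilon> * norm h" using elim by (intro mult_right_mono) auto
        finally show "norm ((\<Sum>k<n. T (e k) y h) - g' y h) \<le> \<epsilon> * norm h" .
      qed
    qed
  qed
  have fs: "(\<lambda>k. P (e k) y) sums f y" if "y \<in> ball x (s / 2)" for y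
  proof -
    have "infsum (\<lambda>\<alpha>. P \<alpha> y) UNIV = f y" using Psum[OF that] by (rule infsumI)
    moreover have "(\<lambda>\<alpha>. P \<alpha> y) summable_on UNIV" using Psum[OF that] by (auto simp: summable_on_def)
    ultimately show ?thesis using sums[of "\<lambda>\<alpha>. P \<alpha> y"] by simp
  qed
  have xin: "x \<in> ball x (s / 2)" using s by simp
  have "\<exists>g. \<forall>y\<in>ball x (s / 2). (\<lambda>k. P (e k) y) sums g y \<and> (g has_derivative g' y) (at y within ball x (s / 2))"
  proof (rule has_derivative_series[where S = "ball x (s / 2)" and f = "\<lambda>k. P (e k)" and f' = "\<lambda>k. T (e k)" and x = x and l = "f x"])
    fix k y assume "y \<in> ball x (s / 2)"
    show "(P (e k) has_derivative T (e k) y) (at y within ball x (s / 2))"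
      unfolding P_def T_def by (rule has_derivative_at_withinI[OF power_series_term_derivative])
  qed (use unif xin fs[OF xin] in simp_all)
  then obtain g where g: "\<And>y. y \<in> ball x (s / 2) \<Longrightarrow> (\<lambda>k. P (e k) y) sums g y"
    "\<And>y. y \<in> ball x (s / 2) \<Longrightarrow> (g has_derivative g' y) (at y within ball x (s / 2))" by blast
  have gf: "g y = f y" if "y \<in> ball x (s / 2)" for y using g(1)[OF that] fs[OF that] by (rule sums_unique2)
  have der: "(f has_derivative g' y) (at y)" if y: "y \<in> ball x (s / 2)" for y
  proof -
    have "(g has_derivative g' y) (at y)" using g(2)[OF y] y by (simp add: at_within_open[OF y])
    then show ?thesis
      by (rule has_derivative_transform_within_open[OF _ open_ball y]) (rule gf)
  qed
  have pd: "partial_deriv i f y = g' y (axis i 1)" if y: "y \<in> ball x (s / 2)" for i y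
    unfolding partial_deriv_def using frechet_derivative_at[OF der[OF y]] by simp
  show "(f has_derivative (\<lambda>h. \<Sum>i\<in>UNIV. h $ i * partial_deriv i f y)) (at y)" if y: "y \<in> ball x (s / 2)" for y
  proof -
    have lin: "linear (g' y)" using der[OF y] by (rule has_derivative_linear)
    have "g' y h = (\<Sum>i\<in>UNIV. h $ i * partial_deriv i f y)" for h
    proof -
      have "h = (\<Sum>i\<in>UNIV. h $ i *\<^sub>R axis i 1)" using basis_expansion[of h] by (simp add: scalar_mult_eq_scaleR)
      then have "g' y h = g' y (\<Sum>i\<in>UNIV. h $ i *\<^sub>R axis i 1)" by simp
      also have "\<dots> = (\<Sum>i\<in>UNIV. h $ i *\<^sub>R g' y (axis i 1))"
        by (simp add: linear_sum[OF lin] linear_scale[OF lin])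
      finally show ?thesis by (simp add: pd[OF y])
    qed
    then have "g' y = (\<lambda>h. \<Sum>i\<in>UNIV. h $ i * partial_deriv i f y)" by blast
    then show ?thesis using der[OF y] by simp
  qed
  show "has_power_series (shift_coeff i c) x (partial_deriv i f) (s / 2)"
    unfolding has_power_series_def
  proof (intro conjI ballI)
    show "0 < s / 2" using s by simp
    fix y assume y: "y \<in> ball x (s / 2)"
    have Ti: "T \<alpha> y (axis i 1) = c \<alpha> * (real (\<alpha> i) * (y $ i - x $ i) ^ (\<alpha> i - 1) * (\<Prod>j\<in>UNIV - {i}. (y $ j - x $ j) ^ \<alpha> j))" for \<alpha>
    proof -
      have "(\<Sum>k\<in>UNIV. real (\<alpha> k) * (y $ k - x $ k) ^ (\<alpha> k - 1) * axis i 1 $ k * (\<Prod>j\<in>UNIV - {k}. (y $ j - x $ j) ^ \<alpha> j))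
        = (\<Sum>k\<in>UNIV. if k = i then real (\<alpha> i) * (y $ i - x $ i) ^ (\<alpha> i - 1) * (\<Prod>j\<in>UNIV - {i}. (y $ j - x $ j) ^ \<alpha> j) else 0)"
        by (rule sum.cong) (auto simp: axis_def)
      then show ?thesis by (simp add: T_def)
    qed
    have hs: "((\<lambda>\<alpha>. T \<alpha> y (axis i 1)) has_sum partial_deriv i f y) UNIV"
      unfolding pd[OF y] g'_def using Tsum[OF y] by simp
    \<comment> \<open>Raising index \<open>i\<close> is injective, and terms outside its range have
      \<open>\<alpha> i = 0\<close> and vanish after differentiation; reindexing along
      \<open>up\<close> yields \<open>shift_coeff\<close>.\<close>
    define up where "up \<beta> = \<beta>(i := \<beta> i + 1)" for \<beta> :: "'n \<Rightarrow> nat"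
    have inj: "inj up"
      by (rule inj_on_inverseI[where g = "\<lambda>\<beta>. \<beta>(i := \<beta> i - 1)"]) (simp add: up_def)
    have "\<alpha> \<in> range up" if "\<alpha> i \<noteq> 0" for \<alpha>
    proof -
      have "\<alpha> = up (\<alpha>(i := \<alpha> i - 1))" using that by (simp add: up_def)
      then show ?thesis by blast
    qed
    then have "((\<lambda>\<alpha>. T \<alpha> y (axis i 1)) has_sum partial_deriv i f y) (range up)"
      by (intro has_sum_cong_neutral[THEN iffD2, OF _ _ _ hs]) (auto simp: Ti)
    then have "((\<lambda>\<alpha>. T \<alpha> y (axis i 1)) \<circ> up has_sum partial_deriv i f y) UNIV"
      using has_sum_reindex[OF inj] by blast
    moreover have "((\<lambda>\<alpha>. T \<alpha> y (axis i 1)) \<circ> up) \<beta> = shift_coeff i c \<beta> * (\<Prod>j\<in>UNIV. (y $ j - x $ j) ^ \<beta> j)" for \<beta>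
    proof -
      have "(\<Prod>j\<in>UNIV. (y $ j - x $ j) ^ \<beta> j) = (y $ i - x $ i) ^ \<beta> i * (\<Prod>j\<in>UNIV - {i}. (y $ j - x $ j) ^ \<beta> j)"
        by (rule prod.remove) auto
      moreover have "(\<Prod>j\<in>UNIV - {i}. (y $ j - x $ j) ^ up \<beta> j) = (\<Prod>j\<in>UNIV - {i}. (y $ j - x $ j) ^ \<beta> j)"
        by (rule prod.cong) (auto simp: up_def)
      ultimately show ?thesis by (simp add: Ti shift_coeff_def) (simp add: up_def)
    qed
    ultimately show "((\<lambda>\<alpha>. shift_coeff i c \<alpha> * (\<Prod>j\<in>UNIV. (y $ j - x $ j) ^ \<alpha> j)) has_sum partial_deriv i f y) UNIV"
      by (simp add: o_def)
  qed
qed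

lemma real_analytic_on_subset: "real_analytic_on S f \<Longrightarrow> T \<subseteq> S \<Longrightarrow> real_analytic_on T f"
  unfolding real_analytic_on_def by blast

lemma ex_radius_derivative_series:
  assumes "r > 0"
  shows "\<exists>s>0. s * sqrt (real CARD('n::finite)) < r"
proof -
  have "sqrt (real CARD('n)) > 0" by simp
  then show ?thesis using assms by (intro exI[of _ "r / (2 * sqrt (real CARD('n)))"]) auto
qed

lemma real_analytic_on_partial_deriv:
  assumes "real_analytic_on S f"
  shows "real_analytic_on S (partial_deriv i f)"
  unfolding real_analytic_on_iff_power_series
proof
  fix x assume "x \<in> S"
  then obtain r c where "has_power_series c x f r" using assms unfolding real_analytic_on_iff_power_series by blast
  moreover from this obtain s where "s > 0" "s * sqrt (real CARD('a)) < r"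
    using ex_radius_derivative_series[of r] unfolding has_power_series_def by blast
  ultimately show "\<exists>r c. has_power_series c x (partial_deriv i f) r"
    using has_power_series_derivative(2) by blast
qed

lemma real_analytic_on_has_derivative:
  assumes "real_analytic_on S f" "x \<in> S"
  shows "(f has_derivative (\<lambda>h. \<Sum>i\<in>UNIV. h $ i * partial_deriv i f x)) (at x)"
proof -
  obtain r c where ps: "has_power_series c x f r" using assms unfolding real_analytic_on_iff_power_series by blast
  moreover from this obtain s where "s > 0" "s * sqrt (real CARD('a)) < r"
    using ex_radius_derivative_series[of r] unfolding has_power_series_def by blast
  ultimately show ?thesis
    using has_power_series_derivative(1)[of c x f r s x] by simp
qed

lemma real_analytic_on_continuous_on: "real_analytic_on S f \<Longrightarrow> continuous_on S f"
  by (meson continuous_at_imp_continuous_on has_derivative_continuous real_analytic_on_has_derivative)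

lemma partial_deriv_eq_has_derivative:
  "(f has_derivative f') (at x) \<Longrightarrow> partial_deriv i f x = f' (axis i 1)"
  unfolding partial_deriv_def using frechet_derivative_at[of f f' x] by simp

lemma partial_deriv_cong:
  assumes "open S" "x \<in> S" "\<And>y. y \<in> S \<Longrightarrow> f y = g y"
  shows "partial_deriv i f x = partial_deriv i g x"
proof -
  have "(f has_derivative F) (at x) \<longleftrightarrow> (g has_derivative F) (at x)" for F
    using assms by (metis has_derivative_transform_within_open)
  then show ?thesis by (simp add: partial_deriv_def frechet_derivative_def)
qed

lemma iterated_partial_cong:
  assumes "open S" "x \<in> S" "\<And>y. y \<in> S \<Longrightarrow> f y = g y"
  shows "iterated_partial is f x = iterated_partial is g x"
  using assms(2)
proof (induction "is" arbitrary: x)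
  case (Cons i "is")
  show ?case unfolding iterated_partial.simps by (rule partial_deriv_cong[OF assms(1) Cons.prems Cons.IH])
qed (use assms in auto)

lemma laplacian_cong:
  assumes "open S" "x \<in> S" "\<And>y. y \<in> S \<Longrightarrow> f y = g y"
  shows "laplacian f x = laplacian g x"
  unfolding laplacian_def by (intro sum.cong refl iterated_partial_cong[OF assms])

section \<open>Taylor coefficients and the identity theorem\<close>

lemma has_power_series_center:
  assumes "has_power_series c x f r"
  shows "f x = c (\<lambda>_. 0)"
proof -
  define P where "P \<alpha> = c \<alpha> * (\<Prod>i\<in>UNIV. (x $ i - x $ i) ^ \<alpha> i)" for \<alpha>
  have P: "(P has_sum f x) UNIV"
    using assms centre_in_ball[of x r] unfolding has_power_series_def P_def by blast
  have "P \<alpha> = 0" if "\<alpha> \<noteq> (\<lambda>_. 0)" for \<alpha>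
  proof -
    have "\<exists>i. \<alpha> i \<noteq> 0" using that by auto
    then obtain i where "\<alpha> i \<noteq> 0" ..
    then have "(x $ i - x $ i) ^ \<alpha> i = 0" by simp
    then have "(\<Prod>i\<in>UNIV. (x $ i - x $ i) ^ \<alpha> i) = 0" by (intro prod_zero[OF finite] bexI[of _ i]) auto
    then show ?thesis unfolding P_def by (simp only: mult_zero_right)
  qed
  then have "(P has_sum f x) UNIV \<longleftrightarrow> (P has_sum f x) {\<lambda>_. 0}"
    by (intro has_sum_cong_neutral) simp_all
  moreover have "(P has_sum P (\<lambda>_. 0)) {\<lambda>_. 0}" by (rule has_sum_finiteI) simp_all
  ultimately have "f x = P (\<lambda>_. 0)" using P has_sum_unique by blast
  then show ?thesis by (simp add: P_def)
qed

text \<open>\<open>K\<close> collects the factors produced by differentiating powers. Its positivity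
  makes a coefficient vanish exactly when the matching derivative vanishes at the centre.\<close>

lemma has_power_series_iterated_partial:
  assumes "has_power_series c x f r"
  shows "\<exists>r' K. (\<forall>\<beta>. K \<beta> > 0) \<and>
    has_power_series (\<lambda>\<beta>. K \<beta> * c (\<lambda>i. \<beta> i + count_list is i)) x (iterated_partial is f) r'"
proof (induction "is")
  case Nil
  show ?case using assms by (intro exI[of _ r] exI[of _ "\<lambda>_. 1"]) simp
next
  case (Cons i "is")
  then obtain r' K where K: "\<And>\<beta>. K \<beta> > 0"
    and ps: "has_power_series (\<lambda>\<beta>. K \<beta> * c (\<lambda>i. \<beta> i + count_list is i)) x (iterated_partial is f) r'"
    by blast
  obtain s where s: "s > 0" "s * sqrt (real CARD('a)) < r'"
    using ex_radius_derivative_series[of r'] ps unfolding has_power_series_def by blast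
  define K' where "K' \<beta> = real (\<beta> i + 1) * K (\<beta>(i := \<beta> i + 1))" for \<beta>
  have "(\<lambda>j. (\<beta>(i := \<beta> i + 1)) j + count_list is j) = (\<lambda>j. \<beta> j + count_list (i # is) j)" for \<beta>
    by auto
  then have "shift_coeff i (\<lambda>\<beta>. K \<beta> * c (\<lambda>i. \<beta> i + count_list is i)) = (\<lambda>\<beta>. K' \<beta> * c (\<lambda>j. \<beta> j + count_list (i # is) j))"
    by (simp add: shift_coeff_def K'_def fun_eq_iff)
  moreover have "K' \<beta> > 0" for \<beta> unfolding K'_def using K by (intro mult_pos_pos) auto
  ultimately show ?case using has_power_series_derivative(2)[OF ps s, of i] by auto
qed

lemma ex_list_count: "\<exists>is. \<forall>i. count_list is i = \<alpha> i" for \<alpha> :: "'n::finite \<Rightarrow> nat"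
proof (induction "mi_order \<alpha>" arbitrary: \<alpha>)
  case 0
  then show ?case by (intro exI[of _ "[]"]) (simp add: mi_order_def)
next
  case (Suc k)
  then obtain i where i: "\<alpha> i \<noteq> 0" unfolding mi_order_def by (metis nat.distinct(1) sum.neutral)
  have "mi_order \<alpha> = \<alpha> i + (\<Sum>j\<in>UNIV - {i}. \<alpha> j)"
    unfolding mi_order_def by (rule sum.remove) auto
  moreover have "mi_order (\<alpha>(i := \<alpha> i - 1)) = (\<alpha> i - 1) + (\<Sum>j\<in>UNIV - {i}. (\<alpha>(i := \<alpha> i - 1)) j)"
    unfolding mi_order_def by (subst sum.remove[of _ i]) auto
  moreover have "(\<Sum>j\<in>UNIV - {i}. (\<alpha>(i := \<alpha> i - 1)) j) = (\<Sum>j\<in>UNIV - {i}. \<alpha> j)" by (rule sum.cong) auto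
  ultimately have "k = mi_order (\<alpha>(i := \<alpha> i - 1))" using Suc.hyps(2) i by simp
  from Suc.hyps(1)[OF this] obtain "is" where "\<And>j. count_list is j = (\<alpha>(i := \<alpha> i - 1)) j" by blast
  then have "count_list (i # is) j = \<alpha> j" for j using i by auto
  then show ?case by blast
qed

lemma real_analytic_on_iterated_partial: "real_analytic_on S f \<Longrightarrow> real_analytic_on S (iterated_partial is f)"
  by (induction "is") (auto intro: real_analytic_on_partial_deriv)

text \<open>Every coefficient of the series is, up to a positive factor, an iterated derivative at
  the centre.\<close>

lemma real_analytic_on_locally_zero:
  assumes "real_analytic_on S f" "x \<in> S" "\<And>is. iterated_partial is f x = 0"
  shows "\<exists>r>0. \<forall>y\<in>ball x r. f y = 0"
proof -
  obtain r c where ps: "has_power_series c x f r" using assms unfolding real_analytic_on_iff_power_series by blast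
  have "c \<alpha> = 0" for \<alpha>
  proof -
    obtain "is" where "is": "\<And>i. count_list is i = \<alpha> i" using ex_list_count by blast
    obtain r' K where K: "\<And>\<beta>. K \<beta> > 0"
      and "has_power_series (\<lambda>\<beta>. K \<beta> * c (\<lambda>i. \<beta> i + count_list is i)) x (iterated_partial is f) r'"
      using has_power_series_iterated_partial[OF ps] by blast
    from has_power_series_center[OF this(2)] have "K (\<lambda>_. 0) * c \<alpha> = 0"
      using assms(3) "is" by simp
    then show ?thesis using K[of "\<lambda>_. 0"] by simp
  qed
  then have "((\<lambda>_::'a \<Rightarrow> nat. 0) has_sum f y) UNIV" if "y \<in> ball x r" for y
  proof -
    have "((\<lambda>\<alpha>. c \<alpha> * (\<Prod>i\<in>UNIV. (y $ i - x $ i) ^ \<alpha> i)) has_sum f y) UNIV"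
      using ps that unfolding has_power_series_def by blast
    then show ?thesis by (simp add: \<open>\<And>\<alpha>. c \<alpha> = 0\<close>)
  qed
  then have "f y = 0" if "y \<in> ball x r" for y
    using has_sum_unique[OF _ has_sum_0[of UNIV "\<lambda>_::'a \<Rightarrow> nat. 0"]] that by blast
  then show ?thesis using ps unfolding has_power_series_def by blast
qed

text \<open>The set where all iterated derivatives vanish is closed by continuity and open because
  the power series is zero near its points.\<close>

lemma real_analytic_on_identity:
  assumes f: "real_analytic_on S f" and S: "open S" "connected S"
    and V: "open V" "V \<inter> S \<noteq> {}" "\<And>y. y \<in> V \<inter> S \<Longrightarrow> f y = 0" and x: "x \<in> S"
  shows "f x = 0"
proof -
  define E where "E = {x \<in> S. \<forall>is. iterated_partial is f x = 0}"
  have zero: "iterated_partial is (\<lambda>_. 0 :: real) y = 0" for "is" and y :: "real^'a"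
  proof (induction "is" arbitrary: y)
    case (Cons i "is")
    then have "iterated_partial is (\<lambda>_. 0 :: real) = (\<lambda>_::real^'a. 0)" by blast
    then show ?case by (simp add: partial_deriv_def)
  qed simp
  have loc: "y \<in> E" if "open T" "y \<in> T" "T \<subseteq> S" "\<And>z. z \<in> T \<Longrightarrow> f z = 0" for y T
    using that iterated_partial_cong[of T y f "\<lambda>_. 0"] zero by (auto simp: E_def)
  have "openin (top_of_set S) E"
  proof -
    have "\<exists>e>0. ball y e \<subseteq> E" if yE: "y \<in> E" for y
    proof -
      obtain r where r: "r > 0" "\<And>z. z \<in> ball y r \<Longrightarrow> f z = 0"
        using real_analytic_on_locally_zero[OF f, of y] yE unfolding E_def by blast
      obtain e where e: "e > 0" "ball y e \<subseteq> S" using yE S(1) openE[of S y] unfolding E_def by blast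
      have "ball y (min e r) \<subseteq> E"
        by (intro subsetI loc[of "ball y (min e r)"]) (use r e in auto)
      then show ?thesis using r e by (intro exI[of _ "min e r"]) auto
    qed
    then have "open E" unfolding open_contains_ball by blast
    then show ?thesis using S(1) by (auto simp: openin_open_eq E_def)
  qed
  moreover have "closedin (top_of_set S) E"
  proof -
    have "E = S \<inter> (\<Inter>is. {x \<in> S. iterated_partial is f x = 0})" by (auto simp: E_def)
    moreover have "closedin (top_of_set S) {x \<in> S. iterated_partial is f x = 0}" for "is"
      by (intro continuous_closedin_preimage_constant real_analytic_on_continuous_on real_analytic_on_iterated_partial f)
    ultimately show ?thesis by (simp add: closedin_INT closedin_Int)
  qed
  moreover have "E \<noteq> {}"
    using loc[of "V \<inter> S"] V S by blast
  ultimately have "E = S" using S(2) unfolding connected_clopen by blast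
  then have "iterated_partial [] f x = 0" using x unfolding E_def by blast
  then show ?thesis by simp
qed

text \<open>Both sides are values at the centre of a power series, where they are the same doubly
  shifted coefficient.\<close>

lemma real_analytic_on_partial_deriv_commute:
  assumes "real_analytic_on S f" "x \<in> S"
  shows "partial_deriv i (partial_deriv j f) x = partial_deriv j (partial_deriv i f) x"
proof -
  obtain r c where ps: "has_power_series c x f r" using assms unfolding real_analytic_on_iff_power_series by blast
  have "partial_deriv i (partial_deriv j f) x = shift_coeff i (shift_coeff j c) (\<lambda>_. 0)" for i j
  proof -
    obtain s where "s > 0" "s * sqrt (real CARD('a)) < r"
      using ex_radius_derivative_series[of r] ps unfolding has_power_series_def by blast
    from has_power_series_derivative(2)[OF ps this] have ps2: "has_power_series (shift_coeff j c) x (partial_deriv j f) (s / 2)" .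
    obtain s' where "s' > 0" "s' * sqrt (real CARD('a)) < s / 2"
      using ex_radius_derivative_series[of "s / 2"] \<open>s > 0\<close> by auto
    from has_power_series_center[OF has_power_series_derivative(2)[OF ps2 this]] show ?thesis .
  qed
  moreover have "shift_coeff i (shift_coeff j c) (\<lambda>_. 0) = shift_coeff j (shift_coeff i c) (\<lambda>_. 0)"
  proof (cases "i = j")
    case False
    have "(\<lambda>_::'a. 0::nat)(i := 1, j := 1) = (\<lambda>_. 0)(j := 1, i := 1)" by (rule fun_upd_twist[OF False])
    then show ?thesis using False by (simp add: shift_coeff_def)
  qed simp
  ultimately show ?thesis by simp
qed

section \<open>Linear operations and directional derivatives\<close>

lemma real_analytic_on_add:
  assumes "real_analytic_on S f" "real_analytic_on S g"
  shows "real_analytic_on S (\<lambda>x. f x + g x)"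
  unfolding real_analytic_on_iff_power_series
proof
  fix x assume "x \<in> S"
  then obtain r c r' c' where "has_power_series c x f r" "has_power_series c' x g r'"
    using assms unfolding real_analytic_on_iff_power_series by metis
  then have "has_power_series (\<lambda>\<alpha>. c \<alpha> + c' \<alpha>) x (\<lambda>x. f x + g x) (min r r')"
    by (auto simp: has_power_series_def distrib_right intro!: has_sum_add)
  then show "\<exists>r c. has_power_series c x (\<lambda>x. f x + g x) r" by blast
qed

lemma real_analytic_on_cmult:
  assumes "real_analytic_on S f"
  shows "real_analytic_on S (\<lambda>x. k * f x)"
  unfolding real_analytic_on_iff_power_series
proof
  fix x assume "x \<in> S"
  then obtain r c where "has_power_series c x f r"
    using assms unfolding real_analytic_on_iff_power_series by metis
  then have "has_power_series (\<lambda>\<alpha>. k * c \<alpha>) x (\<lambda>x. k * f x) r"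
    by (auto simp: has_power_series_def mult.assoc intro!: has_sum_cmult_right)
  then show "\<exists>r c. has_power_series c x (\<lambda>x. k * f x) r" by blast
qed

lemma real_analytic_on_zero: "real_analytic_on S (\<lambda>x. 0)"
  unfolding real_analytic_on_iff_power_series has_power_series_def
  by (auto intro!: exI[of _ 1] exI[of _ "\<lambda>_. 0"])

lemma real_analytic_on_sum:
  "(\<And>i. i \<in> I \<Longrightarrow> real_analytic_on S (f i)) \<Longrightarrow> real_analytic_on S (\<lambda>x. \<Sum>i\<in>I. f i x)"
  by (induction I rule: infinite_finite_induct) (auto intro: real_analytic_on_zero real_analytic_on_add)

lemma partial_deriv_add:
  assumes "real_analytic_on S f" "real_analytic_on S g" "x \<in> S"
  shows "partial_deriv i (\<lambda>x. f x + g x) x = partial_deriv i f x + partial_deriv i g x"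
proof -
  have "(f has_derivative frechet_derivative f (at x)) (at x)" "(g has_derivative frechet_derivative g (at x)) (at x)"
    using real_analytic_on_has_derivative[OF assms(1,3)] real_analytic_on_has_derivative[OF assms(2,3)]
    by (auto simp: frechet_derivative_works[symmetric] differentiable_def)
  from partial_deriv_eq_has_derivative[OF has_derivative_add[OF this]] show ?thesis
    by (simp add: partial_deriv_def)
qed

lemma partial_deriv_cmult:
  assumes "real_analytic_on S f" "x \<in> S"
  shows "partial_deriv i (\<lambda>x. k * f x) x = k * partial_deriv i f x"
proof -
  have "(f has_derivative frechet_derivative f (at x)) (at x)"
    using real_analytic_on_has_derivative[OF assms]
    by (auto simp: frechet_derivative_works[symmetric] differentiable_def)
  from partial_deriv_eq_has_derivative[OF has_derivative_mult_right[OF this]] show ?thesis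
    by (simp add: partial_deriv_def)
qed

lemma partial_deriv_sum:
  assumes "\<And>k. k \<in> I \<Longrightarrow> real_analytic_on S (f k)" "x \<in> S"
  shows "partial_deriv i (\<lambda>x. \<Sum>k\<in>I. f k x) x = (\<Sum>k\<in>I. partial_deriv i (f k) x)"
  using assms(1)
proof (induction I rule: infinite_finite_induct)
  case (insert k F)
  then show ?case
    using partial_deriv_add[of S "f k" "\<lambda>x. \<Sum>k\<in>F. f k x" x i] assms(2)
    by (simp add: real_analytic_on_sum)
qed (simp_all add: partial_deriv_def)

definition dir_deriv :: "real^'n \<Rightarrow> (real^'n \<Rightarrow> real) \<Rightarrow> real^'n \<Rightarrow> real" where
  "dir_deriv e f x = (\<Sum>i\<in>UNIV. e $ i * partial_deriv i f x)"

lemma real_analytic_on_dir_deriv: "real_analytic_on S f \<Longrightarrow> real_analytic_on S (dir_deriv e f)"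
  unfolding dir_deriv_def by (intro real_analytic_on_sum real_analytic_on_cmult real_analytic_on_partial_deriv)

lemma real_analytic_on_laplacian: "real_analytic_on S f \<Longrightarrow> real_analytic_on S (laplacian f)"
  unfolding laplacian_def by (intro real_analytic_on_sum real_analytic_on_iterated_partial)

lemma partial_deriv_dir_deriv:
  assumes "real_analytic_on S f" "x \<in> S"
  shows "partial_deriv i (dir_deriv e f) x = dir_deriv e (partial_deriv i f) x"
proof -
  have "partial_deriv i (dir_deriv e f) x = (\<Sum>k\<in>UNIV. partial_deriv i (\<lambda>x. e $ k * partial_deriv k f x) x)"
    unfolding dir_deriv_def using assms
    by (intro partial_deriv_sum[where S = S] real_analytic_on_cmult real_analytic_on_partial_deriv)
  also have "\<dots> = (\<Sum>k\<in>UNIV. e $ k * partial_deriv k (partial_deriv i f) x)"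
  proof (rule sum.cong[OF refl])
    fix k
    show "partial_deriv i (\<lambda>x. e $ k * partial_deriv k f x) x = e $ k * partial_deriv k (partial_deriv i f) x"
      using partial_deriv_cmult[OF real_analytic_on_partial_deriv[OF assms(1)] assms(2)]
        real_analytic_on_partial_deriv_commute[OF assms, of i k] by simp
  qed
  finally show ?thesis by (simp add: dir_deriv_def)
qed

lemma dir_deriv_cong:
  assumes "open S" "x \<in> S" "\<And>y. y \<in> S \<Longrightarrow> f y = g y"
  shows "dir_deriv e f x = dir_deriv e g x"
  unfolding dir_deriv_def using partial_deriv_cong[OF assms] by simp

lemma laplacian_dir_deriv:
  assumes "real_analytic_on S f" "open S" "x \<in> S"
  shows "laplacian (dir_deriv e f) x = dir_deriv e (laplacian f) x"
proof -
  have "partial_deriv i (partial_deriv i (dir_deriv e f)) x = dir_deriv e (partial_deriv i (partial_deriv i f)) x" for i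
  proof -
    have "partial_deriv i (partial_deriv i (dir_deriv e f)) x = partial_deriv i (dir_deriv e (partial_deriv i f)) x"
      using assms by (intro partial_deriv_cong[where S = S] partial_deriv_dir_deriv)
    also have "\<dots> = dir_deriv e (partial_deriv i (partial_deriv i f)) x"
      using assms by (intro partial_deriv_dir_deriv real_analytic_on_partial_deriv)
    finally show ?thesis .
  qed
  then have "laplacian (dir_deriv e f) x = (\<Sum>i\<in>UNIV. dir_deriv e (partial_deriv i (partial_deriv i f)) x)"
    by (simp add: laplacian_def)
  also have "\<dots> = (\<Sum>k\<in>UNIV. e $ k * (\<Sum>i\<in>UNIV. partial_deriv k (partial_deriv i (partial_deriv i f)) x))"
    unfolding dir_deriv_def sum_distrib_left by (rule sum.swap)
  also have "\<dots> = (\<Sum>k\<in>UNIV. e $ k * partial_deriv k (laplacian f) x)"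
    unfolding laplacian_def using assms
    by (subst partial_deriv_sum[where S = S]) (auto intro: real_analytic_on_partial_deriv)
  finally show ?thesis by (simp add: dir_deriv_def)
qed

text \<open>Differentiability compares \<open>f y\<close> with \<open>f x\<close> only; here any two
  nearby points are compared, by the mean value inequality for \<open>f\<close> minus its linear
  part at \<open>x\<close>. This form makes a level set bi-Lipschitz to its projection near a point
  with nonzero gradient.\<close>

lemma real_analytic_on_strict_derivative:
  assumes f: "real_analytic_on S f" "open S" "x \<in> S" and "\<tau> > 0"
  shows "\<exists>\<delta>>0. \<forall>y\<in>ball x \<delta>. \<forall>y'\<in>ball x \<delta>.
    \<bar>f y - f y' - (\<Sum>i\<in>UNIV. (y $ i - y' $ i) * partial_deriv i f x)\<bar> \<le> \<tau> * norm (y - y')"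
proof -
  define F where "F y = (\<Sum>i\<in>UNIV. \<bar>partial_deriv i f y - partial_deriv i f x\<bar>)" for y
  have "continuous_on S F" unfolding F_def
    by (intro continuous_intros real_analytic_on_continuous_on real_analytic_on_partial_deriv f)
  then have "isCont F x" using f by (simp add: continuous_on_eq_continuous_at)
  then have "\<forall>\<^sub>F y in nhds x. F y < \<tau>"
    using \<open>\<tau> > 0\<close> order_tendstoD(2)[of F "F x" "nhds x" \<tau>] unfolding isCont_def tendsto_at_iff_tendsto_nhds
    by (simp add: F_def[of x])
  then obtain d where d: "d > 0" "\<And>y. dist y x < d \<Longrightarrow> F y < \<tau>" unfolding eventually_nhds_metric by blast
  obtain e where e: "e > 0" "ball x e \<subseteq> S" using f by (auto elim: openE)
  define \<delta> where "\<delta> = min d e"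
  have \<delta>: "\<delta> > 0" "ball x \<delta> \<subseteq> S" using d e by (auto simp: \<delta>_def)
  have "\<bar>f y - f y' - (\<Sum>i\<in>UNIV. (y $ i - y' $ i) * partial_deriv i f x)\<bar> \<le> \<tau> * norm (y - y')"
    if y: "y \<in> ball x \<delta>" "y' \<in> ball x \<delta>" for y y'
  proof -
    define g where "g z = f z - (\<Sum>i\<in>UNIV. z $ i * partial_deriv i f x)" for z
    have "norm (g y - g y') \<le> \<tau> * norm (y - y')"
    proof (rule differentiable_bound[OF convex_ball _ _ y(1,2)])
      fix z assume z: "z \<in> ball x \<delta>"
      then have "z \<in> S" using \<delta> by blast
      have "bounded_linear (\<lambda>z::real^'a. \<Sum>i\<in>UNIV. z $ i * partial_deriv i f x)"
        by (intro bounded_linear_sum bounded_linear_mult_left[THEN bounded_linear_compose] bounded_linear_vec_nth)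
      then have D: "(g has_derivative (\<lambda>h. (\<Sum>i\<in>UNIV. h $ i * partial_deriv i f z) - (\<Sum>i\<in>UNIV. h $ i * partial_deriv i f x))) (at z)"
        unfolding g_def by (intro has_derivative_diff real_analytic_on_has_derivative[OF f(1) \<open>z \<in> S\<close>] bounded_linear_imp_has_derivative)
      then show "(g has_derivative (\<lambda>h. (\<Sum>i\<in>UNIV. h $ i * partial_deriv i f z) - (\<Sum>i\<in>UNIV. h $ i * partial_deriv i f x))) (at z within ball x \<delta>)"
        by (rule has_derivative_at_withinI)
      show "onorm (\<lambda>h. (\<Sum>i\<in>UNIV. h $ i * partial_deriv i f z) - (\<Sum>i\<in>UNIV. h $ i * partial_deriv i f x)) \<le> \<tau>"
      proof (rule onorm_bound)
        fix h :: "real^'a"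
        have "norm ((\<Sum>i\<in>UNIV. h $ i * partial_deriv i f z) - (\<Sum>i\<in>UNIV. h $ i * partial_deriv i f x))
          = \<bar>\<Sum>i\<in>UNIV. h $ i * (partial_deriv i f z - partial_deriv i f x)\<bar>"
          by (simp add: sum_subtractf[symmetric] right_diff_distrib)
        also have "\<dots> \<le> (\<Sum>i\<in>UNIV. norm h * \<bar>partial_deriv i f z - partial_deriv i f x\<bar>)"
          by (rule order_trans[OF sum_abs]) (auto simp: abs_mult intro!: sum_mono mult_right_mono component_le_norm_cart)
        also have "\<dots> = norm h * F z" by (simp add: F_def sum_distrib_left)
        also have "\<dots> \<le> norm h * \<tau>" using d(2)[of z] z by (intro mult_left_mono) (auto simp: \<delta>_def dist_commute)
        finally show "norm ((\<Sum>i\<in>UNIV. h $ i * partial_deriv i f z) - (\<Sum>i\<in>UNIV. h $ i * partial_deriv i f x)) \<le> \<tau> * norm h"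
          by (simp add: mult.commute)
      qed (use \<open>\<tau> > 0\<close> in simp)
    qed
    then show ?thesis by (simp add: g_def left_diff_distrib sum_subtractf algebra_simps)
  qed
  then show ?thesis using \<delta>(1) by blast
qed

section \<open>Averages over balls with weight \<open>(1 - |y|\<^sup>2)\<^sup>k\<close>\<close>

text \<open>The \<open>max\<close> extends the weight by 0, so averages become integrals over the
  whole space and translation invariance applies.\<close>

definition bump :: "'a::euclidean_space \<Rightarrow> real" where
  "bump y = max 0 (1 - (norm y)\<^sup>2)"

lemma bump_nonneg[simp]: "bump y \<ge> 0" and bump_le_1: "bump y \<le> 1"
  by (auto simp: bump_def)

lemma bump_eq_0: "norm y \<ge> 1 \<Longrightarrow> bump y = 0"
  using power_mono[of 1 "norm y" 2] by (simp add: bump_def)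

lemma continuous_on_bump[continuous_intros]: "continuous_on S g \<Longrightarrow> continuous_on S (\<lambda>x. bump (g x))"
  unfolding bump_def by (intro continuous_intros)

lemma bump_measurable[measurable]: "bump \<in> borel_measurable borel"
  by (intro borel_measurable_continuous_onI continuous_intros)

lemma integrable_bump:
  fixes F :: "'a::euclidean_space \<Rightarrow> real"
  assumes "continuous_on (cball 0 1) F" "k \<ge> 1"
  shows "integrable lborel (\<lambda>y. bump y ^ k * F y)"
proof -
  have "integrable lborel (\<lambda>y. indicator (cball 0 1) y *\<^sub>R (bump y ^ k * F y))"
    by (intro borel_integrable_compact compact_cball continuous_intros assms(1))
  also have "(\<lambda>y. indicator (cball 0 1) y *\<^sub>R (bump y ^ k * F y)) = (\<lambda>y. bump y ^ k * F y)"
    using assms(2) by (auto simp: fun_eq_iff indicator_def bump_eq_0)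
  finally show ?thesis .
qed

text \<open>The delicate point is s = 0, where the exponent k + 1 \<ge> 2 makes the difference
  quotient tend to 0.\<close>

lemma max_0_power_has_derivative:
  assumes "k \<ge> 1"
  shows "((\<lambda>s::real. max 0 s ^ Suc k) has_real_derivative real (Suc k) * max 0 s ^ k) (at s)"
proof -
  consider "s > 0" | "s < 0" | "s = 0" by linarith
  then show ?thesis
  proof cases
    case 1
    have "((\<lambda>s::real. s ^ Suc k) has_real_derivative real (Suc k) * s ^ k) (at s)"
      by (rule derivative_eq_intros refl | simp)+
    then have "((\<lambda>s::real. max 0 s ^ Suc k) has_real_derivative real (Suc k) * s ^ k) (at s)"
      by (rule has_field_derivative_transform_within_open[where S = "{0<..}"]) (use 1 in auto)
    then show ?thesis using 1 by simp
  next
    case 2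
    have "((\<lambda>s::real. 0) has_real_derivative 0) (at s)" by simp
    then have "((\<lambda>s::real. max 0 s ^ Suc k) has_real_derivative 0) (at s)"
      by (rule has_field_derivative_transform_within_open[where S = "{..<0}"]) (use 2 in auto)
    then show ?thesis using 2 assms by (simp add: power_0_left del: power_Suc)
  next
    case 3
    have "(\<lambda>h::real. max 0 h ^ k) \<midarrow>0\<rightarrow> max 0 0 ^ k" by (intro tendsto_intros)
    moreover have "max 0 (0::real) ^ k = 0" using assms by simp
    ultimately have lim: "(\<lambda>h::real. max 0 h ^ k) \<midarrow>0\<rightarrow> 0" by (simp only:)
    have "(\<lambda>h::real. (max 0 h ^ Suc k) / h) \<midarrow>0\<rightarrow> 0"
    proof (rule Lim_null_comparison[OF _ lim])
      have "norm (max 0 h ^ Suc k / h) \<le> max 0 h ^ k" for h :: real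
        by (cases "h > 0") (auto simp: max_def)
      then show "\<forall>\<^sub>F h::real in at 0. norm (max 0 h ^ Suc k / h) \<le> max 0 h ^ k" by simp
    qed
    then show ?thesis using 3 assms by (simp add: DERIV_def del: power_Suc) (simp add: power_0_left)
  qed
qed

lemma bump_power_has_derivative:
  fixes y :: "'a::euclidean_space"
  assumes "k \<ge> 1"
  shows "((\<lambda>y. bump y ^ Suc k) has_derivative (\<lambda>h. - (2 * real (Suc k) * bump y ^ k * (y \<bullet> h)))) (at y)"
proof -
  have "((\<lambda>y::'a. 1 - y \<bullet> y) has_derivative (\<lambda>h. - (2 * (y \<bullet> h)))) (at y)"
    by (auto intro!: derivative_eq_intros simp: inner_commute)
  from has_derivative_compose[OF this max_0_power_has_derivative[OF assms, unfolded has_field_derivative_def]]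
  have "((\<lambda>y. bump y ^ Suc k) has_derivative (\<lambda>h. real (Suc k) * max 0 (1 - y \<bullet> y) ^ k * - (2 * (y \<bullet> h)))) (at y)"
    unfolding bump_def power2_norm_eq_inner .
  moreover have "(\<lambda>h. real (Suc k) * max 0 (1 - y \<bullet> y) ^ k * - (2 * (y \<bullet> h))) = (\<lambda>h. - (2 * real (Suc k) * bump y ^ k * (y \<bullet> h)))"
    by (simp add: bump_def power2_norm_eq_inner fun_eq_iff)
  ultimately show ?thesis by simp
qed

lemma integral_lborel_translate:
  fixes X :: "'a::euclidean_space \<Rightarrow> real"
  assumes "X \<in> borel_measurable borel"
  shows "(LINT y|lborel. X (y + c)) = (LINT y|lborel. X y)"
proof -
  have "(LINT y|lborel. X y) = (LINT y|distr lborel borel ((+) c). X y)" by (simp add: lborel_distr_plus)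
  also have "\<dots> = (LINT y|lborel. X (c + y))" using assms by (intro integral_distr) auto
  finally show ?thesis by (simp add: add.commute)
qed

lemma integrable_lborel_translate:
  fixes X :: "'a::euclidean_space \<Rightarrow> real"
  assumes "integrable lborel X"
  shows "integrable lborel (\<lambda>y. X (y + c))"
proof -
  have "integrable (distr lborel borel ((+) c)) X" using assms by (simp add: lborel_distr_plus)
  then show ?thesis using assms by (subst (asm) integrable_distr_eq) (auto simp: add.commute)
qed

text \<open>The integral of a translate does not depend on the translation; differentiate it.\<close>

lemma bump_integration_by_parts:
  fixes V :: "'a::euclidean_space \<Rightarrow> real"
  assumes S: "open S" "cball 0 1 \<subseteq> S"
    and V: "\<And>y. y \<in> S \<Longrightarrow> (V has_derivative V' y) (at y)"
    and We: "\<And>y. y \<in> S \<Longrightarrow> V' y e = W y" and W: "continuous_on S W" and k: "k \<ge> 1"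
  shows "(LINT y|lborel. bump y ^ Suc k * W y) = 2 * real (Suc k) * (LINT y|lborel. bump y ^ k * ((y \<bullet> e) * V y))"
proof -
  define X where "X y = bump y ^ Suc k * V y" for y
  define D where "D y = bump y ^ Suc k * W y - 2 * real (Suc k) * (bump y ^ k * ((y \<bullet> e) * V y))" for y
  have contV: "continuous_on S V"
    using V by (meson continuous_at_imp_continuous_on has_derivative_continuous)
  \<comment> \<open>Off \<open>S\<close> the product vanishes in a whole neighbourhood, because the
    unit ball is closed and contained in \<open>S\<close>. The formula thus holds everywhere
    although \<open>V\<close> is known to be differentiable on \<open>S\<close> only.\<close>
  have DX: "(X has_derivative (\<lambda>h. if y \<in> S then bump y ^ Suc k * V' y h - 2 * real (Suc k) * (bump y ^ k * ((y \<bullet> h) * V y)) else 0)) (at y)" for y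
  proof (cases "y \<in> S")
    case True
    have "(X has_derivative (\<lambda>h. bump y ^ Suc k * V' y h + - (2 * real (Suc k) * bump y ^ k * (y \<bullet> h)) * V y)) (at y)"
      unfolding X_def by (rule has_derivative_mult[OF bump_power_has_derivative[OF k] V[OF True]])
    then show ?thesis using True by (simp add: mult_ac)
  next
    case False
    have "((\<lambda>_::'a. 0::real) has_derivative (\<lambda>_. 0)) (at y)" by simp
    then have "(X has_derivative (\<lambda>_. 0)) (at y)"
      by (rule has_derivative_transform_within_open[OF _ open_Compl[OF closed_cball[of 0 1]]])
        (use False S in \<open>auto simp: X_def bump_eq_0\<close>)
    then show ?thesis using False by simp
  qed
  have D0: "D y = 0" if "norm y \<ge> 1" for y using that k by (simp add: D_def bump_eq_0)
  have DXe: "((\<lambda>t. X (y + t *\<^sub>R e)) has_real_derivative D (y + t *\<^sub>R e)) (at t)" for y t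
  proof -
    have "((\<lambda>t. y + t *\<^sub>R e) has_derivative (\<lambda>t. t *\<^sub>R e)) (at t)"
      by (auto intro!: derivative_eq_intros)
    from has_derivative_compose[OF this DX[of "y + t *\<^sub>R e"]]
    have *: "((\<lambda>t. X (y + t *\<^sub>R e)) has_derivative (\<lambda>h. if y + t *\<^sub>R e \<in> S then bump (y + t *\<^sub>R e) ^ Suc k * V' (y + t *\<^sub>R e) (h *\<^sub>R e) -
      2 * real (Suc k) * (bump (y + t *\<^sub>R e) ^ k * (((y + t *\<^sub>R e) \<bullet> (h *\<^sub>R e)) * V (y + t *\<^sub>R e))) else 0)) (at t)" .
    have "V' (y + t *\<^sub>R e) (h *\<^sub>R e) = h * W (y + t *\<^sub>R e)" if "y + t *\<^sub>R e \<in> S" for h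
      using linear_scale[OF has_derivative_linear[OF V[OF that]]] We[OF that] by simp
    moreover have "D (y + t *\<^sub>R e) = 0" if "y + t *\<^sub>R e \<notin> S"
    proof -
      have "\<not> norm (y + t *\<^sub>R e) \<le> 1" using that S(2) mem_cball_0 by blast
      then show ?thesis by (intro D0) simp
    qed
    ultimately have "(\<lambda>h. if y + t *\<^sub>R e \<in> S then bump (y + t *\<^sub>R e) ^ Suc k * V' (y + t *\<^sub>R e) (h *\<^sub>R e) -
      2 * real (Suc k) * (bump (y + t *\<^sub>R e) ^ k * (((y + t *\<^sub>R e) \<bullet> (h *\<^sub>R e)) * V (y + t *\<^sub>R e))) else 0) = (\<lambda>h. D (y + t *\<^sub>R e) * h)"
      by (auto simp: fun_eq_iff D_def algebra_simps simp del: power_Suc)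
    with * show ?thesis by (simp add: has_field_derivative_def)
  qed
  have contD: "continuous_on (cball 0 1) D"
    unfolding D_def using S(2) contV W by (intro continuous_intros) (auto intro: continuous_on_subset)
  then have "bounded (D ` cball 0 1)" using compact_continuous_image compact_imp_bounded compact_cball by blast
  then obtain K where K: "K > 0" "\<And>y. y \<in> cball 0 1 \<Longrightarrow> norm (D y) \<le> K"
    unfolding bounded_pos by auto
  have DK: "norm (D y) \<le> K" for y using K D0[of y] by (cases "norm y \<le> 1") auto
  have lip: "norm (X (y + t *\<^sub>R e) - X y) \<le> K * norm t" for y t
  proof -
    have "norm (X (y + t *\<^sub>R e) - X (y + 0 *\<^sub>R e)) \<le> K * norm (t - 0)"
    proof (rule field_differentiable_bound[where S = UNIV])
      show "((\<lambda>t. X (y + t *\<^sub>R e)) has_real_derivative D (y + s *\<^sub>R e)) (at s within UNIV)" for s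
        using DXe by simp
    qed (use DK in auto)
    then show ?thesis by simp
  qed
  have "continuous_on UNIV X"
    using DX by (meson continuous_at_imp_continuous_on has_derivative_continuous)
  then have Xm[measurable]: "X \<in> borel_measurable borel" by (rule borel_measurable_continuous_onI)
  have Xint: "integrable lborel X"
    unfolding X_def using contV S(2) by (intro integrable_bump) (auto intro: continuous_on_subset)
  \<comment> \<open>Difference quotients of \<open>X\<close> with step 1 / (n + 1). Their integrals
    vanish by translation invariance, the Lipschitz bound dominates them on a fixed ball, and they
    tend to \<open>D\<close>; so \<open>D\<close> has integral 0, which is the claim.\<close>
  define s where "s n y = (X (y + (1 / real (Suc n)) *\<^sub>R e) - X y) * real (Suc n)" for n y
  have sm[measurable]: "s n \<in> borel_measurable borel" for n unfolding s_def by measurable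
  have sint: "(LINT y|lborel. s n y) = 0" for n
    unfolding s_def using Xint integrable_lborel_translate[OF Xint]
    by (simp add: integral_lborel_translate)
  have lim: "(\<lambda>n. s n y) \<longlonglongrightarrow> D y" for y
  proof -
    have "(\<lambda>h. (X (y + h *\<^sub>R e) - X y) / h) \<midarrow>0\<rightarrow> D y"
      using DXe[of y 0] by (simp add: DERIV_def)
    moreover have "filterlim (\<lambda>n. 1 / real (Suc n)) (at 0) sequentially"
      unfolding filterlim_at using LIMSEQ_Suc[OF lim_1_over_n] by auto
    ultimately have "(\<lambda>n. (X (y + (1 / real (Suc n)) *\<^sub>R e) - X y) / (1 / real (Suc n))) \<longlonglongrightarrow> D y"
      by (rule filterlim_compose)
    then show ?thesis by (simp add: s_def)
  qed
  have bound: "norm (s n y) \<le> K * indicator (cball 0 (1 + norm e)) y" for n y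
  proof (cases "norm y \<le> 1 + norm e")
    case True
    have "norm (s n y) \<le> (K * norm (1 / real (Suc n))) * real (Suc n)"
      unfolding s_def norm_mult using lip[of y "1 / real (Suc n)"] by (intro mult_mono) auto
    then show ?thesis using True by simp
  next
    case False
    have "norm ((1 / real (Suc n)) *\<^sub>R e) \<le> norm e" by (simp add: divide_le_eq mult_le_cancel_left1)
    then have "norm (y + (1 / real (Suc n)) *\<^sub>R e) \<ge> 1"
      using False norm_diff_ineq[of y "(1 / real (Suc n)) *\<^sub>R e"] by linarith
    moreover have "norm y \<ge> 1" using False norm_ge_zero[of e] by linarith
    ultimately show ?thesis using False by (simp add: s_def X_def bump_eq_0)
  qed
  have "(\<lambda>n. LINT y|lborel. s n y) \<longlonglongrightarrow> (LINT y|lborel. D y)"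
  proof (rule integral_dominated_convergence)
    show "D \<in> borel_measurable lborel" by (rule borel_measurable_LIMSEQ_real[where u = s, OF lim]) simp
    show "integrable lborel (\<lambda>y. K * indicator (cball 0 (1 + norm e)) y)"
      by (intro integrable_mult_right integrable_real_indicator) (auto simp: emeasure_cball)
    show "s n \<in> borel_measurable lborel" for n by simp
    show "AE y in lborel. (\<lambda>n. s n y) \<longlonglongrightarrow> D y" using lim by simp
    show "AE y in lborel. norm (s n y) \<le> K * indicator (cball 0 (1 + norm e)) y" for n using bound by simp
  qed
  then have "(\<lambda>n::nat. 0::real) \<longlonglongrightarrow> (LINT y|lborel. D y)" by (simp only: sint)
  then have "(LINT y|lborel. D y) = 0" by (simp add: LIMSEQ_const_iff)
  moreover have "integrable lborel (\<lambda>y. bump y ^ Suc k * W y)"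
    using W S(2) by (intro integrable_bump) (auto intro: continuous_on_subset)
  moreover have "integrable lborel (\<lambda>y. bump y ^ k * ((y \<bullet> e) * V y))"
    using contV S(2) k by (intro integrable_bump continuous_intros) (auto intro: continuous_on_subset)
  ultimately show ?thesis by (simp add: D_def del: power_Suc)
qed

definition has_laplacian_on ::
  "('a::euclidean_space \<Rightarrow> real) \<Rightarrow> ('a \<Rightarrow> 'a \<Rightarrow> real) \<Rightarrow> ('a \<Rightarrow> real) \<Rightarrow> 'a set \<Rightarrow> bool" where
  "has_laplacian_on F F' L S \<longleftrightarrow>
     (\<forall>y\<in>S. (F has_derivative F' y) (at y)) \<and>
     (\<exists>F2. (\<forall>b\<in>Basis. (\<forall>y\<in>S. ((\<lambda>y. F' y b) has_derivative F2 b y) (at y)) \<and> continuous_on S (\<lambda>y. F2 b y b)) \<and>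
       (\<forall>y\<in>S. L y = (\<Sum>b\<in>Basis. F2 b y b)))"

lemma has_laplacian_onE:
  assumes "has_laplacian_on F F' L S"
  obtains F2 where "\<forall>b\<in>Basis. \<forall>y\<in>S. ((\<lambda>y. F' y b) has_derivative F2 b y) (at y)"
    "\<forall>b\<in>Basis. continuous_on S (\<lambda>y. F2 b y b)" "\<forall>y\<in>S. L y = (\<Sum>b\<in>Basis. F2 b y b)"
proof -
  from assms obtain F2 where F2: "(\<forall>b\<in>Basis. (\<forall>y\<in>S. ((\<lambda>y. F' y b) has_derivative F2 b y) (at y)) \<and> continuous_on S (\<lambda>y. F2 b y b))"
    "\<forall>y\<in>S. L y = (\<Sum>b\<in>Basis. F2 b y b)"
    unfolding has_laplacian_on_def by (elim conjE exE)
  show ?thesis by (rule that[of F2]) (use F2 in simp_all)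
qed

definition bump_avg :: "nat \<Rightarrow> ('a::euclidean_space \<Rightarrow> real) \<Rightarrow> 'a \<Rightarrow> real \<Rightarrow> real" where
  "bump_avg k F z R = (LINT y|lborel. bump y ^ k * F (z + R *\<^sub>R y))"

lemma has_laplacian_on_continuous:
  assumes "has_laplacian_on F F' L S"
  shows "continuous_on S F" "b \<in> Basis \<Longrightarrow> continuous_on S (\<lambda>y. F' y b)" "continuous_on S L"
proof -
  show "continuous_on S F" using assms unfolding has_laplacian_on_def
    by (meson continuous_at_imp_continuous_on has_derivative_continuous)
  show "continuous_on S (\<lambda>y. F' y b)" if "b \<in> Basis" using assms that unfolding has_laplacian_on_def
    by (meson continuous_at_imp_continuous_on has_derivative_continuous)
  obtain F2 where F2': "\<forall>b\<in>Basis. \<forall>y\<in>S. ((\<lambda>y. F' y b) has_derivative F2 b y) (at y)"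
    "\<forall>b\<in>Basis. continuous_on S (\<lambda>y. F2 b y b)" "\<forall>y\<in>S. L y = (\<Sum>b\<in>Basis. F2 b y b)"
    by (rule has_laplacian_onE[OF assms])
  note F2 = F2'[rule_format]
  have "continuous_on S (\<lambda>y. \<Sum>b\<in>Basis. F2 b y b)" by (intro continuous_on_sum F2(2))
  then show "continuous_on S L" by (rule continuous_on_eq) (simp add: F2(3))
qed

lemma cball_affine_subset:
  fixes z :: "'a::real_normed_vector"
  assumes "cball z r \<subseteq> S" "0 \<le> R" "R \<le> r" "y \<in> cball 0 1"
  shows "z + R *\<^sub>R y \<in> S"
proof -
  have "norm (R *\<^sub>R y) \<le> r * 1" using assms by (simp only: norm_scaleR) (intro mult_mono, auto)
  then show ?thesis using assms(1) by (auto simp: subset_iff dist_norm)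
qed

lemma continuous_on_affine_compose:
  fixes F :: "'a::real_normed_vector \<Rightarrow> real"
  assumes "continuous_on S F" "cball z r \<subseteq> S" "0 \<le> R" "R \<le> r"
  shows "continuous_on (cball 0 1) (\<lambda>y. F (z + R *\<^sub>R y))"
  by (rule continuous_on_compose2[OF assms(1)]) (use cball_affine_subset[OF assms(2-4)] in \<open>auto intro!: continuous_intros\<close>)

text \<open>Differentiation under the integral sign. The one-sided derivative at R = 0 is included
  because averages are compared with their value there.\<close>

lemma bump_avg_has_derivative_gen:
  fixes z :: "'a::euclidean_space"
  assumes S: "open S" "cball z r \<subseteq> S" and F: "\<And>y. y \<in> S \<Longrightarrow> (F has_derivative F' y) (at y)"
    and F': "\<And>b. b \<in> Basis \<Longrightarrow> continuous_on S (\<lambda>y. F' y b)"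
    and k: "k \<ge> 1" and R: "R \<in> {0..r}"
  shows "(bump_avg k F z has_real_derivative (LINT y|lborel. bump y ^ k * F' (z + R *\<^sub>R y) y)) (at R within {0..r})"
proof -
  have contF: "continuous_on S F" using F
    by (meson continuous_at_imp_continuous_on has_derivative_continuous)
  have lin: "F' p h = (\<Sum>b\<in>Basis. (h \<bullet> b) * F' p b)" if "p \<in> S" for p h
  proof -
    have l: "linear (F' p)" using F[OF that] by (rule has_derivative_linear)
    have "F' p h = F' p (\<Sum>b\<in>Basis. (h \<bullet> b) *\<^sub>R b)" by (simp add: euclidean_representation)
    also have "\<dots> = (\<Sum>b\<in>Basis. (h \<bullet> b) * F' p b)" by (simp add: linear_sum[OF l] linear_scale[OF l])
    finally show ?thesis .
  qed
  \<comment> \<open>\<open>leibniz_rule_field_derivative\<close> integrates over a box; on the part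
    of the box outside the unit ball the weight is 0.\<close>
  let ?B = "cbox (- One) One :: 'a set"
  let ?f = "\<lambda>R y. bump y ^ k * F (z + R *\<^sub>R y)" and ?fx = "\<lambda>R y. bump y ^ k * F' (z + R *\<^sub>R y) y"
  have BI: "cball (0::'a) 1 \<subseteq> ?B"
  proof
    fix y :: 'a assume y: "y \<in> cball 0 1"
    have "\<bar>y \<bullet> b\<bar> \<le> 1" if "b \<in> Basis" for b using Basis_le_norm[OF that, of y] y by simp
    then show "y \<in> ?B" by (auto simp: mem_box abs_le_iff minus_le_iff)
  qed
  have conv: "(LINT y|lborel. bump y ^ k * G y) = integral ?B (\<lambda>y. bump y ^ k * G y)"
    "(\<lambda>y. bump y ^ k * G y) integrable_on ?B"
    if "continuous_on (cball 0 1) G" for G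
  proof -
    have int: "integrable lborel (\<lambda>y. bump y ^ k * G y)" using that k by (rule integrable_bump)
    have eq: "(\<lambda>y. indicator ?B y *\<^sub>R (bump y ^ k * G y)) = (\<lambda>y. bump y ^ k * G y)"
    proof
      fix y show "indicator ?B y *\<^sub>R (bump y ^ k * G y) = bump y ^ k * G y"
      proof (cases "y \<in> ?B")
        case False
        then have "\<not> norm y \<le> 1" using BI mem_cball_0 by blast
        then show ?thesis using k by (simp add: bump_eq_0)
      qed simp
    qed
    have si: "set_integrable lborel ?B (\<lambda>y. bump y ^ k * G y)" unfolding set_integrable_def eq by (rule int)
    show "(LINT y|lborel. bump y ^ k * G y) = integral ?B (\<lambda>y. bump y ^ k * G y)"
      using set_borel_integral_eq_integral(2)[OF si] unfolding set_lebesgue_integral_def eq .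
    show "(\<lambda>y. bump y ^ k * G y) integrable_on ?B"
      by (rule set_borel_integral_eq_integral(1)[OF si])
  qed
  have cF: "continuous_on (cball 0 1) (\<lambda>y. F (z + R *\<^sub>R y))" if "R \<in> {0..r}" for R
    using continuous_on_affine_compose[OF contF S(2)] that by auto
  have cF': "continuous_on (cball 0 1) (\<lambda>y. F' (z + R *\<^sub>R y) y)" if "R \<in> {0..r}" for R
  proof -
    have "continuous_on (cball 0 1) (\<lambda>y. \<Sum>b\<in>Basis. (y \<bullet> b) * F' (z + R *\<^sub>R y) b)"
      using continuous_on_affine_compose[OF F' S(2)] that by (intro continuous_intros) auto
    then show ?thesis
      by (rule continuous_on_eq) (use cball_affine_subset[OF S(2)] that lin in auto)
  qed
  have "((\<lambda>R. integral ?B (?f R)) has_field_derivative integral ?B (?fx R)) (at R within {0..r})"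
  proof (rule leibniz_rule_field_derivative[OF _ _ _ R])
    fix R y assume Ry: "R \<in> {0..r}" "y \<in> ?B"
    show "((\<lambda>R. ?f R y) has_field_derivative ?fx R y) (at R within {0..r})"
    proof (cases "norm y \<le> 1")
      case True
      then have p: "z + R *\<^sub>R y \<in> S" using cball_affine_subset[OF S(2), of R y] Ry by auto
      have "((\<lambda>R. z + R *\<^sub>R y) has_derivative (\<lambda>t. t *\<^sub>R y)) (at R)"
        by (auto intro!: derivative_eq_intros)
      from has_derivative_compose[OF this F[OF p]]
      have "((\<lambda>R. F (z + R *\<^sub>R y)) has_derivative (\<lambda>t. F' (z + R *\<^sub>R y) (t *\<^sub>R y))) (at R)" .
      moreover have "F' (z + R *\<^sub>R y) (t *\<^sub>R y) = F' (z + R *\<^sub>R y) y * t" for t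
        using linear_scale[OF has_derivative_linear[OF F[OF p]]] by simp
      ultimately have "((\<lambda>R. F (z + R *\<^sub>R y)) has_real_derivative F' (z + R *\<^sub>R y) y) (at R)"
        by (simp add: has_field_derivative_def)
      then show ?thesis by (rule DERIV_cmult[OF has_field_derivative_at_within])
    next
      case False
      then have "bump y ^ k = 0" using k by (simp add: bump_eq_0)
      then show ?thesis by (simp only: mult_zero_left DERIV_const)
    qed
  next
    fix R assume "R \<in> {0..r}"
    then show "?f R integrable_on ?B" by (rule conv(2)[OF cF])
  next
    \<comment> \<open>Joint continuity is checked on two open sets covering the domain: on
      \<open>S1\<close> the point z + R y lies in \<open>S\<close>, on \<open>S2\<close> the weight
      vanishes.\<close>
    define S1 where "S1 = {p :: real \<times> 'a. z + fst p *\<^sub>R snd p \<in> S}"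
    define S2 where "S2 = {p :: real \<times> 'a. norm (snd p) > 1}"
    have "open ((\<lambda>p :: real \<times> 'a. z + fst p *\<^sub>R snd p) -` S)"
      by (intro open_vimage S(1) continuous_intros)
    then have o1: "open S1" by (simp only: S1_def vimage_def)
    have o2: "open S2" unfolding S2_def by (intro open_Collect_less continuous_intros)
    have "continuous_on S1 (\<lambda>p. bump (snd p) ^ k * (\<Sum>b\<in>Basis. (snd p \<bullet> b) * F' (z + fst p *\<^sub>R snd p) b))"
    proof (intro continuous_on_mult continuous_on_power continuous_on_bump continuous_on_sum continuous_on_inner
        continuous_on_snd continuous_on_id continuous_on_const)
      fix b :: 'a assume "b \<in> Basis"
      show "continuous_on S1 (\<lambda>p. F' (z + fst p *\<^sub>R snd p) b)"
        by (rule continuous_on_compose2[OF F'[OF \<open>b \<in> Basis\<close>]]) (auto simp: S1_def intro!: continuous_intros)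
    qed
    then have c1: "continuous_on S1 (\<lambda>p. ?fx (fst p) (snd p))"
    proof (rule continuous_on_eq)
      fix p assume p: "p \<in> S1"
      then have "F' (z + fst p *\<^sub>R snd p) (snd p) = (\<Sum>b\<in>Basis. (snd p \<bullet> b) * F' (z + fst p *\<^sub>R snd p) b)"
        by (intro lin) (simp add: S1_def)
      then show "bump (snd p) ^ k * (\<Sum>b\<in>Basis. (snd p \<bullet> b) * F' (z + fst p *\<^sub>R snd p) b) = ?fx (fst p) (snd p)" by simp
    qed
    have "continuous_on S2 (\<lambda>p. 0 :: real)" by simp
    then have c2: "continuous_on S2 (\<lambda>p. ?fx (fst p) (snd p))"
      by (rule continuous_on_eq) (use k in \<open>auto simp: S2_def bump_eq_0\<close>)
    have "{0..r} \<times> ?B \<subseteq> S1 \<union> S2"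
    proof
      fix p assume p: "p \<in> {0..r} \<times> ?B"
      show "p \<in> S1 \<union> S2"
        using cball_affine_subset[OF S(2), of "fst p" "snd p"] p by (cases "norm (snd p) \<le> 1") (auto simp: S1_def S2_def)
    qed
    then show "continuous_on ({0..r} \<times> ?B) (\<lambda>(x, t). ?fx x t)"
      using continuous_on_subset[OF continuous_on_open_Un[OF o1 o2 c1 c2]] by (simp add: split_beta)
  qed simp
  then have "((\<lambda>R. integral ?B (?f R)) has_field_derivative (LINT y|lborel. ?fx R y)) (at R within {0..r})"
    using conv(1)[OF cF'[OF R]] by simp
  moreover have "bump_avg k F z R = integral ?B (?f R)" if "R \<in> {0..r}" for R
    unfolding bump_avg_def by (rule conv(1)[OF cF[OF that]])
  ultimately show ?thesis
    using R by (subst has_field_derivative_cong_ev[where g = "\<lambda>R. integral ?B (?f R)" and y = R, OF refl _ refl refl])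
      (auto simp: eventually_nhds intro!: exI[of _ UNIV])
qed

text \<open>The field bump(y)^k y is - 1 / (2 (k + 1)) times the gradient of bump^(k + 1).
  Integration by parts therefore turns the radial derivative into an average of the Laplacian with
  the next weight.\<close>

lemma bump_avg_has_derivative:
  fixes z :: "'a::euclidean_space"
  assumes S: "open S" "cball z r \<subseteq> S" and F: "has_laplacian_on F F' L S" and k: "k \<ge> 1" and R: "R \<in> {0..r}"
  shows "(bump_avg k F z has_real_derivative R / (2 * real (Suc k)) * bump_avg (Suc k) L z R) (at R within {0..r})"
proof -
  obtain F2 where F2': "\<forall>b\<in>Basis. \<forall>y\<in>S. ((\<lambda>y. F' y b) has_derivative F2 b y) (at y)"
    "\<forall>b\<in>Basis. continuous_on S (\<lambda>y. F2 b y b)" "\<forall>y\<in>S. L y = (\<Sum>b\<in>Basis. F2 b y b)"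
    by (rule has_laplacian_onE[OF F])
  note F2 = F2'[rule_format]
  have F1: "\<And>y. y \<in> S \<Longrightarrow> (F has_derivative F' y) (at y)" using F unfolding has_laplacian_on_def by blast
  note F' = has_laplacian_on_continuous(2)[OF F]
  have R': "0 \<le> R" "R \<le> r" using R by auto
  have sub: "z + R *\<^sub>R y \<in> S" if "y \<in> cball 0 1" for y by (rule cball_affine_subset[OF S(2) R' that])
  have ibp: "(LINT y|lborel. bump y ^ Suc k * (R * F2 b (z + R *\<^sub>R y) b))
      = 2 * real (Suc k) * (LINT y|lborel. bump y ^ k * ((y \<bullet> b) * F' (z + R *\<^sub>R y) b))" if b: "b \<in> Basis" for b
  proof (rule bump_integration_by_parts)
    show "open ((\<lambda>y. z + R *\<^sub>R y) -` S)" by (intro open_vimage S continuous_intros)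
    show "cball 0 1 \<subseteq> (\<lambda>y. z + R *\<^sub>R y) -` S" using sub by blast
    fix y assume "y \<in> (\<lambda>y. z + R *\<^sub>R y) -` S"
    then have y: "z + R *\<^sub>R y \<in> S" by simp
    have "((\<lambda>y. z + R *\<^sub>R y) has_derivative (\<lambda>h. R *\<^sub>R h)) (at y)" by (auto intro!: derivative_eq_intros)
    from has_derivative_compose[OF this F2(1)[OF b y]]
    show "((\<lambda>y. F' (z + R *\<^sub>R y) b) has_derivative (\<lambda>h. F2 b (z + R *\<^sub>R y) (R *\<^sub>R h))) (at y)" .
    show "F2 b (z + R *\<^sub>R y) (R *\<^sub>R b) = R * F2 b (z + R *\<^sub>R y) b"
      using linear_scale[OF has_derivative_linear[OF F2(1)[OF b y]]] by simp
  next
    show "continuous_on ((\<lambda>y. z + R *\<^sub>R y) -` S) (\<lambda>y. R * F2 b (z + R *\<^sub>R y) b)"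
      by (intro continuous_intros continuous_on_compose2[OF F2(2)[OF b]]) auto
  qed (rule k)
  have lin: "F' p h = (\<Sum>b\<in>Basis. (h \<bullet> b) * F' p b)" if "p \<in> S" for p h
  proof -
    have l: "linear (F' p)" using F1[OF that] by (rule has_derivative_linear)
    have "F' p h = F' p (\<Sum>b\<in>Basis. (h \<bullet> b) *\<^sub>R b)" by (simp add: euclidean_representation)
    also have "\<dots> = (\<Sum>b\<in>Basis. (h \<bullet> b) * F' p b)" by (simp add: linear_sum[OF l] linear_scale[OF l])
    finally show ?thesis .
  qed
  have cont1: "continuous_on (cball 0 1) (\<lambda>y. F' (z + R *\<^sub>R y) b)" if "b \<in> Basis" for b
    by (rule continuous_on_affine_compose[OF F'[OF that] S(2) R'])
  have cont2: "continuous_on (cball 0 1) (\<lambda>y. F2 b (z + R *\<^sub>R y) b)" if "b \<in> Basis" for b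
    by (rule continuous_on_affine_compose[OF F2(2)[OF that] S(2) R'])
  have "(LINT y|lborel. bump y ^ k * F' (z + R *\<^sub>R y) y) = (LINT y|lborel. (\<Sum>b\<in>Basis. bump y ^ k * ((y \<bullet> b) * F' (z + R *\<^sub>R y) b)))"
  proof (rule Bochner_Integration.integral_cong[OF refl])
    fix y show "bump y ^ k * F' (z + R *\<^sub>R y) y = (\<Sum>b\<in>Basis. bump y ^ k * ((y \<bullet> b) * F' (z + R *\<^sub>R y) b))"
      using sub[of y] lin[of "z + R *\<^sub>R y" y] k
      by (cases "norm y \<le> 1") (auto simp: sum_distrib_left bump_eq_0 power_0_left)
  qed
  also have "\<dots> = (\<Sum>b\<in>Basis. LINT y|lborel. bump y ^ k * ((y \<bullet> b) * F' (z + R *\<^sub>R y) b))"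
    by (intro Bochner_Integration.integral_sum integrable_bump continuous_intros cont1 k)
  also have "\<dots> = (\<Sum>b\<in>Basis. R / (2 * real (Suc k)) * (LINT y|lborel. bump y ^ Suc k * F2 b (z + R *\<^sub>R y) b))"
  proof (rule sum.cong[OF refl])
    fix b :: 'a assume b: "b \<in> Basis"
    have "(LINT y|lborel. bump y ^ Suc k * (R * F2 b (z + R *\<^sub>R y) b)) = R * (LINT y|lborel. bump y ^ Suc k * F2 b (z + R *\<^sub>R y) b)"
      by (simp add: mult.left_commute del: power_Suc)
    with ibp[OF b] show "(LINT y|lborel. bump y ^ k * ((y \<bullet> b) * F' (z + R *\<^sub>R y) b))
      = R / (2 * real (Suc k)) * (LINT y|lborel. bump y ^ Suc k * F2 b (z + R *\<^sub>R y) b)"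
      by (simp add: field_simps del: power_Suc)
  qed
  also have "\<dots> = R / (2 * real (Suc k)) * (LINT y|lborel. (\<Sum>b\<in>Basis. bump y ^ Suc k * F2 b (z + R *\<^sub>R y) b))"
    by (subst Bochner_Integration.integral_sum) (auto simp: sum_distrib_left intro!: integrable_bump cont2 simp del: power_Suc)
  also have "(LINT y|lborel. (\<Sum>b\<in>Basis. bump y ^ Suc k * F2 b (z + R *\<^sub>R y) b)) = bump_avg (Suc k) L z R"
    unfolding bump_avg_def
  proof (rule Bochner_Integration.integral_cong[OF refl])
    fix y show "(\<Sum>b\<in>Basis. bump y ^ Suc k * F2 b (z + R *\<^sub>R y) b) = bump y ^ Suc k * L (z + R *\<^sub>R y)"
      using sub[of y] F2(3)[of "z + R *\<^sub>R y"]
      by (cases "norm y \<le> 1") (auto simp: sum_distrib_left bump_eq_0)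
  qed
  finally have eq: "(LINT y|lborel. bump y ^ k * F' (z + R *\<^sub>R y) y) = R / (2 * real (Suc k)) * bump_avg (Suc k) L z R" .
  show ?thesis
    using bump_avg_has_derivative_gen[OF S F1 F' k R] by (simp only: eq)
qed

lemma bump_avg_0:
  fixes z :: "'a::euclidean_space"
  shows "bump_avg k F z 0 = F z * (LINT y|lborel. bump (y::'a) ^ k)"
  by (simp add: bump_avg_def)

text \<open>Mean value inequality for subharmonic functions: the average increases with the radius,
  and at radius 0 it is the value at the centre times the total weight.\<close>

lemma bump_avg_mono_derivative:
  fixes z :: "'a::euclidean_space"
  assumes S: "open S" "cball z r \<subseteq> S" and F: "has_laplacian_on F F' L S" and k: "k \<ge> 1" and r: "0 \<le> r"
    and L: "\<And>y. y \<in> S \<Longrightarrow> L y \<ge> 0"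
  shows "F z * (LINT y|lborel. bump (y::'a) ^ k) \<le> bump_avg k F z r"
proof (cases "r = 0")
  case False
  have D: "(bump_avg k F z has_real_derivative R / (2 * real (Suc k)) * bump_avg (Suc k) L z R) (at R within {0..r})"
    if "R \<in> {0..r}" for R using bump_avg_has_derivative[OF S F k that] .
  have "bump_avg k F z 0 \<le> bump_avg k F z r"
  proof (rule DERIV_nonneg_imp_increasing_open[OF r])
    fix R assume R: "0 < R" "R < r"
    have "(bump_avg k F z has_real_derivative R / (2 * real (Suc k)) * bump_avg (Suc k) L z R) (at R)"
      using D[of R] R at_within_Icc_at[of 0 R r] by simp
    moreover have "bump_avg (Suc k) L z R \<ge> 0"
      unfolding bump_avg_def
    proof (rule integral_nonneg_AE, rule AE_I2)
      fix y show "0 \<le> bump y ^ Suc k * L (z + R *\<^sub>R y)"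
        using L[OF cball_affine_subset[OF S(2), of R y]] R by (cases "norm y \<le> 1") (auto simp: bump_eq_0)
    qed
    ultimately show "\<exists>y. (bump_avg k F z has_real_derivative y) (at R) \<and> 0 \<le> y"
      using R by (intro exI conjI) (assumption, simp)
  next
    show "continuous_on {0..r} (bump_avg k F z)"
      using D by (meson DERIV_continuous continuous_on_eq_continuous_within)
  qed
  then show ?thesis by (simp add: bump_avg_0)
qed (simp add: bump_avg_0)

lemma has_laplacian_on_uminus:
  assumes "has_laplacian_on F F' L S"
  shows "has_laplacian_on (\<lambda>y. - F y) (\<lambda>y h. - F' y h) (\<lambda>y. - L y) S"
proof -
  obtain F2 where F2': "\<forall>b\<in>Basis. \<forall>y\<in>S. ((\<lambda>y. F' y b) has_derivative F2 b y) (at y)"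
    "\<forall>b\<in>Basis. continuous_on S (\<lambda>y. F2 b y b)" "\<forall>y\<in>S. L y = (\<Sum>b\<in>Basis. F2 b y b)"
    by (rule has_laplacian_onE[OF assms])
  note F2 = F2'[rule_format]
  show ?thesis unfolding has_laplacian_on_def
    using assms F2 by (intro conjI exI[of _ "\<lambda>b y h. - F2 b y h"])
     (auto simp: has_laplacian_on_def sum_negf intro!: has_derivative_minus continuous_intros)
qed

text \<open>The subharmonic inequality applies to both \<open>F\<close> and
  \<open>- F\<close>.\<close>

lemma harmonic_mean_value:
  fixes z :: "'a::euclidean_space"
  assumes S: "open S" "cball z r \<subseteq> S" and F: "has_laplacian_on F F' (\<lambda>_. 0) S" and k: "k \<ge> 1" and r: "0 \<le> r"
  shows "bump_avg k F z r = F z * (LINT y|lborel. bump (y::'a) ^ k)"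
proof -
  have "bump_avg k (\<lambda>y. - F y) z r = - bump_avg k F z r" by (simp add: bump_avg_def)
  moreover have "has_laplacian_on (\<lambda>y. - F y) (\<lambda>y h. - F' y h) (\<lambda>_. 0) S"
    using has_laplacian_on_uminus[OF F] by simp
  ultimately show ?thesis
    using bump_avg_mono_derivative[OF S F k r] bump_avg_mono_derivative[OF S _ k r, of "\<lambda>y. - F y" "\<lambda>y h. - F' y h" "\<lambda>_. 0"]
    by simp
qed

definition bump_vol :: "'a::euclidean_space itself \<Rightarrow> nat \<Rightarrow> real" where
  "bump_vol _ k = (LINT y|lborel. bump (y::'a) ^ k)"

lemma bump_vol_pos:
  assumes "k \<ge> 1"
  shows "bump_vol TYPE('a::euclidean_space) k > 0"
proof -
  have int: "integrable lborel (\<lambda>y::'a. bump y ^ k)"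
    using integrable_bump[of "\<lambda>_. 1" k] assms by simp
  have "(LINT y|lborel. indicator (ball (0::'a) (1/2)) y * (3/4 :: real) ^ k) \<le> (LINT y|lborel. bump (y::'a) ^ k)"
  proof (rule integral_mono[OF _ int])
    fix y :: 'a
    show "indicator (ball 0 (1/2)) y * (3/4 :: real) ^ k \<le> bump y ^ k"
    proof (cases "norm y < 1/2")
      case True
      then have "(norm y)\<^sup>2 \<le> (1/2)\<^sup>2" by (intro power_mono) auto
      then have "3/4 \<le> bump y" by (simp add: bump_def power2_eq_square)
      then show ?thesis using True by (simp add: power_mono)
    qed simp
  qed (auto simp: emeasure_ball)
  moreover have "(LINT y|lborel. indicator (ball (0::'a) (1/2)) y * (3/4 :: real) ^ k) > 0"
    by (simp add: content_ball)
  ultimately show ?thesis unfolding bump_vol_def by linarith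
qed

text \<open>\<open>W\<close> is the derivative of \<open>G\<close> in direction \<open>e\<close> and
  harmonic itself. Its mean value property with weight bump^2 is integrated by parts, which moves
  the derivative to the weight and leaves \<open>G\<close> under the integral.\<close>

lemma harmonic_gradient_bound:
  fixes z :: "'a::euclidean_space"
  assumes S: "open S" "cball z r \<subseteq> S" and r: "r > 0"
    and G: "\<And>y. y \<in> S \<Longrightarrow> (G has_derivative G' y) (at y)" "\<And>y. y \<in> S \<Longrightarrow> G' y e = W y"
    and W: "has_laplacian_on W W' (\<lambda>_. 0) S" and M: "\<And>y. y \<in> cball z r \<Longrightarrow> \<bar>G y\<bar> \<le> M"
  shows "\<bar>W z\<bar> \<le> 4 * bump_vol TYPE('a) 1 / bump_vol TYPE('a) 2 * norm e / r * M"
proof -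
  have contW: "continuous_on S W" by (rule has_laplacian_on_continuous[OF W])
  have contG: "continuous_on S G" using G(1) by (meson continuous_at_imp_continuous_on has_derivative_continuous)
  have M0: "M \<ge> 0" using M[of z] r by force
  have r': "0 \<le> r" using r by simp
  have "r * (W z * bump_vol TYPE('a) 2) = r * (LINT y|lborel. bump y ^ Suc 1 * W (z + r *\<^sub>R y))"
    using harmonic_mean_value[OF S W, of 2] r by (simp add: bump_vol_def bump_avg_def numeral_2_eq_2)
  also have "\<dots> = (LINT y|lborel. bump y ^ Suc 1 * (r * W (z + r *\<^sub>R y)))"
    by (simp add: mult.left_commute del: power_Suc)
  also have "\<dots> = 2 * real (Suc 1) * (LINT y|lborel. bump y ^ 1 * ((y \<bullet> e) * G (z + r *\<^sub>R y)))"
  proof (rule bump_integration_by_parts)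
    show "open ((\<lambda>y. z + r *\<^sub>R y) -` S)" by (intro open_vimage S continuous_intros)
    show "cball 0 1 \<subseteq> (\<lambda>y. z + r *\<^sub>R y) -` S" using cball_affine_subset[OF S(2) r'] by auto
    fix y assume "y \<in> (\<lambda>y. z + r *\<^sub>R y) -` S"
    then have y: "z + r *\<^sub>R y \<in> S" by simp
    have "((\<lambda>y. z + r *\<^sub>R y) has_derivative (\<lambda>h. r *\<^sub>R h)) (at y)" by (auto intro!: derivative_eq_intros)
    from has_derivative_compose[OF this G(1)[OF y]]
    show "((\<lambda>y. G (z + r *\<^sub>R y)) has_derivative (\<lambda>h. G' (z + r *\<^sub>R y) (r *\<^sub>R h))) (at y)" .
    show "G' (z + r *\<^sub>R y) (r *\<^sub>R e) = r * W (z + r *\<^sub>R y)"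
      using linear_scale[OF has_derivative_linear[OF G(1)[OF y]]] G(2)[OF y] by simp
  next
    show "continuous_on ((\<lambda>y. z + r *\<^sub>R y) -` S) (\<lambda>y. r * W (z + r *\<^sub>R y))"
      by (intro continuous_intros continuous_on_compose2[OF contW]) auto
  qed simp
  finally have eq: "r * (W z * bump_vol TYPE('a) 2) = 4 * (LINT y|lborel. bump y * ((y \<bullet> e) * G (z + r *\<^sub>R y)))" by simp
  have "\<bar>LINT y|lborel. bump y * ((y \<bullet> e) * G (z + r *\<^sub>R y))\<bar> \<le> (LINT y|lborel. bump (y::'a) * (norm e * M))"
  proof (rule order_trans[OF integral_abs_bound], rule integral_mono)
    have i1: "integrable lborel (\<lambda>y. bump y ^ 1 * ((y \<bullet> e) * G (z + r *\<^sub>R y)))"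
      by (intro integrable_bump continuous_intros continuous_on_affine_compose[OF contG S(2)] r') auto
    then show "integrable lborel (\<lambda>y. \<bar>bump y * ((y \<bullet> e) * G (z + r *\<^sub>R y))\<bar>)" by simp
    have "integrable lborel (\<lambda>y::'a. bump y ^ 1 * (norm e * M))" by (intro integrable_bump) auto
    then show "integrable lborel (\<lambda>y::'a. bump y * (norm e * M))" by simp
    fix y
    show "\<bar>bump y * ((y \<bullet> e) * G (z + r *\<^sub>R y))\<bar> \<le> bump y * (norm e * M)"
    proof (cases "norm y \<le> 1")
      case True
      have "\<bar>y \<bullet> e\<bar> \<le> norm y * norm e" by (rule Cauchy_Schwarz_ineq2)
      also have "\<dots> \<le> norm e" using True by (simp add: mult_left_le_one_le)
      finally have 1: "\<bar>y \<bullet> e\<bar> \<le> norm e" .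
      have 2: "\<bar>G (z + r *\<^sub>R y)\<bar> \<le> M"
        by (intro M cball_affine_subset[OF order_refl]) (use True r in auto)
      show ?thesis unfolding abs_mult using 1 2 by (auto intro!: mult_mono mult_left_mono)
    qed (simp add: bump_eq_0)
  qed
  also have "\<dots> = bump_vol TYPE('a) 1 * (norm e * M)" by (simp add: bump_vol_def)
  finally have "\<bar>r * (W z * bump_vol TYPE('a) 2)\<bar> \<le> 4 * (bump_vol TYPE('a) 1 * (norm e * M))"
    unfolding eq by simp
  then show ?thesis using bump_vol_pos[of 2, where ?'a = 'a] r
    by (simp add: abs_mult field_simps)
qed

text \<open>Iterate the gradient bound over \<open>k\<close> concentric shells of equal width.\<close>

lemma harmonic_iterated_derivative_bound:
  fixes H :: "nat \<Rightarrow> 'a::euclidean_space \<Rightarrow> real"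
  assumes S: "open S" and H: "\<And>k. \<exists>H'. has_laplacian_on (H k) H' (\<lambda>_. 0) S \<and> (\<forall>y\<in>S. H' y e = H (Suc k) y)"
    and e: "norm e = 1" and M: "\<And>y. y \<in> S \<Longrightarrow> \<bar>H 0 y\<bar> \<le> M" and z: "cball z \<delta> \<subseteq> S" "\<delta> > 0"
  shows "\<bar>H k z\<bar> \<le> (4 * bump_vol TYPE('a) 1 / bump_vol TYPE('a) 2 * real k / \<delta>) ^ k * M"
  using z
proof (induction k arbitrary: z \<delta>)
  case 0
  then show ?case using M[of z] by (auto simp: subset_iff)
next
  case (Suc k)
  define C where "C = 4 * bump_vol TYPE('a) 1 / bump_vol TYPE('a) 2"
  have C: "C > 0" using bump_vol_pos[of 1, where ?'a = 'a] bump_vol_pos[of 2, where ?'a = 'a] by (simp add: C_def)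
  \<comment> \<open>One derivative is spent on radius \<delta> / (k + 1). About each point of that
    ball the radius \<delta> k / (k + 1) remains for the other k derivatives, so the quotient of
    their number by the radius is again (k + 1) / \<delta>. For k = 0 no radius remains and the
    bound on \<open>H 0\<close> is used directly.\<close>
  define r where "r = \<delta> / real (Suc k)"
  have r: "r > 0" using Suc.prems by (simp add: r_def)
  have "r * 1 \<le> r * real (Suc k)" using r by (intro mult_left_mono) auto
  then have r\<delta>: "r \<le> \<delta>" by (simp add: r_def)
  have zS: "z \<in> S" using Suc.prems by (auto simp: subset_iff)
  have M0: "M \<ge> 0" using M[OF zS] by linarith
  have bd: "\<bar>H k y\<bar> \<le> (C * real (Suc k) / \<delta>) ^ k * M" if y: "y \<in> cball z r" for y
  proof (cases "k = 0")
    case True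
    have "cball z r \<subseteq> S" using Suc.prems(1) r\<delta> by auto
    then show ?thesis using M[of y] y True by auto
  next
    case False
    define \<delta>' where "\<delta>' = r * real k"
    have \<delta>': "\<delta>' > 0" using False r by (simp add: \<delta>'_def)
    have sum: "r + \<delta>' = \<delta>" 
    proof -
      have "r + \<delta>' = r * real (Suc k)" by (simp add: \<delta>'_def algebra_simps)
      then show ?thesis by (simp add: r_def)
    qed
    have "cball y \<delta>' \<subseteq> cball z \<delta>"
    proof
      fix x assume "x \<in> cball y \<delta>'"
      then show "x \<in> cball z \<delta>" using y sum dist_triangle[of z x y] by simp
    qed
    then have "\<bar>H k y\<bar> \<le> (C * real k / \<delta>') ^ k * M"
      unfolding C_def using Suc.prems(1) \<delta>' by (intro Suc.IH) auto
    also have "C * real k / \<delta>' = C * real (Suc k) / \<delta>" using False Suc.prems by (simp add: \<delta>'_def r_def field_simps)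
    finally show ?thesis .
  qed
  obtain H1 where H1: "has_laplacian_on (H k) H1 (\<lambda>_. 0) S" "\<And>y. y \<in> S \<Longrightarrow> H1 y e = H (Suc k) y" using H[of k] by blast
  obtain H2 where H2: "has_laplacian_on (H (Suc k)) H2 (\<lambda>_. 0) S" using H[of "Suc k"] by blast
  have "\<bar>H (Suc k) z\<bar> \<le> 4 * bump_vol TYPE('a) 1 / bump_vol TYPE('a) 2 * norm e / r * ((C * real (Suc k) / \<delta>) ^ k * M)"
  proof (rule harmonic_gradient_bound[where S = S and G = "H k" and G' = H1 and W = "H (Suc k)" and W' = H2])
    show "cball z r \<subseteq> S" using Suc.prems(1) r\<delta> by auto
    show "(H k has_derivative H1 y) (at y)" if "y \<in> S" for y
      using H1(1) that unfolding has_laplacian_on_def by blast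
    show "\<bar>H k y\<bar> \<le> (C * real (Suc k) / \<delta>) ^ k * M" if "y \<in> cball z r" for y by (rule bd[OF that])
  qed (use S r H1(2) H2 in auto)
  also have "\<dots> = (C * real (Suc k) / \<delta>) ^ Suc k * M"
    unfolding C_def[symmetric] using e Suc.prems by (simp add: r_def)
  finally show ?case by (simp add: C_def)
qed

section \<open>Polar coordinates and integrated sphere bounds\<close>

lemma nn_integral_lborel_affine:
  fixes f :: "'a::euclidean_space \<Rightarrow> ennreal"
  assumes [measurable]: "f \<in> borel_measurable borel" and c: "c > 0"
  shows "(\<integral>\<^sup>+y. f (t + c *\<^sub>R y) \<partial>lborel) = ennreal (1 / c ^ DIM('a)) * (\<integral>\<^sup>+y. f y \<partial>lborel)"
proof -
  have "(\<integral>\<^sup>+y. f y \<partial>lborel) = (\<integral>\<^sup>+y. f y \<partial>density (distr lborel borel (\<lambda>x. t + c *\<^sub>R x)) (\<lambda>_. ennreal (\<bar>c\<bar> ^ DIM('a))))"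
    using lborel_affine[of c t] c by simp
  also have "\<dots> = ennreal (c ^ DIM('a)) * (\<integral>\<^sup>+y. f (t + c *\<^sub>R y) \<partial>lborel)"
    using c by (subst nn_integral_density) (auto simp: nn_integral_distr nn_integral_cmult)
  finally have "(\<integral>\<^sup>+y. f y \<partial>lborel) = ennreal (c ^ DIM('a)) * (\<integral>\<^sup>+y. f (t + c *\<^sub>R y) \<partial>lborel)" .
  moreover have "ennreal (1 / c ^ DIM('a)) * ennreal (c ^ DIM('a)) = 1"
    using c by (simp add: ennreal_mult[symmetric])
  ultimately show ?thesis by (simp only: mult.assoc[symmetric] mult_1)
qed

lemma integral_lborel_affine:
  fixes f :: "'a::euclidean_space \<Rightarrow> real"
  assumes [measurable]: "f \<in> borel_measurable borel" and c: "c > 0"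
  shows "(LINT y|lborel. f (t + c *\<^sub>R y)) = (1 / c ^ DIM('a)) * (LINT y|lborel. f y)"
proof -
  have "(LINT y|lborel. f y) = (LINT y|density (distr lborel borel (\<lambda>x. t + c *\<^sub>R x)) (\<lambda>_. ennreal (\<bar>c\<bar> ^ DIM('a))). f y)"
    using lborel_affine[of c t] c by simp
  also have "\<dots> = c ^ DIM('a) * (LINT y|lborel. f (t + c *\<^sub>R y))"
    using c by (subst integral_density) (auto simp: integral_distr)
  finally show ?thesis using c by (simp add: field_simps)
qed

lemma nn_integral_inverse_power_tail:
  assumes "a > 0" "m \<ge> 1"
  shows "(\<integral>\<^sup>+t. ennreal (1 / t ^ Suc m) * indicator {a..} t \<partial>lborel) = ennreal (1 / (real m * a ^ m))"
proof -
  have "(\<integral>\<^sup>+t. ennreal (1 / t ^ Suc m) * indicator {a..} t \<partial>lborel) = ennreal (0 - (- (1 / (real m * a ^ m))))"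
  proof (rule nn_integral_FTC_atLeast)
    fix x assume "a \<le> x"
    then have x: "x > 0" using assms by simp
    obtain m' where m': "m = Suc m'" using assms(2) by (cases m) auto
    show "DERIV (\<lambda>t. - (1 / (real m * t ^ m))) x :> 1 / x ^ Suc m"
    proof -
      have "((\<lambda>t. t ^ m) has_real_derivative real m * x ^ m') (at x)"
        by (rule derivative_eq_intros refl | simp add: m')+
      from DERIV_inverse_fun[OF this] have "((\<lambda>t. inverse (t ^ m)) has_real_derivative - (real m * x ^ m' * inverse ((x ^ m)\<^sup>2))) (at x)"
        using x by (simp add: numeral_2_eq_2)
      from DERIV_cmult[OF this, of "- (1 / real m)"]
      have "((\<lambda>t. - (1 / (real m * t ^ m))) has_real_derivative - (1 / real m) * - (real m * x ^ m' * inverse ((x ^ m)\<^sup>2))) (at x)"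
        by (simp add: divide_inverse)
      moreover have "- (1 / real m) * - (real m * x ^ m' * inverse ((x ^ m)\<^sup>2)) = 1 / x ^ Suc m"
      proof -
        have "- (1 / real m) * - (real m * x ^ m' * inverse ((x ^ m)\<^sup>2)) = x ^ m' * inverse ((x ^ m)\<^sup>2)"
          using m' by simp
        also have "\<dots> = 1 / x ^ Suc m" using x by (simp add: m' power2_eq_square field_simps)
        finally show ?thesis .
      qed
      ultimately show ?thesis by simp
    qed
    show "0 \<le> 1 / x ^ Suc m" using x by simp
  next
    have "((\<lambda>t. 1 / (real m * t ^ m)) \<longlongrightarrow> 0) at_top"
      using assms by (intro real_tendsto_divide_at_top[OF tendsto_const] filterlim_tendsto_pos_mult_at_top[OF tendsto_const]
          filterlim_pow_at_top filterlim_ident) auto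
    from tendsto_minus[OF this] show "((\<lambda>t. - (1 / (real m * t ^ m))) \<longlongrightarrow> 0) at_top" by simp
  qed auto
  then show ?thesis by simp
qed

text \<open>The sphere is parametrised by w / |w| for \<open>w\<close> in the unit ball, so no
  surface measure occurs. After s = t |w| and an exchange of integrals, the substitution y = t w
  leaves |y|^m times the integral of t^(- m - 1) over t > |y|, which is 1 / m, with m the
  dimension.\<close>

lemma polar_nn_integral:
  fixes \<phi> :: "'a::euclidean_space \<Rightarrow> ennreal"
  assumes [measurable]: "\<phi> \<in> borel_measurable borel"
  shows "(\<integral>\<^sup>+w. indicator (ball 0 1) w * (\<integral>\<^sup>+s. indicator {0<..} s * ennreal (s ^ (DIM('a) - 1)) * \<phi> ((s / norm w) *\<^sub>R w) \<partial>lborel) \<partial>lborel)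
    = ennreal (1 / real DIM('a)) * (\<integral>\<^sup>+y. \<phi> y \<partial>lborel)"
proof -
  let ?m = "DIM('a)"
  have m: "?m \<ge> 1" by (simp add: Suc_leI)
  have [measurable]: "ball (0::'a) 1 \<in> sets borel" by simp
  have sub: "(\<integral>\<^sup>+s. indicator {0<..} s * ennreal (s ^ (?m - 1)) * \<phi> ((s / norm w) *\<^sub>R w) \<partial>lborel)
    = (\<integral>\<^sup>+t. indicator {0<..} t * ennreal (t ^ (?m - 1) * norm w ^ ?m) * \<phi> (t *\<^sub>R w) \<partial>lborel)" if "w \<noteq> 0" for w :: 'a
  proof -
    have n: "norm w > 0" using that by simp
    have "(\<integral>\<^sup>+s. indicator {0<..} s * ennreal (s ^ (?m - 1)) * \<phi> ((s / norm w) *\<^sub>R w) \<partial>lborel)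
      = ennreal \<bar>norm w\<bar> * (\<integral>\<^sup>+t. indicator {0<..} (0 + norm w * t) * ennreal ((0 + norm w * t) ^ (?m - 1)) * \<phi> (((0 + norm w * t) / norm w) *\<^sub>R w) \<partial>lborel)"
    proof (rule nn_integral_real_affine)
      show "(\<lambda>s. indicator {0<..} s * ennreal (s ^ (?m - 1)) * \<phi> ((s / norm w) *\<^sub>R w)) \<in> borel_measurable borel" by measurable
    qed (use n in simp)
    also have "\<dots> = (\<integral>\<^sup>+t. ennreal \<bar>norm w\<bar> * (indicator {0<..} (0 + norm w * t) * ennreal ((0 + norm w * t) ^ (?m - 1)) * \<phi> (((0 + norm w * t) / norm w) *\<^sub>R w)) \<partial>lborel)"
      by (rule nn_integral_cmult[symmetric]) measurable
    also have "\<dots> = (\<integral>\<^sup>+t. indicator {0<..} t * ennreal (t ^ (?m - 1) * norm w ^ ?m) * \<phi> (t *\<^sub>R w) \<partial>lborel)"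
    proof (rule nn_integral_cong)
      fix t :: real
      show "ennreal \<bar>norm w\<bar> * (indicator {0<..} (0 + norm w * t) * ennreal ((0 + norm w * t) ^ (?m - 1)) * \<phi> (((0 + norm w * t) / norm w) *\<^sub>R w))
        = indicator {0<..} t * ennreal (t ^ (?m - 1) * norm w ^ ?m) * \<phi> (t *\<^sub>R w)"
      proof (cases "t > 0")
        case True
        have "norm w * (norm w * t) ^ (?m - 1) = t ^ (?m - 1) * norm w ^ ?m"
          using m by (cases ?m) (auto simp: power_mult_distrib)
        then have "ennreal (norm w) * ennreal ((norm w * t) ^ (?m - 1)) = ennreal (t ^ (?m - 1) * norm w ^ ?m)"
          using n True by (simp add: ennreal_mult[symmetric])
        then show ?thesis using n True by (simp add: indicator_def mult.assoc[symmetric])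
      qed (use n in \<open>auto simp: indicator_def zero_less_mult_iff\<close>)
    qed
    finally show ?thesis .
  qed
  have AE0: "AE w in lborel. (w::'a) \<noteq> 0" by (rule AE_lborel_singleton)
  have "(\<integral>\<^sup>+w. indicator (ball 0 1) w * (\<integral>\<^sup>+s. indicator {0<..} s * ennreal (s ^ (?m - 1)) * \<phi> ((s / norm w) *\<^sub>R w) \<partial>lborel) \<partial>lborel)
    = (\<integral>\<^sup>+w. (\<integral>\<^sup>+t. indicator (ball 0 1) w * (indicator {0<..} t * ennreal (t ^ (?m - 1) * norm w ^ ?m) * \<phi> (t *\<^sub>R w)) \<partial>lborel) \<partial>lborel)"
  proof (rule nn_integral_cong_AE, use AE0 in eventually_elim)
    fix w :: 'a assume "w \<noteq> 0"
    show "indicator (ball 0 1) w * (\<integral>\<^sup>+s. indicator {0<..} s * ennreal (s ^ (?m - 1)) * \<phi> ((s / norm w) *\<^sub>R w) \<partial>lborel)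
      = (\<integral>\<^sup>+t. indicator (ball 0 1) w * (indicator {0<..} t * ennreal (t ^ (?m - 1) * norm w ^ ?m) * \<phi> (t *\<^sub>R w)) \<partial>lborel)"
      unfolding sub[OF \<open>w \<noteq> 0\<close>] by (rule nn_integral_cmult[symmetric]) measurable
  qed
  also have "\<dots> = (\<integral>\<^sup>+t. (\<integral>\<^sup>+w. indicator (ball 0 1) w * (indicator {0<..} t * ennreal (t ^ (?m - 1) * norm w ^ ?m) * \<phi> (t *\<^sub>R w)) \<partial>lborel) \<partial>lborel)"
    by (rule lborel_pair.Fubini'[symmetric]) measurable
  also have "\<dots> = (\<integral>\<^sup>+t. (\<integral>\<^sup>+y. indicator {0<..} t * (indicator {p. norm (snd p) < fst p} (t, y) * ennreal (norm y ^ ?m / t ^ Suc ?m)) * \<phi> y \<partial>lborel) \<partial>lborel)"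
  proof (rule nn_integral_cong)
    fix t :: real
    show "(\<integral>\<^sup>+w. indicator (ball 0 1) w * (indicator {0<..} t * ennreal (t ^ (?m - 1) * norm w ^ ?m) * \<phi> (t *\<^sub>R w)) \<partial>lborel)
      = (\<integral>\<^sup>+y. indicator {0<..} t * (indicator {p. norm (snd p) < fst p} (t, y) * ennreal (norm y ^ ?m / t ^ Suc ?m)) * \<phi> y \<partial>lborel)"
    proof (cases "t > 0")
      case True
      let ?f = "\<lambda>y. indicator (ball 0 1) ((1 / t) *\<^sub>R y) * (ennreal (t ^ (?m - 1) * norm ((1 / t) *\<^sub>R y) ^ ?m) * \<phi> y) :: ennreal"
      have "(\<integral>\<^sup>+w. indicator (ball 0 1) w * (indicator {0<..} t * ennreal (t ^ (?m - 1) * norm w ^ ?m) * \<phi> (t *\<^sub>R w)) \<partial>lborel)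
        = (\<integral>\<^sup>+w. ?f (0 + t *\<^sub>R w) \<partial>lborel)"
        using True by (intro nn_integral_cong) (simp add: mult_ac)
      also have "\<dots> = ennreal (1 / t ^ ?m) * (\<integral>\<^sup>+y. ?f y \<partial>lborel)"
        by (rule nn_integral_lborel_affine[OF _ True]) measurable
      also have "\<dots> = (\<integral>\<^sup>+y. ennreal (1 / t ^ ?m) * ?f y \<partial>lborel)"
        by (rule nn_integral_cmult[symmetric]) measurable
      also have "\<dots> = (\<integral>\<^sup>+y. indicator {0<..} t * (indicator {p. norm (snd p) < fst p} (t, y) * ennreal (norm y ^ ?m / t ^ Suc ?m)) * \<phi> y \<partial>lborel)"
      proof (rule nn_integral_cong)
        fix y :: 'a
        have "1 / t ^ ?m * (t ^ (?m - 1) * norm ((1 / t) *\<^sub>R y) ^ ?m) = norm y ^ ?m / t ^ Suc ?m"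
          using True m by (cases ?m) (auto simp: field_simps)
        then have "ennreal (1 / t ^ ?m) * ennreal (t ^ (?m - 1) * norm ((1 / t) *\<^sub>R y) ^ ?m) = ennreal (norm y ^ ?m / t ^ Suc ?m)"
          using True by (subst ennreal_mult[symmetric]) auto
        moreover have "indicator (ball 0 1) ((1 / t) *\<^sub>R y) = (indicator {p. norm (snd p) < fst p} (t, y) :: ennreal)"
          using True by (auto simp: indicator_def)
        ultimately show "ennreal (1 / t ^ ?m) * ?f y = indicator {0<..} t * (indicator {p. norm (snd p) < fst p} (t, y) * ennreal (norm y ^ ?m / t ^ Suc ?m)) * \<phi> y"
          using True by (auto simp: indicator_def mult.assoc[symmetric])
      qed
      finally show ?thesis .
    qed simp
  qed
  also have "\<dots> = (\<integral>\<^sup>+y. (\<integral>\<^sup>+t. indicator {0<..} t * (indicator {p. norm (snd p) < fst p} (t, y) * ennreal (norm y ^ ?m / t ^ Suc ?m)) * \<phi> y \<partial>lborel) \<partial>lborel)"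
    by (rule lborel_pair.Fubini'[symmetric]) measurable
  also have "\<dots> = (\<integral>\<^sup>+y. ennreal (1 / real ?m) * \<phi> y \<partial>lborel)"
  proof (rule nn_integral_cong_AE, use AE0 in eventually_elim)
    fix y :: 'a assume "y \<noteq> 0"
    then have n: "norm y > 0" by simp
    have "(\<integral>\<^sup>+t. indicator {0<..} t * (indicator {p. norm (snd p) < fst p} (t, y) * ennreal (norm y ^ ?m / t ^ Suc ?m)) * \<phi> y \<partial>lborel)
      = (\<integral>\<^sup>+t. (ennreal (norm y ^ ?m) * \<phi> y) * (ennreal (1 / t ^ Suc ?m) * indicator {norm y..} t) \<partial>lborel)"
    proof (rule nn_integral_cong_AE, use AE_lborel_singleton[of "norm y"] in eventually_elim)
      fix t :: real assume "t \<noteq> norm y"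
      then show "indicator {0<..} t * (indicator {p. norm (snd p) < fst p} (t, y) * ennreal (norm y ^ ?m / t ^ Suc ?m)) * \<phi> y
        = (ennreal (norm y ^ ?m) * \<phi> y) * (ennreal (1 / t ^ Suc ?m) * indicator {norm y..} t)"
      proof (cases "norm y < t")
        case True
        then have "t > 0" using n by linarith
        then have "ennreal (norm y ^ ?m / t ^ Suc ?m) = ennreal (norm y ^ ?m) * ennreal (1 / t ^ Suc ?m)"
          by (subst ennreal_mult[symmetric]) auto
        then show ?thesis using True \<open>t > 0\<close> by (simp add: mult_ac del: power_Suc)
      qed (use \<open>t \<noteq> norm y\<close> in \<open>auto simp: indicator_def\<close>)
    qed
    also have "\<dots> = (ennreal (norm y ^ ?m) * \<phi> y) * ennreal (1 / (real ?m * norm y ^ ?m))"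
      unfolding nn_integral_inverse_power_tail[OF n m, symmetric] by (rule nn_integral_cmult) measurable
    also have "\<dots> = (ennreal (norm y ^ ?m) * ennreal (1 / (real ?m * norm y ^ ?m))) * \<phi> y" by (simp add: mult_ac)
    also have "ennreal (norm y ^ ?m) * ennreal (1 / (real ?m * norm y ^ ?m)) = ennreal (1 / real ?m)"
      using n by (subst ennreal_mult[symmetric]) auto
    finally show "(\<integral>\<^sup>+t. indicator {0<..} t * (indicator {p. norm (snd p) < fst p} (t, y) * ennreal (norm y ^ ?m / t ^ Suc ?m)) * \<phi> y \<partial>lborel) = ennreal (1 / real ?m) * \<phi> y" .
  qed
  also have "\<dots> = ennreal (1 / real ?m) * (\<integral>\<^sup>+y. \<phi> y \<partial>lborel)" by (rule nn_integral_cmult) measurable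
  finally show ?thesis .
qed

text \<open>Integrability is not assumed: the integral of a non-integrable function is 0 by
  convention.\<close>

lemma ennreal_integral_le_nn_integral:
  fixes g :: "'a \<Rightarrow> real"
  shows "ennreal (LINT x|M. g x) \<le> (\<integral>\<^sup>+x. ennreal (g x) \<partial>M)"
proof (cases "integrable M g")
  case True
  have "(LINT x|M. g x) \<le> enn2real (\<integral>\<^sup>+x. ennreal (g x) \<partial>M)"
    using real_lebesgue_integral_def[OF True] by simp
  then have "ennreal (LINT x|M. g x) \<le> ennreal (enn2real (\<integral>\<^sup>+x. ennreal (g x) \<partial>M))" by (rule ennreal_leI)
  also have "\<dots> \<le> (\<integral>\<^sup>+x. ennreal (g x) \<partial>M)" by (simp add: ennreal_enn2real_if)
  finally show ?thesis .
qed (simp add: not_integrable_integral_eq)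

text \<open>Layer cake formula: bump^2 is a superposition of indicators of balls of radius
  \<open>s\<close> with density 4 s (1 - s^2), minus the derivative of (1 - s^2)^2.\<close>

lemma integral_bump_layers:
  fixes y :: "'a::euclidean_space"
  shows "(LINT s|lborel. indicator {0<..<1} s * (4 * s * (1 - s\<^sup>2)) * indicator {p. norm (snd p) < fst p} (s, y)) = bump y ^ 2"
proof (cases "norm y < 1")
  case True
  have "(LINT s|lborel. indicator {0<..<1} s * (4 * s * (1 - s\<^sup>2)) * indicator {p. norm (snd p) < fst p} (s, y))
    = (LINT s|lborel. (4 * s * (1 - s\<^sup>2)) * indicator {norm y..1} s)"
  proof (rule integral_cong_AE)
    show "AE s in lborel. indicator {0<..<1} s * (4 * s * (1 - s\<^sup>2)) * indicator {p. norm (snd p) < fst p} (s, y)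
      = (4 * s * (1 - s\<^sup>2)) * indicator {norm y..1} s"
      using AE_lborel_singleton[of "norm y"] AE_lborel_singleton[of "1::real"]
    proof eventually_elim
      fix s :: real assume "s \<noteq> norm y" "s \<noteq> 1"
      then show "indicator {0<..<1} s * (4 * s * (1 - s\<^sup>2)) * indicator {p. norm (snd p) < fst p} (s, y)
        = (4 * s * (1 - s\<^sup>2)) * indicator {norm y..1} s"
        using norm_ge_zero[of y] le_less_trans[of 0 "norm y" s] by (cases "norm y < s") (auto simp: indicator_def)
    qed
  qed measurable
  also have "\<dots> = - (1 - 1\<^sup>2)\<^sup>2 - - (1 - (norm y)\<^sup>2)\<^sup>2"
  proof (rule integral_FTC_Icc_real)
    fix x :: real
    show "DERIV (\<lambda>s. - (1 - s\<^sup>2)\<^sup>2) x :> 4 * x * (1 - x\<^sup>2)"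
      by (rule derivative_eq_intros refl | simp add: algebra_simps)+
    show "isCont (\<lambda>s. 4 * s * (1 - s\<^sup>2)) x" by (intro continuous_intros)
  qed (use True in simp)
  also have "\<dots> = bump y ^ 2"
    using True power_mono[of "norm y" 1 2] by (simp add: bump_def)
  finally show ?thesis .
next
  case False
  then have "(\<lambda>s. indicator {0<..<1} s * (4 * s * (1 - s\<^sup>2)) * indicator {p. norm (snd p) < fst p} (s, y)) = (\<lambda>s. 0 :: real)"
    by (auto simp: indicator_def)
  then show ?thesis using False by (simp add: bump_eq_0)
qed

lemma bump_sq_integral_layers:
  fixes h :: "'a::euclidean_space \<Rightarrow> real"
  assumes h[measurable]: "h \<in> borel_measurable borel" and K: "\<And>y. norm (h y) \<le> K"
  shows "(LINT y|lborel. bump y ^ 2 * h y) =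
    (LINT s|lborel. indicator {0<..<1} s * (4 * s * (1 - s\<^sup>2)) * (LINT y|lborel. indicator (ball 0 s) y * h y))"
proof -
  define J where "J s y = indicator {0<..<1} s * (4 * s * (1 - s\<^sup>2)) * indicator {p. norm (snd p) < fst p} (s, y) * h y" for s and y :: 'a
  have K0: "K \<ge> 0" using K[of 0] norm_ge_zero[of "h 0"] by linarith
  have Jm: "case_prod J \<in> borel_measurable (lborel \<Otimes>\<^sub>M lborel)" unfolding J_def by measurable
  have int: "integrable (lborel \<Otimes>\<^sub>M lborel) (case_prod J)"
  proof (rule Bochner_Integration.integrable_bound[OF _ Jm])
    have "emeasure lborel ({0..1::real} \<times> cball (0::'a) 1) < \<infinity>"
      by (intro emeasure_bounded_finite bounded_Times) auto
    moreover have "{0..1::real} \<times> cball (0::'a) 1 \<in> sets lborel" by (simp add: borel_Times)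
    ultimately show "integrable (lborel \<Otimes>\<^sub>M lborel) (\<lambda>p. 4 * K * indicator ({0..1::real} \<times> cball (0::'a) 1) p :: real)"
      unfolding lborel_prod by (auto intro!: integrable_mult_right integrable_real_indicator)
    have "norm (J s y) \<le> norm (4 * K * indicator ({0..1::real} \<times> cball (0::'a) 1) (s, y) :: real)" for s y
    proof (cases "0 < s \<and> s < 1 \<and> norm y < s")
      case True
      have s2: "0 \<le> 1 - s\<^sup>2" "1 - s\<^sup>2 \<le> 1" using True power_mono[of s 1 2] by auto
      have "norm (J s y) = 4 * s * (1 - s\<^sup>2) * norm (h y)" using True s2 by (simp add: J_def abs_mult)
      also have "\<dots> \<le> 4 * 1 * 1 * K" using True s2 K[of y] by (intro mult_mono) auto
      finally show ?thesis using True K0 by simp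
    qed (auto simp: J_def indicator_def)
    then show "AE p in lborel \<Otimes>\<^sub>M lborel. norm (case_prod J p) \<le> norm (4 * K * indicator ({0..1::real} \<times> cball (0::'a) 1) p :: real)"
      by (auto simp: split_beta)
  qed
  have "(LINT y|lborel. bump y ^ 2 * h y) = (LINT y|lborel. (LINT s|lborel. J s y))"
    unfolding J_def integral_mult_left_zero integral_bump_layers ..
  also have "\<dots> = (LINT s|lborel. (LINT y|lborel. J s y))"
    by (rule lborel_pair.Fubini_integral[OF int])
  also have "\<dots> = (LINT s|lborel. indicator {0<..<1} s * (4 * s * (1 - s\<^sup>2)) * (LINT y|lborel. indicator (ball 0 s) y * h y))"
  proof (rule Bochner_Integration.integral_cong[OF refl])
    fix s :: real
    have "(LINT y|lborel. J s y) = (LINT y|lborel. indicator {0<..<1} s * (4 * s * (1 - s\<^sup>2)) * (indicator (ball 0 s) y * h y))"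
      by (rule Bochner_Integration.integral_cong) (auto simp: J_def indicator_def)
    then show "(LINT y|lborel. J s y) = indicator {0<..<1} s * (4 * s * (1 - s\<^sup>2)) * (LINT y|lborel. indicator (ball 0 s) y * h y)"
      by simp
  qed
  finally show ?thesis .
qed

text \<open>The hypothesis is integrated over the radii \<rho> = R s against 4 (1 - s^2). Together
  with the factor \<rho> on the left this is the density of \<open>integral_bump_layers\<close>,
  which produces bump^2; on the right, polar coordinates turn 1 - s^2 into the weight bump.\<close>

lemma bump_avg_le_of_sphere_bound:
  fixes z :: "'a::euclidean_space"
  assumes m: "DIM('a) = Suc d" and S: "cball z r \<subseteq> S"
    and F: "continuous_on S F" "\<And>y. y \<in> S \<Longrightarrow> F y \<ge> 0" and f: "continuous_on S f" and \<kappa>: "\<kappa> \<ge> 0"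
    and bound: "\<And>\<rho>. 0 < \<rho> \<Longrightarrow> \<rho> < r \<Longrightarrow>
      \<rho> * (LINT y:ball z \<rho>|lborel. f y) \<le> \<kappa> * (LINT y:sphere z \<rho>|hausdorff_measure d. F y)"
    and R: "0 < R" "R \<le> r"
  shows "R\<^sup>2 * bump_avg 2 f z R \<le> 4 * sphere_const d / real DIM('a) * \<kappa> * bump_avg 1 F z R"
proof -
  \<comment> \<open>Cut off outside the closed ball, the functions are Borel on the whole space, and
    the integrals in question do not change.\<close>
  define Ft where "Ft y = indicator (cball z r) y *\<^sub>R F y" for y
  define ft where "ft y = indicator (cball z r) y *\<^sub>R f y" for y
  have [measurable]: "Ft \<in> borel_measurable borel"
    unfolding Ft_def using F(1) S by (intro borel_measurable_continuous_on_indicator) (auto intro: continuous_on_subset)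
  have [measurable]: "ft \<in> borel_measurable borel"
    unfolding ft_def using f S by (intro borel_measurable_continuous_on_indicator) (auto intro: continuous_on_subset)
  have Ft0: "Ft y \<ge> 0" for y using F(2) S by (auto simp: Ft_def indicator_def)
  have "compact (f ` cball z r)" using f S by (intro compact_continuous_image) (auto intro: continuous_on_subset)
  then obtain K where K: "\<forall>y\<in>f ` cball z r. norm y \<le> K" using compact_imp_bounded bounded_iff by metis
  have K0: "0 \<le> \<bar>K\<bar>" by simp
  have ftK: "norm (ft y) \<le> \<bar>K\<bar>" for y
    using K by (auto simp: ft_def indicator_def intro: order_trans[OF _ abs_ge_self])
  have sub: "z + R *\<^sub>R y \<in> cball z r" if "norm y \<le> 1" for y
    using cball_affine_subset[OF order_refl, of R r y z] R that by auto
  have b2: "bump_avg 2 f z R = (LINT y|lborel. bump y ^ 2 * ft (z + R *\<^sub>R y))"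
    unfolding bump_avg_def
  proof (rule Bochner_Integration.integral_cong[OF refl])
    fix y show "bump y ^ 2 * f (z + R *\<^sub>R y) = bump y ^ 2 * ft (z + R *\<^sub>R y)"
      using sub[of y] by (cases "norm y \<le> 1") (simp_all add: ft_def bump_eq_0)
  qed
  define C where "C = sphere_const d"
  have C0: "C > 0" unfolding C_def by (rule sphere_const_pos)
  define a where "a \<rho> = (\<integral>\<^sup>+w. ennreal (Ft (radial_proj z \<rho> w)) * indicator (ball 0 1) w \<partial>lborel)" for \<rho>
  define dd where "dd s = (LINT y|lborel. indicator (ball 0 s) y * ft (z + R *\<^sub>R y))" for s
  have sphere: "ennreal (LINT y:sphere z \<rho>|hausdorff_measure d. F y) \<le> ennreal (C * \<rho> ^ d) * a \<rho>"
    if \<rho>: "0 < \<rho>" "\<rho> < r" for \<rho>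
  proof -
    have "ennreal (LINT y:sphere z \<rho>|hausdorff_measure d. F y) \<le> (\<integral>\<^sup>+y. ennreal (indicator (sphere z \<rho>) y *\<^sub>R F y) \<partial>hausdorff_measure d)"
      unfolding set_lebesgue_integral_def by (rule ennreal_integral_le_nn_integral)
    also have "\<dots> = (\<integral>\<^sup>+y. ennreal (Ft y) * indicator (sphere z \<rho>) y \<partial>hausdorff_measure d)"
      using \<rho> by (intro nn_integral_cong) (auto simp: Ft_def indicator_def)
    also have "\<dots> \<le> ennreal (sphere_const d * \<rho> ^ d) * (\<integral>\<^sup>+w. ennreal (Ft (radial_proj z \<rho> w)) * indicator (ball 0 1) w \<partial>lborel)"
      by (rule nn_integral_sphere_le(1)[OF \<rho>(1) m]) measurable
    finally show ?thesis by (simp add: a_def C_def)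
  qed
  have layer: "ennreal (R\<^sup>2 * (indicator {0<..<1} s * (4 * s * (1 - s\<^sup>2)) * dd s))
      \<le> ennreal (4 * \<kappa> * C) * (indicator {0<..} s * ennreal (max 0 (1 - s\<^sup>2) * s ^ d) * a (R * s))" for s
  proof (cases "0 < s \<and> s < 1")
    case True
    define \<rho> where "\<rho> = R * s"
    have \<rho>: "0 < \<rho>" "\<rho> < r"
    proof -
      show "0 < \<rho>" using R True by (simp add: \<rho>_def)
      have "R * s < R * 1" using R True by (intro mult_strict_left_mono) auto
      then show "\<rho> < r" unfolding \<rho>_def using R by linarith
    qed
    have s2: "0 \<le> 1 - s\<^sup>2" using True power_mono[of s 1 2] by auto
    let ?g = "\<lambda>y. indicator (ball z \<rho>) y * ft y"
    have "dd s = (LINT y|lborel. ?g (z + R *\<^sub>R y))"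
      unfolding dd_def
    proof (rule Bochner_Integration.integral_cong[OF refl])
      fix y :: 'a
      have "z + R *\<^sub>R y \<in> ball z \<rho> \<longleftrightarrow> y \<in> ball 0 s" using R by (simp add: dist_norm \<rho>_def)
      then show "indicator (ball 0 s) y * ft (z + R *\<^sub>R y) = ?g (z + R *\<^sub>R y)" by (simp add: indicator_def)
    qed
    also have "\<dots> = (1 / R ^ DIM('a)) * (LINT y|lborel. ?g y)"
    proof (rule integral_lborel_affine)
      have [measurable]: "ball z \<rho> \<in> sets borel" by simp
      show "?g \<in> borel_measurable borel" by measurable
    qed (use R in simp)
    also have "(LINT y|lborel. ?g y) = (LINT y:ball z \<rho>|lborel. f y)"
      unfolding set_lebesgue_integral_def using \<rho>
      by (intro Bochner_Integration.integral_cong) (auto simp: ft_def indicator_def)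
    finally have dd: "(LINT y:ball z \<rho>|lborel. f y) = R ^ Suc d * dd s" using R m by (simp add: field_simps)
    have "R ^ d * (R\<^sup>2 * (s * dd s)) \<le> \<kappa> * (LINT y:sphere z \<rho>|hausdorff_measure d. F y)"
      using bound[OF \<rho>] unfolding dd by (simp add: \<rho>_def power2_eq_square mult_ac)
    then have "4 * (1 - s\<^sup>2) * (R ^ d * (R\<^sup>2 * (s * dd s))) \<le> 4 * (1 - s\<^sup>2) * (\<kappa> * (LINT y:sphere z \<rho>|hausdorff_measure d. F y))"
      using s2 by (intro mult_left_mono) auto
    then have "R ^ d * (R\<^sup>2 * (indicator {0<..<1} s * (4 * s * (1 - s\<^sup>2)) * dd s)) \<le> (4 * \<kappa> * (1 - s\<^sup>2)) * (LINT y:sphere z \<rho>|hausdorff_measure d. F y)"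
      using True by (simp add: mult_ac)
    then have "ennreal (R ^ d * (R\<^sup>2 * (indicator {0<..<1} s * (4 * s * (1 - s\<^sup>2)) * dd s))) \<le> ennreal ((4 * \<kappa> * (1 - s\<^sup>2)) * (LINT y:sphere z \<rho>|hausdorff_measure d. F y))"
      by (rule ennreal_leI)
    also have "\<dots> = ennreal (4 * \<kappa> * (1 - s\<^sup>2)) * ennreal (LINT y:sphere z \<rho>|hausdorff_measure d. F y)"
      using \<kappa> s2 by (intro ennreal_mult') auto
    also have "\<dots> \<le> ennreal (4 * \<kappa> * (1 - s\<^sup>2)) * (ennreal (C * \<rho> ^ d) * a \<rho>)"
      by (intro mult_left_mono sphere \<rho>) simp
    also have "\<dots> = ennreal ((4 * \<kappa> * (1 - s\<^sup>2)) * (C * \<rho> ^ d)) * a \<rho>"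
      using \<kappa> s2 C0 \<rho> by (simp add: ennreal_mult mult.assoc)
    finally have le: "ennreal (R ^ d) * ennreal (R\<^sup>2 * (indicator {0<..<1} s * (4 * s * (1 - s\<^sup>2)) * dd s))
        \<le> ennreal ((4 * \<kappa> * (1 - s\<^sup>2)) * (C * \<rho> ^ d)) * a \<rho>"
      using R by (simp add: ennreal_mult')
    have "ennreal (R\<^sup>2 * (indicator {0<..<1} s * (4 * s * (1 - s\<^sup>2)) * dd s))
        \<le> ennreal ((4 * \<kappa> * (1 - s\<^sup>2)) * (C * \<rho> ^ d) / R ^ d) * a \<rho>"
      by (rule ennreal_mult_le_imp_le_divide[OF _ le]) (use R \<kappa> s2 C0 \<rho> in auto)
    also have "(4 * \<kappa> * (1 - s\<^sup>2)) * (C * \<rho> ^ d) / R ^ d = 4 * \<kappa> * C * ((1 - s\<^sup>2) * s ^ d)"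
      using R by (simp add: \<rho>_def power_mult_distrib)
    also have "ennreal (4 * \<kappa> * C * ((1 - s\<^sup>2) * s ^ d)) = ennreal (4 * \<kappa> * C) * ennreal (max 0 (1 - s\<^sup>2) * s ^ d)"
      using \<kappa> C0 s2 True by (subst ennreal_mult) auto
    finally show ?thesis using True by (simp add: \<rho>_def mult.assoc)
  qed auto
  define \<phi> where "\<phi> y = ennreal (bump y * Ft (z + R *\<^sub>R y))" for y
  have [measurable]: "\<phi> \<in> borel_measurable borel" unfolding \<phi>_def by measurable
  have polar: "(\<integral>\<^sup>+s. indicator {0<..} s * ennreal (max 0 (1 - s\<^sup>2) * s ^ d) * a (R * s) \<partial>lborel)
     = ennreal (1 / real DIM('a)) * (\<integral>\<^sup>+y. \<phi> y \<partial>lborel)"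
  proof -
    have [measurable]: "ball (0::'a) 1 \<in> sets borel" by simp
    have [measurable]: "(\<lambda>p::'a \<times> real. radial_proj z (R * snd p) (fst p)) \<in> borel_measurable (borel \<Otimes>\<^sub>M borel)"
      unfolding radial_proj_def by measurable
    have [measurable]: "(\<lambda>p::real \<times> 'a. radial_proj z (R * fst p) (snd p)) \<in> borel_measurable (borel \<Otimes>\<^sub>M borel)"
      unfolding radial_proj_def by measurable
    have [measurable]: "(\<lambda>p::real \<times> 'a. indicator (ball 0 1) (snd p) :: ennreal) \<in> borel_measurable (lborel \<Otimes>\<^sub>M lborel)"
      by (rule measurable_compose[OF measurable_snd]) simp
    have [measurable]: "(\<lambda>w::'a. radial_proj z (R * s) w) \<in> borel_measurable borel" for s by measurable
    have "(\<integral>\<^sup>+s. indicator {0<..} s * ennreal (max 0 (1 - s\<^sup>2) * s ^ d) * a (R * s) \<partial>lborel)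
      = (\<integral>\<^sup>+s. (\<integral>\<^sup>+w. indicator {0<..} s * ennreal (max 0 (1 - s\<^sup>2) * s ^ d) * (ennreal (Ft (radial_proj z (R * s) w)) * indicator (ball 0 1) w) \<partial>lborel) \<partial>lborel)"
      unfolding a_def by (intro nn_integral_cong nn_integral_cmult[symmetric]) measurable
    also have "\<dots> = (\<integral>\<^sup>+w. (\<integral>\<^sup>+s. indicator {0<..} s * ennreal (max 0 (1 - s\<^sup>2) * s ^ d) * (ennreal (Ft (radial_proj z (R * s) w)) * indicator (ball 0 1) w) \<partial>lborel) \<partial>lborel)"
      by (rule lborel_pair.Fubini'[symmetric]) measurable
    also have "\<dots> = (\<integral>\<^sup>+w. indicator (ball 0 1) w * (\<integral>\<^sup>+s. indicator {0<..} s * ennreal (s ^ (DIM('a) - 1)) * \<phi> ((s / norm w) *\<^sub>R w) \<partial>lborel) \<partial>lborel)"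
    proof (rule nn_integral_cong_AE, use AE_lborel_singleton[of "0::'a"] in eventually_elim)
      fix w :: 'a assume w: "w \<noteq> 0"
      have "(\<integral>\<^sup>+s. indicator {0<..} s * ennreal (max 0 (1 - s\<^sup>2) * s ^ d) * (ennreal (Ft (radial_proj z (R * s) w)) * indicator (ball 0 1) w) \<partial>lborel)
        = (\<integral>\<^sup>+s. indicator (ball 0 1) w * (indicator {0<..} s * ennreal (s ^ (DIM('a) - 1)) * \<phi> ((s / norm w) *\<^sub>R w)) \<partial>lborel)"
      proof (rule nn_integral_cong)
        fix s :: real
        show "indicator {0<..} s * ennreal (max 0 (1 - s\<^sup>2) * s ^ d) * (ennreal (Ft (radial_proj z (R * s) w)) * indicator (ball 0 1) w)
          = indicator (ball 0 1) w * (indicator {0<..} s * ennreal (s ^ (DIM('a) - 1)) * \<phi> ((s / norm w) *\<^sub>R w))"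
        proof (cases "s > 0")
          case True
          have "bump ((s / norm w) *\<^sub>R w) = max 0 (1 - s\<^sup>2)" using w True by (simp add: bump_def)
          then have "\<phi> ((s / norm w) *\<^sub>R w) = ennreal (max 0 (1 - s\<^sup>2) * Ft (radial_proj z (R * s) w))"
            by (simp add: \<phi>_def radial_proj_def)
          then show ?thesis using True Ft0 m by (simp add: ennreal_mult mult_ac)
        qed simp
      qed
      also have "\<dots> = indicator (ball 0 1) w * (\<integral>\<^sup>+s. indicator {0<..} s * ennreal (s ^ (DIM('a) - 1)) * \<phi> ((s / norm w) *\<^sub>R w) \<partial>lborel)"
        by (rule nn_integral_cmult) measurable
      finally show "(\<integral>\<^sup>+s. indicator {0<..} s * ennreal (max 0 (1 - s\<^sup>2) * s ^ d) * (ennreal (Ft (radial_proj z (R * s) w)) * indicator (ball 0 1) w) \<partial>lborel)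
        = indicator (ball 0 1) w * (\<integral>\<^sup>+s. indicator {0<..} s * ennreal (s ^ (DIM('a) - 1)) * \<phi> ((s / norm w) *\<^sub>R w) \<partial>lborel)" .
    qed
    also have "\<dots> = ennreal (1 / real DIM('a)) * (\<integral>\<^sup>+y. \<phi> y \<partial>lborel)" by (rule polar_nn_integral) measurable
    finally show ?thesis .
  qed
  have avgF: "(\<integral>\<^sup>+y. \<phi> y \<partial>lborel) = ennreal (bump_avg 1 F z R)"
  proof -
    have int: "integrable lborel (\<lambda>y. bump y ^ 1 * F (z + R *\<^sub>R y))"
      using continuous_on_affine_compose[OF F(1) S, of R] R by (intro integrable_bump) auto
    have eq: "(\<lambda>y. bump y * Ft (z + R *\<^sub>R y)) = (\<lambda>y. bump y ^ 1 * F (z + R *\<^sub>R y))"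
    proof
      fix y show "bump y * Ft (z + R *\<^sub>R y) = bump y ^ 1 * F (z + R *\<^sub>R y)"
        using sub[of y] by (cases "norm y \<le> 1") (simp_all add: Ft_def bump_eq_0)
    qed
    have "(\<integral>\<^sup>+y. \<phi> y \<partial>lborel) = ennreal (LINT y|lborel. bump y * Ft (z + R *\<^sub>R y))"
      unfolding \<phi>_def
    proof (rule nn_integral_eq_integral)
      show "integrable lborel (\<lambda>y. bump y * Ft (z + R *\<^sub>R y))" unfolding eq by (rule int)
    qed (use Ft0 in auto)
    then show ?thesis by (simp only: eq bump_avg_def)
  qed
  have F0: "bump_avg 1 F z R \<ge> 0"
    unfolding bump_avg_def
  proof (rule integral_nonneg_AE, rule AE_I2)
    fix y show "0 \<le> bump y ^ 1 * F (z + R *\<^sub>R y)"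
      using sub[of y] F(2) S by (cases "norm y \<le> 1") (auto simp: bump_eq_0 subset_iff)
  qed
  have "R\<^sup>2 * bump_avg 2 f z R = (LINT s|lborel. R\<^sup>2 * (indicator {0<..<1} s * (4 * s * (1 - s\<^sup>2)) * dd s))"
    unfolding b2 dd_def by (subst bump_sq_integral_layers[where K = "\<bar>K\<bar>"]) (use ftK in auto)
  then have "ennreal (R\<^sup>2 * bump_avg 2 f z R) = ennreal (LINT s|lborel. R\<^sup>2 * (indicator {0<..<1} s * (4 * s * (1 - s\<^sup>2)) * dd s))"
    by (simp only:)
  also have "\<dots> \<le> (\<integral>\<^sup>+s. ennreal (R\<^sup>2 * (indicator {0<..<1} s * (4 * s * (1 - s\<^sup>2)) * dd s)) \<partial>lborel)"
    by (rule ennreal_integral_le_nn_integral)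
  also have "\<dots> \<le> (\<integral>\<^sup>+s. ennreal (4 * \<kappa> * C) * (indicator {0<..} s * ennreal (max 0 (1 - s\<^sup>2) * s ^ d) * a (R * s)) \<partial>lborel)"
    by (intro nn_integral_mono layer)
  also have "\<dots> = ennreal (4 * \<kappa> * C) * (\<integral>\<^sup>+s. indicator {0<..} s * ennreal (max 0 (1 - s\<^sup>2) * s ^ d) * a (R * s) \<partial>lborel)"
  proof (rule nn_integral_cmult)
    have [measurable]: "ball (0::'a) 1 \<in> sets borel" by simp
    have [measurable]: "(\<lambda>p::real \<times> 'a. radial_proj z (R * fst p) (snd p)) \<in> borel_measurable (borel \<Otimes>\<^sub>M borel)"
      unfolding radial_proj_def by measurable
    have [measurable]: "(\<lambda>p::real \<times> 'a. indicator (ball 0 1) (snd p) :: ennreal) \<in> borel_measurable (lborel \<Otimes>\<^sub>M lborel)"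
      by (rule measurable_compose[OF measurable_snd]) simp
    have "(\<lambda>s. a (R * s)) \<in> borel_measurable lborel"
      unfolding a_def by (rule lborel.borel_measurable_nn_integral) measurable
    then show "(\<lambda>s. indicator {0<..} s * ennreal (max 0 (1 - s\<^sup>2) * s ^ d) * a (R * s)) \<in> borel_measurable lborel"
      by measurable
  qed
  also have "\<dots> = ennreal (4 * \<kappa> * C * (1 / real DIM('a) * bump_avg 1 F z R))"
    unfolding polar avgF using \<kappa> C0 F0 by (simp add: ennreal_mult[symmetric])
  finally have "R\<^sup>2 * bump_avg 2 f z R \<le> 4 * \<kappa> * C * (1 / real DIM('a) * bump_avg 1 F z R)"
    by (rule ennreal_le_iff[THEN iffD1, rotated]) (use \<kappa> C0 F0 in auto)
  then show ?thesis by (simp add: C_def mult_ac)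
qed

section \<open>A weighted Poincare inequality\<close>

lemma bump_segment:
  fixes x y :: "'a::euclidean_space"
  assumes "norm x \<le> 1" "norm y \<le> 1" "0 \<le> t" "t \<le> 1"
  shows "bump x * bump y \<le> bump (y + t *\<^sub>R (x - y))" "norm (y + t *\<^sub>R (x - y)) \<le> 1"
proof -
  have eq: "y + t *\<^sub>R (x - y) = (1 - t) *\<^sub>R y + t *\<^sub>R x" by (simp add: algebra_simps)
  have n: "norm (y + t *\<^sub>R (x - y)) \<le> (1 - t) * norm y + t * norm x"
    unfolding eq using norm_triangle_ineq[of "(1 - t) *\<^sub>R y" "t *\<^sub>R x"] assms by simp
  also have "\<dots> \<le> max (norm x) (norm y)"
    using assms convex_bound_le[of "norm y" "max (norm x) (norm y)" "norm x" "1 - t" t] by simp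
  \<comment> \<open>The end with the larger norm has the smaller weight, which bounds the weight on
    the segment from below; the weight of the other end is at most 1 and is dropped.\<close>
  finally have M: "norm (y + t *\<^sub>R (x - y)) \<le> max (norm x) (norm y)" .
  then show "norm (y + t *\<^sub>R (x - y)) \<le> 1" using assms by auto
  have mono: "bump v \<le> bump w" if "norm w \<le> norm v" for v w :: 'a
    unfolding bump_def using power_mono[OF that, of 2] by (intro max.mono) auto
  show "bump x * bump y \<le> bump (y + t *\<^sub>R (x - y))"
  proof (cases "norm x \<le> norm y")
    case True
    have "bump x * bump y \<le> 1 * bump y" by (intro mult_right_mono bump_le_1 bump_nonneg)
    also have "\<dots> \<le> bump (y + t *\<^sub>R (x - y))" using M True by (auto intro: mono)
    finally show ?thesis .
  next
    case False
    have "bump x * bump y \<le> bump x * 1" by (intro mult_left_mono bump_le_1 bump_nonneg)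
    also have "\<dots> \<le> bump (y + t *\<^sub>R (x - y))" using M False by (auto intro: mono)
    finally show ?thesis .
  qed
qed

lemma square_integral_le_integral_square:
  fixes h :: "real \<Rightarrow> real"
  assumes "continuous_on {0..1} h"
  shows "(integral {0..1} h)\<^sup>2 \<le> integral {0..1} (\<lambda>t. (h t)\<^sup>2)"
proof -
  define I where "I = integral {0..1} h"
  have i1: "h integrable_on {0..1}" and i2: "(\<lambda>t. (h t)\<^sup>2) integrable_on {0..1}"
    by (intro integrable_continuous_interval continuous_intros assms)+
  have "0 \<le> integral {0..1} (\<lambda>t. (h t - I)\<^sup>2)"
    by (intro integral_nonneg integrable_continuous_interval continuous_intros assms) auto
  also have "(\<lambda>t. (h t - I)\<^sup>2) = (\<lambda>t. ((h t)\<^sup>2 - 2 * I * h t) + I\<^sup>2)"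
    by (auto simp: power2_eq_square algebra_simps)
  also have "integral {0..1} \<dots> = (integral {0..1} (\<lambda>t. (h t)\<^sup>2) - 2 * I * I) + I\<^sup>2"
    using i1 i2 by (subst integral_add integral_diff integral_mult_right, auto simp: I_def
        intro!: integrable_diff integrable_on_mult_right)+
  finally show ?thesis by (simp add: I_def power2_eq_square)
qed

lemma has_derivative_inner_bound:
  fixes f' :: "'a::euclidean_space \<Rightarrow> real"
  assumes "linear f'"
  shows "(f' h)\<^sup>2 \<le> (norm h)\<^sup>2 * (\<Sum>b\<in>Basis. (f' b)\<^sup>2)"
proof -
  have "f' h = f' (\<Sum>b\<in>Basis. (h \<bullet> b) *\<^sub>R b)" by (simp add: euclidean_representation)
  also have "\<dots> = (\<Sum>b\<in>Basis. (h \<bullet> b) * f' b)" by (simp add: linear_sum[OF assms] linear_scale[OF assms])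
  finally have "(f' h)\<^sup>2 = (\<Sum>b\<in>Basis. (h \<bullet> b) * f' b)\<^sup>2" by simp
  also have "\<dots> \<le> (\<Sum>b\<in>Basis. (h \<bullet> b)\<^sup>2) * (\<Sum>b\<in>Basis. (f' b)\<^sup>2)" by (rule Cauchy_Schwarz_ineq_sum)
  also have "(\<Sum>b\<in>Basis. (h \<bullet> b)\<^sup>2) = (norm h)\<^sup>2"
    unfolding power2_norm_eq_inner euclidean_inner[of h h] by (simp add: power2_eq_square)
  finally show ?thesis .
qed

lemma bump_variance_eq:
  fixes p :: "'a::euclidean_space \<Rightarrow> real"
  assumes p: "continuous_on (cball 0 1) p" and m: "m = (LINT y|lborel. bump y ^ 2 * p y)"
  shows "(LINT y|lborel. bump y ^ 2 * (p y - m / bump_vol TYPE('a) 2)\<^sup>2)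
    = (LINT y|lborel. bump y ^ 2 * (p y)\<^sup>2) - m\<^sup>2 / bump_vol TYPE('a) 2"
proof -
  let ?v = "bump_vol TYPE('a) 2"
  define a where "a = m / ?v"
  have v: "?v > 0" by (rule bump_vol_pos) simp
  have i1: "integrable lborel (\<lambda>y. bump y ^ 2 * (p y)\<^sup>2)" by (intro integrable_bump continuous_intros p) simp
  have i2: "integrable lborel (\<lambda>y. bump y ^ 2 * p y)" by (intro integrable_bump p) simp
  have i3: "integrable lborel (\<lambda>y::'a. bump y ^ 2)" using integrable_bump[of "\<lambda>_::'a. 1" 2] by simp
  have "(LINT y|lborel. bump y ^ 2 * (p y - a)\<^sup>2) =
    (LINT y|lborel. bump y ^ 2 * (p y)\<^sup>2 - 2 * a * (bump y ^ 2 * p y) + a\<^sup>2 * bump y ^ 2)"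
    by (rule Bochner_Integration.integral_cong) (auto simp: power2_diff algebra_simps)
  also have "\<dots> = (LINT y|lborel. bump y ^ 2 * (p y)\<^sup>2) - 2 * a * m + a\<^sup>2 * ?v"
    using i1 i2 i3 by (simp add: m bump_vol_def)
  also have "\<dots> = (LINT y|lborel. bump y ^ 2 * (p y)\<^sup>2) - m\<^sup>2 / ?v"
    using v by (simp add: a_def power2_eq_square field_simps)
  finally show ?thesis by (simp add: a_def)
qed

text \<open>Twice the variance is, up to normalisation, the mean of (f x - f y)^2 over pairs. The
  fundamental theorem on the segment and Cauchy-Schwarz bound this by integrals of the squared
  gradient, and \<open>bump_segment\<close> moves the two weights to the running point.\<close>

lemma bump_poincare:
  fixes f :: "'a::euclidean_space \<Rightarrow> real"
  assumes S: "cball 0 1 \<subseteq> S" and f: "\<And>y. y \<in> S \<Longrightarrow> (f has_derivative f' y) (at y)"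
    and f': "\<And>b. b \<in> Basis \<Longrightarrow> continuous_on S (\<lambda>y. f' y b)"
    and c: "c = (LINT y|lborel. bump y ^ 2 * f y) / bump_vol TYPE('a) 2"
  shows "(LINT y|lborel. bump y ^ 2 * (f y - c)\<^sup>2) \<le>
    2 * 2 ^ DIM('a) * measure lborel (ball (0::'a) 1) / bump_vol TYPE('a) 2 * (LINT y|lborel. bump y ^ 2 * (\<Sum>b\<in>Basis. (f' y b)\<^sup>2))"
proof -
  let ?m = "DIM('a)"
  define G where "G y = (\<Sum>b\<in>Basis. (f' y b)\<^sup>2)" for y
  define A where "A k = (LINT y|lborel. bump y ^ 2 * (f y) ^ k)" for k
  define V where "V = measure lborel (ball (0::'a) 1)"
  have A0: "A 0 = bump_vol TYPE('a) 2" by (simp add: A_def bump_vol_def)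
  have A0p: "A 0 > 0" unfolding A0 by (rule bump_vol_pos) simp
  have contf: "continuous_on (cball 0 1) f"
    using f S by (meson continuous_at_imp_continuous_on has_derivative_continuous subsetD)
  have contf': "continuous_on (cball 0 1) (\<lambda>y. f' y b)" if "b \<in> Basis" for b
    using f'[OF that] S by (rule continuous_on_subset)
  have contG: "continuous_on (cball 0 1) G" unfolding G_def by (intro continuous_intros contf')
  have G0: "G y \<ge> 0" for y unfolding G_def by (intro sum_nonneg) simp
  define g where "g y = indicator (cball 0 1) y *\<^sub>R (bump y ^ 2 * G y)" for y
  let ?Q = "\<lambda>t x y. indicator {0..1} t * (indicator (ball 0 1) x * (indicator (ball 0 1) y * ennreal (g (y + t *\<^sub>R (x - y))))) :: ennreal"
  let ?I = "\<integral>\<^sup>+w. ennreal (g w) \<partial>lborel" and ?J = "LINT y|lborel. bump y ^ 2 * G y"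
  have gm[measurable]: "g \<in> borel_measurable borel"
    unfolding g_def by (intro borel_measurable_continuous_on_indicator continuous_intros contG) simp
  have g0: "g y \<ge> 0" for y using G0[of y] by (simp add: g_def)
  have intG: "integrable lborel (\<lambda>y. bump y ^ 2 * G y)" by (intro integrable_bump contG) simp
  have geq: "g = (\<lambda>y. bump y ^ 2 * G y)" by (auto simp: g_def fun_eq_iff indicator_def bump_eq_0)
  have nng: "(\<integral>\<^sup>+y. ennreal (g y) \<partial>lborel) = ennreal ?J"
    using nn_integral_eq_integral[of lborel g] intG g0 unfolding geq by simp
  have intA: "integrable lborel (\<lambda>y. bump y ^ 2 * (p * (f y) ^ k))" for p k
    by (intro integrable_bump continuous_intros contf) simp
  have A_eq: "(LINT y|lborel. bump y ^ 2 * (p * (f y) ^ k)) = p * A k" for p k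
    unfolding A_def by (simp add: mult.left_commute)
  have comb: "(LINT y|lborel. bump y ^ 2 * (p * f y ^ 2 + q * f y ^ 1 + r * f y ^ 0)) = p * A 2 + q * A 1 + r * A 0" for p q r
  proof -
    have "(LINT y|lborel. bump y ^ 2 * (p * f y ^ 2 + q * f y ^ 1 + r * f y ^ 0))
      = (LINT y|lborel. bump y ^ 2 * (p * f y ^ 2) + bump y ^ 2 * (q * f y ^ 1) + bump y ^ 2 * (r * f y ^ 0))"
      by (simp only: distrib_left)
    also have "\<dots> = p * A 2 + q * A 1 + r * A 0"
      using intA by (simp only: Bochner_Integration.integral_add Bochner_Integration.integrable_add A_eq)
    finally show ?thesis .
  qed
  have combi: "integrable lborel (\<lambda>y. bump y ^ 2 * (p * f y ^ 2 + q * f y ^ 1 + r * f y ^ 0))" for p q r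
    by (intro integrable_bump continuous_intros contf) simp
  have var: "(LINT y|lborel. bump y ^ 2 * (f y - c)\<^sup>2) = A 2 - (A 1)\<^sup>2 / A 0"
    using bump_variance_eq[OF contf, of "A 1"] by (simp add: c A0[symmetric]) (simp add: A_def)
  have inner: "(\<integral>\<^sup>+x. ennreal (bump x ^ 2 * (bump y ^ 2 * (f x - f y)\<^sup>2)) \<partial>lborel)
      = ennreal (bump y ^ 2 * (A 0 * f y ^ 2 + (- 2 * A 1) * f y ^ 1 + A 2 * f y ^ 0))" for y
  proof -
    let ?p = "bump y ^ 2"
    have eq: "(\<lambda>x. bump x ^ 2 * (?p * (f x - f y)\<^sup>2)) =
        (\<lambda>x. bump x ^ 2 * (?p * f x ^ 2 + (- 2 * f y * ?p) * f x ^ 1 + (?p * (f y)\<^sup>2) * f x ^ 0))"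
      by (auto simp: power2_eq_square algebra_simps)
    have "(\<integral>\<^sup>+x. ennreal (bump x ^ 2 * (?p * (f x - f y)\<^sup>2)) \<partial>lborel) = ennreal (LINT x|lborel. bump x ^ 2 * (?p * (f x - f y)\<^sup>2))"
      by (rule nn_integral_eq_integral) (unfold eq, rule combi, use AE_I2 in \<open>simp add: eq[symmetric]\<close>)
    also have "(LINT x|lborel. bump x ^ 2 * (?p * (f x - f y)\<^sup>2)) = ?p * (A 0 * f y ^ 2 + (- 2 * A 1) * f y ^ 1 + A 2 * f y ^ 0)"
      unfolding eq comb by (simp add: algebra_simps power2_eq_square)
    finally show ?thesis .
  qed
  have inner0: "0 \<le> bump y ^ 2 * (A 0 * f y ^ 2 + (- 2 * A 1) * f y ^ 1 + A 2 * f y ^ 0)" for y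
  proof -
    have "0 \<le> (LINT x|lborel. bump x ^ 2 * (f x - f y)\<^sup>2)" by (rule integral_nonneg_AE) simp
    also have "(\<lambda>x. bump x ^ 2 * (f x - f y)\<^sup>2) = (\<lambda>x. bump x ^ 2 * (1 * f x ^ 2 + (- 2 * f y) * f x ^ 1 + ((f y)\<^sup>2) * f x ^ 0))"
      by (auto simp: power2_eq_square algebra_simps)
    finally have "0 \<le> A 0 * f y ^ 2 + (- 2 * A 1) * f y ^ 1 + A 2 * f y ^ 0"
      unfolding comb by (simp add: algebra_simps power2_eq_square)
    then show ?thesis by simp
  qed
  have dbl: "(\<integral>\<^sup>+y. (\<integral>\<^sup>+x. ennreal (bump x ^ 2 * (bump y ^ 2 * (f x - f y)\<^sup>2)) \<partial>lborel) \<partial>lborel) = ennreal (2 * A 0 * (A 2 - (A 1)\<^sup>2 / A 0))"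
  proof -
    have "(\<integral>\<^sup>+y. (\<integral>\<^sup>+x. ennreal (bump x ^ 2 * (bump y ^ 2 * (f x - f y)\<^sup>2)) \<partial>lborel) \<partial>lborel)
      = ennreal (LINT y|lborel. bump y ^ 2 * (A 0 * f y ^ 2 + (- 2 * A 1) * f y ^ 1 + A 2 * f y ^ 0))"
      unfolding inner by (rule nn_integral_eq_integral) (rule combi, use inner0 in simp)
    also have "(LINT y|lborel. bump y ^ 2 * (A 0 * f y ^ 2 + (- 2 * A 1) * f y ^ 1 + A 2 * f y ^ 0)) = 2 * A 0 * (A 2 - (A 1)\<^sup>2 / A 0)"
      unfolding comb using A0p by (simp add: power2_eq_square field_simps)
    finally show ?thesis .
  qed
  have segment: "ennreal (bump x ^ 2 * (bump y ^ 2 * (f x - f y)\<^sup>2)) \<le>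
     4 * (\<integral>\<^sup>+t. ?Q t x y \<partial>lborel)" for x y
  proof (cases "norm x < 1 \<and> norm y < 1")
    case True
    have xi: "norm (y + t *\<^sub>R (x - y)) \<le> 1" "bump x * bump y \<le> bump (y + t *\<^sub>R (x - y))" if "t \<in> {0..1}" for t
      using bump_segment[of x y t] True that by auto
    have xiS: "y + t *\<^sub>R (x - y) \<in> S" if "t \<in> {0..1}" for t using xi(1)[OF that] S by auto
    define h where "h t = f' (y + t *\<^sub>R (x - y)) (x - y)" for t
    have lin: "linear (f' p)" if "p \<in> S" for p using f[OF that] by (rule has_derivative_linear)
    have "((\<lambda>t. f (y + t *\<^sub>R (x - y))) has_real_derivative h t) (at t)" if "t \<in> {0..1}" for t
    proof -
      have "((\<lambda>t. y + t *\<^sub>R (x - y)) has_derivative (\<lambda>s. s *\<^sub>R (x - y))) (at t)"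
        by (auto intro!: derivative_eq_intros)
      from has_derivative_compose[OF this f[OF xiS[OF that]]]
      have "((\<lambda>t. f (y + t *\<^sub>R (x - y))) has_derivative (\<lambda>s. f' (y + t *\<^sub>R (x - y)) (s *\<^sub>R (x - y)))) (at t)" .
      moreover have "f' (y + t *\<^sub>R (x - y)) (s *\<^sub>R (x - y)) = h t * s" for s
        using linear_scale[OF lin[OF xiS[OF that]]] by (simp add: h_def)
      ultimately show ?thesis by (simp add: has_field_derivative_def)
    qed
    then have "(h has_integral (f (y + 1 *\<^sub>R (x - y)) - f (y + 0 *\<^sub>R (x - y)))) {0..1}"
      by (intro fundamental_theorem_of_calculus)
        (auto simp: has_real_derivative_iff_has_vector_derivative[symmetric] intro: has_field_derivative_at_within)
    then have fxy: "f x - f y = integral {0..1} h" by (simp add: integral_unique)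
    have conth: "continuous_on {0..1} h"
    proof -
      have "continuous_on {0..1} (\<lambda>t. \<Sum>b\<in>Basis. ((x - y) \<bullet> b) * f' (y + t *\<^sub>R (x - y)) b)"
        using xiS by (intro continuous_intros continuous_on_compose2[OF f']) auto
      then show ?thesis
      proof (rule continuous_on_eq)
        fix t :: real assume "t \<in> {0..1}"
        note l = lin[OF xiS[OF this]]
        have "h t = f' (y + t *\<^sub>R (x - y)) (\<Sum>b\<in>Basis. ((x - y) \<bullet> b) *\<^sub>R b)"
          unfolding h_def euclidean_representation ..
        also have "\<dots> = (\<Sum>b\<in>Basis. ((x - y) \<bullet> b) * f' (y + t *\<^sub>R (x - y)) b)"
          by (simp only: linear_sum[OF l] linear_scale[OF l] real_scaleR_def)
        finally show "(\<Sum>b\<in>Basis. ((x - y) \<bullet> b) * f' (y + t *\<^sub>R (x - y)) b) = h t" ..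
      qed
    qed
    have ih: "(\<lambda>t. (h t)\<^sup>2) integrable_on {0..1}" by (intro integrable_continuous_interval continuous_intros conth)
    have "(bump x * bump y)\<^sup>2 * (f x - f y)\<^sup>2 \<le> (bump x * bump y)\<^sup>2 * integral {0..1} (\<lambda>t. (h t)\<^sup>2)"
      unfolding fxy by (intro mult_left_mono square_integral_le_integral_square conth) simp
    also have "\<dots> = integral {0..1} (\<lambda>t. (bump x * bump y)\<^sup>2 * (h t)\<^sup>2)" by simp
    finally have "ennreal (bump x ^ 2 * (bump y ^ 2 * (f x - f y)\<^sup>2)) \<le> ennreal (integral {0..1} (\<lambda>t. (bump x * bump y)\<^sup>2 * (h t)\<^sup>2))"
      by (intro ennreal_leI) (simp add: power_mult_distrib mult.assoc)
    also have "\<dots> = (\<integral>\<^sup>+t. ennreal ((bump x * bump y)\<^sup>2 * (h t)\<^sup>2) * indicator {0..1} t \<partial>lborel)"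
      by (rule nn_integral_has_integral_lebesgue'[symmetric])
        (simp, rule integrable_integral[OF integrable_on_mult_right[OF ih]])
    also have "\<dots> \<le> (\<integral>\<^sup>+t. 4 * ?Q t x y \<partial>lborel)"
    proof (rule nn_integral_mono)
      fix t :: real
      show "ennreal ((bump x * bump y)\<^sup>2 * (h t)\<^sup>2) * indicator {0..1} t
        \<le> 4 * ?Q t x y"
      proof (cases "t \<in> {0..1}")
        case t: True
        have n2: "(norm (x - y))\<^sup>2 \<le> 2\<^sup>2"
          using True norm_triangle_ineq4[of x y] by (intro power_mono) auto
        have "(h t)\<^sup>2 \<le> (norm (x - y))\<^sup>2 * G (y + t *\<^sub>R (x - y))"
          unfolding h_def G_def by (rule has_derivative_inner_bound[OF lin[OF xiS[OF t]]])
        also have "\<dots> \<le> 2\<^sup>2 * G (y + t *\<^sub>R (x - y))" by (intro mult_right_mono n2 G0)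
        finally have "(bump x * bump y)\<^sup>2 * (h t)\<^sup>2 \<le> (bump (y + t *\<^sub>R (x - y)))\<^sup>2 * (2\<^sup>2 * G (y + t *\<^sub>R (x - y)))"
          using xi(2)[OF t] by (intro mult_mono power_mono) auto
        also have "\<dots> = 4 * g (y + t *\<^sub>R (x - y))" by (simp add: geq)
        finally have "ennreal ((bump x * bump y)\<^sup>2 * (h t)\<^sup>2) \<le> ennreal (4 * g (y + t *\<^sub>R (x - y)))" by (rule ennreal_leI)
        also have "\<dots> = 4 * ennreal (g (y + t *\<^sub>R (x - y)))" using g0 by (simp add: ennreal_mult)
        finally show ?thesis using t True by simp
      qed simp
    qed
    also have "\<dots> = 4 * (\<integral>\<^sup>+t. ?Q t x y \<partial>lborel)"
      by (rule nn_integral_cmult) measurable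
    finally show ?thesis .
  qed (auto simp: bump_eq_0)
  have [measurable]: "ball (0::'a) 1 \<in> sets borel" by simp
  have Vn: "emeasure lborel (ball (0::'a) 1) = ennreal V"
    unfolding V_def by (rule emeasure_eq_ennreal_measure) (simp add: emeasure_ball)
  have V0: "V \<ge> 0" by (simp add: V_def)
  have scale: "(\<integral>\<^sup>+w. ennreal (g (v + s *\<^sub>R w)) \<partial>lborel) \<le> ennreal (2 ^ ?m) * ?I" if "1 / 2 \<le> s" for v s
  proof -
    have "(\<integral>\<^sup>+w. ennreal (g (v + s *\<^sub>R w)) \<partial>lborel) = ennreal (1 / s ^ ?m) * ?I"
      by (rule nn_integral_lborel_affine) (use that in auto)
    moreover have "1 / s ^ ?m \<le> 2 ^ ?m"
      using power_mono[of "1 / s" 2 ?m] that by (simp add: power_divide field_simps)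
    ultimately show ?thesis by (simp add: mult_right_mono ennreal_leI)
  qed
  \<comment> \<open>The running point is (1 - t) y + t x. For t \<ge> 1/2 the variable
    \<open>x\<close> is substituted, otherwise \<open>y\<close>; the scaling factor is then at least
    1/2 and the Jacobian costs at most 2^m.\<close>
  have Q: "(\<integral>\<^sup>+y. (\<integral>\<^sup>+x. ?Q t x y \<partial>lborel) \<partial>lborel)
      \<le> indicator {0..1} t * (ennreal (2 ^ ?m * V) * ?I)" for t :: real
  proof (cases "t \<in> {0..1}")
    case True
    have eq: "y + t *\<^sub>R (x - y) = (1 - t) *\<^sub>R y + t *\<^sub>R x" for x y :: 'a by (simp add: algebra_simps)
    have fin: "(\<integral>\<^sup>+y. indicator (ball (0::'a) 1) y * (ennreal (2 ^ ?m) * ?I) \<partial>lborel)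
       = ennreal (2 ^ ?m * V) * ?I"
    proof -
      have "(\<integral>\<^sup>+y. indicator (ball (0::'a) 1) y * (ennreal (2 ^ ?m) * ?I) \<partial>lborel)
        = emeasure lborel (ball (0::'a) 1) * (ennreal (2 ^ ?m) * ?I)"
        by (subst nn_integral_multc) auto
      then show ?thesis using V0 by (simp add: Vn ennreal_mult mult_ac)
    qed
    show ?thesis
    proof (cases "t \<ge> 1 / 2")
      case big: True
      have "(\<integral>\<^sup>+y. (\<integral>\<^sup>+x. ?Q t x y \<partial>lborel) \<partial>lborel)
        \<le> (\<integral>\<^sup>+y. indicator (ball (0::'a) 1) y * (\<integral>\<^sup>+x. ennreal (g ((1 - t) *\<^sub>R y + t *\<^sub>R x)) \<partial>lborel) \<partial>lborel)"
      proof (rule nn_integral_mono)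
        fix y :: 'a
        have "(\<integral>\<^sup>+x. ?Q t x y \<partial>lborel)
          \<le> (\<integral>\<^sup>+x. indicator (ball 0 1) y * ennreal (g ((1 - t) *\<^sub>R y + t *\<^sub>R x)) \<partial>lborel)"
          unfolding eq by (rule nn_integral_mono) (auto simp: indicator_def)
        also have "\<dots> = indicator (ball 0 1) y * (\<integral>\<^sup>+x. ennreal (g ((1 - t) *\<^sub>R y + t *\<^sub>R x)) \<partial>lborel)"
          by (rule nn_integral_cmult) measurable
        finally show "(\<integral>\<^sup>+x. ?Q t x y \<partial>lborel)
          \<le> indicator (ball 0 1) y * (\<integral>\<^sup>+x. ennreal (g ((1 - t) *\<^sub>R y + t *\<^sub>R x)) \<partial>lborel)" .
      qed
      also have "\<dots> \<le> (\<integral>\<^sup>+y. indicator (ball (0::'a) 1) y * (ennreal (2 ^ ?m) * ?I) \<partial>lborel)"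
        by (intro nn_integral_mono mult_left_mono scale big) simp
      finally show ?thesis unfolding fin using True by simp
    next
      case small: False
      have "(\<integral>\<^sup>+y. (\<integral>\<^sup>+x. ?Q t x y \<partial>lborel) \<partial>lborel)
        = (\<integral>\<^sup>+x. (\<integral>\<^sup>+y. ?Q t x y \<partial>lborel) \<partial>lborel)"
        by (rule lborel_pair.Fubini') measurable
      also have "\<dots> \<le> (\<integral>\<^sup>+x. indicator (ball (0::'a) 1) x * (\<integral>\<^sup>+y. ennreal (g (t *\<^sub>R x + (1 - t) *\<^sub>R y)) \<partial>lborel) \<partial>lborel)"
      proof (rule nn_integral_mono)
        fix x :: 'a
        have "(\<integral>\<^sup>+y. ?Q t x y \<partial>lborel)
          \<le> (\<integral>\<^sup>+y. indicator (ball 0 1) x * ennreal (g (t *\<^sub>R x + (1 - t) *\<^sub>R y)) \<partial>lborel)"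
          unfolding eq by (rule nn_integral_mono) (auto simp: indicator_def add.commute)
        also have "\<dots> = indicator (ball 0 1) x * (\<integral>\<^sup>+y. ennreal (g (t *\<^sub>R x + (1 - t) *\<^sub>R y)) \<partial>lborel)"
          by (rule nn_integral_cmult) measurable
        finally show "(\<integral>\<^sup>+y. ?Q t x y \<partial>lborel)
          \<le> indicator (ball 0 1) x * (\<integral>\<^sup>+y. ennreal (g (t *\<^sub>R x + (1 - t) *\<^sub>R y)) \<partial>lborel)" .
      qed
      also have "\<dots> \<le> (\<integral>\<^sup>+y. indicator (ball (0::'a) 1) y * (ennreal (2 ^ ?m) * ?I) \<partial>lborel)"
        by (intro nn_integral_mono mult_left_mono scale) (use small in auto)
      finally show ?thesis unfolding fin using True by simp
    qed
  qed simp
  define ib where "ib = (indicator (ball 0 1) :: 'a \<Rightarrow> ennreal)"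
  have [measurable]: "ib \<in> borel_measurable borel" unfolding ib_def by simp
  have "ennreal (2 * A 0 * (A 2 - (A 1)\<^sup>2 / A 0)) \<le> (\<integral>\<^sup>+y. (\<integral>\<^sup>+x. 4 * (\<integral>\<^sup>+t. ?Q t x y \<partial>lborel) \<partial>lborel) \<partial>lborel)"
    unfolding dbl[symmetric] by (intro nn_integral_mono segment)
  also have "\<dots> = 4 * (\<integral>\<^sup>+y. (\<integral>\<^sup>+x. (\<integral>\<^sup>+t. ?Q t x y \<partial>lborel) \<partial>lborel) \<partial>lborel)"
    unfolding ib_def[symmetric] by (simp add: nn_integral_cmult)
  also have "(\<integral>\<^sup>+y. (\<integral>\<^sup>+x. (\<integral>\<^sup>+t. ?Q t x y \<partial>lborel) \<partial>lborel) \<partial>lborel) = (\<integral>\<^sup>+t. (\<integral>\<^sup>+y. (\<integral>\<^sup>+x. ?Q t x y \<partial>lborel) \<partial>lborel) \<partial>lborel)"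
  proof -
    have "(\<integral>\<^sup>+y. (\<integral>\<^sup>+x. (\<integral>\<^sup>+t. ?Q t x y \<partial>lborel) \<partial>lborel) \<partial>lborel) = (\<integral>\<^sup>+y. (\<integral>\<^sup>+t. (\<integral>\<^sup>+x. ?Q t x y \<partial>lborel) \<partial>lborel) \<partial>lborel)"
      unfolding ib_def[symmetric] by (rule nn_integral_cong, rule lborel_pair.Fubini') measurable
    also have "\<dots> = (\<integral>\<^sup>+t. (\<integral>\<^sup>+y. (\<integral>\<^sup>+x. ?Q t x y \<partial>lborel) \<partial>lborel) \<partial>lborel)"
      unfolding ib_def[symmetric] by (rule lborel_pair.Fubini') measurable
    finally show ?thesis .
  qed
  also have "\<dots> \<le> (\<integral>\<^sup>+t. indicator {0..1::real} t * (ennreal (2 ^ ?m * V) * ?I) \<partial>lborel)"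
    by (rule nn_integral_mono) (rule Q)
  also have "\<dots> = ennreal (2 ^ ?m * V) * ?I"
    by (subst nn_integral_multc) auto
  also have "\<dots> = ennreal (2 ^ ?m * V * ?J)"
    unfolding nng using V0 by (intro ennreal_mult''[symmetric] integral_nonneg_AE) (use G0 in auto)
  finally have fin: "ennreal (2 * A 0 * (A 2 - (A 1)\<^sup>2 / A 0)) \<le> 4 * ennreal (2 ^ ?m * V * ?J)"
    by (simp add: mult_left_mono)
  have I0: "0 \<le> ?J" by (rule integral_nonneg_AE) (use G0 in auto)
  have "ennreal (2 * A 0 * (A 2 - (A 1)\<^sup>2 / A 0)) \<le> ennreal (4 * (2 ^ ?m * V * ?J))"
    using fin V0 I0 by (simp add: ennreal_mult)
  then have "2 * A 0 * (A 2 - (A 1)\<^sup>2 / A 0) \<le> 4 * (2 ^ ?m * V * ?J)"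
    by (rule ennreal_le_iff[THEN iffD1, rotated]) (use V0 I0 in auto)
  then have "(A 2 - (A 1)\<^sup>2 / A 0) \<le> 2 * 2 ^ ?m * V / A 0 * ?J"
    using A0p by (simp add: field_simps)
  then show ?thesis unfolding var by (simp add: A0 V_def G_def)
qed

section \<open>Zeros of holomorphic functions\<close>

text \<open>\<open>pole_lemma_open\<close> removes one linear factor for each point; distinctness of
  the points keeps the product of the earlier factors nonzero at the next one.\<close>

lemma holomorphic_divide_zeros:
  fixes f :: "complex \<Rightarrow> complex"
  assumes "finite X" "open D" "f holomorphic_on D" "X \<subseteq> D" "\<And>x. x \<in> X \<Longrightarrow> f x = 0"
  shows "\<exists>g. g holomorphic_on D \<and> (\<forall>z\<in>D. f z = g z * (\<Prod>x\<in>X. z - x))"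
  using assms(1,4,5)
proof (induction X)
  case empty
  then show ?case using assms(3) by auto
next
  case (insert a X)
  then obtain g where g: "g holomorphic_on D" "\<And>z. z \<in> D \<Longrightarrow> f z = g z * (\<Prod>x\<in>X. z - x)"
    by auto
  have "a \<in> D" using insert by auto
  have "(\<Prod>x\<in>X. a - x) \<noteq> 0" using insert by (auto simp: prod_zero_iff)
  moreover have "g a * (\<Prod>x\<in>X. a - x) = 0" using g(2)[OF \<open>a \<in> D\<close>] insert.prems(2) by auto
  ultimately have ga: "g a = 0" by simp
  define h where "h z = (if z = a then deriv g a else (g z - g a) / (z - a))" for z
  have "h holomorphic_on D" unfolding h_def by (rule pole_lemma_open[OF g(1) assms(2)])
  moreover have "g z = h z * (z - a)" for z using ga by (auto simp: h_def)
  then have "f z = h z * (\<Prod>x\<in>insert a X. z - x)" if "z \<in> D" for z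
    using g(2)[OF that] insert.hyps by (simp add: mult_ac)
  ultimately show ?case by blast
qed

text \<open>Divide out the zeros and apply the maximum modulus principle on the large disc.\<close>

lemma holomorphic_bound_of_zeros:
  fixes f :: "complex \<Rightarrow> complex"
  assumes f: "f holomorphic_on ball 0 R'" and R: "R < R'" "5 * \<rho> \<le> R" "0 < \<rho>"
    and S: "\<And>z. z \<in> cball 0 R \<Longrightarrow> norm (f z) \<le> S"
    and X: "finite X" "X \<subseteq> cball 0 \<rho>" "\<And>x. x \<in> X \<Longrightarrow> f x = 0" and z: "z \<in> cball 0 \<rho>"
  shows "norm (f z) \<le> S / 2 ^ card X"
proof -
  have "X \<subseteq> ball 0 R'" using X(2) R by auto
  then obtain g where g: "g holomorphic_on ball 0 R'" "\<And>z. z \<in> ball 0 R' \<Longrightarrow> f z = g z * (\<Prod>x\<in>X. z - x)"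
    using holomorphic_divide_zeros[OF X(1) open_ball f _ X(3)] by blast
  have S0: "S \<ge> 0" using order_trans[OF norm_ge_zero S[of 0]] R by simp
  \<comment> \<open>On |w| = R \<ge> 5 \<rho> every factor has modulus at least 4 \<rho>, on the
    small disc at most 2 \<rho>. The quotient gains a factor 1/2 for each zero.\<close>
  have gb: "norm (g w) \<le> S / (4 * \<rho>) ^ card X" if w: "norm w = R" for w
  proof -
    have "(4 * \<rho>) ^ card X = (\<Prod>x\<in>X. 4 * \<rho>)" by simp
    also have "\<dots> \<le> (\<Prod>x\<in>X. norm (w - x))"
    proof (rule prod_mono)
      fix x assume "x \<in> X"
      then have "norm x \<le> \<rho>" using X(2) by auto
      then show "0 \<le> 4 * \<rho> \<and> 4 * \<rho> \<le> norm (w - x)" using R w norm_triangle_ineq2[of w x] by auto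
    qed
    finally have "(4 * \<rho>) ^ card X \<le> norm (\<Prod>x\<in>X. w - x)" by (simp add: prod_norm)
    then have "norm (g w) * (4 * \<rho>) ^ card X \<le> norm (g w) * norm (\<Prod>x\<in>X. w - x)" by (rule mult_left_mono) simp
    also have "\<dots> = norm (f w)" using g(2)[of w] w R by (simp add: norm_mult)
    also have "\<dots> \<le> S" using S[of w] w by simp
    finally show ?thesis using R by (simp add: field_simps)
  qed
  have "norm (g z) \<le> S / (4 * \<rho>) ^ card X"
  proof (rule maximum_modulus_frontier[of g "cball 0 R"])
    show "g holomorphic_on interior (cball 0 R)" using g(1) R by (auto intro: holomorphic_on_subset)
    show "continuous_on (closure (cball 0 R)) g"
      using holomorphic_on_imp_continuous_on[OF g(1)] R by (auto intro: continuous_on_subset)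
    show "norm (g w) \<le> S / (4 * \<rho>) ^ card X" if "w \<in> frontier (cball 0 R)" for w
      using that R by (intro gb) (simp add: frontier_cball)
    show "z \<in> cball 0 R" using z R by auto
  qed simp
  moreover have "(\<Prod>x\<in>X. norm (z - x)) \<le> (\<Prod>x\<in>X. 2 * \<rho>)"
  proof (rule prod_mono)
    fix x assume "x \<in> X"
    then have "norm x \<le> \<rho>" using X(2) by auto
    then show "0 \<le> norm (z - x) \<and> norm (z - x) \<le> 2 * \<rho>" using z norm_triangle_ineq4[of z x] by auto
  qed
  ultimately have "norm (g z) * (\<Prod>x\<in>X. norm (z - x)) \<le> S / (4 * \<rho>) ^ card X * (2 * \<rho>) ^ card X"
    using S0 R by (intro mult_mono) (auto intro: prod_nonneg)
  also have "S / (4 * \<rho>) ^ card X * (2 * \<rho>) ^ card X = S / 2 ^ card X"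
  proof -
    have "(4 * \<rho>) ^ card X = (2 * (2 * \<rho>)) ^ card X" by simp
    also have "\<dots> = 2 ^ card X * (2 * \<rho>) ^ card X" by (rule power_mult_distrib)
    finally have eq: "(4 * \<rho>) ^ card X = 2 ^ card X * (2 * \<rho>) ^ card X" .
    show ?thesis unfolding eq using R by simp
  qed
  finally show ?thesis using g(2)[of z] z R by (simp add: norm_mult prod_norm)
qed

text \<open>Dividing out more than \<open>N\<close> zeros would make the value at the centre smaller
  than S / 2^N. Arguing with finite subsets gives finiteness at the same time.\<close>

lemma holomorphic_zero_count:
  fixes f :: "complex \<Rightarrow> complex"
  assumes f: "f holomorphic_on ball 0 R'" and R: "R < R'" "5 * \<rho> \<le> R" "0 < \<rho>"
    and S: "\<And>z. z \<in> cball 0 R \<Longrightarrow> norm (f z) \<le> S" and S0: "S > 0"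
    and N: "norm (f 0) \<ge> S / 2 ^ N"
  shows "finite {z \<in> cball 0 \<rho>. f z = 0} \<and> card {z \<in> cball 0 \<rho>. f z = 0} \<le> N"
proof (rule finite_if_finite_subsets_card_bdd)
  fix X assume X: "X \<subseteq> {z \<in> cball 0 \<rho>. f z = 0}" "finite X"
  show "card X \<le> N"
  proof -
    have "S / 2 ^ N \<le> S / 2 ^ card X"
    proof (rule order_trans[OF N])
      show "norm (f 0) \<le> S / 2 ^ card X"
        by (rule holomorphic_bound_of_zeros[OF f R S X(2)]) (use X(1) R in auto)
    qed
    then have "(2::real) ^ card X \<le> 2 ^ N" using S0 by (simp add: field_simps)
    then show ?thesis by simp
  qed
qed

section \<open>Propagation of smallness from an interval\<close>

lemma power_div_fact_le_exp:
  fixes x :: real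
  assumes "x \<ge> 0"
  shows "x ^ n / fact n \<le> exp x"
proof -
  have s: "summable (\<lambda>n. x ^ n /\<^sub>R fact n)" using exp_converges[of x] by (rule sums_summable)
  have "(\<Sum>k\<in>{n}. x ^ k /\<^sub>R fact k) \<le> (\<Sum>k. x ^ k /\<^sub>R fact k)"
    by (rule sum_le_suminf[OF s]) (use assms in auto)
  then show ?thesis by (simp add: exp_def divide_inverse mult.commute)
qed

text \<open>n^n / n! is one term of the series of e^n, and e \<le> 3. This turns bounds (B k)^k on
  k-th derivatives into geometric bounds on Taylor coefficients.\<close>

lemma power_self_le_fact: "real n ^ n \<le> 3 ^ n * fact n"
proof -
  have "real n ^ n / fact n \<le> exp (real n)" by (rule power_div_fact_le_exp) simp
  also have "\<dots> = exp 1 ^ n" by (simp add: exp_of_nat_mult[symmetric])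
  also have "\<dots> \<le> 3 ^ n" using exp_le by (intro power_mono) auto
  finally show ?thesis by (simp add: field_simps)
qed

text \<open>These products are the denominators of the Lagrange basis for the nodes 0, ..., k -
  1.\<close>

lemma prod_abs_diff_nat:
  assumes "i < k"
  shows "(\<Prod>j\<in>{..<k} - {i}. \<bar>real i - real j\<bar>) = fact i * fact (k - 1 - i)"
  using assms
proof (induction k)
  case (Suc k)
  show ?case
  proof (cases "i < k")
    case True
    have "{..<Suc k} - {i} = insert k ({..<k} - {i})" using True by auto
    then have "(\<Prod>j\<in>{..<Suc k} - {i}. \<bar>real i - real j\<bar>) = (real k - real i) * (fact i * fact (k - 1 - i))"
      using Suc.IH True by simp
    also have "(real k - real i) * (fact i * fact (k - 1 - i)) = fact i * fact (Suc (k - 1 - i))"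
      using True by (simp add: of_nat_diff algebra_simps)
    also have "Suc (k - 1 - i) = Suc k - 1 - i" using True by simp
    finally show ?thesis .
  next
    case False
    then have i: "i = k" using Suc.prems by simp
    have "(\<Prod>j\<in>{..<Suc k} - {k}. \<bar>real k - real j\<bar>) = (\<Prod>j<k. real (k - j))"
      by (rule prod.cong) (auto simp: of_nat_diff)
    also have "\<dots> = fact k" by (simp add: fact_prod_rev atLeast0LessThan)
    finally show ?thesis by (simp add: i)
  qed
qed simp

text \<open>
  Subtract the Lagrange interpolation polynomial with \<open>k\<close> equidistant nodes in the interval and
  bound the difference, which vanishes at the nodes, by \<open>holomorphic_bound_of_zeros\<close>.
\<close>

lemma holomorphic_bound_of_interval:
  fixes f :: "complex \<Rightarrow> complex"
  assumes f: "f holomorphic_on ball 0 R'" and R: "R < R'" "5 * \<rho> \<le> R" "0 < \<rho>"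
    and S: "\<And>z. z \<in> cball 0 R \<Longrightarrow> norm (f z) \<le> S"
    and I: "- \<rho> \<le> a" "0 < l" "a + l \<le> \<rho>" and eps: "\<And>x. a \<le> x \<Longrightarrow> x \<le> a + l \<Longrightarrow> norm (f (of_real x)) \<le> \<epsilon>"
    and k: "k \<ge> 1" and z: "z \<in> cball 0 \<rho>"
  shows "norm (f z) \<le> S / 2 ^ k + 2 * \<epsilon> * (12 * R / l) ^ k"
proof -
  define x where "x i = a + l * real i / real k" for i
  have xI: "a \<le> x i" "x i \<le> a + l" if "i < k" for i
  proof -
    show "a \<le> x i" using I by (simp add: x_def)
    have "l * real i / real k \<le> l * real k / real k" using that I by (intro divide_right_mono mult_left_mono) auto
    then show "x i \<le> a + l" using k by (simp add: x_def)
  qed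
  have xr: "\<bar>x i\<bar> \<le> \<rho>" if "i < k" for i using xI[OF that] I by auto
  have xd: "x i - x j = l / real k * (real i - real j)" for i j by (simp add: x_def algebra_simps diff_divide_distrib)
  define c where "c = (\<lambda>i. complex_of_real (x i))"
  have injc: "inj_on c {..<k}"
    by (rule inj_onI) (use I k in \<open>simp add: c_def x_def\<close>)
  define L where "L i w = (\<Prod>j\<in>{..<k} - {i}. (w - c j) / (c i - c j))" for i w
  define p where "p w = (\<Sum>i<k. f (c i) * L i w)" for w
  have e0: "\<epsilon> \<ge> 0" using order_trans[OF norm_ge_zero eps[of a]] I by simp
  have S0: "S \<ge> 0" using order_trans[OF norm_ge_zero S[of 0]] R by simp
  \<comment> \<open>Each numerator has modulus at most 2 R, and distances of nodes are multiples of
    the spacing l / k.\<close>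
  have Lb: "norm (L i w) \<le> (2 * R * real k / l) ^ (k - 1) / (fact i * fact (k - 1 - i))" if i: "i < k" and w: "norm w \<le> R" for i w
  proof -
    have card: "card ({..<k} - {i}) = k - 1" using i by simp
    have "norm (L i w) = (\<Prod>j\<in>{..<k} - {i}. norm (w - c j) / (l / real k * \<bar>real i - real j\<bar>))"
      unfolding L_def prod_norm[symmetric]
    proof (rule prod.cong[OF refl])
      fix j
      have "norm (c i - c j) = \<bar>x i - x j\<bar>" by (simp add: c_def flip: of_real_diff)
      also have "\<dots> = l / real k * \<bar>real i - real j\<bar>" unfolding xd using I by (simp add: abs_mult)
      finally show "norm ((w - c j) / (c i - c j)) = norm (w - c j) / (l / real k * \<bar>real i - real j\<bar>)"
        by (simp add: norm_divide)
    qed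
    also have "\<dots> \<le> (\<Prod>j\<in>{..<k} - {i}. (2 * R * real k / l) / \<bar>real i - real j\<bar>)"
    proof (rule prod_mono)
      fix j assume j: "j \<in> {..<k} - {i}"
      have "norm (w - c j) \<le> R + \<rho>" using w xr[of j] j norm_triangle_ineq4[of w "c j"] by (auto simp: c_def)
      then have n: "norm (w - c j) \<le> 2 * R" using R by simp
      have "norm (w - c j) / (l / real k * \<bar>real i - real j\<bar>) \<le> 2 * R / (l / real k * \<bar>real i - real j\<bar>)"
        using n I k by (intro divide_right_mono) auto
      also have "\<dots> = (2 * R * real k / l) / \<bar>real i - real j\<bar>" using I by (simp add: field_simps)
      finally show "0 \<le> norm (w - c j) / (l / real k * \<bar>real i - real j\<bar>) \<and>
        norm (w - c j) / (l / real k * \<bar>real i - real j\<bar>) \<le> (2 * R * real k / l) / \<bar>real i - real j\<bar>"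
        using I by simp
    qed
    also have "\<dots> = (2 * R * real k / l) ^ (k - 1) / (fact i * fact (k - 1 - i))"
      unfolding prod_dividef prod_abs_diff_nat[OF i] prod_constant card power_divide ..
    finally show ?thesis .
  qed
  have pb: "norm (p w) \<le> \<epsilon> * (12 * R / l) ^ k" if w: "norm w \<le> R" for w
  proof -
    let ?B = "2 * R * real k / l"
    have B0: "?B \<ge> 0" using R I by simp
    have "norm (p w) \<le> (\<Sum>i<k. norm (f (c i) * L i w))" unfolding p_def by (rule norm_sum)
    also have "\<dots> \<le> (\<Sum>i<k. \<epsilon> * (?B ^ (k - 1) / (fact i * fact (k - 1 - i))))"
    proof (rule sum_mono)
      fix i assume "i \<in> {..<k}"
      then have i: "i < k" by simp
      have "norm (f (c i)) \<le> \<epsilon>" unfolding c_def by (rule eps) (use xI[OF i] in auto)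
      then show "norm (f (c i) * L i w) \<le> \<epsilon> * (?B ^ (k - 1) / (fact i * fact (k - 1 - i)))"
        unfolding norm_mult using Lb[OF i w] e0 by (intro mult_mono) auto
    qed
    also have "\<dots> = \<epsilon> * ?B ^ (k - 1) * (\<Sum>i<k. 1 / (fact i * fact (k - 1 - i)))"
      by (simp add: sum_distrib_left divide_inverse mult.assoc)
    also have "(\<Sum>i<k. 1 / (fact i * fact (k - 1 - i))) = (2 ^ (k - 1) / fact (k - 1) :: real)"
    proof -
      have "(\<Sum>i<k. 1 / (fact i * fact (k - 1 - i))) = (\<Sum>i\<le>k - 1. real ((k - 1) choose i) / fact (k - 1))"
        using k by (intro sum.cong) (auto simp: binomial_fact)
      also have "\<dots> = real (\<Sum>i\<le>k - 1. (k - 1) choose i) / fact (k - 1)"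
        by (simp add: sum_divide_distrib)
      finally show ?thesis by (simp add: choose_row_sum)
    qed
    also have "\<epsilon> * ?B ^ (k - 1) * (2 ^ (k - 1) / fact (k - 1)) \<le> \<epsilon> * (12 * R / l) ^ k"
    proof -
      obtain m where m: "k = Suc m" using k by (cases k) auto
      \<comment> \<open>k^(k - 1) / (k - 1)! equals k^k / k!, which is at most 3^k. This 3, the 2 R
        of the numerators and the 2 of the binomial sum make up the base 12 R / l.\<close>
      have "real k ^ m * real k \<le> 3 ^ k * (fact m * real k)"
        using power_self_le_fact[of k] by (simp add: m algebra_simps)
      then have kk: "real k ^ m / fact m \<le> 3 ^ k" using k by (simp add: field_simps)
      have "?B ^ (k - 1) * (2 ^ (k - 1) / fact (k - 1)) = (4 * R / l) ^ m * (real k ^ m / fact m)"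
      proof -
        have "?B ^ m * 2 ^ m = (?B * 2) ^ m" by (rule power_mult_distrib[symmetric])
        also have "?B * 2 = 4 * R / l * real k" by simp
        also have "(4 * R / l * real k) ^ m = (4 * R / l) ^ m * real k ^ m" by (rule power_mult_distrib)
        finally have "?B ^ m * 2 ^ m = (4 * R / l) ^ m * real k ^ m" .
        then show ?thesis by (simp only: m diff_Suc_1 times_divide_eq_right)
      qed
      also have "\<dots> \<le> (4 * R / l) ^ m * 3 ^ k" using R I by (intro mult_left_mono kk) auto
      also have "\<dots> \<le> (4 * R / l) ^ k * 3 ^ k"
      proof -
        have "1 \<le> 4 * R / l" using R I by (simp add: field_simps)
        then show ?thesis by (intro mult_right_mono power_increasing) (auto simp: m)
      qed
      also have "\<dots> = (4 * R / l * 3) ^ k" by (rule power_mult_distrib[symmetric])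
      also have "4 * R / l * 3 = 12 * R / l" by simp
      finally have "?B ^ (k - 1) * (2 ^ (k - 1) / fact (k - 1)) \<le> (12 * R / l) ^ k" .
      from mult_left_mono[OF this e0] show ?thesis by (simp only: mult.assoc)
    qed
    finally show ?thesis .
  qed
  have hol: "(\<lambda>w. f w - p w) holomorphic_on ball 0 R'"
    unfolding p_def L_def using injc
    by (intro holomorphic_intros f) (auto dest: inj_onD)
  have vanish: "f w - p w = 0" if "w \<in> c ` {..<k}" for w
  proof -
    obtain i where i: "i < k" "w = c i" using \<open>w \<in> c ` {..<k}\<close> by auto
    have Lj: "L j (c i) = (if j = i then 1 else 0)" if "j < k" for j
    proof (cases "j = i")
      case True
      have "L i (c i) = (\<Prod>j\<in>{..<k} - {i}. 1)"
        unfolding L_def by (rule prod.cong) (use injc i in \<open>auto dest: inj_onD\<close>)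
      then show ?thesis using True by simp
    next
      case False
      then have "L j (c i) = 0" unfolding L_def by (intro prod_zero) (use i in auto)
      then show ?thesis using False by simp
    qed
    have "p (c i) = (\<Sum>j<k. if j = i then f (c i) else 0)"
      unfolding p_def by (rule sum.cong) (auto simp: Lj)
    then show ?thesis using i by simp
  qed
  \<comment> \<open>The difference vanishes at the k nodes and gains 2^(- k). The interpolation
    polynomial is estimated directly, and its second contribution explains the factor 2 in front of
    \<epsilon>.\<close>
  have "norm (f z - p z) \<le> (S + \<epsilon> * (12 * R / l) ^ k) / 2 ^ card (c ` {..<k})"
  proof (rule holomorphic_bound_of_zeros[OF hol R _ _ _ vanish z])
    show "norm (f w - p w) \<le> S + \<epsilon> * (12 * R / l) ^ k" if "w \<in> cball 0 R" for w
      using norm_triangle_ineq4[of "f w" "p w"] S[OF that] pb[of w] that by simp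
    show "c ` {..<k} \<subseteq> cball 0 \<rho>" using xr by (auto simp: c_def)
  qed auto
  also have "card (c ` {..<k}) = k" using card_image[OF injc] by simp
  finally have "norm (f z - p z) \<le> S / 2 ^ k + \<epsilon> * (12 * R / l) ^ k / 2 ^ k" by (simp add: add_divide_distrib)
  also have "\<epsilon> * (12 * R / l) ^ k / 2 ^ k \<le> \<epsilon> * (12 * R / l) ^ k / 1"
    using e0 R I by (intro divide_left_mono) auto
  finally have "norm (f z - p z) \<le> S / 2 ^ k + \<epsilon> * (12 * R / l) ^ k" by simp
  moreover have "norm (p z) \<le> \<epsilon> * (12 * R / l) ^ k" using z R by (intro pb) auto
  moreover have "norm (f z) \<le> norm (f z - p z) + norm (p z)" using norm_triangle_ineq[of "f z - p z" "p z"] by simp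
  ultimately show ?thesis by simp
qed

text \<open>Since n^n \<le> 3^n n!, the Taylor coefficients at 0 are at most M (3 B)^n, so the
  series converges on the disc of radius \<open>R\<close>; the same bound on the Lagrange remainder
  shows that it represents the function. On half the disc the geometric series sums to at most
  2.\<close>

lemma real_taylor_holomorphic:
  fixes f :: "nat \<Rightarrow> real \<Rightarrow> real"
  assumes der: "\<And>k t. \<bar>t\<bar> < R \<Longrightarrow> (f k has_real_derivative f (Suc k) t) (at t)"
    and bd: "\<And>k t. \<bar>t\<bar> < R \<Longrightarrow> \<bar>f k t\<bar> \<le> (B * real k) ^ k * M"
    and R: "R > 0" "B \<ge> 0" "3 * B * R \<le> 1"
  shows "\<exists>F. F holomorphic_on ball 0 R \<and> (\<forall>t. \<bar>t\<bar> < R \<longrightarrow> F (of_real t) = of_real (f 0 t)) \<and>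
    (\<forall>z\<in>ball 0 (R / 2). norm (F z) \<le> 2 * M)"
proof -
  define a where "a n = f n 0 / fact n" for n
  have M: "M \<ge> 0" using bd[of 0 0] R(1) by simp
  have tb: "\<bar>f n t / fact n\<bar> \<le> (3 * B) ^ n * M" if "\<bar>t\<bar> < R" for n t
  proof -
    have "\<bar>f n t / fact n\<bar> \<le> (B * real n) ^ n * M / fact n"
      using bd[OF that, of n] by (simp add: divide_right_mono)
    also have "\<dots> = B ^ n * M * (real n ^ n / fact n)" by (simp add: power_mult_distrib)
    also have "\<dots> \<le> B ^ n * M * 3 ^ n"
      using power_self_le_fact[of n] R(2) M by (intro mult_left_mono) (auto simp: field_simps)
    finally show ?thesis by (simp add: power_mult_distrib mult_ac)
  qed
  have geo: "3 * B * x < 1" "0 \<le> 3 * B * x" if "0 \<le> x" "x < R" for x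
  proof -
    show "3 * B * x < 1"
    proof (cases "B = 0")
      case False
      then have "3 * B * x < 3 * B * R" using R(2) that by simp
      then show ?thesis using R(3) by simp
    qed simp
  qed (use R(2) that in auto)
  have ab: "norm (complex_of_real (a n) * z ^ n) \<le> M * (3 * B * norm z) ^ n" for n z
  proof -
    have "norm (complex_of_real (a n) * z ^ n) = \<bar>a n\<bar> * norm z ^ n" by (simp add: norm_mult norm_power)
    also have "\<dots> \<le> ((3 * B) ^ n * M) * norm z ^ n"
      unfolding a_def using tb[of 0 n] R(1) by (intro mult_right_mono) auto
    finally show ?thesis by (simp add: power_mult_distrib mult_ac)
  qed
  define F where "F z = (\<Sum>n. complex_of_real (a n) * z ^ n)" for z
  have gs: "summable (\<lambda>n. M * (3 * B * norm z) ^ n)" if "norm z < R" for z :: complex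
    using geo[of "norm z"] that by (intro summable_mult summable_geometric) auto
  have nsum: "summable (\<lambda>n. norm (complex_of_real (a n) * z ^ n))" if "norm z < R" for z
    by (rule summable_comparison_test'[OF gs[OF that]]) (use ab in auto)
  have sum: "(\<lambda>n. complex_of_real (a n) * z ^ n) sums F z" if "norm z < R" for z
    unfolding F_def using summable_norm_cancel[OF nsum[OF that]] by (rule summable_sums)
  have "F holomorphic_on ball 0 R"
    by (rule power_series_holomorphic[of 0 R "\<lambda>n. complex_of_real (a n)"]) (use sum in auto)
  moreover have "F (of_real t) = of_real (f 0 t)" if t: "\<bar>t\<bar> < R" for t
  proof -
    have "(\<lambda>n. \<Sum>k<n. a k * t ^ k) \<longlonglongrightarrow> f 0 t"
    proof -
      have rem: "\<bar>f 0 t - (\<Sum>k<n. a k * t ^ k)\<bar> \<le> M * (3 * B * \<bar>t\<bar>) ^ n" for n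
      proof -
        have "\<exists>s. \<bar>s\<bar> \<le> \<bar>t\<bar> \<and> f 0 t = (\<Sum>m<n. f m 0 / fact m * t ^ m) + f n s / fact n * t ^ n"
          by (rule Maclaurin_bi_le) (use der t in auto)
        then obtain s where s: "\<bar>s\<bar> \<le> \<bar>t\<bar>" "f 0 t = (\<Sum>m<n. f m 0 / fact m * t ^ m) + f n s / fact n * t ^ n" by blast
        have "\<bar>f 0 t - (\<Sum>k<n. a k * t ^ k)\<bar> = \<bar>f n s / fact n\<bar> * \<bar>t\<bar> ^ n"
          using s(2) by (simp add: a_def abs_mult power_abs)
        also have "\<dots> \<le> ((3 * B) ^ n * M) * \<bar>t\<bar> ^ n"
          using tb[of s n] s(1) t by (intro mult_right_mono) auto
        finally show ?thesis by (simp add: power_mult_distrib mult_ac)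
      qed
      have "(\<lambda>n. M * (3 * B * \<bar>t\<bar>) ^ n) \<longlonglongrightarrow> M * 0"
        using geo[of "\<bar>t\<bar>"] t by (intro tendsto_mult_left LIMSEQ_realpow_zero) auto
      then have lim: "(\<lambda>n. M * (3 * B * \<bar>t\<bar>) ^ n) \<longlonglongrightarrow> 0" by simp
      have "(\<lambda>n. f 0 t - (\<Sum>k<n. a k * t ^ k)) \<longlonglongrightarrow> 0"
      proof (rule Lim_null_comparison[OF _ lim])
        show "\<forall>\<^sub>F n in sequentially. norm (f 0 t - (\<Sum>k<n. a k * t ^ k)) \<le> M * (3 * B * \<bar>t\<bar>) ^ n"
          unfolding real_norm_def by (intro always_eventually allI rem)
      qed
      from tendsto_diff[OF tendsto_const[of "f 0 t"] this] show ?thesis by simp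
    qed
    then have "(\<lambda>n. a n * t ^ n) sums f 0 t" by (simp add: sums_def)
    then have 1: "(\<lambda>n. complex_of_real (a n * t ^ n)) sums of_real (f 0 t)" by (rule sums_of_real)
    have 2: "(\<lambda>n. complex_of_real (a n * t ^ n)) sums F (of_real t)" using sum[of "of_real t"] t by simp
    show ?thesis by (rule sums_unique2[OF 2 1])
  qed
  moreover have "norm (F z) \<le> 2 * M" if z: "z \<in> ball 0 (R / 2)" for z
  proof -
    have zR: "norm z < R" using z R by simp
    have "norm (F z) \<le> (\<Sum>n. norm (complex_of_real (a n) * z ^ n))"
      unfolding F_def by (rule summable_norm[OF nsum[OF zR]])
    also have "\<dots> \<le> (\<Sum>n. M * (3 * B * norm z) ^ n)"
      by (rule suminf_le[OF ab nsum[OF zR] gs[OF zR]])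
    also have "\<dots> = M * (1 / (1 - 3 * B * norm z))"
    proof -
      have g: "norm (3 * B * norm z) < 1" using geo[of "norm z"] zR by auto
      show ?thesis unfolding suminf_mult[OF summable_geometric[OF g]] suminf_geometric[OF g] ..
    qed
    also have "\<dots> \<le> M * 2"
    proof -
      have "3 * B * (2 * norm z) < 1" using geo[of "2 * norm z"] z by auto
      then show ?thesis using M by (intro mult_left_mono) (auto simp: field_simps)
    qed
    finally show ?thesis by simp
  qed
  ultimately show ?thesis by blast
qed

section \<open>Measure of zero sets of real analytic functions\<close>

text \<open>Both points are close to p - s e_j, so rays from \<open>p\<close> are nearly parallel to
  axis \<open>j\<close>, while the approximate normal \<open>G\<close> has a large component
  \<open>j\<close>. Points of one level set seen from \<open>p\<close> in nearby directions must
  then be close. The tolerance 1 / (8 n) stays below the transversality, which is of order 1 / sqrt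
  n.\<close>

lemma central_proj_bilipschitz:
  fixes G p x x' :: "real^'n"
  assumes s: "s > 0"
    and x: "norm (x - p + s *\<^sub>R axis j 1) \<le> s / (8 * real CARD('n))"
    and x': "norm (x' - p + s *\<^sub>R axis j 1) \<le> s / (8 * real CARD('n))"
    and G: "G \<noteq> 0" "norm G \<le> sqrt (real CARD('n)) * \<bar>G $ j\<bar>"
    and Gx: "\<bar>G \<bullet> (x - x')\<bar> \<le> 1 / (8 * real CARD('n)) * norm G * norm (x - x')"
  shows "dist x x' \<le> 20 * real CARD('n) * s * dist (central_proj j p x) (central_proj j p x')"
proof -
  define n where "n = real CARD('n)"
  define q where "q = sqrt n"
  have n: "n \<ge> 1" by (simp add: n_def)
  have q: "1 \<le> q" "q * q = n" "q > 0" using n by (auto simp: q_def)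
  have qn: "q \<le> n" using q mult_left_mono[of 1 q q] by simp
  define a where "a = x - p"
  define b where "b = x' - p"
  have th: "s / (8 * n) \<le> s / 8" using s n by (intro divide_left_mono) auto
  have comp: "\<bar>c $ j + s\<bar> \<le> s / (8 * n)" if "norm (c + s *\<^sub>R axis j 1) \<le> s / (8 * n)" for c :: "real^'n"
    using component_le_norm_cart[of "c + s *\<^sub>R axis j 1" j] that by (simp add: axis_def)
  have na: "norm (a + s *\<^sub>R axis j 1) \<le> s / (8 * n)" and nb: "norm (b + s *\<^sub>R axis j 1) \<le> s / (8 * n)"
    using x x' by (auto simp: a_def b_def n_def)
  have aj: "\<bar>a $ j\<bar> \<le> 9 / 8 * s" "a $ j \<noteq> 0" using comp[OF na] th s by linarith+
  have bj: "\<bar>b $ j\<bar> \<ge> 7 / 8 * s" "b $ j \<noteq> 0" using comp[OF nb] th s by linarith+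
  define \<beta> where "\<beta> = central_proj j p x'"
  define \<Delta> where "\<Delta> = central_proj j p x - \<beta>"
  have a_eq: "a = a $ j *\<^sub>R central_proj j p x" using aj(2) by (simp add: central_proj_def a_def)
  have b_eq: "b = b $ j *\<^sub>R \<beta>" using bj(2) by (simp add: central_proj_def b_def \<beta>_def)
  \<comment> \<open>A displacement along the ray plus one across it. The second is controlled by the
    distance of the projections, the first has to be bounded through \<open>G\<close>.\<close>
  have diff: "x - x' = (x - x') $ j *\<^sub>R \<beta> + a $ j *\<^sub>R \<Delta>"
  proof -
    have "x - x' = a - b" by (simp add: a_def b_def)
    also have "\<dots> = a $ j *\<^sub>R central_proj j p x - b $ j *\<^sub>R \<beta>" using a_eq b_eq by simp
    also have "\<dots> = (a $ j - b $ j) *\<^sub>R \<beta> + a $ j *\<^sub>R \<Delta>" by (simp add: \<Delta>_def algebra_simps)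
    also have "a $ j - b $ j = (x - x') $ j" by (simp add: a_def b_def)
    finally show ?thesis .
  qed
  have \<beta>e: "norm (\<beta> - axis j 1) \<le> 1 / (2 * n)"
  proof -
    have "b $ j *\<^sub>R (\<beta> - axis j 1) = (b + s *\<^sub>R axis j 1) - (b $ j + s) *\<^sub>R axis j 1"
      using b_eq by (simp add: algebra_simps)
    then have "\<bar>b $ j\<bar> * norm (\<beta> - axis j 1) = norm ((b + s *\<^sub>R axis j 1) - (b $ j + s) *\<^sub>R axis j 1)"
      by (metis norm_scaleR)
    also have "\<dots> \<le> s / (8 * n) + s / (8 * n)"
      using norm_triangle_ineq4[of "b + s *\<^sub>R axis j 1" "(b $ j + s) *\<^sub>R axis j 1"] nb comp[OF nb]
      by (simp add: norm_axis_1)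
    finally have "\<bar>b $ j\<bar> * norm (\<beta> - axis j 1) \<le> s / (4 * n)" by simp
    moreover have "7 / 8 * s * norm (\<beta> - axis j 1) \<le> \<bar>b $ j\<bar> * norm (\<beta> - axis j 1)"
      using bj(1) by (intro mult_right_mono) auto
    ultimately have "7 / 8 * s * norm (\<beta> - axis j 1) \<le> s / (4 * n)" by linarith
    then have "norm (\<beta> - axis j 1) \<le> 2 / (7 * n)" using s n by (simp add: field_simps)
    also have "\<dots> \<le> 1 / (2 * n)" using n by (simp add: field_simps)
    finally show ?thesis .
  qed
  have \<beta>n: "norm \<beta> \<le> 3 / 2"
  proof -
    have "norm \<beta> \<le> norm (\<beta> - axis j 1) + norm (axis j (1::real) :: real^'n)" using norm_triangle_ineq[of "\<beta> - axis j 1" "axis j 1"] by simp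
    moreover have "1 / (2 * n) \<le> 1 / 2" using n by (intro divide_left_mono) auto
    ultimately show ?thesis using \<beta>e by (simp add: norm_axis_1)
  qed
  define g where "g = norm G"
  have g: "g > 0" using G by (simp add: g_def)
  \<comment> \<open>Transversality of the ray: \<open>\<beta>\<close> differs from the axis by at
    most 1 / (2 n), which costs at most half of the lower bound g / q for component \<open>j\<close>
    of \<open>G\<close>.\<close>
  have G\<beta>: "g / (2 * q) \<le> \<bar>G \<bullet> \<beta>\<bar>"
  proof -
    have "G \<bullet> \<beta> = G $ j + G \<bullet> (\<beta> - axis j 1)" by (simp add: inner_diff_right inner_axis)
    moreover have "\<bar>G \<bullet> (\<beta> - axis j 1)\<bar> \<le> g * (1 / (2 * n))"
      unfolding g_def by (rule order_trans[OF Cauchy_Schwarz_ineq2]) (intro mult_left_mono \<beta>e, simp)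
    moreover have "g / q \<le> \<bar>G $ j\<bar>" using G(2) q(3) by (simp add: g_def q_def n_def field_simps)
    moreover have "g * (1 / (2 * n)) \<le> g / (2 * q)" using g qn q(3) by (simp add: frac_le)
    moreover have "g / q = g / (2 * q) + g / (2 * q)" by simp
    ultimately show ?thesis by linarith
  qed
  define D where "D = norm \<Delta>"
  define d where "d = norm (x - x')"
  define c where "c = \<bar>(x - x') $ j\<bar>"
  have "G \<bullet> (x - x') = (x - x') $ j * (G \<bullet> \<beta>) + a $ j * (G \<bullet> \<Delta>)"
    by (subst diff) (simp add: inner_add_right)
  then have "c * \<bar>G \<bullet> \<beta>\<bar> \<le> \<bar>G \<bullet> (x - x')\<bar> + \<bar>a $ j\<bar> * \<bar>G \<bullet> \<Delta>\<bar>"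
    unfolding c_def abs_mult[symmetric] by linarith
  moreover have "c * (g / (2 * q)) \<le> c * \<bar>G \<bullet> \<beta>\<bar>" by (intro mult_left_mono G\<beta>) (simp add: c_def)
  moreover have "\<bar>a $ j\<bar> * \<bar>G \<bullet> \<Delta>\<bar> \<le> (9 / 8 * s) * (g * D)"
    unfolding g_def D_def by (intro mult_mono aj Cauchy_Schwarz_ineq2) (use s in auto)
  moreover have "\<bar>G \<bullet> (x - x')\<bar> \<le> 1 / (8 * n) * g * d" using Gx by (simp add: n_def g_def d_def)
  ultimately have "c * (g / (2 * q)) \<le> 1 / (8 * n) * g * d + (9 / 8 * s) * (g * D)" by linarith
  then have "g * (c / (2 * q)) \<le> g * (d / (8 * n) + 9 / 8 * s * D)" by (simp add: algebra_simps)
  then have "c / (2 * q) \<le> d / (8 * n) + 9 / 8 * s * D" by (rule mult_left_le_imp_le[OF _ g])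
  then have "c \<le> 2 * q * (d / (8 * n) + 9 / 8 * s * D)" using q(3) by (simp add: divide_le_eq mult.commute)
  also have "\<dots> \<le> 2 * n * (d / (8 * n) + 9 / 8 * s * D)"
    using qn n s by (intro mult_right_mono) (auto simp: d_def D_def)
  also have "\<dots> = d / 4 + 9 / 4 * n * s * D" using n by (simp add: field_simps)
  finally have c: "c \<le> d / 4 + 9 / 4 * n * s * D" .
  have "d \<le> c * norm \<beta> + \<bar>a $ j\<bar> * D"
    unfolding d_def c_def D_def by (subst (1) diff) (rule order_trans[OF norm_triangle_ineq], simp)
  also have "\<dots> \<le> c * (3 / 2) + (9 / 8 * s) * D"
    by (intro add_mono mult_left_mono mult_right_mono \<beta>n aj) (auto simp: c_def D_def)
  finally have d: "d \<le> 3 / 2 * c + 9 / 8 * (s * D)" by simp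
  define X where "X = n * s * D"
  have sD: "0 \<le> s * D" using s by (simp add: D_def)
  have X: "s * D \<le> X" using mult_right_mono[OF n sD] by (simp add: X_def mult.assoc)
  \<comment> \<open>The coefficient 1/4 is small enough for \<open>d\<close> to be absorbed when
    this is inserted into the bound for \<open>d\<close>.\<close>
  have "c \<le> d / 4 + 9 / 4 * X" using c by (simp add: X_def mult.assoc)
  with d X sD have "d \<le> 20 * X" by linarith
  then have "d \<le> 20 * (n * s * D)" by (simp only: X_def)
  then show ?thesis by (simp add: d_def D_def \<Delta>_def \<beta>_def dist_norm n_def mult_ac)
qed

lemma ex_component_ge_norm:
  fixes G :: "real^'n"
  shows "\<exists>j. norm G \<le> sqrt (real CARD('n)) * \<bar>G $ j\<bar>"
proof -
  define c where "c = Max (range (\<lambda>j. \<bar>G $ j\<bar>))"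
  have fin: "finite (range (\<lambda>j. \<bar>G $ j\<bar>))" by simp
  then have "c \<in> range (\<lambda>j. \<bar>G $ j\<bar>)" unfolding c_def by (rule Max_in) simp
  then obtain j where j: "c = \<bar>G $ j\<bar>" by (rule rangeE)
  have "norm G \<le> sqrt (real CARD('n)) * c"
  proof (rule norm_le_sqrt_card_mult)
    show "\<bar>G $ i\<bar> \<le> c" for i unfolding c_def by (rule Max_ge[OF fin]) simp
    show "c \<ge> 0" using j by simp
  qed
  then show ?thesis using j by auto
qed

text \<open>
  Stratify the zero set by vanishing order: a zero of order \<open>k + 1\<close> lies on a level set, with nonzero
  gradient, of a derivative of order \<open>k\<close> that vanishes on the whole stratum.
\<close>

lemma hausdorff_zero_set_le:
  fixes U :: "real^'n \<Rightarrow> real" and p :: "'n \<Rightarrow> real^'n"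
  assumes U: "real_analytic_on B U" "open B" "cball x0 \<rho> \<subseteq> B" and s: "s > 0"
    and p: "\<And>j x. x \<in> cball x0 \<rho> \<Longrightarrow> norm (x - p j + s *\<^sub>R axis j 1) \<le> s / (8 * real CARD('n))"
    and nz: "\<And>z. z \<in> cball x0 \<rho> \<Longrightarrow> \<exists>is. iterated_partial is U z \<noteq> 0"
    and mult: "\<And>j v. v $ j = 1 \<Longrightarrow> finite {t. p j + t *\<^sub>R v \<in> {x \<in> cball x0 \<rho>. U x = 0}} \<and>
      card {t. p j + t *\<^sub>R v \<in> {x \<in> cball x0 \<rho>. U x = 0}} \<le> M"
  shows "hausdorff (CARD('n) - 1) {x \<in> cball x0 \<rho>. U x = 0} \<le>
    of_nat CARD('n) * ennreal ((20 * real CARD('n) * s) ^ (CARD('n) - 1) * crofton_const TYPE('n) * (2 ^ CARD('n) * real M))"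
proof -
  define Z where "Z = {x \<in> cball x0 \<rho>. U x = 0}"
  define L where "L = 20 * real CARD('n) * s"
  have L: "L > 0" using s by (simp add: L_def)
  \<comment> \<open>Points where all derivatives up to order \<open>k\<close> vanish. These are
    closed conditions, which makes the pieces below compact.\<close>
  define van where "van k = {x \<in> cball x0 \<rho>. \<forall>is. length is \<le> k \<longrightarrow> iterated_partial is U x = 0}" for k
  have ana: "real_analytic_on B (iterated_partial is U)" for "is" by (rule real_analytic_on_iterated_partial[OF U(1)])
  have clv: "closed (van k)" for k
  proof -
    have "closed {x \<in> cball x0 \<rho>. iterated_partial is U x = 0}" for "is"
      using real_analytic_on_continuous_on[OF ana] U(3)
      by (intro continuous_closed_preimage_constant) (auto intro: continuous_on_subset)
    then have "closed (cball x0 \<rho> \<inter> (\<Inter>is\<in>{is. length is \<le> k}. {x \<in> cball x0 \<rho>. iterated_partial is U x = 0}))"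
      by (intro closed_Int closed_INT) auto
    also have "cball x0 \<rho> \<inter> (\<Inter>is\<in>{is. length is \<le> k}. {x \<in> cball x0 \<rho>. iterated_partial is U x = 0}) = van k"
      by (auto simp: van_def)
    finally show ?thesis .
  qed
  have vZ: "van k \<subseteq> Z" for k
  proof
    fix x assume x: "x \<in> van k"
    then have "iterated_partial [] U x = 0" unfolding van_def by (metis (mono_tags, lifting) list.size(3) mem_Collect_eq zero_le)
    then show "x \<in> Z" using x by (simp add: van_def Z_def)
  qed
  define good where "good j = {C. compact C \<and> C \<subseteq> Z \<and>
    (\<forall>x\<in>C. \<forall>y\<in>C. dist x y \<le> L * dist (central_proj j (p j) x) (central_proj j (p j) y))}" for j
  define Y where "Y is j = {z \<in> van (length is). gradient (iterated_partial is U) z \<noteq> 0 \<and>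
    norm (gradient (iterated_partial is U) z) \<le> sqrt (real CARD('n)) * \<bar>gradient (iterated_partial is U) z $ j\<bar>}" for "is" j
  \<comment> \<open>Two points of the stratum near \<open>z\<close> are both zeros of
    \<open>\<phi>\<close>, so the strict derivative makes \<open>G \<bullet> (x - y)\<close> small
    compared with the distance, as \<open>central_proj_bilipschitz\<close> asks.\<close>
  have local: "\<exists>\<delta>>0. van (length is) \<inter> cball z \<delta> \<in> good j" if z: "z \<in> Y is j" for "is" j z
  proof -
    define \<phi> where "\<phi> = iterated_partial is U"
    define G where "G = gradient \<phi> z"
    have G: "G \<noteq> 0" "norm G \<le> sqrt (real CARD('n)) * \<bar>G $ j\<bar>" using z by (auto simp: Y_def G_def \<phi>_def)
    have zB: "z \<in> B" using z U(3) by (auto simp: Y_def van_def)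
    define \<tau> where "\<tau> = 1 / (8 * real CARD('n)) * norm G"
    have \<tau>: "\<tau> > 0" using G by (simp add: \<tau>_def)
    obtain \<delta> where \<delta>: "\<delta> > 0" "\<And>y y'. y \<in> ball z \<delta> \<Longrightarrow> y' \<in> ball z \<delta> \<Longrightarrow>
        \<bar>\<phi> y - \<phi> y' - (\<Sum>i\<in>UNIV. (y $ i - y' $ i) * partial_deriv i \<phi> z)\<bar> \<le> \<tau> * norm (y - y')"
      using real_analytic_on_strict_derivative[OF ana U(2) zB \<tau>] unfolding \<phi>_def by blast
    have "van (length is) \<inter> cball z (\<delta> / 2) \<in> good j"
    proof -
      have "compact (van (length is) \<inter> cball z (\<delta> / 2))" using clv by (intro closed_Int_compact) auto
      moreover have "dist x y \<le> L * dist (central_proj j (p j) x) (central_proj j (p j) y)"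
        if xy: "x \<in> van (length is) \<inter> cball z (\<delta> / 2)" "y \<in> van (length is) \<inter> cball z (\<delta> / 2)" for x y
        unfolding L_def
      proof (rule central_proj_bilipschitz[OF s p p G])
        show "x \<in> cball x0 \<rho>" "y \<in> cball x0 \<rho>" using xy by (auto simp: van_def)
        have \<phi>0: "\<phi> x = 0" "\<phi> y = 0" using xy by (auto simp: van_def \<phi>_def)
        have "G \<bullet> (x - y) = (\<Sum>i\<in>UNIV. (x $ i - y $ i) * partial_deriv i \<phi> z)"
          by (simp add: G_def gradient_def inner_vec_def mult.commute)
        then have "\<bar>G \<bullet> (x - y)\<bar> \<le> \<tau> * norm (x - y)" using \<delta>(2)[of x y] xy \<delta>(1) \<phi>0 by simp
        then show "\<bar>G \<bullet> (x - y)\<bar> \<le> 1 / (8 * real CARD('n)) * norm G * norm (x - y)" by (simp add: \<tau>_def)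
      qed
      ultimately show ?thesis using vZ unfolding good_def by blast
    qed
    then show ?thesis using \<delta>(1) by (intro exI[of _ "\<delta> / 2"]) auto
  qed
  have exW: "\<exists>\<W>. countable \<W> \<and> \<W> \<subseteq> good j \<and> Y is j \<subseteq> \<Union>\<W>" for "is" j
  proof -
    have "\<forall>z\<in>Y is j. \<exists>\<delta>. \<delta> > 0 \<and> van (length is) \<inter> cball z \<delta> \<in> good j" using local by blast
    from bchoice[OF this] obtain \<delta> where \<delta>: "\<And>z. z \<in> Y is j \<Longrightarrow> \<delta> z > 0 \<and> van (length is) \<inter> cball z (\<delta> z) \<in> good j"
      by blast
    \<comment> \<open>By Lindelof, countably many of these balls cover the stratum; the projection
      lemma takes a sequence of compact pieces.\<close>
    obtain W where W: "W \<subseteq> (\<lambda>z. ball z (\<delta> z)) ` Y is j" "countable W" "\<Union>W = \<Union>((\<lambda>z. ball z (\<delta> z)) ` Y is j)"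
      using Lindelof[of "(\<lambda>z. ball z (\<delta> z)) ` Y is j"] by auto
    obtain Y' where Y': "countable Y'" "Y' \<subseteq> Y is j" "W = (\<lambda>z. ball z (\<delta> z)) ` Y'"
      using countable_subset_image[of W "\<lambda>z. ball z (\<delta> z)" "Y is j"] W(1,2) by auto
    show ?thesis
    proof (intro exI conjI)
      show "countable ((\<lambda>z. van (length is) \<inter> cball z (\<delta> z)) ` Y')" using Y'(1) by simp
      show "(\<lambda>z. van (length is) \<inter> cball z (\<delta> z)) ` Y' \<subseteq> good j" using \<delta> Y'(2) by blast
      show "Y is j \<subseteq> \<Union>((\<lambda>z. van (length is) \<inter> cball z (\<delta> z)) ` Y')"
      proof
        fix z assume z: "z \<in> Y is j"
        then have "z \<in> \<Union>W" using \<delta>[OF z] unfolding W(3) by force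
        then obtain y where "y \<in> Y'" "z \<in> ball y (\<delta> y)" unfolding Y'(3) by blast
        moreover have "z \<in> van (length is)" using z by (simp add: Y_def)
        ultimately show "z \<in> \<Union>((\<lambda>z. van (length is) \<inter> cball z (\<delta> z)) ` Y')"
          by (auto intro!: bexI[of _ y])
      qed
    qed
  qed
  define \<W> where "\<W> is j = (SOME \<W>. countable \<W> \<and> \<W> \<subseteq> good j \<and> Y is j \<subseteq> \<Union>\<W>)" for "is" j
  have \<W>: "countable (\<W> is j) \<and> \<W> is j \<subseteq> good j \<and> Y is j \<subseteq> \<Union>(\<W> is j)" for "is" j
    unfolding \<W>_def by (rule someI_ex[OF exW])
  define D where "D j = insert {} (\<Union>is. \<W> is j)" for j
  have emp: "{} \<in> good j" for j by (simp add: good_def)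
  have D: "countable (D j)" "D j \<noteq> {}" "D j \<subseteq> good j" for j
    using \<W> emp by (auto simp: D_def)
  have bound: "hausdorff (CARD('n) - 1) (\<Union>(D j)) \<le> ennreal (L ^ (CARD('n) - 1) * crofton_const TYPE('n) * (2 ^ CARD('n) * real M))" for j
  proof -
    define C where "C = from_nat_into (D j)"
    have rC: "range C = D j" unfolding C_def by (rule range_from_nat_into[OF D(2,1)])
    then have Cg: "C m \<in> good j" for m using D(3) by blast
    have eq: "\<Union>(D j) = (\<Union>m. C m)" using rC by metis
    show ?thesis unfolding eq
    proof (rule hausdorff_Union_le_central_proj[where Z = Z and p = "p j" and j = j])
      show "compact (C m)" "C m \<subseteq> Z" for m using Cg[of m] by (auto simp: good_def)
      show "dist x y \<le> L * dist (central_proj j (p j) x) (central_proj j (p j) y)" if "x \<in> C m" "y \<in> C m" for m x y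
        using Cg[of m] that by (auto simp: good_def)
      fix x assume "x \<in> Z"
      then have n: "norm (x - p j + s *\<^sub>R axis j 1) \<le> s / (8 * real CARD('n))" using p by (simp add: Z_def)
      also have "\<dots> \<le> s / 8" using s by (intro divide_left_mono) auto
      finally have n8: "norm (x - p j + s *\<^sub>R axis j 1) \<le> s / 8" .
      have cj: "\<bar>x $ j - p j $ j + s\<bar> \<le> s / 8"
        using component_le_norm_cart[of "x - p j + s *\<^sub>R axis j 1" j] n8 by (simp add: axis_def)
      then show "x $ j \<noteq> p j $ j" using s by auto
      fix i show "\<bar>x $ i - p j $ i\<bar> \<le> \<bar>x $ j - p j $ j\<bar>"
      proof (cases "i = j")
        case False
        have "\<bar>x $ i - p j $ i\<bar> \<le> s / 8"
          using component_le_norm_cart[of "x - p j + s *\<^sub>R axis j 1" i] n8 False by (simp add: axis_def)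
        then show ?thesis using cj s by linarith
      qed simp
    next
      fix v :: "real^'n" assume "v $ j = 1"
      then show "finite {t. p j + t *\<^sub>R v \<in> Z} \<and> card {t. p j + t *\<^sub>R v \<in> Z} \<le> M" unfolding Z_def by (rule mult)
    qed (rule L)
  qed
  have cover: "Z \<subseteq> (\<Union>j\<in>UNIV. \<Union>(D j))"
  proof
    fix z assume z: "z \<in> Z"
    then have zc: "z \<in> cball x0 \<rho>" by (simp add: Z_def)
    \<comment> \<open>The least order of a nonvanishing derivative; it is positive because U z = 0.
      Removing the outermost differentiation leaves a derivative that vanishes at \<open>z\<close>
      and has nonzero gradient there.\<close>
    define m where "m = (LEAST m. \<exists>is. length is = m \<and> iterated_partial is U z \<noteq> 0)"
    have ex: "\<exists>m is. length is = m \<and> iterated_partial is U z \<noteq> 0" using nz[OF zc] by blast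
    from LeastI_ex[OF ex] obtain "is" where "is": "length is = m" "iterated_partial is U z \<noteq> 0" unfolding m_def by blast
    have "is \<noteq> []" using "is"(2) z by (auto simp: Z_def)
    then obtain i js where ijs: "is = i # js" by (cases "is") auto
    have min: "iterated_partial ks U z = 0" if "length ks < m" for ks
      using not_less_Least[of "length ks" "\<lambda>m. \<exists>is. length is = m \<and> iterated_partial is U z \<noteq> 0"] that unfolding m_def by blast
    have "z \<in> van (length js)" using zc min "is"(1) ijs by (auto simp: van_def)
    moreover have "gradient (iterated_partial js U) z $ i \<noteq> 0" using "is"(2) ijs by (simp add: gradient_def)
    then have "gradient (iterated_partial js U) z \<noteq> 0" by auto
    moreover obtain j where "norm (gradient (iterated_partial js U) z) \<le> sqrt (real CARD('n)) * \<bar>gradient (iterated_partial js U) z $ j\<bar>"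
      using ex_component_ge_norm by blast
    ultimately have "z \<in> Y js j" by (simp add: Y_def)
    then show "z \<in> (\<Union>j\<in>UNIV. \<Union>(D j))" using \<W>[of js j] by (fastforce simp: D_def)
  qed
  have fin: "hausdorff d (\<Union>j\<in>J. A j) \<le> (\<Sum>j\<in>J. hausdorff d (A j))" if "finite J" for J :: "'n set" and A :: "'n \<Rightarrow> (real^'n) set" and d
    using that
  proof (induction J rule: finite_induct)
    case empty
    then show ?case by (simp add: hausdorff_empty)
  next
    case (insert j J)
    then show ?case using order_trans[OF hausdorff_Un add_left_mono] by simp
  qed
  have "hausdorff (CARD('n) - 1) Z \<le> hausdorff (CARD('n) - 1) (\<Union>j\<in>UNIV. \<Union>(D j))" by (rule hausdorff_mono[OF cover])
  also have "\<dots> \<le> (\<Sum>j\<in>UNIV. hausdorff (CARD('n) - 1) (\<Union>(D j)))" by (rule fin) simp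
  also have "\<dots> \<le> (\<Sum>j\<in>(UNIV::'n set). ennreal (L ^ (CARD('n) - 1) * crofton_const TYPE('n) * (2 ^ CARD('n) * real M)))"
    by (intro sum_mono bound)
  finally show ?thesis by (simp add: Z_def L_def)
qed

section \<open>Lifting to \<open>n + 1\<close> variables\<close>

lemma has_laplacian_onI:
  assumes "\<And>y. y \<in> S \<Longrightarrow> (F has_derivative F' y) (at y)"
    and "\<And>b y. b \<in> Basis \<Longrightarrow> y \<in> S \<Longrightarrow> ((\<lambda>y. F' y b) has_derivative F2 b y) (at y)"
    and "\<And>b. b \<in> Basis \<Longrightarrow> continuous_on S (\<lambda>y. F2 b y b)"
    and "\<And>y. y \<in> S \<Longrightarrow> L y = (\<Sum>b\<in>Basis. F2 b y b)"
  shows "has_laplacian_on F F' L S"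
  unfolding has_laplacian_on_def using assms by (intro conjI exI[of _ F2] ballI) simp_all

lemma has_laplacian_on_cong_laplacian:
  assumes "has_laplacian_on F F' L S" "\<And>y. y \<in> S \<Longrightarrow> L y = K y"
  shows "has_laplacian_on F F' K S"
proof -
  obtain F2 where F2: "\<forall>b\<in>Basis. \<forall>y\<in>S. ((\<lambda>y. F' y b) has_derivative F2 b y) (at y)"
    "\<forall>b\<in>Basis. continuous_on S (\<lambda>y. F2 b y b)" "\<forall>y\<in>S. L y = (\<Sum>b\<in>Basis. F2 b y b)"
    by (rule has_laplacian_onE[OF assms(1)])
  have D: "\<forall>y\<in>S. (F has_derivative F' y) (at y)"
    using assms(1) unfolding has_laplacian_on_def by blast
  show ?thesis
    by (rule has_laplacian_onI[where ?F2.0 = F2]) (use D F2 in \<open>simp_all flip: assms(2)\<close>)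
qed

lemma has_laplacian_on_add:
  assumes "has_laplacian_on F F' L S" "has_laplacian_on H H' K S"
  shows "has_laplacian_on (\<lambda>y. F y + H y) (\<lambda>y h. F' y h + H' y h) (\<lambda>y. L y + K y) S"
proof -
  obtain F2 where F2: "\<forall>b\<in>Basis. \<forall>y\<in>S. ((\<lambda>y. F' y b) has_derivative F2 b y) (at y)"
    "\<forall>b\<in>Basis. continuous_on S (\<lambda>y. F2 b y b)" "\<forall>y\<in>S. L y = (\<Sum>b\<in>Basis. F2 b y b)"
    by (rule has_laplacian_onE[OF assms(1)])
  obtain H2 where H2: "\<forall>b\<in>Basis. \<forall>y\<in>S. ((\<lambda>y. H' y b) has_derivative H2 b y) (at y)"
    "\<forall>b\<in>Basis. continuous_on S (\<lambda>y. H2 b y b)" "\<forall>y\<in>S. K y = (\<Sum>b\<in>Basis. H2 b y b)"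
    by (rule has_laplacian_onE[OF assms(2)])
  have D: "\<forall>y\<in>S. (F has_derivative F' y) (at y)" "\<forall>y\<in>S. (H has_derivative H' y) (at y)"
    using assms unfolding has_laplacian_on_def by blast+
  show ?thesis
    by (rule has_laplacian_onI[where ?F2.0 = "\<lambda>b y h. F2 b y h + H2 b y h"])
      (use D F2 H2 in \<open>auto simp: sum.distrib intro!: has_derivative_add continuous_on_add\<close>)
qed

lemma has_laplacian_on_square:
  assumes "has_laplacian_on F F' L S"
  shows "has_laplacian_on (\<lambda>y. (F y)\<^sup>2) (\<lambda>y h. 2 * F y * F' y h) (\<lambda>y. 2 * (F y * L y + (\<Sum>b\<in>Basis. (F' y b)\<^sup>2))) S"
proof -
  obtain F2 where F2: "\<forall>b\<in>Basis. \<forall>y\<in>S. ((\<lambda>y. F' y b) has_derivative F2 b y) (at y)"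
    "\<forall>b\<in>Basis. continuous_on S (\<lambda>y. F2 b y b)" "\<forall>y\<in>S. L y = (\<Sum>b\<in>Basis. F2 b y b)"
    by (rule has_laplacian_onE[OF assms])
  have D: "\<And>y. y \<in> S \<Longrightarrow> (F has_derivative F' y) (at y)"
    using assms unfolding has_laplacian_on_def by blast
  note cont = has_laplacian_on_continuous(1,2)[OF assms]
  show ?thesis
  proof (rule has_laplacian_onI[where ?F2.0 = "\<lambda>b y h. 2 * F' y h * F' y b + 2 * F y * F2 b y h"])
    fix y assume y: "y \<in> S"
    have "((\<lambda>y. F y * F y) has_derivative (\<lambda>h. F y * F' y h + F' y h * F y)) (at y)"
      by (rule has_derivative_mult[OF D[OF y] D[OF y]])
    then show "((\<lambda>y. (F y)\<^sup>2) has_derivative (\<lambda>h. 2 * F y * F' y h)) (at y)"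
      by (simp add: power2_eq_square algebra_simps)
    show "2 * (F y * L y + (\<Sum>b\<in>Basis. (F' y b)\<^sup>2)) = (\<Sum>b\<in>Basis. 2 * F' y b * F' y b + 2 * F y * F2 b y b)"
      using F2(3) y by (simp add: sum.distrib sum_distrib_left power2_eq_square algebra_simps)
    fix b :: 'a assume b: "b \<in> Basis"
    have "((\<lambda>y. 2 * F y) has_derivative (\<lambda>h. 2 * F' y h)) (at y)" by (rule has_derivative_mult_right[OF D[OF y]])
    moreover have "((\<lambda>y. F' y b) has_derivative F2 b y) (at y)" using F2(1) b y by blast
    ultimately have "((\<lambda>y. 2 * F y * F' y b) has_derivative (\<lambda>h. 2 * F y * F2 b y h + 2 * F' y h * F' y b)) (at y)"
      by (rule has_derivative_mult)
    then show "((\<lambda>y. 2 * F y * F' y b) has_derivative (\<lambda>h. 2 * F' y h * F' y b + 2 * F y * F2 b y h)) (at y)"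
      by (simp only: add.commute)
  next
    fix b :: 'a assume b: "b \<in> Basis"
    then have "continuous_on S (\<lambda>y. F2 b y b)" using F2(2) by blast
    then show "continuous_on S (\<lambda>y. 2 * F' y b * F' y b + 2 * F y * F2 b y b)"
      using cont(1) cont(2)[OF b] by (intro continuous_intros)
  qed
qed

lemma sum_Basis_vec:
  fixes f :: "real^'n \<Rightarrow> 'b::comm_monoid_add"
  shows "(\<Sum>b\<in>Basis. f b) = (\<Sum>i\<in>UNIV. f (axis i 1))"
proof -
  have "inj (\<lambda>i::'n. axis i (1::real) :: real^'n)" by (auto simp: inj_def axis_eq_axis)
  note sum.reindex[OF this, of f]
  moreover have "(Basis :: (real^'n) set) = range (\<lambda>i::'n. axis i 1)" by (auto simp: Basis_vec_def)
  ultimately show ?thesis by simp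
qed

lemma sum_Basis_vec_real:
  fixes f :: "(real^'n) \<times> real \<Rightarrow> 'b::comm_monoid_add"
  shows "(\<Sum>b\<in>Basis. f b) = (\<Sum>i\<in>UNIV. f (axis i 1, 0)) + f (0, 1)"
proof -
  have "(\<Sum>b\<in>Basis. f b) = (\<Sum>b\<in>(\<lambda>u::real^'n. (u, 0::real)) ` Basis. f b) + (\<Sum>b\<in>{(0::real^'n, 1::real)}. f b)"
    unfolding Basis_prod_def by (subst sum.union_disjoint) auto
  also have "(\<Sum>b\<in>(\<lambda>u::real^'n. (u, 0::real)) ` Basis. f b) = (\<Sum>b\<in>Basis. f (b, 0))"
    by (subst sum.reindex) (auto simp: inj_on_def)
  finally show ?thesis by (simp add: sum_Basis_vec)
qed

lemma dir_deriv_axis: "dir_deriv (axis i 1) f x = partial_deriv i f x"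
proof -
  have "dir_deriv (axis i 1) f x = (\<Sum>k\<in>UNIV. if k = i then partial_deriv i f x else 0)"
    unfolding dir_deriv_def by (rule sum.cong) (auto simp: axis_def)
  then show ?thesis by simp
qed

lemma dir_deriv_0: "dir_deriv 0 f x = 0"
  by (simp add: dir_deriv_def)

lemma real_analytic_on_has_derivative_dir_deriv:
  "real_analytic_on S f \<Longrightarrow> x \<in> S \<Longrightarrow> (f has_derivative (\<lambda>h. dir_deriv h f x)) (at x)"
  unfolding dir_deriv_def by (rule real_analytic_on_has_derivative)

lemma separated_product_derivative:
  fixes w :: "real^'n \<Rightarrow> real"
  assumes "real_analytic_on B w" "(\<eta> has_real_derivative \<eta>1) (at (snd y))" "fst y \<in> B"
  shows "((\<lambda>y. w (fst y) * \<eta> (snd y)) has_derivative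
    (\<lambda>h. w (fst y) * (\<eta>1 * snd h) + dir_deriv (fst h) w (fst y) * \<eta> (snd y))) (at y)"
proof -
  have 1: "((\<lambda>y. w (fst y)) has_derivative (\<lambda>h. dir_deriv (fst h) w (fst y))) (at y)"
    using has_derivative_compose[OF bounded_linear_imp_has_derivative[OF bounded_linear_fst]
      real_analytic_on_has_derivative_dir_deriv[OF assms(1,3)]] .
  have 2: "((\<lambda>y. \<eta> (snd y)) has_derivative (\<lambda>h. \<eta>1 * snd h)) (at y)"
    using has_derivative_compose[OF bounded_linear_imp_has_derivative[OF bounded_linear_snd]
      assms(2)[unfolded has_field_derivative_def]] .
  show ?thesis by (rule has_derivative_mult[OF 1 2])
qed

text \<open>The exponential and the harmonic lifts are sums of products of a function of x and a
  function of t, so their Laplacians all come from this computation.\<close>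

lemma separated_product_has_laplacian:
  fixes w :: "real^'n \<Rightarrow> real"
  assumes w: "real_analytic_on B w"
    and \<eta>: "\<And>t. (\<eta> has_real_derivative \<eta>1 t) (at t)" "\<And>t. (\<eta>1 has_real_derivative \<eta>2 t) (at t)" "continuous_on UNIV \<eta>2"
  shows "has_laplacian_on (\<lambda>y. w (fst y) * \<eta> (snd y))
    (\<lambda>y h. w (fst y) * (\<eta>1 (snd y) * snd h) + dir_deriv (fst h) w (fst y) * \<eta> (snd y))
    (\<lambda>y. laplacian w (fst y) * \<eta> (snd y) + w (fst y) * \<eta>2 (snd y)) (B \<times> UNIV)"
proof (rule has_laplacian_onI[where ?F2.0 = "\<lambda>b y h.
    (w (fst y) * (\<eta>2 (snd y) * snd h) + dir_deriv (fst h) w (fst y) * \<eta>1 (snd y)) * snd b +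
    (dir_deriv (fst b) w (fst y) * (\<eta>1 (snd y) * snd h) + dir_deriv (fst h) (dir_deriv (fst b) w) (fst y) * \<eta> (snd y))"])
  fix y :: "(real^'n) \<times> real" assume y: "y \<in> B \<times> UNIV"
  then have yB: "fst y \<in> B" by auto
  show "((\<lambda>y. w (fst y) * \<eta> (snd y)) has_derivative
    (\<lambda>h. w (fst y) * (\<eta>1 (snd y) * snd h) + dir_deriv (fst h) w (fst y) * \<eta> (snd y))) (at y)"
    by (rule separated_product_derivative[OF w \<eta>(1) yB])
  show "laplacian w (fst y) * \<eta> (snd y) + w (fst y) * \<eta>2 (snd y) = (\<Sum>b\<in>Basis.
    (w (fst y) * (\<eta>2 (snd y) * snd b) + dir_deriv (fst b) w (fst y) * \<eta>1 (snd y)) * snd b +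
    (dir_deriv (fst b) w (fst y) * (\<eta>1 (snd y) * snd b) + dir_deriv (fst b) (dir_deriv (fst b) w) (fst y) * \<eta> (snd y)))"
  proof -
    have "dir_deriv (axis i 1) (dir_deriv (axis i 1) w) (fst y) = partial_deriv i (partial_deriv i w) (fst y)" for i
      unfolding dir_deriv_axis[abs_def] ..
    then show ?thesis
      unfolding sum_Basis_vec_real by (simp add: dir_deriv_0 laplacian_def sum_distrib_right)
  qed
  fix b :: "(real^'n) \<times> real"
  have 1: "((\<lambda>y. w (fst y) * \<eta>1 (snd y) * snd b) has_derivative
    (\<lambda>h. (w (fst y) * (\<eta>2 (snd y) * snd h) + dir_deriv (fst h) w (fst y) * \<eta>1 (snd y)) * snd b)) (at y)"
    by (rule has_derivative_mult_left[OF separated_product_derivative[OF w \<eta>(2) yB]])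
  have 2: "((\<lambda>y. dir_deriv (fst b) w (fst y) * \<eta> (snd y)) has_derivative
    (\<lambda>h. dir_deriv (fst b) w (fst y) * (\<eta>1 (snd y) * snd h) + dir_deriv (fst h) (dir_deriv (fst b) w) (fst y) * \<eta> (snd y))) (at y)"
    by (rule separated_product_derivative[OF real_analytic_on_dir_deriv[OF w] \<eta>(1) yB])
  show "((\<lambda>y. w (fst y) * (\<eta>1 (snd y) * snd b) + dir_deriv (fst b) w (fst y) * \<eta> (snd y)) has_derivative
    (\<lambda>h. (w (fst y) * (\<eta>2 (snd y) * snd h) + dir_deriv (fst h) w (fst y) * \<eta>1 (snd y)) * snd b +
    (dir_deriv (fst b) w (fst y) * (\<eta>1 (snd y) * snd h) + dir_deriv (fst h) (dir_deriv (fst b) w) (fst y) * \<eta> (snd y)))) (at y)"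
    using has_derivative_add[OF 1 2] by (simp only: mult.assoc)
next
  fix b :: "(real^'n) \<times> real"
  have c1: "continuous_on (B \<times> UNIV) (\<lambda>y. v (fst y))" if "real_analytic_on B v" for v :: "real^'n \<Rightarrow> real"
    by (rule continuous_on_compose2[OF real_analytic_on_continuous_on[OF that]]) (auto intro!: continuous_intros)
  have c2: "continuous_on (B \<times> UNIV) (\<lambda>y :: (real^'n) \<times> real. \<theta> (snd y))" if "continuous_on UNIV \<theta>" for \<theta> :: "real \<Rightarrow> real"
    by (rule continuous_on_compose2[OF that]) (auto intro!: continuous_intros)
  have "continuous_on UNIV \<eta>" "continuous_on UNIV \<eta>1"
    using \<eta>(1,2) by (meson DERIV_isCont continuous_at_imp_continuous_on)+
  then show "continuous_on (B \<times> UNIV) (\<lambda>y. (w (fst y) * (\<eta>2 (snd y) * snd b) + dir_deriv (fst b) w (fst y) * \<eta>1 (snd y)) * snd b +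
    (dir_deriv (fst b) w (fst y) * (\<eta>1 (snd y) * snd b) + dir_deriv (fst b) (dir_deriv (fst b) w) (fst y) * \<eta> (snd y)))"
    by (intro continuous_on_add continuous_on_mult continuous_on_const c1 c2 w real_analytic_on_dir_deriv \<eta>(3))
qed

text \<open>The equation \<Delta>^2 U = \<lambda>^2 U as a second-order system, from the
  factorisation (\<Delta> + \<lambda>) (\<Delta> - \<lambda>). Having constant coefficients, the
  system passes to directional derivatives of every order.\<close>

definition eig_pair :: "real \<Rightarrow> (real^'n) set \<Rightarrow> (real^'n \<Rightarrow> real) \<Rightarrow> (real^'n \<Rightarrow> real) \<Rightarrow> bool" where
  "eig_pair lam B U V \<longleftrightarrow> open B \<and> real_analytic_on B U \<and> real_analytic_on B V \<and>
     (\<forall>x\<in>B. laplacian U x = lam * U x + V x \<and> laplacian V x = - lam * V x)"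

lemma dir_deriv_linear_combination:
  assumes "real_analytic_on B U" "real_analytic_on B V" "x \<in> B"
  shows "dir_deriv e (\<lambda>x. a * U x + b * V x) x = a * dir_deriv e U x + b * dir_deriv e V x"
proof -
  have "partial_deriv i (\<lambda>x. a * U x + b * V x) x = a * partial_deriv i U x + b * partial_deriv i V x" for i
    using assms by (simp add: partial_deriv_add[OF real_analytic_on_cmult real_analytic_on_cmult] partial_deriv_cmult[of B])
  then show ?thesis by (simp add: dir_deriv_def sum_distrib_left algebra_simps sum.distrib)
qed

lemma eig_pair_dir_deriv:
  assumes "eig_pair lam B U V"
  shows "eig_pair lam B (dir_deriv e U) (dir_deriv e V)"
proof -
  have B: "open B" and U: "real_analytic_on B U" and V: "real_analytic_on B V"
    and LU: "\<And>x. x \<in> B \<Longrightarrow> laplacian U x = lam * U x + 1 * V x" and LV: "\<And>x. x \<in> B \<Longrightarrow> laplacian V x = (- lam) * V x + 0 * V x"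
    using assms by (auto simp: eig_pair_def)
  have "laplacian (dir_deriv e U) x = lam * dir_deriv e U x + dir_deriv e V x" if "x \<in> B" for x
  proof -
    have "laplacian (dir_deriv e U) x = dir_deriv e (laplacian U) x" by (rule laplacian_dir_deriv[OF U B that])
    also have "\<dots> = dir_deriv e (\<lambda>x. lam * U x + 1 * V x) x" by (rule dir_deriv_cong[OF B that LU])
    also have "\<dots> = lam * dir_deriv e U x + 1 * dir_deriv e V x" by (rule dir_deriv_linear_combination[OF U V that])
    finally show ?thesis by simp
  qed
  moreover have "laplacian (dir_deriv e V) x = - lam * dir_deriv e V x" if "x \<in> B" for x
  proof -
    have "laplacian (dir_deriv e V) x = dir_deriv e (laplacian V) x" by (rule laplacian_dir_deriv[OF V B that])
    also have "\<dots> = dir_deriv e (\<lambda>x. (- lam) * V x + 0 * V x) x" by (rule dir_deriv_cong[OF B that LV])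
    also have "\<dots> = (- lam) * dir_deriv e V x + 0 * dir_deriv e V x" by (rule dir_deriv_linear_combination[OF V V that])
    finally show ?thesis by simp
  qed
  ultimately show ?thesis using B U V by (simp add: eig_pair_def real_analytic_on_dir_deriv)
qed

definition lift_deriv :: "(real^'n \<Rightarrow> real) \<Rightarrow> (real \<Rightarrow> real) \<Rightarrow> (real \<Rightarrow> real) \<Rightarrow> (real^'n) \<times> real \<Rightarrow> (real^'n) \<times> real \<Rightarrow> real" where
  "lift_deriv w \<eta> \<eta>1 y h = w (fst y) * (\<eta>1 (snd y) * snd h) + dir_deriv (fst h) w (fst y) * \<eta> (snd y)"

text \<open>The factor exp (\<surd>\<lambda> t) adds \<lambda> w to the Laplacian. Hence the lift of
  \<open>V\<close> is harmonic, and that of \<open>U\<close> satisfies \<Delta> g = h + 2 \<lambda>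
  g.\<close>

lemma exp_lift_has_laplacian:
  assumes "real_analytic_on B w" "lam > 0"
  shows "has_laplacian_on (exp_lift lam w) (lift_deriv w (\<lambda>t. exp (sqrt lam * t)) (\<lambda>t. sqrt lam * exp (sqrt lam * t)))
     (exp_lift lam (\<lambda>x. laplacian w x + lam * w x)) (B \<times> UNIV)"
proof -
  have "has_laplacian_on (\<lambda>y. w (fst y) * exp (sqrt lam * snd y))
    (\<lambda>y h. w (fst y) * ((sqrt lam * exp (sqrt lam * snd y)) * snd h) + dir_deriv (fst h) w (fst y) * exp (sqrt lam * snd y))
    (\<lambda>y. laplacian w (fst y) * exp (sqrt lam * snd y) + w (fst y) * (lam * exp (sqrt lam * snd y))) (B \<times> UNIV)"
  proof (rule separated_product_has_laplacian[OF assms(1)])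
    show "((\<lambda>t. exp (sqrt lam * t)) has_real_derivative sqrt lam * exp (sqrt lam * t)) (at t)" for t
      by (auto intro!: derivative_eq_intros)
    show "((\<lambda>t. sqrt lam * exp (sqrt lam * t)) has_real_derivative lam * exp (sqrt lam * t)) (at t)" for t
      using assms(2) by (auto intro!: derivative_eq_intros simp: mult.assoc[symmetric])
  qed (intro continuous_intros)
  moreover have "(\<lambda>y. laplacian w (fst y) * exp (sqrt lam * snd y) + w (fst y) * (lam * exp (sqrt lam * snd y)))
    = exp_lift lam (\<lambda>x. laplacian w x + lam * w x)"
    by (auto simp: exp_lift_def algebra_simps)
  ultimately show ?thesis unfolding lift_deriv_def[abs_def] exp_lift_def[abs_def] by simp
qed

text \<open>
  The second factor \<open>\<eta>\<close> solves \<open>\<eta>'' - \<lambda> \<eta> = - cos (\<surd>\<lambda> t)\<close>, which cancels the contribution of \<open>V\<close> to the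
  Laplacian of the first summand; it vanishes at \<open>t = 0\<close>.
\<close>

definition harmonic_lift :: "real \<Rightarrow> (real^'n \<Rightarrow> real) \<Rightarrow> (real^'n \<Rightarrow> real) \<Rightarrow> (real^'n) \<times> real \<Rightarrow> real" where
  "harmonic_lift lam U V y = U (fst y) * cos (sqrt lam * snd y)
     + V (fst y) * ((cos (sqrt lam * snd y) - cosh (sqrt lam * snd y)) / (2 * lam))"

text \<open>The second part feeds the iterated derivative bound: a horizontal derivative of the lift
  is the lift of the differentiated pair and so harmonic again.\<close>

lemma harmonic_lift_has_laplacian:
  assumes "eig_pair lam B U V" "lam > 0"
  shows "\<exists>G'. has_laplacian_on (harmonic_lift lam U V) G' (\<lambda>_. 0) (B \<times> UNIV) \<and>
     (\<forall>y\<in>B \<times> UNIV. \<forall>e. G' y (e, 0) = harmonic_lift lam (dir_deriv e U) (dir_deriv e V) y)"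
proof -
  have U: "real_analytic_on B U" and V: "real_analytic_on B V"
    and LU: "\<And>x. x \<in> B \<Longrightarrow> laplacian U x = lam * U x + V x" and LV: "\<And>x. x \<in> B \<Longrightarrow> laplacian V x = (- lam) * V x"
    using assms by (auto simp: eig_pair_def)
  let ?c = "\<lambda>t. cos (sqrt lam * t)" and ?c1 = "\<lambda>t. - (sqrt lam * sin (sqrt lam * t))"
  let ?k = "\<lambda>t. (cos (sqrt lam * t) - cosh (sqrt lam * t)) / (2 * lam)"
  let ?k1 = "\<lambda>t. (- sin (sqrt lam * t) - sinh (sqrt lam * t)) / (2 * sqrt lam)"
  have s: "sqrt lam * sqrt lam = lam" "sqrt lam > 0" using assms(2) by auto
  have 1: "has_laplacian_on (\<lambda>y. U (fst y) * ?c (snd y))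
    (\<lambda>y h. U (fst y) * (?c1 (snd y) * snd h) + dir_deriv (fst h) U (fst y) * ?c (snd y))
    (\<lambda>y. laplacian U (fst y) * ?c (snd y) + U (fst y) * (- lam * ?c (snd y))) (B \<times> UNIV)"
  proof (rule separated_product_has_laplacian[OF U])
    show "(?c has_real_derivative ?c1 t) (at t)" for t
      by (auto intro!: derivative_eq_intros)
    show "(?c1 has_real_derivative - lam * ?c t) (at t)" for t
      using s(1) by (auto intro!: derivative_eq_intros simp: mult.assoc[symmetric])
  qed (intro continuous_intros)
  have 2: "has_laplacian_on (\<lambda>y. V (fst y) * ?k (snd y))
    (\<lambda>y h. V (fst y) * (?k1 (snd y) * snd h) + dir_deriv (fst h) V (fst y) * ?k (snd y))
    (\<lambda>y. laplacian V (fst y) * ?k (snd y) + V (fst y) * (- (cos (sqrt lam * snd y) + cosh (sqrt lam * snd y)) / 2)) (B \<times> UNIV)"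
  proof (rule separated_product_has_laplacian[OF V])
    show "(?k has_real_derivative ?k1 t) (at t)" for t
    proof -
      have "(?k has_real_derivative (- (sqrt lam * sin (sqrt lam * t)) - sqrt lam * sinh (sqrt lam * t)) / (2 * (sqrt lam * sqrt lam))) (at t)"
        unfolding s(1)
      proof (rule DERIV_cdivide)
        show "((\<lambda>t. cos (sqrt lam * t) - cosh (sqrt lam * t)) has_real_derivative - (sqrt lam * sin (sqrt lam * t)) - sqrt lam * sinh (sqrt lam * t)) (at t)"
          by (auto intro!: derivative_eq_intros)
      qed
      moreover have E: "(- (s * a) - s * b) / (2 * (s * s)) = (- a - b) / (2 * s)" if "s > 0" for s a b :: real
        using that by (simp add: field_simps)
      ultimately show ?thesis by (simp only: E[OF s(2)])
    qed
    show "(?k1 has_real_derivative - (cos (sqrt lam * t) + cosh (sqrt lam * t)) / 2) (at t)" for t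
    proof -
      have "(?k1 has_real_derivative (- (sqrt lam * cos (sqrt lam * t)) - sqrt lam * cosh (sqrt lam * t)) / (2 * sqrt lam)) (at t)"
      proof (rule DERIV_cdivide)
        show "((\<lambda>t. - sin (sqrt lam * t) - sinh (sqrt lam * t)) has_real_derivative - (sqrt lam * cos (sqrt lam * t)) - sqrt lam * cosh (sqrt lam * t)) (at t)"
          by (auto intro!: derivative_eq_intros)
      qed
      also have "(- (sqrt lam * cos (sqrt lam * t)) - sqrt lam * cosh (sqrt lam * t)) / (2 * sqrt lam) = - (cos (sqrt lam * t) + cosh (sqrt lam * t)) / 2"
        using s(2) by (simp add: field_simps)
      finally show ?thesis .
    qed
  qed (auto intro!: continuous_intros)
  have L: "(laplacian U (fst y) * ?c (snd y) + U (fst y) * (- lam * ?c (snd y))) +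
     (laplacian V (fst y) * ?k (snd y) + V (fst y) * (- (cos (sqrt lam * snd y) + cosh (sqrt lam * snd y)) / 2)) = 0"
    if "y \<in> B \<times> UNIV" for y
    using that assms(2) LU[of "fst y"] LV[of "fst y"] by (auto simp: field_simps)
  define G' where "G' y h = (U (fst y) * (?c1 (snd y) * snd h) + dir_deriv (fst h) U (fst y) * ?c (snd y)) +
    (V (fst y) * (?k1 (snd y) * snd h) + dir_deriv (fst h) V (fst y) * ?k (snd y))" for y h
  have "has_laplacian_on (harmonic_lift lam U V) G' (\<lambda>y. (laplacian U (fst y) * ?c (snd y) + U (fst y) * (- lam * ?c (snd y))) +
     (laplacian V (fst y) * ?k (snd y) + V (fst y) * (- (cos (sqrt lam * snd y) + cosh (sqrt lam * snd y)) / 2))) (B \<times> UNIV)"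
    using has_laplacian_on_add[OF 1 2] unfolding harmonic_lift_def[abs_def] G'_def[abs_def] .
  then have "has_laplacian_on (harmonic_lift lam U V) G' (\<lambda>_. 0) (B \<times> UNIV)"
    by (rule has_laplacian_on_cong_laplacian) (rule L)
  moreover have "\<forall>y\<in>B \<times> UNIV. \<forall>e. G' y (e, 0) = harmonic_lift lam (dir_deriv e U) (dir_deriv e V) y"
    by (simp add: G'_def harmonic_lift_def)
  ultimately show ?thesis by blast
qed

definition lift_energy :: "real \<Rightarrow> (real^'n \<Rightarrow> real) \<Rightarrow> (real^'n \<Rightarrow> real) \<Rightarrow> (real^'n) \<times> real \<Rightarrow> real" where
  "lift_energy lam U V y = (exp_lift lam U y)\<^sup>2 + (exp_lift lam V y)\<^sup>2"

definition lift_density :: "real \<Rightarrow> (real^'n \<Rightarrow> real) \<Rightarrow> (real^'n \<Rightarrow> real) \<Rightarrow> (real^'n) \<times> real \<Rightarrow> real" where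
  "lift_density lam U V y = grad_norm_sq (exp_lift lam U) y + grad_norm_sq (exp_lift lam V) y
     + exp_lift lam U y * exp_lift lam V y + 2 * lam * (exp_lift lam U y)\<^sup>2"

lemma lift_energy_nonneg: "lift_energy lam U V y \<ge> 0"
  by (simp add: lift_energy_def)

lemma grad_norm_sq_eq:
  "(f has_derivative f') (at y) \<Longrightarrow> grad_norm_sq f y = (\<Sum>b\<in>Basis. (f' b)\<^sup>2)"
  unfolding grad_norm_sq_def by (simp add: frechet_derivative_at[symmetric])

text \<open>The reason for the shape of the frequency: with \<Delta> g = h + 2 \<lambda> g and
  \<Delta> h = 0, the Laplacian of g^2 + h^2 is twice the integrand of the numerator.\<close>

lemma lift_energy_has_laplacian:
  assumes "eig_pair lam B U V" "lam > 0"
  shows "\<exists>F'. has_laplacian_on (lift_energy lam U V) F' (\<lambda>y. 2 * lift_density lam U V y) (B \<times> UNIV)"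
proof -
  have U: "real_analytic_on B U" and V: "real_analytic_on B V"
    and LU: "\<And>x. x \<in> B \<Longrightarrow> laplacian U x = lam * U x + V x" and LV: "\<And>x. x \<in> B \<Longrightarrow> laplacian V x = (- lam) * V x"
    using assms by (auto simp: eig_pair_def)
  note 1 = exp_lift_has_laplacian[OF U assms(2)] and 2 = exp_lift_has_laplacian[OF V assms(2)]
  let ?L = "\<lambda>w. exp_lift lam (\<lambda>x. laplacian w x + lam * w x)"
  show ?thesis
  proof (rule exI, rule has_laplacian_on_cong_laplacian)
    show "has_laplacian_on (lift_energy lam U V) (\<lambda>y h. 2 * exp_lift lam U y * lift_deriv U (\<lambda>t. exp (sqrt lam * t)) (\<lambda>t. sqrt lam * exp (sqrt lam * t)) y h
      + 2 * exp_lift lam V y * lift_deriv V (\<lambda>t. exp (sqrt lam * t)) (\<lambda>t. sqrt lam * exp (sqrt lam * t)) y h)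
      (\<lambda>y. 2 * (exp_lift lam U y * ?L U y + (\<Sum>b\<in>Basis. (lift_deriv U (\<lambda>t. exp (sqrt lam * t)) (\<lambda>t. sqrt lam * exp (sqrt lam * t)) y b)\<^sup>2))
        + 2 * (exp_lift lam V y * ?L V y + (\<Sum>b\<in>Basis. (lift_deriv V (\<lambda>t. exp (sqrt lam * t)) (\<lambda>t. sqrt lam * exp (sqrt lam * t)) y b)\<^sup>2)))
      (B \<times> UNIV)"
      using has_laplacian_on_add[OF has_laplacian_on_square[OF 1] has_laplacian_on_square[OF 2]]
      unfolding lift_energy_def[abs_def] .
    fix y assume y: "y \<in> B \<times> (UNIV::real set)"
    then have yB: "fst y \<in> B" by auto
    have D: "(exp_lift lam U has_derivative lift_deriv U (\<lambda>t. exp (sqrt lam * t)) (\<lambda>t. sqrt lam * exp (sqrt lam * t)) y) (at y)"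
      "(exp_lift lam V has_derivative lift_deriv V (\<lambda>t. exp (sqrt lam * t)) (\<lambda>t. sqrt lam * exp (sqrt lam * t)) y) (at y)"
      using 1 2 y unfolding has_laplacian_on_def by blast+
    show "2 * (exp_lift lam U y * ?L U y + (\<Sum>b\<in>Basis. (lift_deriv U (\<lambda>t. exp (sqrt lam * t)) (\<lambda>t. sqrt lam * exp (sqrt lam * t)) y b)\<^sup>2))
        + 2 * (exp_lift lam V y * ?L V y + (\<Sum>b\<in>Basis. (lift_deriv V (\<lambda>t. exp (sqrt lam * t)) (\<lambda>t. sqrt lam * exp (sqrt lam * t)) y b)\<^sup>2))
      = 2 * lift_density lam U V y"
      unfolding lift_density_def grad_norm_sq_eq[OF D(1)] grad_norm_sq_eq[OF D(2)]
      by (simp add: exp_lift_def LU[OF yB] LV[OF yB] power2_eq_square algebra_simps)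
  qed
qed

section \<open>Growth of the energy under a bounded frequency\<close>

lemma cball_lift_subset: "cball x \<rho> \<subseteq> B \<Longrightarrow> cball (x, t) \<rho> \<subseteq> B \<times> (UNIV :: real set)"
proof
  fix y :: "'a \<times> real" assume "cball x \<rho> \<subseteq> B" "y \<in> cball (x, t) \<rho>"
  then show "y \<in> B \<times> UNIV" using dist_fst_le[of "(x, t)" y] by (auto simp: mem_Times_iff)
qed

text \<open>To clear the denominator it must be positive, as division by 0 gives 0. A nonzero value
  of \<open>U\<close> in the ball persists on an open set, over which the sphere carries positive
  Hausdorff measure.\<close>

lemma density_le_of_frequency_le:
  fixes U :: "real^'n \<Rightarrow> real" and lam :: real
  defines "V \<equiv> \<lambda>x. laplacian U x - lam * U x"
  assumes eig: "eig_pair lam B U V" and lam: "lam > 0" and \<rho>: "\<rho> > 0" and B: "cball x0 \<rho> \<subseteq> B"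
    and ne: "\<exists>x\<in>ball x0 \<rho>. U x \<noteq> 0" and freq: "frequency lam U (x0, 0) \<rho> \<le> \<kappa>"
  shows "\<rho> * (LINT y:ball (x0, 0) \<rho>|lborel. lift_density lam U V y)
    \<le> \<kappa> * (LINT y:sphere (x0, 0) \<rho>|hausdorff_measure CARD('n). lift_energy lam U V y)"
proof -
  let ?M = "hausdorff_measure CARD('n) :: ((real^'n) \<times> real) measure" and ?S = "sphere (x0, 0::real) \<rho>"
  let ?F = "lift_energy lam U V"
  have [measurable_cong]: "sets ?M = sets borel" by (rule sets_hausdorff_measure)
  have oB: "open B" and U: "real_analytic_on B U" using eig by (auto simp: eig_pair_def)
  obtain F' where "has_laplacian_on ?F F' (\<lambda>y. 2 * lift_density lam U V y) (B \<times> UNIV)"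
    using lift_energy_has_laplacian[OF eig lam] by blast
  then have "continuous_on (B \<times> UNIV) ?F" by (rule has_laplacian_on_continuous)
  then have cF: "continuous_on ?S ?F"
    using cball_lift_subset[OF B, of 0] sphere_cball by (rule continuous_on_subset[OF _ order_trans[rotated]])
  have fin: "emeasure ?M ?S < \<infinity>"
    by (rule nn_integral_sphere_le(2)[of _ _ "\<lambda>_. 0"]) (use \<rho> in auto)
  define G where "G y = indicator ?S y *\<^sub>R ?F y" for y
  have mG: "G \<in> borel_measurable borel"
    unfolding G_def by (rule borel_measurable_continuous_on_indicator[OF _ cF]) auto
  then have [measurable]: "G \<in> borel_measurable ?M" by simp
  have bd: "bounded (?F ` ?S)" using compact_continuous_image[OF cF compact_sphere] compact_imp_bounded by blast
  then obtain K where K: "\<And>y. y \<in> ?S \<Longrightarrow> norm (?F y) \<le> K" unfolding bounded_iff by blast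
  have "integrable ?M (\<lambda>y. indicator ?S y *\<^sub>R G y)"
  proof (rule integrableI_bounded_set_indicator[where B=K])
    show "AE y in ?M. y \<in> ?S \<longrightarrow> norm (G y) \<le> K" using K by (intro AE_I2) (simp add: G_def)
  qed (use fin in simp_all)
  also have "(\<lambda>y. indicator ?S y *\<^sub>R G y) = G" by (auto simp: G_def fun_eq_iff indicator_def)
  finally have int: "integrable ?M G" .
  have G0: "G y \<ge> 0" for y by (simp add: G_def lift_energy_nonneg)
  have "(LINT y|?M. G y) > 0"
  proof -
    have "(LINT y|?M. G y) \<noteq> 0"
    proof
      assume "(LINT y|?M. G y) = 0"
      then have ae: "AE y in ?M. G y = 0" using integral_nonneg_eq_0_iff_AE[OF int] G0 by simp
      let ?W = "{x\<in>B. U x \<noteq> 0}"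
      have "open ?W"
        using continuous_open_preimage[OF real_analytic_on_continuous_on[OF U] oB, of "- {0}"]
        by (auto simp: vimage_def Int_def)
      moreover have "?W \<inter> ball (fst (x0, 0::real)) \<rho> \<noteq> {}"
      proof -
        from ne obtain x where "x \<in> ball x0 \<rho>" "U x \<noteq> 0" by blast
        then have "x \<in> ?W \<inter> ball (fst (x0, 0::real)) \<rho>" using B ball_subset_cball[of x0 \<rho>] by auto
        then show ?thesis by blast
      qed
      ultimately have pos: "hausdorff CARD('n) (?S \<inter> fst -` ?W) \<noteq> 0" by (rule hausdorff_sphere_pos)
      have "{y\<in>space ?M. \<not> G y = 0} \<in> sets ?M" by measurable
      moreover have "space ?M = UNIV" using sets_eq_imp_space_eq[OF sets_hausdorff_measure[of "CARD('n)"]] by simp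
      ultimately have sG: "{y. G y \<noteq> 0} \<in> sets borel" "{y. G y \<noteq> 0} \<in> sets ?M" by (auto simp: sets_hausdorff_measure)
      have "emeasure ?M {y. G y \<noteq> 0} = 0"
        using ae AE_iff_measurable[OF sG(2), of "\<lambda>y. G y = 0"] \<open>space ?M = UNIV\<close> by auto
      then have "hausdorff CARD('n) {y. G y \<noteq> 0} = 0" using emeasure_hausdorff_measure[OF sG(1)] by simp
      moreover have "?S \<inter> fst -` ?W \<subseteq> {y. G y \<noteq> 0}"
        by (auto simp: G_def lift_energy_def exp_lift_def add_nonneg_eq_0_iff)
      ultimately show False using pos hausdorff_mono[of "?S \<inter> fst -` ?W" "{y. G y \<noteq> 0}" "CARD('n)"] by auto
    qed
    moreover have "(LINT y|?M. G y) \<ge> 0" by (rule integral_nonneg_AE) (simp add: G0)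
    ultimately show ?thesis by simp
  qed
  moreover have "(LINT y|?M. G y) = (LINT y:?S|?M. ?F y)" by (simp add: set_lebesgue_integral_def G_def)
  ultimately have H: "(LINT y:?S|?M. ?F y) > 0" by simp
  have "frequency lam U (x0, 0) \<rho> = \<rho> * (LINT y:ball (x0, 0) \<rho>|lborel. lift_density lam U V y) / (LINT y:?S|?M. ?F y)"
    unfolding frequency_def lift_density_def lift_energy_def V_def Let_def ..
  with freq H show ?thesis by (simp add: field_simps)
qed


text \<open>Half the constant of \<open>bump_avg_le_of_sphere_bound\<close> in dimension n + 1; the
  half comes from the derivative of the average, which is R / 2 times an average of
  \<open>lift_density\<close>.\<close>

definition growth_const :: "'n::finite itself \<Rightarrow> real" where
  "growth_const _ = 2 * sphere_const CARD('n) / real (CARD('n) + 1)"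

lemma growth_const_pos: "growth_const TYPE('n::finite) > 0"
  unfolding growth_const_def using sphere_const_pos[of "CARD('n)"] by simp

lemma bump_avg_lift_density_le:
  fixes U :: "real^'n \<Rightarrow> real" and lam :: real
  defines "V \<equiv> \<lambda>x. laplacian U x - lam * U x"
  assumes eig: "eig_pair lam B U V" and lam: "lam > 0" and B: "cball x0 r \<subseteq> B" and \<kappa>: "\<kappa> \<ge> 0"
    and ne: "\<And>\<rho>. 0 < \<rho> \<Longrightarrow> \<rho> < r \<Longrightarrow> \<exists>x\<in>ball x0 \<rho>. U x \<noteq> 0"
    and freq: "\<And>\<rho>. 0 < \<rho> \<Longrightarrow> \<rho> < r \<Longrightarrow> frequency lam U (x0, 0) \<rho> \<le> \<kappa>"
    and R: "0 < R" "R \<le> r"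
  shows "R\<^sup>2 * bump_avg 2 (lift_density lam U V) (x0, 0) R
    \<le> 2 * growth_const TYPE('n) * \<kappa> * bump_avg 1 (lift_energy lam U V) (x0, 0) R"
proof -
  obtain F' where F': "has_laplacian_on (lift_energy lam U V) F' (\<lambda>y. 2 * lift_density lam U V y) (B \<times> UNIV)"
    using lift_energy_has_laplacian[OF eig lam] by blast
  have "continuous_on (B \<times> UNIV) (\<lambda>y. (1/2) * (2 * lift_density lam U V y))"
    by (intro continuous_on_mult_left has_laplacian_on_continuous(3)[OF F'])
  then have c: "continuous_on (B \<times> UNIV) (lift_density lam U V)" by simp
  have "R\<^sup>2 * bump_avg 2 (lift_density lam U V) (x0, 0) R
    \<le> 4 * sphere_const CARD('n) / real DIM((real^'n) \<times> real) * \<kappa> * bump_avg 1 (lift_energy lam U V) (x0, 0) R"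
  proof (rule bump_avg_le_of_sphere_bound[where S="B \<times> UNIV", OF _ _ has_laplacian_on_continuous(1)[OF F'] lift_energy_nonneg c \<kappa> _ R])
    fix \<rho> :: real assume \<rho>: "0 < \<rho>" "\<rho> < r"
    show "\<rho> * (LINT y:ball (x0, 0) \<rho>|lborel. lift_density lam U V y)
      \<le> \<kappa> * (LINT y:sphere (x0, 0) \<rho>|hausdorff_measure CARD('n). lift_energy lam U V y)"
      unfolding V_def using \<rho> B eig lam ne freq
      by (intro density_le_of_frequency_le) (auto simp: V_def intro: subset_trans[OF subset_cball])
  qed (use cball_lift_subset[OF B] in auto)
  then show ?thesis by (simp add: growth_const_def mult.assoc)
qed

text \<open>The function f(x) x^(- \<kappa>) does not increase.\<close>

lemma powr_growth:
  fixes f :: "real \<Rightarrow> real"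
  assumes "0 < a" "a \<le> b"
    and f: "\<And>x. a \<le> x \<Longrightarrow> x \<le> b \<Longrightarrow> (f has_real_derivative f' x) (at x)"
    and le: "\<And>x. a \<le> x \<Longrightarrow> x \<le> b \<Longrightarrow> x * f' x \<le> \<kappa> * f x"
  shows "f b \<le> (b / a) powr \<kappa> * f a"
proof -
  have "f b * b powr - \<kappa> \<le> f a * a powr - \<kappa>"
  proof (rule DERIV_nonpos_imp_nonincreasing[OF assms(2)])
    fix x assume x: "a \<le> x" "x \<le> b"
    then have x0: "x > 0" using assms(1) by simp
    have "((\<lambda>x. f x * x powr - \<kappa>) has_real_derivative f' x * x powr - \<kappa> + (- \<kappa> * x powr (- \<kappa> - 1)) * f x) (at x)"
      by (rule DERIV_mult[OF f[OF x] has_real_derivative_powr[OF x0]]) 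
    moreover have "f' x * x powr - \<kappa> + (- \<kappa> * x powr (- \<kappa> - 1)) * f x = x powr (- \<kappa> - 1) * (x * f' x - \<kappa> * f x)"
      using x0 powr_add[of x "- \<kappa> - 1" 1] by (simp add: algebra_simps)
    moreover have "x powr (- \<kappa> - 1) * (x * f' x - \<kappa> * f x) \<le> 0"
      using le[OF x] by (simp add: mult_nonneg_nonpos)
    ultimately show "\<exists>y. ((\<lambda>x. f x * x powr - \<kappa>) has_real_derivative y) (at x) \<and> y \<le> 0" by auto
  qed
  then have "b powr \<kappa> * (f b * b powr - \<kappa>) \<le> b powr \<kappa> * (f a * a powr - \<kappa>)" by (rule mult_left_mono) simp
  moreover have "b powr \<kappa> * b powr - \<kappa> = 1" using assms(1,2) by (simp flip: powr_add)
  ultimately show ?thesis using assms(1,2) by (simp add: powr_divide powr_minus_divide algebra_simps)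
qed

text \<open>The doubling estimate. When \<open>\<kappa>\<close> is of order \<surd>\<lambda>, so is
  the exponent of growth.\<close>

lemma lift_energy_growth:
  fixes U :: "real^'n \<Rightarrow> real" and lam :: real
  defines "V \<equiv> \<lambda>x. laplacian U x - lam * U x"
  assumes eig: "eig_pair lam B U V" and lam: "lam > 0" and B: "cball x0 r \<subseteq> B" and \<kappa>: "\<kappa> \<ge> 0"
    and ne: "\<And>\<rho>. 0 < \<rho> \<Longrightarrow> \<rho> < r \<Longrightarrow> \<exists>x\<in>ball x0 \<rho>. U x \<noteq> 0"
    and freq: "\<And>\<rho>. 0 < \<rho> \<Longrightarrow> \<rho> < r \<Longrightarrow> frequency lam U (x0, 0) \<rho> \<le> \<kappa>"
    and R: "0 < R1" "R1 \<le> R2" "R2 < r"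
  shows "bump_avg 1 (lift_energy lam U V) (x0, 0) R2
    \<le> (R2 / R1) powr (growth_const TYPE('n) * \<kappa>) * bump_avg 1 (lift_energy lam U V) (x0, 0) R1"
proof (rule powr_growth[OF R(1,2), where f' = "\<lambda>R. R / 2 * bump_avg 2 (lift_density lam U V) (x0, 0) R"])
  fix R assume "R1 \<le> R" "R \<le> R2"
  then have R': "0 < R" "R < r" using R by auto
  obtain F' where F': "has_laplacian_on (lift_energy lam U V) F' (\<lambda>y. 2 * lift_density lam U V y) (B \<times> UNIV)"
    using lift_energy_has_laplacian[OF eig lam] by blast
  have oB: "open (B \<times> (UNIV :: real set))" using eig by (simp add: eig_pair_def open_Times)
  have "R \<in> {0..r}" using R' by auto
  note D = bump_avg_has_derivative[OF oB cball_lift_subset[OF B, of 0] F' order.refl this]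
  moreover have "at R within {0..r} = at R" using R' by (simp add: at_within_Icc_at)
  moreover have "R / (2 * real (Suc 1)) * bump_avg (Suc 1) (\<lambda>y. 2 * lift_density lam U V y) (x0, 0) R = R / 2 * bump_avg 2 (lift_density lam U V) (x0, 0) R"
    by (simp add: bump_avg_def numeral_2_eq_2[symmetric] mult.left_commute[of _ 2] del: power_Suc)
  ultimately show "(bump_avg 1 (lift_energy lam U V) (x0, 0) has_real_derivative R / 2 * bump_avg 2 (lift_density lam U V) (x0, 0) R) (at R)"
    by (simp only:)
  have "R\<^sup>2 * bump_avg 2 (lift_density lam U V) (x0, 0) R
    \<le> 2 * growth_const TYPE('n) * \<kappa> * bump_avg 1 (lift_energy lam U V) (x0, 0) R"
    unfolding V_def by (rule bump_avg_lift_density_le[OF eig[unfolded V_def] lam B \<kappa> ne freq R'(1) less_imp_le[OF R'(2)]])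
  then show "R * (R / 2 * bump_avg 2 (lift_density lam U V) (x0, 0) R)
    \<le> growth_const TYPE('n) * \<kappa> * bump_avg 1 (lift_energy lam U V) (x0, 0) R"
    by (simp add: power2_eq_square)
qed

section \<open>Size of the harmonic lift\<close>

lemma sinh_le_mult_cosh:
  fixes x :: real
  assumes "x \<ge> 0"
  shows "sinh x \<le> x * cosh x"
proof -
  have "0 * cosh 0 - sinh 0 \<le> x * cosh x - sinh x"
  proof (rule DERIV_nonneg_imp_nondecreasing[OF assms])
    fix t :: real assume "0 \<le> t" "t \<le> x"
    have "((\<lambda>t. t * cosh t - sinh t) has_real_derivative t * sinh t) (at t)"
      by (auto intro!: derivative_eq_intros)
    moreover have "t * sinh t \<ge> 0" using \<open>0 \<le> t\<close> by simp
    ultimately show "\<exists>y. ((\<lambda>t. t * cosh t - sinh t) has_real_derivative y) (at t) \<and> 0 \<le> y" by blast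
  qed
  then show ?thesis by simp
qed

text \<open>The factor x^2 = \<lambda> t^2 cancels the denominator 2 \<lambda> in
  \<open>harmonic_lift\<close> and keeps the bounds uniform for small \<lambda>.\<close>

lemma cosh_minus_cos_le:
  fixes x :: real
  shows "\<bar>cos x - cosh x\<bar> \<le> x\<^sup>2 * cosh x"
proof -
  have "cosh x - 1 \<le> x\<^sup>2 / 2 * cosh x"
  proof -
    define y where "y = \<bar>x\<bar> / 2"
    have y: "y \<ge> 0" "cosh x = cosh (2 * y)" "x\<^sup>2 = 4 * y\<^sup>2" by (auto simp: y_def power_divide abs_if)
    have "cosh (2 * y) - 1 = 2 * (sinh y)\<^sup>2" by (simp add: cosh_double cosh_square_eq)
    also have "\<dots> \<le> 2 * (y * cosh y)\<^sup>2"
      using sinh_le_mult_cosh[OF y(1)] y(1) by (intro mult_left_mono power_mono) auto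
    also have "\<dots> = y\<^sup>2 * (1 + cosh (2 * y))"
      by (simp add: cosh_double sinh_square_eq power_mult_distrib)
    also have "\<dots> \<le> y\<^sup>2 * (2 * cosh (2 * y))"
      using cosh_real_ge_1[of "2 * y"] by (intro mult_left_mono) auto
    finally show ?thesis unfolding y(2) y(3) by simp
  qed
  moreover have "1 - cos x \<le> x\<^sup>2 / 2 * cosh x"
  proof -
    have "1 - cos (2 * (x / 2)) = 2 * (sin (x / 2))\<^sup>2" by (simp only: cos_double_sin)
    also have "\<dots> \<le> 2 * (x / 2)\<^sup>2"
      using iffD1[OF abs_le_square_iff abs_sin_x_le_abs_x[of "x / 2"]] by (rule mult_left_mono) simp
    finally have "1 - cos x \<le> x\<^sup>2 / 2 * 1" by (simp add: power_divide)
    also have "\<dots> \<le> x\<^sup>2 / 2 * cosh x" using cosh_real_ge_1[of x] by (intro mult_left_mono) auto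
    finally show ?thesis .
  qed
  moreover have "cos x \<le> cosh x" using cosh_real_ge_1[of x] cos_le_one[of x] by linarith
  ultimately show ?thesis by simp
qed

lemma harmonic_lift_sq_le:
  assumes lam: "lam > 0" and t: "\<bar>snd y\<bar> \<le> r"
  shows "(harmonic_lift lam U V y)\<^sup>2 \<le> 2 * (1 + r\<^sup>2)\<^sup>2 * exp (4 * sqrt lam * r) * lift_energy lam U V y"
proof -
  define x t where "x = fst y" and "t = snd y"
  define \<sigma> where "\<sigma> = sqrt lam * t"
  have t: "\<bar>t\<bar> \<le> r" "t\<^sup>2 \<le> r\<^sup>2" using t power_mono[of "\<bar>t\<bar>" r 2] by (auto simp: t_def)
  have \<sigma>: "\<bar>\<sigma>\<bar> \<le> sqrt lam * r" using lam t(1) by (simp add: \<sigma>_def abs_mult)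
  have "\<sigma>\<^sup>2 = lam * t\<^sup>2" using lam by (simp add: \<sigma>_def power_mult_distrib)
  define E where "E = exp (sqrt lam * r)"
  have E1: "E \<ge> 1" unfolding E_def using \<sigma> abs_ge_zero[of \<sigma>] by (simp del: abs_ge_zero)
  have ch: "cosh \<sigma> \<le> E"
  proof -
    have "exp \<sigma> \<le> E" "exp (- \<sigma>) \<le> E" using \<sigma> by (auto simp: E_def)
    then show ?thesis by (simp add: cosh_def)
  qed
  have "\<bar>harmonic_lift lam U V y\<bar> \<le> \<bar>U x\<bar> * \<bar>cos \<sigma>\<bar> + \<bar>V x\<bar> * (\<bar>cos \<sigma> - cosh \<sigma>\<bar> / (2 * lam))"
    unfolding harmonic_lift_def x_def[symmetric] t_def[symmetric] \<sigma>_def[symmetric]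
    using lam by (auto intro!: order_trans[OF abs_triangle_ineq] simp: abs_mult)
  also have "\<dots> \<le> \<bar>U x\<bar> * ((1 + r\<^sup>2) * E) + \<bar>V x\<bar> * ((1 + r\<^sup>2) * E)"
  proof (intro add_mono mult_left_mono abs_ge_zero)
    have "1 * 1 \<le> (1 + r\<^sup>2) * E" using E1 by (intro mult_mono) auto
    then show "\<bar>cos \<sigma>\<bar> \<le> (1 + r\<^sup>2) * E" using abs_cos_le_one[of \<sigma>] by linarith
    have "\<bar>cos \<sigma> - cosh \<sigma>\<bar> / (2 * lam) \<le> (lam * t\<^sup>2 * cosh \<sigma>) / (2 * lam)"
      using cosh_minus_cos_le[of \<sigma>] lam by (intro divide_right_mono) (auto simp: \<open>\<sigma>\<^sup>2 = _\<close>)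
    also have "\<dots> = t\<^sup>2 / 2 * cosh \<sigma>" using lam by simp
    also have "\<dots> \<le> (1 + r\<^sup>2) * E"
    proof (rule mult_mono[OF _ ch])
      show "t\<^sup>2 / 2 \<le> 1 + r\<^sup>2" using t(2) zero_le_power2[of t] by linarith
    qed auto
    finally show "\<bar>cos \<sigma> - cosh \<sigma>\<bar> / (2 * lam) \<le> (1 + r\<^sup>2) * E" .
  qed
  finally have "(harmonic_lift lam U V y)\<^sup>2 \<le> ((1 + r\<^sup>2) * E * (\<bar>U x\<bar> + \<bar>V x\<bar>))\<^sup>2"
    by (simp add: abs_le_square_iff[symmetric] algebra_simps)
  also have "\<dots> = (1 + r\<^sup>2)\<^sup>2 * E\<^sup>2 * (\<bar>U x\<bar> + \<bar>V x\<bar>)\<^sup>2" by (simp add: power_mult_distrib)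
  also have "\<dots> \<le> (1 + r\<^sup>2)\<^sup>2 * E\<^sup>2 * (2 * (E\<^sup>2 * lift_energy lam U V y))"
  proof (intro mult_left_mono)
    have "(\<bar>U x\<bar> + \<bar>V x\<bar>)\<^sup>2 \<le> 2 * ((U x)\<^sup>2 + (V x)\<^sup>2)"
      using zero_le_power2[of "\<bar>U x\<bar> - \<bar>V x\<bar>"] by (simp add: power2_diff power2_sum)
    \<comment> \<open>The lifts carry the factor exp \<sigma>, which is small for negative t;
      multiplying and dividing by its square costs a second E^2.\<close>
    also have "(U x)\<^sup>2 + (V x)\<^sup>2 = ((U x)\<^sup>2 + (V x)\<^sup>2) * ((exp (- \<sigma>))\<^sup>2 * (exp \<sigma>)\<^sup>2)"
      by (simp flip: power_mult_distrib exp_add)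
    also have "\<dots> = (exp (- \<sigma>))\<^sup>2 * lift_energy lam U V y"
      unfolding lift_energy_def exp_lift_def x_def[symmetric] t_def[symmetric] \<sigma>_def[symmetric]
      by (simp add: power_mult_distrib algebra_simps)
    also have "\<dots> \<le> E\<^sup>2 * lift_energy lam U V y"
      using \<sigma> by (intro mult_right_mono lift_energy_nonneg power_mono) (auto simp: E_def)
    finally show "(\<bar>U x\<bar> + \<bar>V x\<bar>)\<^sup>2 \<le> 2 * (E\<^sup>2 * lift_energy lam U V y)" by simp
  qed auto
  also have "\<dots> = 2 * (1 + r\<^sup>2)\<^sup>2 * (E\<^sup>2 * E\<^sup>2) * lift_energy lam U V y" by simp
  also have "E\<^sup>2 * E\<^sup>2 = exp (4 * sqrt lam * r)" by (simp add: E_def power2_eq_square flip: exp_add)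
  finally show ?thesis .
qed

lemma bump_avg_rescale:
  fixes H :: "'a::euclidean_space \<Rightarrow> real"
  assumes H: "continuous_on (cball z R) H" "\<And>y. H y \<ge> 0" and R: "R > 0" "r > 0" and j: "j \<ge> 1" and k: "k \<ge> 1"
    and C: "C \<ge> 0" "\<And>w. norm w \<le> 1 \<Longrightarrow> bump w ^ k \<le> C * bump ((1 / R) *\<^sub>R (y - z) + (r / R) *\<^sub>R w) ^ j"
  shows "bump_avg k H y r \<le> C * (R / r) ^ DIM('a) * bump_avg j H z R"
proof -
  define t where "t = (1 / R) *\<^sub>R (y - z)"
  define f where "f w = bump w ^ j * H (z + R *\<^sub>R w)" for w
  have rR: "r / R > 0" using R by simp
  have c: "continuous_on (cball 0 1) (\<lambda>w. H (z + R *\<^sub>R w))"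
    by (rule continuous_on_affine_compose[OF H(1)]) (use R in \<open>auto simp: cball_affine_subset\<close>)
  have if1: "integrable lborel f" using integrable_bump[OF c j] by (simp add: f_def[abs_def])
  then have [measurable]: "f \<in> borel_measurable borel" by (simp add: borel_measurable_integrable measurable_lborel1)
  have eq: "z + R *\<^sub>R (t + (r / R) *\<^sub>R w) = y + r *\<^sub>R w" for w
    using R by (simp add: t_def algebra_simps)
  have ft: "(LINT w|lborel. f (t + (r / R) *\<^sub>R w)) = (R / r) ^ DIM('a) * (LINT w|lborel. f w)"
    using rR by (subst integral_lborel_affine) (simp_all add: power_divide)
  have "integrable lborel (\<lambda>w. f (t + (r / R) *\<^sub>R w))"
  proof (rule integrableI_bounded)
    have "(\<integral>\<^sup>+w. ennreal (norm (f (t + (r / R) *\<^sub>R w))) \<partial>lborel) = ennreal (1 / (r / R) ^ DIM('a)) * (\<integral>\<^sup>+w. ennreal (norm (f w)) \<partial>lborel)"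
      by (rule nn_integral_lborel_affine[OF _ rR]) simp
    also have "\<dots> < \<infinity>" using if1 unfolding integrable_iff_bounded by (simp add: ennreal_mult_less_top)
    finally show "(\<integral>\<^sup>+w. ennreal (norm (f (t + (r / R) *\<^sub>R w))) \<partial>lborel) < \<infinity>" .
  qed simp
  then have int2: "integrable lborel (\<lambda>w. C * f (t + (r / R) *\<^sub>R w))" by simp
  have "bump_avg k H y r \<le> (LINT w|lborel. C * f (t + (r / R) *\<^sub>R w))"
    unfolding bump_avg_def
  proof (rule integral_mono'[OF int2])
    fix w :: 'a
    show "0 \<le> C * f (t + (r / R) *\<^sub>R w)" by (simp add: f_def H(2) C(1))
    show "bump w ^ k * H (y + r *\<^sub>R w) \<le> C * f (t + (r / R) *\<^sub>R w)"
    proof (cases "norm w \<le> 1")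
      case True
      have "bump w ^ k * H (y + r *\<^sub>R w) \<le> (C * bump (t + (r / R) *\<^sub>R w) ^ j) * H (y + r *\<^sub>R w)"
        using C(2)[OF True] unfolding t_def by (rule mult_right_mono) (rule H(2))
      then show ?thesis unfolding f_def eq by (simp only: mult.assoc)
    next
      case False
      then have "bump w = 0" by (intro bump_eq_0) simp
      then show ?thesis using k by (simp add: f_def H(2) C(1) power_0_left)
    qed
  qed
  then show ?thesis using ft by (simp add: f_def bump_avg_def mult.assoc)
qed

text \<open>The ball of radius R / 4 about a point \<open>y\<close> of the half ball stays in the
  ball of radius 3 R / 4 about \<open>z\<close>, where the weight is at least 7/16.\<close>

lemma bump_avg_recenter:
  fixes H :: "'a::euclidean_space \<Rightarrow> real"
  assumes H: "continuous_on (cball z R) H" "\<And>y. H y \<ge> 0" and R: "R > 0" and y: "dist z y \<le> R / 2"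
  shows "bump_avg 1 H y (R / 4) \<le> 4 * 4 ^ DIM('a) * bump_avg 1 H z R"
proof -
  define t where "t = (1 / R) *\<^sub>R (y - z)"
  have "norm t = dist z y / R" using R by (simp only: t_def norm_scaleR) (simp add: dist_norm norm_minus_commute)
  also have "\<dots> \<le> (R / 2) / R" using y R by (intro divide_right_mono) auto
  finally have t: "norm t \<le> 1 / 2" using R by simp
  have "bump_avg 1 H y (R / 4) \<le> 4 * (R / (R / 4)) ^ DIM('a) * bump_avg 1 H z R"
  proof (rule bump_avg_rescale[OF H R])
    fix w :: 'a assume w: "norm w \<le> 1"
    have "norm (t + (1/4) *\<^sub>R w) \<le> 3 / 4"
      using norm_triangle_ineq[of t "(1/4) *\<^sub>R w"] t w by simp
    then have "(norm (t + (1/4) *\<^sub>R w))\<^sup>2 \<le> (3 / 4)\<^sup>2" by (intro power_mono) auto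
    then have "1 \<le> 4 * bump (t + (1/4) *\<^sub>R w)" by (simp add: bump_def power_divide)
    then show "bump w ^ 1 \<le> 4 * bump ((1 / R) *\<^sub>R (y - z) + (R / 4 / R) *\<^sub>R w) ^ 1"
      using bump_le_1[of w] R by (simp add: t_def)
  qed (use R in auto)
  then show ?thesis using R by simp
qed

text \<open>Trades the weight bump for bump^2 at the cost of half the radius: on the smaller ball
  the second weight is at least 9/16.\<close>

lemma bump_avg_half:
  fixes H :: "'a::euclidean_space \<Rightarrow> real"
  assumes H: "continuous_on (cball z R) H" "\<And>y. H y \<ge> 0" and R: "R > 0"
  shows "bump_avg 1 H z (R / 2) \<le> 2 * 2 ^ DIM('a) * bump_avg 2 H z R"
proof -
  have "bump_avg 1 H z (R / 2) \<le> 2 * (R / (R / 2)) ^ DIM('a) * bump_avg 2 H z R"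
  proof (rule bump_avg_rescale[OF H R])
    fix w :: 'a assume w: "norm w \<le> 1"
    then have "(norm w)\<^sup>2 \<le> 1\<^sup>2" by (intro power_mono) auto
    then have "3 / 4 \<le> bump ((1/2) *\<^sub>R w)" by (simp add: bump_def power_divide)
    then have "(3 / 4)\<^sup>2 \<le> (bump ((1/2) *\<^sub>R w))\<^sup>2" by (intro power_mono) auto
    then show "bump w ^ 1 \<le> 2 * bump ((1 / R) *\<^sub>R (z - z) + (R / 2 / R) *\<^sub>R w) ^ 2"
      using bump_le_1[of w] R by (simp add: power_divide)
  qed (use R in auto)
  then show ?thesis using R by simp
qed

text \<open>The square of a harmonic function is subharmonic. Its value is at most a multiple of an
  average over a small ball, hence of the average over radius \<open>R\<close>, and there
  \<open>harmonic_lift_sq_le\<close> compares with the energy.\<close>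

lemma harmonic_lift_bound:
  assumes eig: "eig_pair lam B U V" and lam: "lam > 0" and B: "cball x0 R \<subseteq> B" and R: "R > 0"
    and y: "dist (x0, 0) y \<le> R / 2"
  shows "(harmonic_lift lam U V y)\<^sup>2 \<le> 4 * 4 ^ (CARD('n) + 1) / bump_vol TYPE((real^'n) \<times> real) 1 *
    (2 * (1 + R\<^sup>2)\<^sup>2 * exp (4 * sqrt lam * R)) * bump_avg 1 (lift_energy lam U V) (x0 :: real^'n, 0) R"
proof -
  let ?G = "harmonic_lift lam U V" and ?z = "(x0, 0::real)" and ?b = "bump_vol TYPE((real^'n) \<times> real) 1"
  let ?S = "B \<times> (UNIV :: real set)"
  have b: "?b > 0" by (rule bump_vol_pos) simp
  have oB: "open ?S" using eig by (simp add: eig_pair_def open_Times)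
  have zR: "cball ?z R \<subseteq> ?S" by (rule cball_lift_subset[OF B])
  obtain G' where G': "has_laplacian_on ?G G' (\<lambda>_. 0) ?S" using harmonic_lift_has_laplacian[OF eig lam] by blast
  note sq = has_laplacian_on_square[OF G']
  have c: "continuous_on (cball ?z R) (\<lambda>y. (?G y)\<^sup>2)"
    by (rule continuous_on_subset[OF has_laplacian_on_continuous(1)[OF sq] zR])
  obtain F' where F': "has_laplacian_on (lift_energy lam U V) F' (\<lambda>y. 2 * lift_density lam U V y) ?S"
    using lift_energy_has_laplacian[OF eig lam] by blast
  have cF: "continuous_on (cball ?z R) (lift_energy lam U V)"
    by (rule continuous_on_subset[OF has_laplacian_on_continuous(1)[OF F'] zR])
  have "(?G y)\<^sup>2 * ?b \<le> bump_avg 1 (\<lambda>y. (?G y)\<^sup>2) y (R / 4)"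
    unfolding bump_vol_def
  proof (rule bump_avg_mono_derivative[OF oB _ sq])
    show "cball y (R / 4) \<subseteq> ?S"
    proof (rule order_trans[OF _ zR], rule subsetI)
      fix w assume "w \<in> cball y (R / 4)"
      then show "w \<in> cball ?z R" using dist_triangle[of ?z w y] y R by simp
    qed
  qed (use R in \<open>auto intro: sum_nonneg\<close>)
  also have "\<dots> \<le> 4 * 4 ^ DIM((real^'n) \<times> real) * bump_avg 1 (\<lambda>y. (?G y)\<^sup>2) ?z R"
    by (rule bump_avg_recenter[OF c _ R y]) simp
  also have "bump_avg 1 (\<lambda>y. (?G y)\<^sup>2) ?z R \<le> 2 * (1 + R\<^sup>2)\<^sup>2 * exp (4 * sqrt lam * R) * bump_avg 1 (lift_energy lam U V) ?z R"
  proof -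
    let ?k = "2 * (1 + R\<^sup>2)\<^sup>2 * exp (4 * sqrt lam * R)"
    have "bump_avg 1 (\<lambda>y. (?G y)\<^sup>2) ?z R \<le> (LINT w|lborel. ?k * (bump w ^ 1 * lift_energy lam U V (?z + R *\<^sub>R w)))"
      unfolding bump_avg_def
    proof (rule integral_mono')
      have "integrable lborel (\<lambda>w. bump w ^ 1 * lift_energy lam U V (?z + R *\<^sub>R w))"
        by (rule integrable_bump, rule continuous_on_affine_compose[OF cF]) (use R in auto)
      then show "integrable lborel (\<lambda>w. ?k * (bump w ^ 1 * lift_energy lam U V (?z + R *\<^sub>R w)))" by simp
      fix w :: "(real^'n) \<times> real"
      show "0 \<le> ?k * (bump w ^ 1 * lift_energy lam U V (?z + R *\<^sub>R w))" by (simp add: lift_energy_nonneg)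
      show "bump w ^ 1 * (?G (?z + R *\<^sub>R w))\<^sup>2 \<le> ?k * (bump w ^ 1 * lift_energy lam U V (?z + R *\<^sub>R w))"
      proof (cases "norm w \<le> 1")
        case True
        have "\<bar>snd (?z + R *\<^sub>R w)\<bar> = R * \<bar>snd w\<bar>" using R by (simp add: abs_mult)
        also have "\<dots> \<le> R * 1" using R True norm_snd_le[of "snd w" "fst w"] by (intro mult_left_mono) auto
        finally have "(?G (?z + R *\<^sub>R w))\<^sup>2 \<le> ?k * lift_energy lam U V (?z + R *\<^sub>R w)"
          by (intro harmonic_lift_sq_le[OF lam]) simp
        then have "bump w * (?G (?z + R *\<^sub>R w))\<^sup>2 \<le> bump w * (?k * lift_energy lam U V (?z + R *\<^sub>R w))"
          by (rule mult_left_mono) simp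
        then show ?thesis by (simp only: power_one_right mult.left_commute[of _ ?k])
      next
        case False
        then have "bump w = 0" by (intro bump_eq_0) simp
        then show ?thesis by simp
      qed
    qed
    also have "\<dots> = ?k * bump_avg 1 (lift_energy lam U V) ?z R" by (simp add: bump_avg_def)
    finally show ?thesis .
  qed
  finally show ?thesis using b by (simp add: field_simps)
qed


section \<open>Holomorphic extension along lines\<close>

lemma has_laplacian_on_subset:
  assumes "has_laplacian_on F F' L S" "T \<subseteq> S"
  shows "has_laplacian_on F F' L T"
proof -
  obtain F2 where F2: "\<forall>b\<in>Basis. \<forall>y\<in>S. ((\<lambda>y. F' y b) has_derivative F2 b y) (at y)"
    "\<forall>b\<in>Basis. continuous_on S (\<lambda>y. F2 b y b)" "\<forall>y\<in>S. L y = (\<Sum>b\<in>Basis. F2 b y b)"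
    by (rule has_laplacian_onE[OF assms(1)])
  have D: "\<forall>y\<in>S. (F has_derivative F' y) (at y)"
    using assms(1) unfolding has_laplacian_on_def by blast
  show ?thesis
  proof (rule has_laplacian_onI[where ?F2.0 = F2])
    show "continuous_on T (\<lambda>y. F2 b y b)" if "b \<in> Basis" for b
      using F2(2) that by (intro continuous_on_subset[OF _ assms(2)]) simp
  qed (use D F2(1,3) subsetD[OF assms(2)] in simp_all)
qed

text \<open>The constant of \<open>harmonic_gradient_bound\<close> in dimension n + 1 for a unit
  direction.\<close>

definition line_const :: "'n::finite itself \<Rightarrow> real" where
  "line_const _ = 4 * bump_vol TYPE((real^'n) \<times> real) 1 / bump_vol TYPE((real^'n) \<times> real) 2"

lemma line_const_pos: "line_const TYPE('n::finite) > 0"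
  unfolding line_const_def using bump_vol_pos[of 1, where ?'a = "(real^'n) \<times> real"] bump_vol_pos[of 2, where ?'a = "(real^'n) \<times> real"]
  by simp

lemma eig_pair_iterated_dir_deriv:
  "eig_pair lam B U V \<Longrightarrow> eig_pair lam B ((dir_deriv e ^^ k) U) ((dir_deriv e ^^ k) V)"
  by (induction k) (simp_all add: eig_pair_dir_deriv)

text \<open>At height 0 the lift of a pair equals its first member, and this holds for the
  differentiated pairs too. Harmonic estimates in n + 1 variables thus bound derivatives of
  \<open>U\<close>.\<close>

lemma iterated_dir_deriv_bound:
  fixes U :: "real^'n \<Rightarrow> real"
  assumes eig: "eig_pair lam B U V" and lam: "lam > 0" and e: "norm e = 1" and S: "open S" "S \<subseteq> B \<times> UNIV"
    and M: "\<And>y. y \<in> S \<Longrightarrow> \<bar>harmonic_lift lam U V y\<bar> \<le> M" and x: "cball (x, 0) \<delta> \<subseteq> S" "\<delta> > 0"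
  shows "\<bar>(dir_deriv e ^^ k) U x\<bar> \<le> (line_const TYPE('n) * real k / \<delta>) ^ k * M"
proof -
  define H where "H k = harmonic_lift lam ((dir_deriv e ^^ k) U) ((dir_deriv e ^^ k) V)" for k
  have "\<bar>H k (x, 0)\<bar> \<le> (4 * bump_vol TYPE((real^'n) \<times> real) 1 / bump_vol TYPE((real^'n) \<times> real) 2 * real k / \<delta>) ^ k * M"
  proof (rule harmonic_iterated_derivative_bound[OF S(1) _ _ _ x, where e = "(e, 0)"])
    show "norm (e, 0::real) = 1" using e by (simp add: norm_Pair)
    show "\<bar>H 0 y\<bar> \<le> M" if "y \<in> S" for y using M[OF that] by (simp add: H_def)
    fix k
    obtain G' where G': "has_laplacian_on (H k) G' (\<lambda>_. 0) (B \<times> UNIV)"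
      "\<forall>y\<in>B \<times> UNIV. \<forall>e'. G' y (e', 0) = harmonic_lift lam (dir_deriv e' ((dir_deriv e ^^ k) U)) (dir_deriv e' ((dir_deriv e ^^ k) V)) y"
      using harmonic_lift_has_laplacian[OF eig_pair_iterated_dir_deriv[OF eig, where e = e and k = k] lam] unfolding H_def by (elim exE conjE)
    have "G' y (e, 0) = H (Suc k) y" if "y \<in> S" for y
      using bspec[OF G'(2) subsetD[OF S(2) that]] unfolding H_def by simp
    then show "\<exists>G'. has_laplacian_on (H k) G' (\<lambda>_. 0) S \<and> (\<forall>y\<in>S. G' y (e, 0) = H (Suc k) y)"
      using has_laplacian_on_subset[OF G'(1) S(2)] by blast
  qed
  then show ?thesis by (simp add: H_def harmonic_lift_def line_const_def)
qed

lemma line_has_derivative: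
  fixes U :: "real^'n \<Rightarrow> real"
  assumes "real_analytic_on B U" "p + t *\<^sub>R e \<in> B"
  shows "((\<lambda>t. U (p + t *\<^sub>R e)) has_real_derivative dir_deriv e U (p + t *\<^sub>R e)) (at t)"
proof -
  have "((\<lambda>t. p + t *\<^sub>R e) has_derivative (\<lambda>h. h *\<^sub>R e)) (at t)" by (auto intro!: derivative_eq_intros)
  from has_derivative_compose[OF this real_analytic_on_has_derivative_dir_deriv[OF assms]]
  have "((\<lambda>t. U (p + t *\<^sub>R e)) has_derivative (\<lambda>h. dir_deriv (h *\<^sub>R e) U (p + t *\<^sub>R e))) (at t)" .
  moreover have "dir_deriv (h *\<^sub>R e) U (p + t *\<^sub>R e) = dir_deriv e U (p + t *\<^sub>R e) * h" for h
    by (simp add: dir_deriv_def sum_distrib_left algebra_simps)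
  ultimately show ?thesis by (simp add: has_field_derivative_def)
qed

text \<open>The bound 1/8 keeps the line in the ball where derivatives are controlled. The other
  bound is the condition 3 B R \<le> 1 of \<open>real_taylor_holomorphic\<close>, where B is 8
  \<open>line_const\<close> divided by the radius of the given ball.\<close>

definition line_radius :: "'n::finite itself \<Rightarrow> real" where
  "line_radius _ = min (1 / 8) (1 / (24 * line_const TYPE('n)))"

lemma line_radius: "line_radius TYPE('n::finite) > 0" "line_radius TYPE('n) \<le> 1 / 8"
  "24 * line_const TYPE('n) * line_radius TYPE('n) \<le> 1"
proof -
  have "24 * line_const TYPE('n) * line_radius TYPE('n) \<le> 24 * line_const TYPE('n) * (1 / (24 * line_const TYPE('n)))"
    unfolding line_radius_def using line_const_pos[where ?'n = 'n] by (intro mult_left_mono) auto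
  then show "24 * line_const TYPE('n) * line_radius TYPE('n) \<le> 1" using line_const_pos[where ?'n = 'n] by simp
qed (use line_const_pos[where ?'n = 'n] in \<open>auto simp: line_radius_def\<close>)

lemma line_iterated_bound:
  fixes U :: "real^'n \<Rightarrow> real"
  assumes eig: "eig_pair lam B U V" and lam: "lam > 0" and B: "cball x0 R \<subseteq> B" and R: "R > 0"
    and M: "\<And>y. dist (x0, 0) y \<le> R / 2 \<Longrightarrow> \<bar>harmonic_lift lam U V y\<bar> \<le> M"
    and p: "dist x0 p \<le> R / 4" and e: "norm e = 1"
  shows "\<bar>(dir_deriv e ^^ k) U p\<bar> \<le> (8 * line_const TYPE('n) / R * real k) ^ k * M"
proof -
  have "\<bar>(dir_deriv e ^^ k) U p\<bar> \<le> (line_const TYPE('n) * real k / (R / 8)) ^ k * M"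
  proof (rule iterated_dir_deriv_bound[OF eig lam e open_ball])
    show "ball (x0, 0::real) (R / 2) \<subseteq> B \<times> UNIV"
    proof (rule order_trans[OF ball_subset_cball], rule cball_lift_subset)
      show "cball x0 (R / 2) \<subseteq> B" using B R subset_cball[of "R / 2" R x0] by auto
    qed
    show "cball (p, 0) (R / 8) \<subseteq> ball (x0, 0::real) (R / 2)"
    proof
      fix y :: "(real^'n) \<times> real" assume "y \<in> cball (p, 0) (R / 8)"
      then have "dist (x0, 0) y \<le> R / 4 + R / 8"
        using dist_triangle[of "(x0, 0)" y "(p, 0)"] p by (simp add: dist_Pair_Pair)
      then show "y \<in> ball (x0, 0) (R / 2)" using R by simp
    qed
  qed (use M R in auto)
  then show ?thesis by (simp add: field_simps)
qed

lemma line_extension: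
  fixes U :: "real^'n \<Rightarrow> real"
  assumes eig: "eig_pair lam B U V" and lam: "lam > 0" and B: "cball x0 R \<subseteq> B" and R: "R > 0"
    and M: "\<And>y. dist (x0, 0) y \<le> R / 2 \<Longrightarrow> \<bar>harmonic_lift lam U V y\<bar> \<le> M"
    and p: "dist x0 p \<le> R / 8" and e: "norm e = 1"
  shows "\<exists>F. F holomorphic_on ball 0 (line_radius TYPE('n) * R) \<and>
    (\<forall>t. \<bar>t\<bar> < line_radius TYPE('n) * R \<longrightarrow> F (of_real t) = of_real (U (p + t *\<^sub>R e))) \<and>
    (\<forall>z\<in>ball 0 (line_radius TYPE('n) * R / 2). norm (F z) \<le> 2 * M)"
proof -
  define f where "f k t = (dir_deriv e ^^ k) U (p + t *\<^sub>R e)" for k t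
  have near: "dist x0 (p + t *\<^sub>R e) \<le> R / 4" if "\<bar>t\<bar> < line_radius TYPE('n) * R" for t
  proof -
    have "line_radius TYPE('n) * R \<le> 1 / 8 * R" using R line_radius(2) by (intro mult_right_mono) auto
    then have "dist p (p + t *\<^sub>R e) \<le> R / 8" using that e by (simp add: dist_norm)
    then show ?thesis using dist_triangle[of x0 "p + t *\<^sub>R e" p] p by simp
  qed
  have "\<exists>F. F holomorphic_on ball 0 (line_radius TYPE('n) * R) \<and>
    (\<forall>t. \<bar>t\<bar> < line_radius TYPE('n) * R \<longrightarrow> F (of_real t) = of_real (f 0 t)) \<and>
    (\<forall>z\<in>ball 0 (line_radius TYPE('n) * R / 2). norm (F z) \<le> 2 * M)"
  proof (rule real_taylor_holomorphic[where B = "8 * line_const TYPE('n) / R"])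
    fix k t assume t: "\<bar>t\<bar> < line_radius TYPE('n) * R"
    have "p + t *\<^sub>R e \<in> B" using near[OF t] B R by (auto simp: subset_iff)
    moreover have "real_analytic_on B ((dir_deriv e ^^ k) U)"
      using eig_pair_iterated_dir_deriv[OF eig, where e = e and k = k] by (simp add: eig_pair_def)
    ultimately show "(f k has_real_derivative f (Suc k) t) (at t)"
      unfolding f_def[abs_def] by (simp add: line_has_derivative)
    show "\<bar>f k t\<bar> \<le> (8 * line_const TYPE('n) / R * real k) ^ k * M"
      unfolding f_def by (rule line_iterated_bound[OF eig lam B R M near[OF t] e])
  next
    show "3 * (8 * line_const TYPE('n) / R) * (line_radius TYPE('n) * R) \<le> 1"
      using line_radius(3)[where ?'n = 'n] R by simp
  qed (use R line_radius(1)[where ?'n = 'n] line_const_pos[where ?'n = 'n] in auto)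
  then show ?thesis by (simp add: f_def)
qed

section \<open>Zeros in a ball with bounded frequency\<close>

text \<open>The hypotheses on one ball. Constants may depend on n, \<open>r0\<close> and
  \<open>K\<close> but not on \<open>lam\<close>, \<open>U\<close> or \<open>x0\<close>; statements
  that produce constants are therefore made outside the locale, with its predicate as a premise
  under the quantifiers.\<close>

locale frequency_ball =
  fixes r0 K :: real and lam :: real and U :: "real^'n \<Rightarrow> real" and x0 :: "real^'n"
  assumes r0: "r0 > 0" and K: "K \<ge> 0" and lam: "lam > 0"
    and eig: "eig_pair lam (ball x0 r0) U (\<lambda>x. laplacian U x - lam * U x)"
    and nz: "\<exists>x\<in>ball x0 r0. U x \<noteq> 0"
    and freq: "\<And>r. 0 < r \<Longrightarrow> r < r0 \<Longrightarrow> frequency lam U (x0, 0) r \<le> K * sqrt lam"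
begin

definition "V x = laplacian U x - lam * U x"

lemma eig_V: "eig_pair lam (ball x0 r0) U V"
  using eig unfolding V_def[abs_def] .

lemma ana: "real_analytic_on (ball x0 r0) U" "real_analytic_on (ball x0 r0) V"
  using eig_V by (auto simp: eig_pair_def)

text \<open>By the identity theorem \<open>U\<close> vanishes on no open part of the ball, so the
  frequency has a positive denominator at every radius.\<close>

lemma nz_open:
  assumes "open W" "W \<inter> ball x0 r0 \<noteq> {}"
  shows "\<exists>x\<in>W \<inter> ball x0 r0. U x \<noteq> 0"
proof (rule ccontr)
  assume *: "\<not> ?thesis"
  obtain x where x: "x \<in> ball x0 r0" "U x \<noteq> 0" using nz by blast
  have "U x = 0"
    by (rule real_analytic_on_identity[OF ana(1) open_ball connected_ball assms _ x(1)]) (use * in auto)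
  with x show False by simp
qed

definition "avg = bump_avg 1 (lift_energy lam U V) (x0, 0)"

lemma avg_nonneg: "avg R \<ge> 0"
  unfolding avg_def bump_avg_def by (intro Bochner_Integration.integral_nonneg) (simp add: lift_energy_nonneg)

lemma nz_ball: "0 < \<rho> \<Longrightarrow> \<rho> \<le> r0 \<Longrightarrow> \<exists>x\<in>ball x0 \<rho>. U x \<noteq> 0"
proof -
  assume \<rho>: "0 < \<rho>" "\<rho> \<le> r0"
  then have "x0 \<in> ball x0 \<rho> \<inter> ball x0 r0" using r0 by simp
  then show ?thesis using nz_open[of "ball x0 \<rho>"] by blast
qed

lemma avg_growth:
  assumes R: "0 < R1" "R1 \<le> R2" "R2 < r0"
  shows "avg R2 \<le> (R2 / R1) powr (growth_const TYPE('n) * K * sqrt lam) * avg R1"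
proof -
  define r where "r = (R2 + r0) / 2"
  have r: "R2 < r" "r < r0" using R by (auto simp: r_def)
  have "cball x0 r \<subseteq> ball x0 r0" using r by (simp add: cball_subset_ball_iff)
  from lift_energy_growth[OF eig lam this, of "K * sqrt lam" R1 R2]
  show ?thesis unfolding avg_def V_def[abs_def]
    using K lam R r nz_ball freq by (simp add: mult.assoc)
qed

text \<open>Not the supremum itself but its upper bound from \<open>harmonic_lift_bound\<close> with
  radius r0 / 2. Being an explicit multiple of the root of an energy average, it can be compared
  with averages over smaller balls by doubling.\<close>

definition "sup_const = sqrt (4 * 4 ^ (CARD('n) + 1) / bump_vol TYPE((real^'n) \<times> real) 1 *
    (2 * (1 + (r0 / 2)\<^sup>2)\<^sup>2 * exp (4 * sqrt lam * (r0 / 2))) * avg (r0 / 2))"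

lemma half_ball: "cball x0 (r0 / 2) \<subseteq> ball x0 r0"
  using r0 by (simp add: cball_subset_ball_iff)

lemma lift_le_sup_const:
  assumes "dist (x0, 0) y \<le> r0 / 2 / 2"
  shows "\<bar>harmonic_lift lam U V y\<bar> \<le> sup_const"
  unfolding sup_const_def avg_def
  by (rule real_le_rsqrt, subst power2_abs, rule harmonic_lift_bound[OF eig_V lam half_ball _ assms])
    (use r0 in simp)

lemma U_le_sup_const:
  assumes "dist x0 x \<le> r0 / 4"
  shows "\<bar>U x\<bar> \<le> sup_const"
  using lift_le_sup_const[of "(x, 0)"] assms by (simp add: harmonic_lift_def dist_Pair_Pair)

lemma sup_const_pos: "sup_const > 0"
proof -
  obtain x where "x \<in> ball x0 (r0 / 4)" "U x \<noteq> 0" using nz_ball[of "r0 / 4"] r0 by auto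
  then show ?thesis using U_le_sup_const[of x] by auto
qed

lemma avg_pos: "avg (r0 / 2) > 0"
  using sup_const_pos avg_nonneg[of "r0 / 2"] unfolding sup_const_def by (cases "avg (r0 / 2) = 0") auto

lemma avg_le:
  assumes t: "0 < t" "t < r0" and T: "\<And>p. p \<in> cball x0 t \<Longrightarrow> \<bar>U p\<bar> \<le> T \<and> \<bar>V p\<bar> \<le> T"
  shows "avg t \<le> bump_vol TYPE((real^'n) \<times> real) 1 * (2 * T\<^sup>2 * exp (2 * sqrt lam * t))"
proof -
  have "avg t \<le> (LINT w|lborel. bump (w :: (real^'n) \<times> real) ^ 1 * (2 * T\<^sup>2 * exp (2 * sqrt lam * t)))"
    unfolding avg_def bump_avg_def
  proof (rule integral_mono')
    show "integrable lborel (\<lambda>w :: (real^'n) \<times> real. bump w ^ 1 * (2 * T\<^sup>2 * exp (2 * sqrt lam * t)))"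
      by (rule integrable_bump) auto
    fix w :: "(real^'n) \<times> real"
    show "bump w ^ 1 * lift_energy lam U V ((x0, 0) + t *\<^sub>R w) \<le> bump w ^ 1 * (2 * T\<^sup>2 * exp (2 * sqrt lam * t))"
    proof (cases "norm w \<le> 1")
      case True
      have n: "norm (fst w) \<le> 1" "\<bar>snd w\<bar> \<le> 1"
        using norm_fst_le[of "fst w" "snd w"] norm_snd_le[of "snd w" "fst w"] True by auto
      define p where "p = x0 + t *\<^sub>R fst w"
      have "p \<in> cball x0 t" using n(1) t(1) mult_left_mono[of "norm (fst w)" 1 t] by (simp add: p_def dist_norm)
      from T[OF this] have UV: "(U p)\<^sup>2 \<le> T\<^sup>2" "(V p)\<^sup>2 \<le> T\<^sup>2"
        using power_mono[of "\<bar>U p\<bar>" T 2] power_mono[of "\<bar>V p\<bar>" T 2] by auto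
      have "lift_energy lam U V ((x0, 0) + t *\<^sub>R w) = ((U p)\<^sup>2 + (V p)\<^sup>2) * exp (2 * (sqrt lam * (t * snd w)))"
        by (simp add: lift_energy_def exp_lift_def p_def power_mult_distrib algebra_simps flip: exp_double)
      also have "\<dots> \<le> (2 * T\<^sup>2) * exp (2 * (sqrt lam * (t * 1)))"
        using UV n(2) t lam by (intro mult_mono) auto
      finally show ?thesis using True by (intro mult_left_mono) (auto simp: mult.assoc)
    next
      case False
      then have "bump w = 0" by (intro bump_eq_0) simp
      then show ?thesis by simp
    qed
  qed auto
  then show ?thesis by (simp add: bump_vol_def)
qed

end

text \<open>The summand 1 in 1 + s absorbs fixed factors, so that all losses take the form exp (- c
  (1 + s)).\<close>

lemma exp_absorb:
  fixes k :: real
  assumes "k > 0" "s \<ge> 0" "a \<ge> \<bar>ln k\<bar>"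
  shows "k * exp (- a * (1 + s)) \<le> 1" 
proof -
  have "ln k \<le> a * (1 + s)" 
    using assms mult_left_mono[of 1 "1 + s" a] abs_ge_self[of "ln k"] abs_ge_zero[of "ln k"] by auto
  then have "exp (ln k) * exp (- a * (1 + s)) \<le> 1" by (simp flip: exp_add)
  then show ?thesis using assms(1) by simp
qed

text \<open>If both functions were small on the ball of radius \<open>t\<close>, so would be the
  energy average there, and doubling up to radius r0 / 2 would bound the square of
  \<open>sup_const\<close> by half of itself.\<close>

lemma lift_lower_bound:
  assumes t: "0 < t" "t \<le> r0 / 2" and K: "K \<ge> 0"
  shows "\<exists>c\<ge>0. \<forall>lam (U :: real^'n \<Rightarrow> real) x0. frequency_ball r0 K lam U x0 \<longrightarrow>
    (\<exists>p\<in>cball x0 t. exp (- c * (1 + sqrt lam)) * frequency_ball.sup_const r0 lam U x0 < \<bar>U p\<bar> \<or>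
      exp (- c * (1 + sqrt lam)) * frequency_ball.sup_const r0 lam U x0 < \<bar>frequency_ball.V lam U p\<bar>)"
proof -
  let ?b = "bump_vol TYPE((real^'n) \<times> real) 1"
  define k where "k = 4 * 4 ^ (CARD('n) + 1) / ?b * (2 * (1 + (r0 / 2)\<^sup>2)\<^sup>2) * (2 * ?b)"
  define q where "q = r0 / 2 / t"
  \<comment> \<open>The summands pay, in this order, for fixed factors, for the exponentials in the
    lifts and for the doubling factor.\<close>
  define c where "c = (\<bar>ln (2 * k)\<bar> + 4 * r0 + growth_const TYPE('n) * K * ln q)"
  have b: "?b > 0" by (rule bump_vol_pos) simp
  have "1 + (r0 / 2)\<^sup>2 > 0" by (intro add_pos_nonneg) auto
  then have k: "k > 0" unfolding k_def using b by (intro mult_pos_pos divide_pos_pos zero_less_power) auto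
  have q: "q \<ge> 1" using t by (simp add: q_def field_simps)
  have g: "growth_const TYPE('n) * K * ln q \<ge> 0" using K q growth_const_pos[where ?'n = 'n] by simp
  have c: "c \<ge> 0" using g t by (simp add: c_def)
  have "\<exists>p\<in>cball x0 t. exp (- c * (1 + sqrt lam)) * frequency_ball.sup_const r0 lam U x0 < \<bar>U p\<bar> \<or>
      exp (- c * (1 + sqrt lam)) * frequency_ball.sup_const r0 lam U x0 < \<bar>frequency_ball.V lam U p\<bar>"
    if "frequency_ball r0 K lam U x0" for lam and U :: "real^'n \<Rightarrow> real" and x0
  proof (rule ccontr)
    interpret frequency_ball r0 K lam U x0 by fact
    define T where "T = exp (- c * (1 + sqrt lam)) * sup_const"
    define s where "s = sqrt lam"
    have s: "s > 0" using lam by (simp add: s_def)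
    assume "\<not> ?thesis"
    then have T: "\<bar>U p\<bar> \<le> T \<and> \<bar>V p\<bar> \<le> T" if "p \<in> cball x0 t" for p
      using that by (force simp: T_def not_less)
    have "avg (r0 / 2) \<le> q powr (growth_const TYPE('n) * K * s) * avg t"
      unfolding q_def s_def by (rule avg_growth) (use t r0 in auto)
    also have "\<dots> \<le> q powr (growth_const TYPE('n) * K * s) * (?b * (2 * T\<^sup>2 * exp (2 * sqrt lam * t)))"
      by (intro mult_left_mono avg_le T) (use t r0 in auto)
    finally have A: "avg (r0 / 2) \<le> q powr (growth_const TYPE('n) * K * s) * (?b * (2 * T\<^sup>2 * exp (2 * s * t)))"
      by (simp add: s_def)
    have "sup_const\<^sup>2 = 4 * 4 ^ (CARD('n) + 1) / ?b * (2 * (1 + (r0 / 2)\<^sup>2)\<^sup>2) * exp (2 * s * r0) * avg (r0 / 2)"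
      unfolding sup_const_def using avg_nonneg[of "r0 / 2"] b by (simp add: s_def)
    also have "\<dots> \<le> 4 * 4 ^ (CARD('n) + 1) / ?b * (2 * (1 + (r0 / 2)\<^sup>2)\<^sup>2) * exp (2 * s * r0)
       * (q powr (growth_const TYPE('n) * K * s) * (?b * (2 * T\<^sup>2 * exp (2 * s * t))))"
      using A b by (intro mult_left_mono) auto
    also have "\<dots> = k * exp (2 * s * r0 + growth_const TYPE('n) * K * ln q * s + 2 * s * t) * T\<^sup>2"
      using q by (simp add: k_def exp_add powr_def mult_ac)
    also have "\<dots> = k * exp (2 * s * r0 + growth_const TYPE('n) * K * ln q * s + 2 * s * t) * (exp (- 2 * c * (1 + s)) * sup_const\<^sup>2)"
      by (simp add: T_def s_def power_mult_distrib mult.assoc flip: exp_double)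
    also have "\<dots> = k * exp (2 * s * r0 + growth_const TYPE('n) * K * ln q * s + 2 * s * t - 2 * c * (1 + s)) * sup_const\<^sup>2"
      by (simp add: exp_diff exp_minus exp_add field_simps)
    also have "\<dots> \<le> k * exp (- \<bar>ln (2 * k)\<bar> * (1 + s)) * sup_const\<^sup>2"
    proof (intro mult_right_mono mult_left_mono)
      have "2 * s * t \<le> s * r0" using t s by (simp add: field_simps)
      moreover have "growth_const TYPE('n) * K * ln q * s \<le> growth_const TYPE('n) * K * ln q * (1 + s)" "s * r0 \<le> (1 + s) * r0"
        using g r0 by (auto intro!: mult_left_mono mult_right_mono)
      moreover have "0 \<le> \<bar>ln (2 * k)\<bar> * (1 + s)" "0 \<le> (1 + s) * r0" "0 \<le> growth_const TYPE('n) * K * ln q * (1 + s)" using s r0 g by auto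
      moreover have "2 * c * (1 + s) = 2 * (\<bar>ln (2 * k)\<bar> * (1 + s)) + 8 * ((1 + s) * r0) + 2 * (growth_const TYPE('n) * K * ln q * (1 + s))"
        by (simp add: c_def algebra_simps)
      ultimately have "2 * s * r0 + growth_const TYPE('n) * K * ln q * s + 2 * s * t - 2 * c * (1 + s) \<le> - \<bar>ln (2 * k)\<bar> * (1 + s)"
        unfolding minus_mult_left[symmetric] mult.assoc by linarith
      then show "exp (2 * s * r0 + growth_const TYPE('n) * K * ln q * s + 2 * s * t - 2 * c * (1 + s)) \<le> exp (- \<bar>ln (2 * k)\<bar> * (1 + s))"
        by simp
    qed (use k in auto)
    also have "\<dots> \<le> 1 / 2 * sup_const\<^sup>2"
      using exp_absorb[of "2 * k" s "\<bar>ln (2 * k)\<bar>"] k s by (intro mult_right_mono) auto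
    finally have "sup_const\<^sup>2 \<le> 1 / 2 * sup_const\<^sup>2" .
    then show False using sup_const_pos by simp
  qed
  then show ?thesis using c by blast
qed


text \<open>Symmetric second difference with Taylor remainders of order 3: the values enter divided
  by h^2, the third derivative multiplied by \<open>h\<close>.\<close>

lemma second_derivative_bound:
  fixes f :: "nat \<Rightarrow> real \<Rightarrow> real"
  assumes h: "h > 0" and der: "\<And>k t. \<bar>t\<bar> \<le> h \<Longrightarrow> (f k has_real_derivative f (Suc k) t) (at t)"
    and a: "\<And>t. \<bar>t\<bar> \<le> h \<Longrightarrow> \<bar>f 0 t\<bar> \<le> a" and b: "\<And>t. \<bar>t\<bar> \<le> h \<Longrightarrow> \<bar>f 3 t\<bar> \<le> b"
  shows "\<bar>f 2 0\<bar> \<le> 4 * a / h\<^sup>2 + h * b / 3"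
proof -
  have D: "\<forall>m t. m < 3 \<and> - h \<le> t \<and> t \<le> h \<longrightarrow> (f m has_real_derivative f (Suc m) t) (at t)"
    using der by (auto simp: abs_le_iff)
  obtain t where t: "0 < t" "t < h" "f 0 h = (\<Sum>m<3. f m 0 / fact m * (h - 0) ^ m) + f 3 t / fact 3 * (h - 0) ^ 3"
    using Taylor_up[of 3 f "f 0" "- h" h 0] D h by auto
  obtain u where u: "- h < u" "u < 0" "f 0 (- h) = (\<Sum>m<3. f m 0 / fact m * (- h - 0) ^ m) + f 3 u / fact 3 * (- h - 0) ^ 3"
    using Taylor_down[of 3 f "f 0" "- h" h 0] D h by auto
  have "h\<^sup>2 * f 2 0 = f 0 h + f 0 (- h) - 2 * f 0 0 - h ^ 3 / 6 * (f 3 t - f 3 u)"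
    unfolding t(3) u(3) by (simp add: lessThan_nat_numeral fact_numeral numeral_3_eq_3[symmetric] field_simps) 
  moreover have "\<bar>f 0 h\<bar> \<le> a" "\<bar>f 0 (- h)\<bar> \<le> a" "\<bar>f 0 0\<bar> \<le> a" using a h by auto
  moreover have "h ^ 3 / 6 * \<bar>f 3 t - f 3 u\<bar> \<le> h ^ 3 / 6 * (2 * b)"
    using b[of t] b[of u] t(1,2) u(1,2) h by (intro mult_left_mono) auto
  moreover have "h ^ 3 / 6 * \<bar>f 3 t - f 3 u\<bar> = \<bar>h ^ 3 / 6 * (f 3 t - f 3 u)\<bar>" using h by (simp add: abs_mult)
  ultimately have "\<bar>h\<^sup>2 * f 2 0\<bar> \<le> 4 * a + h ^ 3 / 6 * (2 * b)" by linarith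
  then have "h\<^sup>2 * \<bar>f 2 0\<bar> \<le> h\<^sup>2 * (4 * a / h\<^sup>2 + h * b / 3)"
    using h by (simp add: abs_mult algebra_simps eval_nat_numeral)
  then show ?thesis by (rule mult_left_le_imp_le) (use h in simp)
qed

lemma laplacian_eq_dir_deriv: "laplacian U p = (\<Sum>i\<in>UNIV. (dir_deriv (axis i 1) ^^ 2) U p)"
proof -
  have "(dir_deriv (axis i 1) ^^ 2) U p = partial_deriv i (partial_deriv i U) p" for i
    unfolding dir_deriv_axis[abs_def] numeral_2_eq_2 by (simp add: dir_deriv_axis[abs_def])
  then show ?thesis by (simp add: laplacian_def)
qed

text \<open>Pure second derivatives are bounded by values of \<open>U\<close> and by third
  derivatives. The number 48 is 8 times 2 times 3, from \<open>line_iterated_bound\<close> with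
  radius r0 / 2 and k = 3.\<close>

lemma (in frequency_ball) V_bound:
  assumes t: "0 < t" "2 * t \<le> r0 / 8" and h: "0 < h" "h \<le> t" and a: "\<And>p. p \<in> cball x0 (2 * t) \<Longrightarrow> \<bar>U p\<bar> \<le> a"
    and p: "p \<in> cball x0 t"
  shows "\<bar>V p\<bar> \<le> real CARD('n) * (4 * a / h\<^sup>2 + h * ((48 * line_const TYPE('n) / r0) ^ 3 * sup_const) / 3) + lam * a"
proof -
  have "\<bar>(dir_deriv (axis i 1) ^^ 2) U p\<bar> \<le> 4 * a / h\<^sup>2 + h * ((48 * line_const TYPE('n) / r0) ^ 3 * sup_const) / 3" for i
  proof -
    define f where "f k t = (dir_deriv (axis i 1) ^^ k) U (p + t *\<^sub>R axis i 1)" for k t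
    have near: "p + \<tau> *\<^sub>R axis i 1 \<in> cball x0 (2 * t)" if "\<bar>\<tau>\<bar> \<le> h" for \<tau>
      using dist_triangle[of x0 "p + \<tau> *\<^sub>R axis i 1" p] p h that by (simp add: dist_norm)
    have "\<bar>f 2 0\<bar> \<le> 4 * a / h\<^sup>2 + h * ((48 * line_const TYPE('n) / r0) ^ 3 * sup_const) / 3"
    proof (rule second_derivative_bound[OF h(1)])
      fix \<tau> :: real assume \<tau>: "\<bar>\<tau>\<bar> \<le> h"
      show "\<bar>f 0 \<tau>\<bar> \<le> a" using a[OF near[OF \<tau>]] by (simp add: f_def)
      have "\<bar>f 3 \<tau>\<bar> \<le> (8 * line_const TYPE('n) / (r0 / 2) * real 3) ^ 3 * sup_const"
        unfolding f_def
        by (rule line_iterated_bound[OF eig_V lam half_ball _ lift_le_sup_const]) (use near[OF \<tau>] t r0 in auto)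
      then show "\<bar>f 3 \<tau>\<bar> \<le> (48 * line_const TYPE('n) / r0) ^ 3 * sup_const" by (simp add: field_simps)
      fix k
      have "real_analytic_on (ball x0 r0) ((dir_deriv (axis i 1) ^^ k) U)"
        using eig_pair_iterated_dir_deriv[OF eig_V, where k = k] by (simp add: eig_pair_def)
      moreover have "p + \<tau> *\<^sub>R axis i 1 \<in> ball x0 r0" using near[OF \<tau>] t r0 by auto
      ultimately show "(f k has_real_derivative f (Suc k) \<tau>) (at \<tau>)"
        unfolding f_def[abs_def] by (simp add: line_has_derivative)
    qed
    then show ?thesis by (simp add: f_def)
  qed
  then have "\<bar>laplacian U p\<bar> \<le> (\<Sum>i\<in>(UNIV::'n set). 4 * a / h\<^sup>2 + h * ((48 * line_const TYPE('n) / r0) ^ 3 * sup_const) / 3)"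
    unfolding laplacian_eq_dir_deriv by (intro order_trans[OF sum_abs] sum_mono)
  moreover have "lam * \<bar>U p\<bar> \<le> lam * a" using a[of p] p t lam by (intro mult_left_mono) auto
  moreover have "\<bar>V p\<bar> \<le> \<bar>laplacian U p\<bar> + lam * \<bar>U p\<bar>"
    unfolding V_def using lam by (simp add: abs_mult order_trans[OF abs_triangle_ineq4])
  ultimately show ?thesis by simp
qed


text \<open>
  A second difference quotient of width \<open>exp (- c (1 + \<surd>\<lambda>))\<close> approximates the Laplacian well enough.
\<close>

lemma V_small_of_U_small:
  assumes t: "0 < t" "2 * t \<le> r0 / 8" and c: "c \<ge> 0"
  shows "\<exists>c'\<ge>c. \<forall>lam (U :: real^'n \<Rightarrow> real) x0. frequency_ball r0 K lam U x0 \<longrightarrow>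
    (\<forall>p\<in>cball x0 (2 * t). \<bar>U p\<bar> \<le> exp (- c' * (1 + sqrt lam)) * frequency_ball.sup_const r0 lam U x0) \<longrightarrow>
    (\<forall>p\<in>cball x0 t. \<bar>frequency_ball.V lam U p\<bar> \<le> exp (- c * (1 + sqrt lam)) * frequency_ball.sup_const r0 lam U x0)"
proof -
  define n where "n = real CARD('n)"
  define k3 where "k3 = (48 * line_const TYPE('n) / r0) ^ 3"
  \<comment> \<open>The width \<open>a * E\<close> used below must not exceed \<open>t\<close>; the
    second bound makes the third-derivative term at most a third of the target.\<close>
  define a where "a = min t (1 / (n * k3))"
  define k where "k = 12 * n / a\<^sup>2"
  \<comment> \<open>Of the three copies of \<open>c\<close>, two compensate the division by h^2 and
    one is the target. The summand 2 + ln 3 absorbs the factor \<open>lam\<close>, which is at most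
    exp (2 \<surd>\<lambda>), and the last one absorbs \<open>k\<close>.\<close>
  define c' where "c' = 3 * c + (2 + ln 3) + \<bar>ln k\<bar>"
  have r0: "r0 > 0" using t by simp
  have n: "n > 0" by (simp add: n_def)
  have k3: "k3 > 0" unfolding k3_def using line_const_pos[where ?'n = 'n] r0 by (intro zero_less_power divide_pos_pos) auto
  have a: "a > 0" "a \<le> t" "a \<le> 1 / (n * k3)" using t n k3 by (auto simp: a_def)
  have k: "k > 0" using n a by (simp add: k_def)
  have ln3: "ln (3 :: real) \<ge> 0" by simp
  then have c': "c' \<ge> c" using c abs_ge_zero[of "ln k"] unfolding c'_def by linarith
  have main: "\<bar>frequency_ball.V lam U p\<bar> \<le> exp (- c * (1 + sqrt lam)) * frequency_ball.sup_const r0 lam U x0"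
    if fb: "frequency_ball r0 K lam U x0" and p: "p \<in> cball x0 t"
      and small: "\<forall>p\<in>cball x0 (2 * t). \<bar>U p\<bar> \<le> exp (- c' * (1 + sqrt lam)) * frequency_ball.sup_const r0 lam U x0"
    for lam and U :: "real^'n \<Rightarrow> real" and x0 p
  proof -
    interpret frequency_ball r0 K lam U x0 by fact
    define s where "s = sqrt lam"
    have s: "s > 0" "s * s = lam" using lam by (auto simp: s_def)
    define E P Q where "E = exp (- c * (1 + s))" and "P = exp (- (2 + ln 3) * (1 + s))" and "Q = exp (- \<bar>ln k\<bar> * (1 + s))"
    have \<eta>: "exp (- c' * (1 + s)) = E * (E * E) * P * Q"
      by (simp add: E_def P_def Q_def c'_def algebra_simps flip: exp_add)
    have E: "E > 0" "E \<le> 1" using c s by (auto simp: E_def)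
    have "- (2 + ln 3) * (1 + s) \<le> 0" by (rule mult_nonpos_nonneg) (use s(1) ln3 in linarith)+
    then have P: "P > 0" "P \<le> 1" unfolding P_def by simp_all
    have lamP: "lam * P \<le> 1 / 3"
    proof -
      have "lam \<le> exp s * exp s" unfolding s(2)[symmetric] using exp_ge_add_one_self[of s] s(1) by (intro mult_mono, linarith+) 
      also have "\<dots> = exp (2 * s)" by (simp flip: exp_add)
      finally have "lam * P \<le> exp (2 * s) * P" using P by (intro mult_right_mono) auto
      also have "\<dots> = exp (- (2 + s * ln 3) - ln 3)" by (simp add: P_def algebra_simps flip: exp_add)
      also have "\<dots> \<le> exp (- ln 3)"
        using mult_nonneg_nonneg[OF less_imp_le[OF s(1)] ln3] unfolding exp_le_cancel_iff by linarith
      finally show ?thesis by (simp add: exp_minus)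
    qed
    have Q: "Q > 0" "Q \<le> 1" "k * Q \<le> 1"
    proof -
      show "k * Q \<le> 1" unfolding Q_def by (rule exp_absorb) (use k s in auto)
      have "0 \<le> \<bar>ln k\<bar> * (1 + s)" using s(1) by (intro mult_nonneg_nonneg) auto
      then show "Q \<le> 1" unfolding Q_def minus_mult_left[symmetric] by simp
    qed (simp add: Q_def)
    define h where "h = a * E"
    have "a * E \<le> t * 1" by (rule mult_mono) (use a t E in auto)
    then have h: "0 < h" "h \<le> t" using a E by (auto simp: h_def)
    have "\<bar>V p\<bar> \<le> n * (4 * (exp (- c' * (1 + s)) * sup_const) / h\<^sup>2 + h * (k3 * sup_const) / 3) + lam * (exp (- c' * (1 + s)) * sup_const)"
      unfolding n_def k3_def s_def by (rule V_bound[OF t h _ p]) (use small in blast)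
    also have "\<dots> = (E * P * (k * Q) / 3 + h * k3 * n / 3 + E * (E * E) * Q * (lam * P)) * sup_const"
      unfolding \<eta> k_def h_def using a E by (simp add: field_simps power2_eq_square)
    also have "\<dots> \<le> (E / 3 + E / 3 + E * (1 / 3)) * sup_const"
    proof (intro mult_right_mono add_mono)
      show "E * P * (k * Q) / 3 \<le> E / 3"
        using mult_mono[of "E * P" E "k * Q" 1] mult_left_mono[of P 1 E] E P Q k by simp
      have "h * k3 * n \<le> E * ((1 / (n * k3)) * (n * k3))"
        unfolding h_def using mult_right_mono[OF a(3), of "E * (n * k3)"] E n k3 by (simp add: mult_ac)
      then show "h * k3 * n / 3 \<le> E / 3" using n k3 by simp
      have "E * (E * E) * Q \<le> E * (1 * 1) * 1" using E Q by (intro mult_mono) auto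
      then show "E * (E * E) * Q * (lam * P) \<le> E * (1 / 3)" using lamP lam E P by (intro mult_mono) auto
    qed (use sup_const_pos in simp)
    finally show ?thesis by (simp add: E_def s_def)
  qed
  show ?thesis
    by (intro exI[of _ c'] conjI c' allI impI ballI) (rule main)
qed


text \<open>The unit of length for disc arguments: an extension along a line is holomorphic on
  radius 80 units and bounded on radius 40; zeros and intervals are placed in radius 4, and the
  maximum principle is used on radius 20, five times as large.\<close>

definition line_step :: "'n::finite itself \<Rightarrow> real \<Rightarrow> real" where
  "line_step _ r0 = line_radius TYPE('n) * (r0 / 2) / 80"

lemma line_step:
  assumes "r0 > 0"
  shows "line_step TYPE('n::finite) r0 > 0" "line_step TYPE('n) r0 \<le> r0 / 1280" "line_radius TYPE('n) * (r0 / 2) = 80 * line_step TYPE('n) r0"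
proof -
  have "line_radius TYPE('n) * (r0 / 2) \<le> 1 / 8 * (r0 / 2)"
    using line_radius(2) assms by (intro mult_right_mono) auto
  then show "line_step TYPE('n) r0 \<le> r0 / 1280" by (simp add: line_step_def)
qed (use line_radius(1)[where ?'n = 'n] assms in \<open>auto simp: line_step_def\<close>)

lemma (in frequency_ball) line_extension_step:
  fixes \<sigma> :: real
  defines "\<sigma> \<equiv> line_step TYPE('n) r0"
  assumes p: "dist x0 p \<le> r0 / 16" and e: "norm e = 1"
  obtains F where "F holomorphic_on ball 0 (80 * \<sigma>)" "\<And>t. \<bar>t\<bar> < 80 * \<sigma> \<Longrightarrow> F (of_real t) = of_real (U (p + t *\<^sub>R e))"
    "\<And>z. norm z < 40 * \<sigma> \<Longrightarrow> norm (F z) \<le> 2 * sup_const"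
proof -
  have "\<exists>F. F holomorphic_on ball 0 (80 * \<sigma>) \<and>
    (\<forall>t. \<bar>t\<bar> < 80 * \<sigma> \<longrightarrow> F (of_real t) = of_real (U (p + t *\<^sub>R e))) \<and>
    (\<forall>z\<in>ball 0 (80 * \<sigma> / 2). norm (F z) \<le> 2 * sup_const)"
    unfolding \<sigma>_def line_step(3)[OF r0, symmetric]
    by (rule line_extension[OF eig_V lam half_ball _ lift_le_sup_const _ e]) (use p r0 in auto)
  then obtain F where "F holomorphic_on ball 0 (80 * \<sigma>)" "\<forall>t. \<bar>t\<bar> < 80 * \<sigma> \<longrightarrow> F (of_real t) = of_real (U (p + t *\<^sub>R e))"
    "\<forall>z\<in>ball 0 (80 * \<sigma> / 2). norm (F z) \<le> 2 * sup_const" by (elim exE conjE)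
  then show ?thesis by (intro that[of F]) simp_all
qed

text \<open>The line from \<open>p\<close> through \<open>q\<close> meets the small ball about
  \<open>q\<close> in a segment on which \<open>U\<close> is at most \<epsilon>. The extension along
  this line carries the smallness back to parameter 0, that is, to \<open>p\<close>.\<close>

lemma (in frequency_ball) U_bound_propagates:
  fixes \<sigma> :: real
  defines "\<sigma> \<equiv> line_step TYPE('n) r0"
  assumes q: "dist x0 q = \<sigma>" and \<tau>: "0 < \<tau>" "\<tau> \<le> \<sigma>" and small: "\<And>x. x \<in> ball q \<tau> \<Longrightarrow> \<bar>U x\<bar> \<le> \<epsilon>"
    and p: "p \<in> cball x0 (\<sigma> / 2)" and k: "k \<ge> 1"
  shows "\<bar>U p\<bar> \<le> 2 * sup_const / 2 ^ k + 2 * \<epsilon> * (240 * \<sigma> / \<tau>) ^ k"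
proof -
  have \<sigma>: "\<sigma> > 0" "\<sigma> \<le> r0 / 1280" unfolding \<sigma>_def by (rule line_step[OF r0])+
  define l where "l = dist p q"
  have l: "\<sigma> / 2 \<le> l" "l \<le> 3 / 2 * \<sigma>"
    using dist_triangle[of x0 q p] dist_triangle[of p q x0] p q by (auto simp: l_def dist_commute)
  define e where "e = (1 / l) *\<^sub>R (q - p)"
  have "norm e = (1 / l) * norm (q - p)" unfolding e_def using l \<sigma> by simp
  then have e: "norm e = 1" using l \<sigma> by (auto simp: l_def dist_norm norm_minus_commute)
  have qe: "q = p + l *\<^sub>R e" using l \<sigma> by (simp add: e_def)
  have "dist x0 p \<le> r0 / 16" using p \<sigma> r0 by simp
  from line_extension_step[OF this e] obtain F where F: "F holomorphic_on ball 0 (80 * \<sigma>)"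
    "\<And>t. \<bar>t\<bar> < 80 * \<sigma> \<Longrightarrow> F (of_real t) = of_real (U (p + t *\<^sub>R e))"
    "\<And>z. norm z < 40 * \<sigma> \<Longrightarrow> norm (F z) \<le> 2 * sup_const"
    unfolding \<sigma>_def[symmetric] by blast
  have "norm (F 0) \<le> 2 * sup_const / 2 ^ k + 2 * \<epsilon> * (12 * (20 * \<sigma>) / \<tau>) ^ k"
  proof (rule holomorphic_bound_of_interval[where R' = "80 * \<sigma>" and \<rho> = "4 * \<sigma>" and a = "l - \<tau> / 2", OF F(1)])
    fix x assume x: "l - \<tau> / 2 \<le> x" "x \<le> l - \<tau> / 2 + \<tau>"
    have "dist q (p + x *\<^sub>R e) = norm ((l - x) *\<^sub>R e)" unfolding qe by (simp add: dist_norm algebra_simps)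
    then have "p + x *\<^sub>R e \<in> ball q \<tau>" using e x \<tau> by simp
    then have "\<bar>U (p + x *\<^sub>R e)\<bar> \<le> \<epsilon>" by (rule small)
    moreover have "\<bar>x\<bar> < 80 * \<sigma>" using x l \<sigma> \<tau> by linarith
    ultimately show "norm (F (of_real x)) \<le> \<epsilon>" using F(2)[of x] by simp
  qed (use \<sigma> \<tau> l k F(3) in auto)
  moreover have "F 0 = of_real (U p)" using F(2)[of 0] \<sigma> by simp
  ultimately show ?thesis by simp
qed

text \<open>The number \<open>k\<close> of nodes is free. Taken proportional to 1 +
  \<surd>\<lambda>, it makes the first term of \<open>U_bound_propagates\<close> as small as
  required, and a larger exponent in the assumed smallness then beats the second.\<close>

lemma U_small_propagates:
  fixes r0 :: real
  defines "\<sigma> \<equiv> line_step TYPE('n::finite) r0"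
  assumes r0: "r0 > 0" and \<tau>: "0 < \<tau>" "\<tau> \<le> \<sigma>" and c: "c \<ge> 0"
  shows "\<exists>c'\<ge>0. \<forall>lam (U :: real^'n \<Rightarrow> real) x0 q. frequency_ball r0 K lam U x0 \<longrightarrow> dist x0 q = \<sigma> \<longrightarrow>
    (\<forall>p\<in>ball q \<tau>. \<bar>U p\<bar> \<le> exp (- c' * (1 + sqrt lam)) * frequency_ball.sup_const r0 lam U x0) \<longrightarrow>
    (\<forall>p\<in>cball x0 (\<sigma> / 2). \<bar>U p\<bar> \<le> exp (- c * (1 + sqrt lam)) * frequency_ball.sup_const r0 lam U x0)"
proof -
  have \<sigma>: "\<sigma> > 0" unfolding \<sigma>_def by (rule line_step(1)[OF r0])
  define L where "L = ln (240 * \<sigma> / \<tau>)"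
  \<comment> \<open>\<open>d * (1 + s)\<close> bounds the number of nodes including the rounding up;
    each node costs a factor \<open>exp L\<close>.\<close>
  define d where "d = (c + ln 4) / ln 2 + 1"
  define c' where "c' = c + ln 4 + d * L"
  have "240 * \<sigma> / \<tau> \<ge> 1" using \<sigma> \<tau> by (simp add: field_simps)
  then have L: "L \<ge> 0" "exp L = 240 * \<sigma> / \<tau>" by (auto simp: L_def)
  have ln4: "ln (4 :: real) > 0" by (rule ln_gt_zero) simp
  have d: "d \<ge> 1" using c ln4 by (simp add: d_def)
  have "d * L \<ge> 0" using d L(1) by simp
  then have c': "c' \<ge> 0" using c ln4 unfolding c'_def by linarith
  have "\<bar>U p\<bar> \<le> exp (- c * (1 + sqrt lam)) * frequency_ball.sup_const r0 lam U x0"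
    if fb: "frequency_ball r0 K lam U x0" and q: "dist x0 q = \<sigma>" and p: "p \<in> cball x0 (\<sigma> / 2)"
      and small: "\<forall>p\<in>ball q \<tau>. \<bar>U p\<bar> \<le> exp (- c' * (1 + sqrt lam)) * frequency_ball.sup_const r0 lam U x0"
    for lam and U :: "real^'n \<Rightarrow> real" and x0 p q
  proof -
    interpret frequency_ball r0 K lam U x0 by fact
    define s where "s = sqrt lam"
    have s: "s > 0" using lam by (simp add: s_def)
    define x where "x = (c * (1 + s) + ln 4) / ln 2"
    define k where "k = nat \<lceil>x\<rceil>"
    define E where "E = exp (- c * (1 + s))"
    have x: "x > 0" unfolding x_def using c s ln4 by (intro divide_pos_pos add_nonneg_pos) auto
    have kx: "real k \<ge> x" "real k \<le> x + 1" "k \<ge> 1" using x unfolding k_def by linarith+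
    have kd: "real k \<le> d * (1 + s)"
    proof -
      have "c * (1 + s) + ln 4 \<le> (c + ln 4) * (1 + s)" using s ln4 by (simp add: algebra_simps)
      then have "x \<le> (c + ln 4) * (1 + s) / ln 2" unfolding x_def by (intro divide_right_mono) auto
      then show ?thesis using kx(2) s by (simp add: d_def algebra_simps)
    qed
    have two: "2 * sup_const / 2 ^ k \<le> E / 2 * sup_const"
    proof -
      have "c * (1 + s) + ln 4 = x * ln 2" by (simp add: x_def)
      also have "\<dots> \<le> real k * ln 2" using kx(1) by (intro mult_right_mono) auto
      finally have "exp (c * (1 + s) + ln 4) \<le> exp (real k * ln 2)" by simp
      then have "exp (c * (1 + s)) * 4 \<le> 2 ^ k" by (simp add: exp_add exp_of_nat_mult)
      then have "E * (exp (c * (1 + s)) * 4) \<le> E * 2 ^ k" by (rule mult_left_mono) (simp add: E_def)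
      moreover have "E * exp (c * (1 + s)) = 1" by (simp add: E_def flip: exp_add)
      ultimately have "4 \<le> E * 2 ^ k" by (simp only: mult.assoc[symmetric] mult_1)
      then show ?thesis using sup_const_pos by (simp add: field_simps)
    qed
    have Qk: "exp (- c' * (1 + s)) * (240 * \<sigma> / \<tau>) ^ k \<le> E / 4"
    proof -
      have "(240 * \<sigma> / \<tau>) ^ k = exp (real k * L)" by (simp add: L(2) exp_of_nat_mult)
      also have "\<dots> \<le> exp (d * (1 + s) * L)" using kd L(1) by (simp add: mult_right_mono)
      finally have "exp (- c' * (1 + s)) * (240 * \<sigma> / \<tau>) ^ k \<le> exp (- c' * (1 + s)) * exp (d * (1 + s) * L)"
        by (rule mult_left_mono) simp
      also have "\<dots> = E * exp (- ln 4 * (1 + s))" by (simp add: E_def c'_def algebra_simps flip: exp_add)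
      also have "exp (- ln 4 * (1 + s)) \<le> exp (- ln (4 :: real))" 
        using mult_pos_pos[OF ln4 s] unfolding exp_le_cancel_iff by (simp add: algebra_simps)
      finally show ?thesis by (simp add: E_def exp_minus)
    qed
    have "\<bar>U p\<bar> \<le> 2 * sup_const / 2 ^ k + 2 * (exp (- c' * (1 + s)) * sup_const) * (240 * \<sigma> / \<tau>) ^ k"
      unfolding \<sigma>_def s_def
      by (rule U_bound_propagates[OF q[unfolded \<sigma>_def] \<tau>[unfolded \<sigma>_def] _ p[unfolded \<sigma>_def] kx(3)]) (use small in blast)
    also have "2 * (exp (- c' * (1 + s)) * sup_const) * (240 * \<sigma> / \<tau>) ^ k = 2 * (exp (- c' * (1 + s)) * (240 * \<sigma> / \<tau>) ^ k) * sup_const"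
      by (simp only: mult_ac)
    also have "2 * sup_const / 2 ^ k + \<dots> \<le> E / 2 * sup_const + 2 * (E / 4) * sup_const"
      using two Qk sup_const_pos by (intro add_mono mult_right_mono mult_left_mono) auto
    finally show ?thesis by (simp add: E_def s_def mult.commute)
  qed
  then show ?thesis by (intro exI[of _ c'] conjI c' allI impI ballI)
qed


section \<open>Zeros on lines and the local measure bound\<close>

lemma (in frequency_ball) nz_iterated_partial:
  assumes "z \<in> ball x0 r0"
  shows "\<exists>is. iterated_partial is U z \<noteq> 0"
proof (rule ccontr)
  assume "\<not> ?thesis"
  then have "\<exists>\<delta>>0. \<forall>y\<in>ball z \<delta>. U y = 0" using real_analytic_on_locally_zero[OF ana(1) assms] by blast
  then obtain \<delta> where \<delta>: "\<delta> > 0" "\<forall>y\<in>ball z \<delta>. U y = 0" by blast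
  then have "ball z \<delta> \<inter> ball x0 r0 \<noteq> {}" using assms by (intro ex_in_conv[THEN iffD1] exI[of _ z]) simp
  then show False using nz_open[OF open_ball, of z \<delta>] \<delta>(2) by blast
qed

text \<open>The extension is centred at \<open>p\<close>, where \<open>U\<close> is not small.
  Points of \<open>cball x0 \<sigma>\<close> are at distance at most 3 \<sigma> from
  \<open>p\<close>, inside the disc of radius 4 \<sigma> in which zeros are counted.\<close>

lemma (in frequency_ball) zeros_on_line:
  fixes \<sigma> :: real and p v :: "real^'n"
  defines "\<sigma> \<equiv> line_step TYPE('n) r0"
  assumes p: "dist x0 p \<le> 2 * \<sigma>" and N: "2 * sup_const / 2 ^ N \<le> \<bar>U p\<bar>" and v: "v $ j = 1"
  shows "finite {t. p + t *\<^sub>R v \<in> {x \<in> cball x0 \<sigma>. U x = 0}} \<and> card {t. p + t *\<^sub>R v \<in> {x \<in> cball x0 \<sigma>. U x = 0}} \<le> N"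
proof -
  have \<sigma>: "\<sigma> > 0" "\<sigma> \<le> r0 / 1280" unfolding \<sigma>_def by (rule line_step[OF r0])+
  have nv: "norm v > 0" using v by auto
  define e where "e = (1 / norm v) *\<^sub>R v"
  have e: "norm e = 1" "v = norm v *\<^sub>R e" using nv by (simp_all add: e_def)
  have "dist x0 p \<le> r0 / 16" using p \<sigma> by simp
  from line_extension_step[OF this e(1)] obtain F where F: "F holomorphic_on ball 0 (80 * \<sigma>)"
    "\<And>t. \<bar>t\<bar> < 80 * \<sigma> \<Longrightarrow> F (of_real t) = of_real (U (p + t *\<^sub>R e))"
    "\<And>z. norm z < 40 * \<sigma> \<Longrightarrow> norm (F z) \<le> 2 * sup_const"
    unfolding \<sigma>_def[symmetric] by blast
  let ?Z = "{z \<in> cball 0 (4 * \<sigma>). F z = 0}" and ?T = "{t. p + t *\<^sub>R v \<in> {x \<in> cball x0 \<sigma>. U x = 0}}"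
  have Z: "finite ?Z \<and> card ?Z \<le> N"
  proof (rule holomorphic_zero_count[OF F(1), where R = "20 * \<sigma>" and S = "2 * sup_const"])
    show "2 * sup_const / 2 ^ N \<le> norm (F 0)" using F(2)[of 0] \<sigma> N by simp
  qed (use \<sigma> F(3) sup_const_pos in auto)
  \<comment> \<open>Rescales the parameter to arc length, since \<open>v\<close> is normalised by
    its component \<open>j\<close> and not by its norm.\<close>
  define \<iota> where "\<iota> t = complex_of_real (norm v * t)" for t
  have "\<iota> ` ?T \<subseteq> ?Z"
  proof
    fix w assume "w \<in> \<iota> ` ?T"
    then obtain t where t: "w = \<iota> t" "p + t *\<^sub>R v \<in> cball x0 \<sigma>" "U (p + t *\<^sub>R v) = 0" by auto
    have "norm (t *\<^sub>R v) = dist p (p + t *\<^sub>R v)" by (simp add: dist_norm)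
    also have "\<dots> \<le> 3 * \<sigma>" using dist_triangle[of p "p + t *\<^sub>R v" x0] p t(2) by (simp add: dist_commute)
    finally have a: "\<bar>norm v * t\<bar> \<le> 3 * \<sigma>" by (simp add: abs_mult mult.commute)
    have pe: "p + (norm v * t) *\<^sub>R e = p + t *\<^sub>R v" using nv by (simp add: e_def)
    have "F w = of_real (U (p + (norm v * t) *\<^sub>R e))"
      unfolding t(1) \<iota>_def by (rule F(2)) (use a \<sigma> in linarith)
    moreover have "norm w \<le> 3 * \<sigma>" unfolding t(1) \<iota>_def norm_of_real using a .
    ultimately show "w \<in> ?Z" using \<sigma> t(3) by (simp add: pe)
  qed
  moreover have "inj_on \<iota> ?T" using nv by (auto simp: inj_on_def \<iota>_def)
  ultimately show ?thesis using Z
    by (meson card_inj_on_le finite_imageD finite_subset order_trans)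
qed

text \<open>By contradiction, with the constants chosen backwards: smallness of \<open>U\<close>
  near \<open>q\<close> spreads to the centre, there it forces \<open>V\<close> to be small, and
  both together contradict \<open>lift_lower_bound\<close>. The gain is that the point lies near a
  prescribed \<open>q\<close>.\<close>

lemma exists_large_U:
  fixes r0 :: real
  defines "\<sigma> \<equiv> line_step TYPE('n::finite) r0"
  assumes r0: "r0 > 0" and K: "K \<ge> 0" and \<tau>: "0 < \<tau>" "\<tau> \<le> \<sigma>"
  shows "\<exists>c\<ge>0. \<forall>lam (U :: real^'n \<Rightarrow> real) x0 q. frequency_ball r0 K lam U x0 \<longrightarrow> dist x0 q = \<sigma> \<longrightarrow>
    (\<exists>p\<in>ball q \<tau>. exp (- c * (1 + sqrt lam)) * frequency_ball.sup_const r0 lam U x0 < \<bar>U p\<bar>)"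
proof -
  have \<sigma>: "\<sigma> > 0" "\<sigma> \<le> r0 / 1280" unfolding \<sigma>_def by (rule line_step[OF r0])+
  have t: "0 < \<sigma> / 4" "\<sigma> / 4 \<le> r0 / 2" "2 * (\<sigma> / 4) \<le> r0 / 8" using \<sigma> by auto
  obtain c1 where c1: "c1 \<ge> 0" "\<forall>lam (U :: real^'n \<Rightarrow> real) x0. frequency_ball r0 K lam U x0 \<longrightarrow>
    (\<exists>p\<in>cball x0 (\<sigma> / 4). exp (- c1 * (1 + sqrt lam)) * frequency_ball.sup_const r0 lam U x0 < \<bar>U p\<bar> \<or>
      exp (- c1 * (1 + sqrt lam)) * frequency_ball.sup_const r0 lam U x0 < \<bar>frequency_ball.V lam U p\<bar>)"
    using lift_lower_bound[OF t(1,2) K, where ?'n = 'n] by blast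
  obtain c2 where c2: "c2 \<ge> c1" "\<forall>lam (U :: real^'n \<Rightarrow> real) x0. frequency_ball r0 K lam U x0 \<longrightarrow>
    (\<forall>p\<in>cball x0 (2 * (\<sigma> / 4)). \<bar>U p\<bar> \<le> exp (- c2 * (1 + sqrt lam)) * frequency_ball.sup_const r0 lam U x0) \<longrightarrow>
    (\<forall>p\<in>cball x0 (\<sigma> / 4). \<bar>frequency_ball.V lam U p\<bar> \<le> exp (- c1 * (1 + sqrt lam)) * frequency_ball.sup_const r0 lam U x0)"
    using V_small_of_U_small[OF t(1,3) c1(1), where ?'n = 'n] by blast
  have "c2 \<ge> 0" using c1 c2 by simp
  then obtain c3 where c3: "c3 \<ge> 0" "\<forall>lam (U :: real^'n \<Rightarrow> real) x0 q. frequency_ball r0 K lam U x0 \<longrightarrow> dist x0 q = \<sigma> \<longrightarrow>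
    (\<forall>p\<in>ball q \<tau>. \<bar>U p\<bar> \<le> exp (- c3 * (1 + sqrt lam)) * frequency_ball.sup_const r0 lam U x0) \<longrightarrow>
    (\<forall>p\<in>cball x0 (\<sigma> / 2). \<bar>U p\<bar> \<le> exp (- c2 * (1 + sqrt lam)) * frequency_ball.sup_const r0 lam U x0)"
    using U_small_propagates[OF r0 \<tau>[unfolded \<sigma>_def], of c2 K] unfolding \<sigma>_def[symmetric] by blast
  have "\<exists>p\<in>ball q \<tau>. exp (- c3 * (1 + sqrt lam)) * frequency_ball.sup_const r0 lam U x0 < \<bar>U p\<bar>"
    if fb: "frequency_ball r0 K lam U x0" and q: "dist x0 q = \<sigma>" for lam and U :: "real^'n \<Rightarrow> real" and x0 q
  proof (rule ccontr)
    interpret frequency_ball r0 K lam U x0 by fact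
    assume "\<not> ?thesis"
    then have "\<forall>p\<in>ball q \<tau>. \<bar>U p\<bar> \<le> exp (- c3 * (1 + sqrt lam)) * sup_const" by (simp add: not_less)
    then have U: "\<forall>p\<in>cball x0 (\<sigma> / 2). \<bar>U p\<bar> \<le> exp (- c2 * (1 + sqrt lam)) * sup_const" using c3(2) fb q by blast
    then have V: "\<forall>p\<in>cball x0 (\<sigma> / 4). \<bar>V p\<bar> \<le> exp (- c1 * (1 + sqrt lam)) * sup_const" using c2(2) fb by simp
    obtain p where p: "p \<in> cball x0 (\<sigma> / 4)" "exp (- c1 * (1 + sqrt lam)) * sup_const < \<bar>U p\<bar> \<or> exp (- c1 * (1 + sqrt lam)) * sup_const < \<bar>V p\<bar>"
      using c1(2) fb by blast
    have "exp (- c2 * (1 + sqrt lam)) * sup_const \<le> exp (- c1 * (1 + sqrt lam)) * sup_const"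
      using mult_right_mono[OF c2(1), of "1 + sqrt lam"] lam sup_const_pos by (intro mult_right_mono) auto
    moreover have "\<bar>U p\<bar> \<le> exp (- c2 * (1 + sqrt lam)) * sup_const" using U p(1) \<sigma> by auto
    ultimately show False using p V by force
  qed
  then show ?thesis by (intro exI[of _ c3] conjI c3(1) allI impI)
qed

text \<open>An error of one radius in the zero and one in the projection centre add up to
  \<open>line_step\<close> divided by 8 n, the tolerance in
  \<open>hausdorff_zero_set_le\<close>.\<close>

definition local_radius :: "'n::finite itself \<Rightarrow> real \<Rightarrow> real" where
  "local_radius _ r0 = line_step TYPE('n) r0 / (16 * real CARD('n))"

text \<open>For each coordinate direction a point where \<open>U\<close> is not small is found near
  x0 + \<sigma> e_j and serves as centre of projection. Its lower bound exp (- c (1 +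
  \<surd>\<lambda>)) becomes a zero count linear in 1 + \<surd>\<lambda>.\<close>

lemma hausdorff_zero_set_local:
  fixes r0 :: real
  assumes r0: "r0 > 0" and K: "K \<ge> 0"
  shows "\<exists>C\<ge>0. \<forall>lam (U :: real^'n \<Rightarrow> real) x0. frequency_ball r0 K lam U x0 \<longrightarrow>
    hausdorff (CARD('n) - 1) {x \<in> cball x0 (local_radius TYPE('n) r0). U x = 0} \<le> ennreal (C * (1 + sqrt lam))"
proof -
  define \<sigma> \<rho> where "\<sigma> = line_step TYPE('n) r0" and "\<rho> = local_radius TYPE('n) r0"
  have \<sigma>: "\<sigma> > 0" "\<sigma> \<le> r0 / 1280" unfolding \<sigma>_def by (rule line_step[OF r0])+
  have n1: "real CARD('n) \<ge> 1" by simp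
  have \<rho>: "\<rho> = \<sigma> / (16 * real CARD('n))" by (simp add: \<rho>_def \<sigma>_def local_radius_def)
  have "\<sigma> / (16 * real CARD('n)) \<le> \<sigma> / 1" using \<sigma>(1) n1 by (intro divide_left_mono) linarith+
  then have \<rho>': "0 < \<rho>" "\<rho> \<le> \<sigma>" using \<sigma> by (auto simp: \<rho>)
  obtain c where c: "c \<ge> 0" "\<forall>lam (U :: real^'n \<Rightarrow> real) x0 q. frequency_ball r0 K lam U x0 \<longrightarrow> dist x0 q = \<sigma> \<longrightarrow>
    (\<exists>p\<in>ball q \<rho>. exp (- c * (1 + sqrt lam)) * frequency_ball.sup_const r0 lam U x0 < \<bar>U p\<bar>)"
    using exists_large_U[OF r0 K \<rho>'[unfolded \<sigma>_def]] unfolding \<sigma>_def[symmetric] by blast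
  define D where "D = (20 * real CARD('n) * \<sigma>) ^ (CARD('n) - 1) * crofton_const TYPE('n) * 2 ^ CARD('n)"
  have D: "D \<ge> 0" unfolding D_def using \<sigma> crofton_const_pos[where ?'n = 'n] by (intro mult_nonneg_nonneg) auto
  define b where "b = (c + ln 2) / ln 2 + 1"
  have b: "b \<ge> 0" unfolding b_def using c(1) by (intro add_nonneg_nonneg divide_nonneg_nonneg) auto
  have "hausdorff (CARD('n) - 1) {x \<in> cball x0 \<rho>. U x = 0} \<le> ennreal (real CARD('n) * D * b * (1 + sqrt lam))"
    if fb: "frequency_ball r0 K lam U x0" for lam and U :: "real^'n \<Rightarrow> real" and x0
  proof -
    interpret frequency_ball r0 K lam U x0 by fact
    define s where "s = sqrt lam"
    have s: "s > 0" using lam by (simp add: s_def)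
    \<comment> \<open>The solution of 2 / 2^x = exp (- c (1 + s)); \<open>N\<close> is its rounding
      up.\<close>
    define x where "x = (c * (1 + s) + ln 2) / ln 2"
    define N where "N = nat \<lceil>x\<rceil>"
    have x: "x \<ge> 0" unfolding x_def using c(1) s by (intro divide_nonneg_nonneg add_nonneg_nonneg) auto
    have Nx: "real N \<ge> x" "real N \<le> x + 1" using x unfolding N_def by linarith+
    have Nb: "real N \<le> b * (1 + s)"
    proof -
      have "c * (1 + s) + ln 2 \<le> (c + ln 2) * (1 + s)" using s by (simp add: algebra_simps)
      then have "x \<le> (c + ln 2) * (1 + s) / ln 2" unfolding x_def by (intro divide_right_mono) auto
      then show ?thesis using Nx(2) s by (simp add: b_def algebra_simps)
    qed
    have two: "2 * sup_const / 2 ^ N \<le> exp (- c * (1 + s)) * sup_const"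
    proof -
      have "c * (1 + s) + ln 2 = x * ln 2" by (simp add: x_def)
      also have "\<dots> \<le> real N * ln 2" using Nx(1) by (intro mult_right_mono) auto
      finally have "exp (c * (1 + s) + ln 2) \<le> exp (real N * ln 2)" by simp
      then have "exp (c * (1 + s)) * 2 \<le> 2 ^ N" by (simp add: exp_add exp_of_nat_mult)
      then have "exp (- c * (1 + s)) * (exp (c * (1 + s)) * 2) \<le> exp (- c * (1 + s)) * 2 ^ N" by (rule mult_left_mono) simp
      moreover have "exp (- c * (1 + s)) * exp (c * (1 + s)) = 1" by (simp flip: exp_add)
      ultimately have "2 \<le> exp (- c * (1 + s)) * 2 ^ N" by (simp only: mult.assoc[symmetric] mult_1)
      then show ?thesis using sup_const_pos by (simp add: field_simps)
    qed
    have "\<exists>p. p \<in> ball (x0 + \<sigma> *\<^sub>R axis j 1) \<rho> \<and> 2 * sup_const / 2 ^ N \<le> \<bar>U p\<bar>" for j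
    proof -
      have "dist x0 (x0 + \<sigma> *\<^sub>R axis j 1) = \<sigma>" using \<sigma> by (simp add: dist_norm)
      then obtain p where "p \<in> ball (x0 + \<sigma> *\<^sub>R axis j 1) \<rho>" "exp (- c * (1 + s)) * sup_const < \<bar>U p\<bar>"
        using c(2) fb unfolding s_def by blast
      with two show ?thesis by (intro exI[of _ p]) auto
    qed
    then obtain p where p: "\<And>j. p j \<in> ball (x0 + \<sigma> *\<^sub>R axis j 1) \<rho>" "\<And>j. 2 * sup_const / 2 ^ N \<le> \<bar>U (p j)\<bar>" by metis
    have "hausdorff (CARD('n) - 1) {x \<in> cball x0 \<rho>. U x = 0} \<le>
      of_nat CARD('n) * ennreal ((20 * real CARD('n) * \<sigma>) ^ (CARD('n) - 1) * crofton_const TYPE('n) * (2 ^ CARD('n) * real N))"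
    proof (rule hausdorff_zero_set_le[OF ana(1) open_ball _ \<sigma>(1)])
      show sub: "cball x0 \<rho> \<subseteq> ball x0 r0" using \<rho>' \<sigma> r0 by (simp add: cball_subset_ball_iff)
      show "\<exists>is. iterated_partial is U z \<noteq> 0" if "z \<in> cball x0 \<rho>" for z
        using nz_iterated_partial sub that by blast
      show "norm (x - p j + \<sigma> *\<^sub>R axis j 1) \<le> \<sigma> / (8 * real CARD('n))" if x: "x \<in> cball x0 \<rho>" for j x
      proof -
        have "norm (x - p j + \<sigma> *\<^sub>R axis j 1) \<le> norm (x - x0) + norm (x0 + \<sigma> *\<^sub>R axis j 1 - p j)"
          using norm_triangle_ineq[of "x - x0" "x0 + \<sigma> *\<^sub>R axis j 1 - p j"] by (simp add: algebra_simps)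
        also have "\<dots> \<le> \<rho> + \<rho>" using x p(1)[of j] by (intro add_mono) (auto simp: dist_norm norm_minus_commute)
        finally show ?thesis by (simp add: \<rho>)
      qed
      fix j and v :: "real^'n" assume v: "v $ j = 1"
      have "dist x0 (p j) \<le> 2 * \<sigma>"
      proof -
        have "dist x0 (x0 + \<sigma> *\<^sub>R axis j 1) = \<sigma>" using \<sigma> by (simp add: dist_norm)
        then show ?thesis using dist_triangle[of x0 "p j" "x0 + \<sigma> *\<^sub>R axis j 1"] p(1)[of j] \<rho>' by simp
      qed
      from zeros_on_line[OF this[unfolded \<sigma>_def] p(2) v, folded \<sigma>_def]
      have Z: "finite {t. p j + t *\<^sub>R v \<in> {x \<in> cball x0 \<sigma>. U x = 0}}" "card {t. p j + t *\<^sub>R v \<in> {x \<in> cball x0 \<sigma>. U x = 0}} \<le> N" by auto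
      have sub: "{t. p j + t *\<^sub>R v \<in> {x \<in> cball x0 \<rho>. U x = 0}} \<subseteq> {t. p j + t *\<^sub>R v \<in> {x \<in> cball x0 \<sigma>. U x = 0}}"
        using \<rho>' by auto
      show "finite {t. p j + t *\<^sub>R v \<in> {x \<in> cball x0 \<rho>. U x = 0}} \<and> card {t. p j + t *\<^sub>R v \<in> {x \<in> cball x0 \<rho>. U x = 0}} \<le> N"
        using finite_subset[OF sub Z(1)] order_trans[OF card_mono[OF Z(1) sub] Z(2)] by blast
    qed
    also have "\<dots> = ennreal (real CARD('n) * (D * real N))"
      using D by (simp add: D_def mult.assoc ennreal_mult'[symmetric] ennreal_of_nat_eq_real_of_nat)
    also have "\<dots> \<le> ennreal (real CARD('n) * (D * (b * (1 + s))))"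
      using Nb D by (intro ennreal_leI mult_left_mono) auto
    finally show ?thesis by (simp add: s_def mult.assoc)
  qed
  then show ?thesis unfolding \<rho>_def using D b by (intro exI[of _ "real CARD('n) * D * b"] conjI allI impI) auto
qed

section \<open>Small eigenvalues\<close>

text \<open>The variance of \<open>p + q\<close> is nonnegative, so the covariance is at least minus
  half the sum of the variances.\<close>

lemma bump_covariance_ge:
  fixes p q :: "'a::euclidean_space \<Rightarrow> real"
  assumes p: "continuous_on (cball 0 1) p" and q: "continuous_on (cball 0 1) q"
    and m: "m = (LINT y|lborel. bump y ^ 2 * p y)" and k: "k = (LINT y|lborel. bump y ^ 2 * q y)"
  shows "(LINT y|lborel. bump y ^ 2 * (p y * q y)) \<ge> m * k / bump_vol TYPE('a) 2
    - ((LINT y|lborel. bump y ^ 2 * (p y)\<^sup>2) - m\<^sup>2 / bump_vol TYPE('a) 2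
      + ((LINT y|lborel. bump y ^ 2 * (q y)\<^sup>2) - k\<^sup>2 / bump_vol TYPE('a) 2)) / 2"
proof -
  let ?v = "bump_vol TYPE('a) 2"
  have v: "?v > 0" by (rule bump_vol_pos) simp
  have i: "integrable lborel (\<lambda>y. bump y ^ 2 * (p y)\<^sup>2)" "integrable lborel (\<lambda>y. bump y ^ 2 * (q y)\<^sup>2)"
    "integrable lborel (\<lambda>y. bump y ^ 2 * (p y * q y))" "integrable lborel (\<lambda>y. bump y ^ 2 * p y)" "integrable lborel (\<lambda>y. bump y ^ 2 * q y)"
    by (intro integrable_bump continuous_intros p q; simp)+
  have mk: "m + k = (LINT y|lborel. bump y ^ 2 * (p y + q y))"
    using i by (simp add: m k distrib_left)
  have "0 \<le> (LINT y|lborel. bump y ^ 2 * (p y + q y - (m + k) / ?v)\<^sup>2)"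
    by (intro Bochner_Integration.integral_nonneg) simp
  also have "\<dots> = (LINT y|lborel. bump y ^ 2 * (p y + q y)\<^sup>2) - (m + k)\<^sup>2 / ?v"
    by (rule bump_variance_eq[OF _ mk]) (intro continuous_intros p q)
  also have "(LINT y|lborel. bump y ^ 2 * (p y + q y)\<^sup>2)
    = (LINT y|lborel. bump y ^ 2 * (p y)\<^sup>2 + 2 * (bump y ^ 2 * (p y * q y)) + bump y ^ 2 * (q y)\<^sup>2)"
    by (rule Bochner_Integration.integral_cong) (auto simp: power2_sum algebra_simps)
  also have "\<dots> = (LINT y|lborel. bump y ^ 2 * (p y)\<^sup>2) + 2 * (LINT y|lborel. bump y ^ 2 * (p y * q y)) + (LINT y|lborel. bump y ^ 2 * (q y)\<^sup>2)"
    using i by simp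
  finally have "(m + k)\<^sup>2 / ?v \<le> (LINT y|lborel. bump y ^ 2 * (p y)\<^sup>2) + 2 * (LINT y|lborel. bump y ^ 2 * (p y * q y)) + (LINT y|lborel. bump y ^ 2 * (q y)\<^sup>2)"
    by simp
  moreover have "(m + k)\<^sup>2 / ?v = m\<^sup>2 / ?v + k\<^sup>2 / ?v + 2 * (m * k / ?v)"
    by (simp add: power2_sum add_divide_distrib)
  ultimately show ?thesis by argo
qed

definition poincare_const :: "'a::euclidean_space itself \<Rightarrow> real" where
  "poincare_const _ = 2 * 2 ^ DIM('a) * measure lborel (ball (0::'a) 1) / bump_vol TYPE('a) 2"

lemma poincare_const_nonneg: "poincare_const TYPE('a::euclidean_space) \<ge> 0"
  unfolding poincare_const_def using bump_vol_pos[of 2, where ?'a = 'a] by simp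

text \<open>The Poincare inequality on the unit ball for the rescaled function, whose squared
  gradient gains the factor R^2.\<close>

lemma bump_avg_variance_le:
  fixes F :: "'a::euclidean_space \<Rightarrow> real"
  assumes F: "has_laplacian_on F F' L S" and S: "cball z R \<subseteq> S" and R: "R > 0"
  shows "bump_avg 2 (\<lambda>y. (F y)\<^sup>2) z R - (bump_avg 2 F z R)\<^sup>2 / bump_vol TYPE('a) 2
    \<le> poincare_const TYPE('a) * (R\<^sup>2 * bump_avg 2 (grad_norm_sq F) z R)"
proof -
  let ?T = "\<lambda>y. z + R *\<^sub>R y"
  have inS: "?T y \<in> S" if "y \<in> cball 0 1" for y using cball_affine_subset[OF S _ order.refl that] R by simp
  have D: "\<And>y. y \<in> S \<Longrightarrow> (F has_derivative F' y) (at y)" using F unfolding has_laplacian_on_def by blast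
  have cF: "continuous_on (cball 0 1) (\<lambda>y. F (?T y))"
    by (rule continuous_on_affine_compose[OF has_laplacian_on_continuous(1)[OF F] S]) (use R in auto)
  define m where "m = bump_avg 2 F z R"
  have m: "m = (LINT y|lborel. bump y ^ 2 * F (?T y))" by (simp add: m_def bump_avg_def)
  have "(LINT y|lborel. bump y ^ 2 * (F (?T y) - m / bump_vol TYPE('a) 2)\<^sup>2) \<le>
    2 * 2 ^ DIM('a) * measure lborel (ball (0::'a) 1) / bump_vol TYPE('a) 2 *
    (LINT y|lborel. bump y ^ 2 * (\<Sum>b\<in>Basis. (R * F' (?T y) b)\<^sup>2))"
  proof (rule bump_poincare[OF order.refl, where f' = "\<lambda>y h. R * F' (?T y) h"])
    fix y :: 'a assume y: "y \<in> cball 0 1"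
    have "(?T has_derivative (\<lambda>h. R *\<^sub>R h)) (at y)" by (auto intro!: derivative_eq_intros)
    from has_derivative_compose[OF this D[OF inS[OF y]]]
    have "((\<lambda>y. F (?T y)) has_derivative (\<lambda>h. F' (?T y) (R *\<^sub>R h))) (at y)" .
    moreover have "F' (?T y) (R *\<^sub>R h) = R * F' (?T y) h" for h
      using linear_cmul[OF has_derivative_linear[OF D[OF inS[OF y]]]] by simp
    ultimately show "((\<lambda>y. F (?T y)) has_derivative (\<lambda>h. R * F' (?T y) h)) (at y)" by simp
  next
    fix b :: 'a assume b: "b \<in> Basis"
    show "continuous_on (cball 0 1) (\<lambda>y. R * F' (?T y) b)"
      by (intro continuous_on_mult_left continuous_on_affine_compose[OF has_laplacian_on_continuous(2)[OF F b] S]) (use R in auto)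
  qed (simp add: m)
  also have "(LINT y|lborel. bump y ^ 2 * (\<Sum>b\<in>Basis. (R * F' (?T y) b)\<^sup>2)) = (LINT y|lborel. R\<^sup>2 * (bump y ^ 2 * grad_norm_sq F (?T y)))"
  proof (rule Bochner_Integration.integral_cong)
    fix y :: 'a
    show "bump y ^ 2 * (\<Sum>b\<in>Basis. (R * F' (?T y) b)\<^sup>2) = R\<^sup>2 * (bump y ^ 2 * grad_norm_sq F (?T y))"
    proof (cases "norm y \<le> 1")
      case True
      then have "y \<in> cball 0 1" by simp
      from grad_norm_sq_eq[OF D[OF inS[OF this]]] show ?thesis
        by (simp add: power_mult_distrib sum_distrib_left[symmetric] mult.left_commute)
    next
      case False
      then have "bump y = 0" by (intro bump_eq_0) simp
      then show ?thesis by simp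
    qed
  qed simp
  also have "\<dots> = R\<^sup>2 * bump_avg 2 (grad_norm_sq F) z R" by (simp add: bump_avg_def)
  finally show ?thesis
    unfolding bump_variance_eq[OF cF m] poincare_const_def by (simp add: bump_avg_def m_def)
qed

text \<open>
  The derivative in \<open>R\<close> of the average of \<open>g\<close> is an average of \<open>h + 2\<lambda>g\<close>, and the averages of the
  harmonic function \<open>h\<close> are known exactly.
\<close>

lemma (in frequency_ball) mean_lift:
  assumes zero: "U x0 = 0" and R: "0 < R" "R \<le> r0 / 4"
  defines "v \<equiv> bump_vol TYPE((real^'n) \<times> real) 3"
  shows "\<bar>bump_avg 2 (exp_lift lam U) (x0, 0) R - V x0 * v * R\<^sup>2 / 12\<bar> \<le> lam * (R\<^sup>2 * v * exp (sqrt lam * r0) * sup_const)"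
    "bump_avg 2 (exp_lift lam V) (x0, 0) R = V x0 * bump_vol TYPE((real^'n) \<times> real) 2"
proof -
  let ?z = "(x0, 0::real)" and ?B = "ball x0 r0" and ?g = "exp_lift lam U" and ?h = "exp_lift lam V"
  have v: "v > 0" unfolding v_def by (rule bump_vol_pos) simp
  have eqs: "\<And>x. x \<in> ?B \<Longrightarrow> laplacian U x = lam * U x + V x" "\<And>x. x \<in> ?B \<Longrightarrow> laplacian V x = - lam * V x"
    using eig_V by (auto simp: eig_pair_def)
  have oB: "open (?B \<times> (UNIV :: real set))" by (intro open_Times) auto
  have "cball x0 R \<subseteq> ?B" using R r0 by (simp add: cball_subset_ball_iff)
  note zR = cball_lift_subset[OF this, of 0]
  obtain g' where g': "has_laplacian_on ?g g' (\<lambda>y. ?h y + 2 * lam * ?g y) (?B \<times> UNIV)"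
    using has_laplacian_on_cong_laplacian[OF exp_lift_has_laplacian[OF ana(1) lam], of "\<lambda>y. ?h y + 2 * lam * ?g y"] eqs(1)
    by (auto simp: exp_lift_def algebra_simps)
  obtain h' where h': "has_laplacian_on ?h h' (\<lambda>y. 0) (?B \<times> UNIV)"
    using has_laplacian_on_cong_laplacian[OF exp_lift_has_laplacian[OF ana(2) lam], of "\<lambda>y. 0"] eqs(2)
    by (auto simp: exp_lift_def algebra_simps)
  have hm: "bump_avg k ?h ?z \<rho> = V x0 * bump_vol TYPE((real^'n) \<times> real) k" if "k \<ge> 1" "\<rho> \<in> {0..R}" for k \<rho>
  proof -
    have "cball ?z \<rho> \<subseteq> ?B \<times> UNIV" using zR subset_cball[of \<rho> R ?z] that by auto
    from harmonic_mean_value[OF oB this h' that(1)] that show ?thesis by (simp add: bump_vol_def exp_lift_def)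
  qed
  show "bump_avg 2 ?h ?z R = V x0 * bump_vol TYPE((real^'n) \<times> real) 2" using hm[of 2 R] R by simp
  define M where "M = v * (exp (sqrt lam * r0) * sup_const)"
  have gM: "\<bar>bump_avg 3 ?g ?z \<rho>\<bar> \<le> M" if \<rho>: "\<rho> \<in> {0..R}" for \<rho>
  proof -
    have i3: "integrable lborel (\<lambda>y::(real^'n) \<times> real. bump y ^ 3 * (exp (sqrt lam * r0) * sup_const))"
      by (intro integrable_bump) auto
    have "\<bar>bump_avg 3 ?g ?z \<rho>\<bar> \<le> (LINT y|lborel. \<bar>bump (y::(real^'n) \<times> real) ^ 3 * ?g (?z + \<rho> *\<^sub>R y)\<bar>)"
      unfolding bump_avg_def by (rule integral_abs_bound)
    also have "\<dots> \<le> (LINT y|lborel. bump (y::(real^'n) \<times> real) ^ 3 * (exp (sqrt lam * r0) * sup_const))"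
    proof (rule integral_mono'[OF i3])
      fix y :: "(real^'n) \<times> real"
      show "0 \<le> bump y ^ 3 * (exp (sqrt lam * r0) * sup_const)" using sup_const_pos by simp
      show "\<bar>bump y ^ 3 * ?g (?z + \<rho> *\<^sub>R y)\<bar> \<le> bump y ^ 3 * (exp (sqrt lam * r0) * sup_const)"
      proof (cases "norm y \<le> 1")
        case True
        have n: "norm (fst y) \<le> 1" "\<bar>snd y\<bar> \<le> 1"
          using norm_fst_le[of "fst y" "snd y"] norm_snd_le[of "snd y" "fst y"] True by auto
        have "\<rho> * norm (fst y) \<le> r0 / 4 * 1" "\<rho> * \<bar>snd y\<bar> \<le> r0 * 1"
          using \<rho> R n by (intro mult_mono; simp)+
        then have "dist x0 (x0 + \<rho> *\<^sub>R fst y) \<le> r0 / 4" "\<rho> * snd y \<le> r0"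
          using \<rho> abs_ge_self[of "\<rho> * snd y"] by (auto simp: dist_norm abs_mult)
        then have "\<bar>U (x0 + \<rho> *\<^sub>R fst y)\<bar> * exp (sqrt lam * (\<rho> * snd y)) \<le> sup_const * exp (sqrt lam * r0)"
          using lam sup_const_pos by (intro mult_mono U_le_sup_const) auto
        then have "\<bar>?g (?z + \<rho> *\<^sub>R y)\<bar> \<le> exp (sqrt lam * r0) * sup_const" by (simp add: exp_lift_def abs_mult mult.commute)
        then show ?thesis by (simp add: abs_mult mult_left_mono)
      next
        case False
        then have "bump y = 0" by (intro bump_eq_0) simp
        then show ?thesis by simp
      qed
    qed
    finally show ?thesis by (simp add: M_def v_def bump_vol_def)
  qed
  \<comment> \<open>Subtracting the quadratic removes the contribution of \<open>h\<close> from the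
    derivative and leaves a remainder with factor \<open>lam\<close>. At 0 the function vanishes
    because U x0 = 0.\<close>
  define \<phi> where "\<phi> \<rho> = bump_avg 2 ?g ?z \<rho> - V x0 * v * \<rho>\<^sup>2 / 12" for \<rho>
  have D: "(\<phi> has_real_derivative \<rho> / 3 * lam * bump_avg 3 ?g ?z \<rho>) (at \<rho> within {0..R})" if \<rho>: "\<rho> \<in> {0..R}" for \<rho>
  proof -
    have "(bump_avg 2 ?g ?z has_real_derivative \<rho> / (2 * real (Suc 2)) * bump_avg (Suc 2) (\<lambda>y. ?h y + 2 * lam * ?g y) ?z \<rho>) (at \<rho> within {0..R})"
      by (rule bump_avg_has_derivative[OF oB zR g' _ \<rho>]) simp
    then have 1: "(bump_avg 2 ?g ?z has_real_derivative \<rho> / 6 * bump_avg 3 (\<lambda>y. ?h y + 2 * lam * ?g y) ?z \<rho>) (at \<rho> within {0..R})"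
      by (simp add: eval_nat_numeral)
    have i: "integrable lborel (\<lambda>y. bump y ^ 3 * ?h (?z + \<rho> *\<^sub>R y))" "integrable lborel (\<lambda>y. bump y ^ 3 * ?g (?z + \<rho> *\<^sub>R y))"
      using \<rho> by (intro integrable_bump continuous_on_affine_compose[OF has_laplacian_on_continuous(1)[OF h'] zR]
        continuous_on_affine_compose[OF has_laplacian_on_continuous(1)[OF g'] zR]; simp)+
    have "bump_avg 3 (\<lambda>y. ?h y + 2 * lam * ?g y) ?z \<rho>
      = (LINT y|lborel. bump y ^ 3 * ?h (?z + \<rho> *\<^sub>R y) + (2 * lam) * (bump y ^ 3 * ?g (?z + \<rho> *\<^sub>R y)))"
      unfolding bump_avg_def by (rule Bochner_Integration.integral_cong) (auto simp: algebra_simps)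
    also have "\<dots> = bump_avg 3 ?h ?z \<rho> + 2 * lam * bump_avg 3 ?g ?z \<rho>" using i by (simp add: bump_avg_def)
    also have "bump_avg 3 ?h ?z \<rho> = V x0 * v" using hm[of 3 \<rho>] \<rho> by (simp add: v_def)
    finally have 2: "bump_avg 3 (\<lambda>y. ?h y + 2 * lam * ?g y) ?z \<rho> = V x0 * v + 2 * lam * bump_avg 3 ?g ?z \<rho>" .
    have "((\<lambda>\<rho>. V x0 * v * \<rho>\<^sup>2 / 12) has_real_derivative V x0 * v * \<rho> / 6) (at \<rho> within {0..R})"
      by (auto intro!: derivative_eq_intros)
    from DERIV_diff[OF 1 this] show ?thesis
      unfolding 2 \<phi>_def[abs_def] by (rule DERIV_cong) (simp add: algebra_simps)
  qed
  have "norm (\<phi> R - \<phi> 0) \<le> (R * lam * M) * norm (R - 0)"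
  proof (rule field_differentiable_bound[OF _ D])
    fix \<rho> assume \<rho>: "\<rho> \<in> {0..R}"
    have "norm (\<rho> / 3 * lam * bump_avg 3 ?g ?z \<rho>) = \<rho> / 3 * lam * \<bar>bump_avg 3 ?g ?z \<rho>\<bar>"
      using \<rho> lam by (simp add: abs_mult)
    also have "\<dots> \<le> R * lam * M" using \<rho> lam gM[OF \<rho>] by (intro mult_mono) auto
    finally show "norm (\<rho> / 3 * lam * bump_avg 3 ?g ?z \<rho>) \<le> R * lam * M" .
  qed (use R in auto)
  moreover have "\<phi> 0 = 0" by (simp add: \<phi>_def bump_avg_0 exp_lift_def zero)
  ultimately show "\<bar>bump_avg 2 ?g ?z R - V x0 * v * R\<^sup>2 / 12\<bar> \<le> lam * (R\<^sup>2 * v * exp (sqrt lam * r0) * sup_const)"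
    using R by (simp add: \<phi>_def M_def power2_eq_square mult_ac)
qed


text \<open>\<open>W\<close> stands for the sum of the variances of \<open>g\<close> and
  \<open>h\<close>, \<open>X\<close> for the gradient term, \<open>m\<close> for the mean of
  \<open>g\<close> and \<open>c\<close> for V x0. Closeness of \<open>m\<close> to
  \<open>c * b\<close> with b > 0 makes \<open>m * c\<close> nonnegative up to an error, so the
  assumption bounds the variances and both means, hence the energy.\<close>

lemma small_center_algebra:
  fixes W X m c D e b v r :: real
  assumes W: "0 \<le> W" "W \<le> X" and r: "r > 0" and D: "r * (X + (m * c - W / 2)) \<le> D" and e: "\<bar>m - c * b\<bar> \<le> e" and b: "b > 0" and v: "v > 0"
  defines "Y \<equiv> D / r + e\<^sup>2 / (2 * b)"
  shows "W + m\<^sup>2 / v + c\<^sup>2 * v \<le> 2 * Y + (4 * Y * b + 2 * e\<^sup>2) / v + 2 * Y / b * v"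
proof -
  have "X + (m * c - W / 2) \<le> D / r" using D r by (simp add: field_simps)
  then have 1: "X / 2 + m * c \<le> D / r" using W by argo
  have "(m - c * b) * c \<ge> - (e * \<bar>c\<bar>)"
    using mult_right_mono[OF e abs_ge_zero[of c]] by (simp add: abs_mult[symmetric] abs_le_iff)
  moreover have "e * \<bar>c\<bar> \<le> e\<^sup>2 / (2 * b) + b * c\<^sup>2 / 2"
  proof -
    have "0 \<le> (e - b * \<bar>c\<bar>)\<^sup>2 / (2 * b)" using b by simp
    also have "\<dots> = e\<^sup>2 / (2 * b) + b * c\<^sup>2 / 2 - e * \<bar>c\<bar>"
      using b by (simp add: power2_eq_square field_simps)
    finally show ?thesis by simp
  qed
  moreover have "(m - c * b) * c = m * c - b * c\<^sup>2" by (simp add: power2_eq_square algebra_simps)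
  ultimately have 2: "m * c \<ge> b * c\<^sup>2 / 2 - e\<^sup>2 / (2 * b)" by linarith
  have Y: "X / 2 + b * c\<^sup>2 / 2 \<le> Y" using 1 2 unfolding Y_def by linarith
  have bc: "b * c\<^sup>2 \<ge> 0" using b by simp
  have "W \<le> 2 * Y" using Y W bc by linarith
  moreover have c2: "c\<^sup>2 \<le> 2 * Y / b" using Y W b by (simp add: field_simps)
  moreover have "m\<^sup>2 \<le> 4 * Y * b + 2 * e\<^sup>2"
  proof -
    have "m\<^sup>2 \<le> 2 * (c * b)\<^sup>2 + 2 * (m - c * b)\<^sup>2"
      using zero_le_power2[of "m - 2 * (c * b)"] by (simp add: power2_eq_square algebra_simps)
    also have "(m - c * b)\<^sup>2 \<le> e\<^sup>2" using power_mono[OF e abs_ge_zero, of 2] by simp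
    also have "(c * b)\<^sup>2 \<le> (2 * Y / b) * b\<^sup>2" unfolding power_mult_distrib using c2 by (rule mult_right_mono) simp
    finally show ?thesis using b by (simp add: power2_eq_square)
  qed
  ultimately show ?thesis using v by (intro add_mono divide_right_mono mult_right_mono) auto
qed

lemma (in frequency_ball) energy_split:
  assumes R: "0 < R" "R \<le> r0 / 4"
  defines "z \<equiv> (x0, 0::real)" and "g \<equiv> exp_lift lam U" and "h \<equiv> exp_lift lam V" and "v \<equiv> bump_vol TYPE((real^'n) \<times> real) 2"
  shows "bump_avg 2 (lift_energy lam U V) z R = bump_avg 2 (\<lambda>y. (g y)\<^sup>2) z R + bump_avg 2 (\<lambda>y. (h y)\<^sup>2) z R"
    "bump_avg 2 (lift_density lam U V) z R = bump_avg 2 (grad_norm_sq g) z R + bump_avg 2 (grad_norm_sq h) z R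
      + bump_avg 2 (\<lambda>y. g y * h y) z R + 2 * lam * bump_avg 2 (\<lambda>y. (g y)\<^sup>2) z R"
    "bump_avg 2 (\<lambda>y. g y * h y) z R \<ge> bump_avg 2 g z R * bump_avg 2 h z R / v
      - (bump_avg 2 (\<lambda>y. (g y)\<^sup>2) z R - (bump_avg 2 g z R)\<^sup>2 / v + (bump_avg 2 (\<lambda>y. (h y)\<^sup>2) z R - (bump_avg 2 h z R)\<^sup>2 / v)) / 2"
    "\<And>w. w \<in> {g, h} \<Longrightarrow> bump_avg 2 (\<lambda>y. (w y)\<^sup>2) z R - (bump_avg 2 w z R)\<^sup>2 / v \<ge> 0"
proof -
  let ?S = "ball x0 r0 \<times> (UNIV :: real set)" and ?T = "\<lambda>y. z + R *\<^sub>R y"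
  have "cball x0 R \<subseteq> ball x0 r0" using R r0 by (simp add: cball_subset_ball_iff)
  note zR = cball_lift_subset[OF this, of 0]
  obtain g' Lg where g': "has_laplacian_on g g' Lg ?S" using exp_lift_has_laplacian[OF ana(1) lam] unfolding g_def by blast
  obtain h' Lh where h': "has_laplacian_on h h' Lh ?S" using exp_lift_has_laplacian[OF ana(2) lam] unfolding h_def by blast
  have grad: "continuous_on ?S (grad_norm_sq f)" if f: "has_laplacian_on f f' L ?S" for f f' L
  proof -
    have D: "(f has_derivative f' y) (at y)" if "y \<in> ?S" for y using f that unfolding has_laplacian_on_def by blast
    have "continuous_on ?S (\<lambda>y. \<Sum>b\<in>Basis. (f' y b)\<^sup>2)"
      by (intro continuous_intros has_laplacian_on_continuous(2)[OF f])
    then show ?thesis by (rule continuous_on_eq) (rule grad_norm_sq_eq[OF D, symmetric])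
  qed
  have cT: "continuous_on (cball 0 1) (\<lambda>y. f (?T y))" if "continuous_on ?S f" for f :: "_ \<Rightarrow> real"
    using continuous_on_affine_compose[OF that zR] R by (simp add: z_def)
  have i: "integrable lborel (\<lambda>y. bump y ^ 2 * f (?T y))" if "continuous_on ?S f" for f
    by (intro integrable_bump cT that) simp
  note cg = has_laplacian_on_continuous(1)[OF g'] and ch = has_laplacian_on_continuous(1)[OF h']
  note cgh = i[OF continuous_on_mult[OF cg ch]] i[OF grad[OF g']] i[OF grad[OF h']]
    i[OF continuous_on_power[OF cg, of 2]] i[OF continuous_on_power[OF ch, of 2]]
  show "bump_avg 2 (lift_energy lam U V) z R = bump_avg 2 (\<lambda>y. (g y)\<^sup>2) z R + bump_avg 2 (\<lambda>y. (h y)\<^sup>2) z R"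
    unfolding bump_avg_def lift_energy_def g_def[symmetric] h_def[symmetric] using cgh by (simp add: distrib_left)
  have "bump_avg 2 (lift_density lam U V) z R = (LINT y|lborel. bump y ^ 2 * grad_norm_sq g (?T y) + bump y ^ 2 * grad_norm_sq h (?T y)
     + bump y ^ 2 * (g (?T y) * h (?T y)) + 2 * lam * (bump y ^ 2 * (g (?T y))\<^sup>2))"
    unfolding bump_avg_def lift_density_def g_def[symmetric] h_def[symmetric]
    by (rule Bochner_Integration.integral_cong) (auto simp: algebra_simps)
  then show "bump_avg 2 (lift_density lam U V) z R = bump_avg 2 (grad_norm_sq g) z R + bump_avg 2 (grad_norm_sq h) z R
      + bump_avg 2 (\<lambda>y. g y * h y) z R + 2 * lam * bump_avg 2 (\<lambda>y. (g y)\<^sup>2) z R"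
    unfolding bump_avg_def using cgh by simp
  show "bump_avg 2 (\<lambda>y. g y * h y) z R \<ge> bump_avg 2 g z R * bump_avg 2 h z R / v
      - (bump_avg 2 (\<lambda>y. (g y)\<^sup>2) z R - (bump_avg 2 g z R)\<^sup>2 / v + (bump_avg 2 (\<lambda>y. (h y)\<^sup>2) z R - (bump_avg 2 h z R)\<^sup>2 / v)) / 2"
    unfolding bump_avg_def v_def by (rule bump_covariance_ge[OF cT[OF cg] cT[OF ch] refl refl])
  have "bump_avg 2 (\<lambda>y. (w y)\<^sup>2) z R - (bump_avg 2 w z R)\<^sup>2 / v \<ge> 0" if "continuous_on ?S w" for w
    unfolding bump_avg_def v_def bump_variance_eq[OF cT[OF that] refl, symmetric]
    by (intro Bochner_Integration.integral_nonneg) simp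
  then show "bump_avg 2 (\<lambda>y. (w y)\<^sup>2) z R - (bump_avg 2 w z R)\<^sup>2 / v \<ge> 0" if "w \<in> {g, h}" for w
    using that cg ch by auto
qed

text \<open>
  If \<open>U x0 = 0\<close>, the means of \<open>g\<close> and \<open>h\<close> have a nearly nonnegative product, so the frequency bound
  controls the gradients, hence by the Poincare inequality the variances and then also the means, by
  \<open>O(\<surd>\<lambda>)\<close> times the energy.  Together with doubling, the energy would have to vanish.
\<close>

lemma center_nonzero_of_small_lam:
  assumes r0: "r0 > 0" and K: "K \<ge> 0"
  shows "\<exists>lam0>0. \<forall>lam (U :: real^'n \<Rightarrow> real) x0. frequency_ball r0 K lam U x0 \<longrightarrow> lam < lam0 \<longrightarrow> U x0 \<noteq> 0"
proof -
  let ?E = "TYPE((real^'n) \<times> real)"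
  define P where "P = poincare_const ?E"
  \<comment> \<open>The bound 1 / (1 + P) gives P R^2 \<le> 1, so the variances together are at most
    the gradient term.\<close>
  define R where "R = min (r0 / 4) (1 / (1 + P))"
  define v where "v = bump_vol ?E 2"
  define b where "b = bump_vol ?E 3 * R\<^sup>2 / 12"
  define \<gamma> where "\<gamma> = growth_const TYPE('n) * K"
  define kk where "kk = 4 * 4 ^ (CARD('n) + 1) / bump_vol ?E 1 * (2 * (1 + (r0 / 2)\<^sup>2)\<^sup>2)"
  \<comment> \<open>Chosen so that the square of the error in \<open>mean_lift\<close> is at most
    \<open>e1 * s * A\<close>.\<close>
  define e1 where "e1 = (12 * b)\<^sup>2 * exp (4 * r0) * kk * (r0 / 2 / R) powr \<gamma>"
  define y where "y = 2 * \<gamma> / R\<^sup>2 + e1 / (2 * b)"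
  \<comment> \<open>Collects doubling, the change of weight and \<open>small_center_algebra\<close>
    into one constant, for the final estimate A \<le> Q s A.\<close>
  define Q where "Q = 2 powr \<gamma> * (2 * 2 ^ (CARD('n) + 1)) * (2 * y + (4 * y * b + 2 * e1) / v + 2 * y / b * v)"
  have P: "P \<ge> 0" unfolding P_def by (rule poincare_const_nonneg)
  have R: "0 < R" "R \<le> r0 / 4" "R \<le> 1 / (1 + P)" using r0 P by (auto simp: R_def)
  have PR: "P * R\<^sup>2 \<le> 1"
  proof -
    have "R * R \<le> 1 / (1 + P) * 1" using R P by (intro mult_mono) (auto intro: order_trans[OF R(3)])
    then have "P * R\<^sup>2 \<le> P * (1 / (1 + P))" unfolding power2_eq_square using P by (intro mult_left_mono) auto
    also have "\<dots> \<le> 1" using P by simp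
    finally show ?thesis .
  qed
  have v: "v > 0" unfolding v_def by (rule bump_vol_pos) simp
  have b: "b > 0" unfolding b_def using R bump_vol_pos[of 3, where ?'a = "(real^'n) \<times> real"] by simp
  have \<gamma>: "\<gamma> \<ge> 0" unfolding \<gamma>_def using K growth_const_pos[where ?'n = 'n] by simp
  have "kk \<ge> 0" unfolding kk_def using bump_vol_pos[of 1, where ?'a = "(real^'n) \<times> real"] by simp
  then have e1: "e1 \<ge> 0" unfolding e1_def by simp
  have y: "y \<ge> 0" unfolding y_def using \<gamma> e1 b by simp
  have Q: "Q \<ge> 0" unfolding Q_def using y e1 b v by simp
  \<comment> \<open>The second bound makes Q \<surd>\<lambda> less than 1, which contradicts the
    final estimate.\<close>
  define lam0 where "lam0 = min 1 ((1 / (Q + 1))\<^sup>2)"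
  have "lam0 > 0" using Q by (simp add: lam0_def)
  moreover have "U x0 \<noteq> 0" if fb: "frequency_ball r0 K lam U x0" and small: "lam < lam0" for lam and U :: "real^'n \<Rightarrow> real" and x0
  proof
    assume zero: "U x0 = 0"
    interpret frequency_ball r0 K lam U x0 by fact
    define s where "s = sqrt lam"
    have s: "0 < s" "s \<le> 1" "lam = s\<^sup>2" using lam small by (auto simp: s_def lam0_def)
    have "s < sqrt ((1 / (Q + 1))\<^sup>2)" unfolding s_def using small by (intro real_sqrt_less_mono) (simp add: lam0_def)
    then have sQ: "s < 1 / (Q + 1)" using Q by simp
    have lam1: "lam \<le> 1" using s by (simp add: power_le_one)
    let ?z = "(x0, 0::real)"
    define g h where "g = exp_lift lam U" and "h = exp_lift lam V"
    define c where "c = V x0"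
    define m where "m = bump_avg 2 g ?z R"
    define A where "A = avg R"
    define Gg Gh where "Gg = bump_avg 2 (\<lambda>y. (g y)\<^sup>2) ?z R" and "Gh = bump_avg 2 (\<lambda>y. (h y)\<^sup>2) ?z R"
    define X where "X = bump_avg 2 (grad_norm_sq g) ?z R + bump_avg 2 (grad_norm_sq h) ?z R"
    define W where "W = (Gg - m\<^sup>2 / v) + (Gh - c\<^sup>2 * v)"
    define e where "e = lam * (R\<^sup>2 * bump_vol ?E 3 * exp (sqrt lam * r0) * sup_const)"
    have hm: "bump_avg 2 h ?z R = c * v" and me: "\<bar>m - c * b\<bar> \<le> e"
      using mean_lift[OF zero R(1,2)] by (simp_all add: h_def c_def v_def m_def g_def b_def e_def mult_ac)
    have cv: "(c * v)\<^sup>2 / v = c\<^sup>2 * v" using v by (simp add: power2_eq_square)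
    then have hmv: "(bump_avg 2 h ?z R)\<^sup>2 / v = c\<^sup>2 * v" unfolding hm .
    note split = energy_split[OF R(1,2), folded g_def h_def v_def, folded m_def Gg_def Gh_def]
    have A: "A > 0"
    proof -
      have "avg (r0 / 2) \<le> (r0 / 2 / R) powr (growth_const TYPE('n) * K * sqrt lam) * avg R"
        by (rule avg_growth) (use R r0 in auto)
      then show ?thesis using avg_pos avg_nonneg[of R] unfolding A_def by (cases "avg R = 0") auto
    qed
    have "cball x0 R \<subseteq> ball x0 r0" using R r0 by (simp add: cball_subset_ball_iff)
    note zR = cball_lift_subset[OF this, of 0] and BR = this
    have var: "bump_avg 2 (\<lambda>y. (exp_lift lam w y)\<^sup>2) ?z R - (bump_avg 2 (exp_lift lam w) ?z R)\<^sup>2 / v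
      \<le> P * (R\<^sup>2 * bump_avg 2 (grad_norm_sq (exp_lift lam w)) ?z R)" if "real_analytic_on (ball x0 r0) w" for w
      unfolding P_def v_def by (rule bump_avg_variance_le[OF exp_lift_has_laplacian[OF that lam] zR R(1)])
    have X0: "bump_avg 2 (grad_norm_sq f) ?z R \<ge> 0" for f
      unfolding bump_avg_def grad_norm_sq_def by (intro Bochner_Integration.integral_nonneg mult_nonneg_nonneg sum_nonneg) auto
    have W0: "W \<ge> 0" using split(4)[of g] split(4)[of h] unfolding W_def Gg_def Gh_def m_def hmv by simp
    have "W \<le> P * R\<^sup>2 * X"
      using var[OF ana(1)] var[OF ana(2)]
      unfolding g_def[symmetric] h_def[symmetric] hmv W_def X_def Gg_def Gh_def m_def by (simp add: algebra_simps)
    also have "\<dots> \<le> 1 * X" using PR X0[of g] X0[of h] by (intro mult_right_mono) (auto simp: X_def)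
    finally have WX: "W \<le> X" by simp
    \<comment> \<open>The frequency bounds the whole density. Its product term is bounded below by
      the covariance estimate, and its nonnegative last term is dropped.\<close>
    have D: "R\<^sup>2 * (X + (m * c - W / 2)) \<le> 2 * \<gamma> * s * A"
    proof -
      have "m * (c * v) / v = m * c" using v by simp
      then have "m * c - W / 2 \<le> bump_avg 2 (\<lambda>y. g y * h y) ?z R"
        using split(3) unfolding hm cv W_def by simp
      moreover have "0 \<le> 2 * lam * Gg" unfolding Gg_def bump_avg_def using lam
        by (intro mult_nonneg_nonneg Bochner_Integration.integral_nonneg) auto
      ultimately have "X + (m * c - W / 2) \<le> bump_avg 2 (lift_density lam U V) ?z R"
        unfolding split(2) X_def by linarith
      then have "R\<^sup>2 * (X + (m * c - W / 2)) \<le> R\<^sup>2 * bump_avg 2 (lift_density lam U V) ?z R"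
        by (rule mult_left_mono) simp
      also have "\<dots> \<le> 2 * growth_const TYPE('n) * (K * sqrt lam) * bump_avg 1 (lift_energy lam U V) ?z R"
        unfolding V_def[abs_def]
        by (rule bump_avg_lift_density_le[OF eig lam BR _ nz_ball freq R(1) order.refl]) (use K lam R r0 in auto)
      finally show ?thesis by (simp add: A_def avg_def \<gamma>_def s_def mult_ac)
    qed
    \<comment> \<open>The error \<open>e\<close> carries the factor \<lambda> = s^2, and s^4 \<le>
      s. Its other factor \<open>sup_const\<close> is compared with \<open>A\<close> by doubling
      from radius \<open>R\<close> to r0 / 2.\<close>
    have e2: "e\<^sup>2 \<le> e1 * s * A"
    proof -
      have "sup_const\<^sup>2 = kk * exp (2 * s * r0) * avg (r0 / 2)"
        unfolding sup_const_def kk_def using avg_nonneg[of "r0 / 2"] bump_vol_pos[of 1, where ?'a = "(real^'n) \<times> real"]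
        by (simp add: s_def)
      also have "avg (r0 / 2) \<le> (r0 / 2 / R) powr (\<gamma> * s) * A"
        unfolding \<gamma>_def s_def A_def by (rule avg_growth) (use R r0 in auto)
      also have "(r0 / 2 / R) powr (\<gamma> * s) \<le> (r0 / 2 / R) powr \<gamma>"
        using R r0 s \<gamma> by (intro powr_mono) (auto simp: field_simps intro: mult_left_le)
      finally have M: "sup_const\<^sup>2 \<le> kk * exp (2 * s * r0) * ((r0 / 2 / R) powr \<gamma> * A)"
        using A \<open>kk \<ge> 0\<close> by (simp add: mult_left_mono mult_right_mono)
      have "e\<^sup>2 = lam\<^sup>2 * ((12 * b)\<^sup>2 * exp (2 * s * r0) * sup_const\<^sup>2)"
        by (simp add: e_def b_def s_def power_mult_distrib mult_ac flip: exp_double)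
      also have "\<dots> \<le> s * ((12 * b)\<^sup>2 * exp (2 * s * r0) * (kk * exp (2 * s * r0) * ((r0 / 2 / R) powr \<gamma> * A)))"
      proof (intro mult_mono M order.refl)
        have "s\<^sup>2 * s\<^sup>2 \<le> s * 1" using s by (intro mult_mono) (auto simp: power2_eq_square mult_le_one intro: mult_left_le)
        then show "lam\<^sup>2 \<le> s" by (simp add: s(3) power2_eq_square)
      qed (use s in auto)
      also have "\<dots> = s * ((12 * b)\<^sup>2 * exp (4 * s * r0) * (kk * ((r0 / 2 / R) powr \<gamma> * A)))"
      proof -
        have "exp (4 * s * r0) = exp (2 * s * r0) * exp (2 * s * r0)" by (simp flip: exp_add)
        then show ?thesis by (simp only: mult_ac)
      qed
      also have "\<dots> \<le> s * ((12 * b)\<^sup>2 * exp (4 * r0) * (kk * ((r0 / 2 / R) powr \<gamma> * A)))"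
        using s r0 A \<open>kk \<ge> 0\<close> by (intro mult_left_mono mult_right_mono) auto
      finally show ?thesis by (simp add: e1_def mult_ac)
    qed
    define Y where "Y = 2 * \<gamma> * s * A / R\<^sup>2 + e\<^sup>2 / (2 * b)"
    have Y: "Y \<le> y * (s * A)"
    proof -
      have "e\<^sup>2 / (2 * b) \<le> e1 * s * A / (2 * b)" using e2 b by (intro divide_right_mono) auto
      then show ?thesis by (simp add: Y_def y_def algebra_simps)
    qed
    have "Gg + Gh = W + m\<^sup>2 / v + c\<^sup>2 * v" by (simp add: W_def)
    also have "\<dots> \<le> 2 * Y + (4 * Y * b + 2 * e\<^sup>2) / v + 2 * Y / b * v"
      unfolding Y_def by (rule small_center_algebra[OF W0 WX _ D me b v]) (use R in simp)
    also have "\<dots> \<le> 2 * (y * (s * A)) + (4 * (y * (s * A)) * b + 2 * (e1 * s * A)) / v + 2 * (y * (s * A)) / b * v"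
      using Y e2 b v by (intro add_mono divide_right_mono mult_right_mono mult_left_mono) auto
    also have "\<dots> = (2 * y + (4 * y * b + 2 * e1) / v + 2 * y / b * v) * (s * A)"
      using b v by (simp add: field_simps)
    finally have G: "Gg + Gh \<le> (2 * y + (4 * y * b + 2 * e1) / v + 2 * y / b * v) * (s * A)" .
    \<comment> \<open>So far an average with weight bump^2 is bounded by \<open>A\<close>, which has
      weight bump; doubling from half the radius together with \<open>bump_avg_half\<close> closes
      the loop.\<close>
    have "A \<le> (R / (R / 2)) powr (growth_const TYPE('n) * K * sqrt lam) * avg (R / 2)"
      unfolding A_def by (rule avg_growth) (use R r0 in auto)
    also have "\<dots> = 2 powr (\<gamma> * s) * avg (R / 2)" using R by (simp add: \<gamma>_def s_def)
    also have "\<dots> \<le> 2 powr \<gamma> * (2 * 2 ^ DIM((real^'n) \<times> real) * bump_avg 2 (lift_energy lam U V) ?z R)"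
    proof (intro mult_mono)
      show "2 powr (\<gamma> * s) \<le> 2 powr \<gamma>" using s \<gamma> by (intro powr_mono) (auto intro: mult_left_le)
      show "avg (R / 2) \<le> 2 * 2 ^ DIM((real^'n) \<times> real) * bump_avg 2 (lift_energy lam U V) ?z R"
      proof -
        obtain F' where "has_laplacian_on (lift_energy lam U V) F' (\<lambda>y. 2 * lift_density lam U V y) (ball x0 r0 \<times> UNIV)"
          using lift_energy_has_laplacian[OF eig_V lam] by blast
        from continuous_on_subset[OF has_laplacian_on_continuous(1)[OF this] zR]
        show ?thesis unfolding avg_def by (rule bump_avg_half[OF _ lift_energy_nonneg R(1)])
      qed
    qed (use avg_nonneg in auto)
    also have "\<dots> = 2 powr \<gamma> * (2 * 2 ^ (CARD('n) + 1)) * (Gg + Gh)" unfolding split(1) by simp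
    also have "\<dots> \<le> 2 powr \<gamma> * (2 * 2 ^ (CARD('n) + 1)) * ((2 * y + (4 * y * b + 2 * e1) / v + 2 * y / b * v) * (s * A))"
      using G by (rule mult_left_mono) simp
    also have "\<dots> = Q * s * A" by (simp add: Q_def mult_ac)
    finally have "1 \<le> Q * s" using A by simp
    moreover have "(Q + 1) * s < 1" using sQ Q by (simp add: field_simps)
    ultimately show False using s by (simp add: algebra_simps)
  qed
  ultimately show ?thesis by blast
qed

section \<open>Covering the inner domain\<close>

lemma laplacian_linear_combination:
  assumes "real_analytic_on S f" "real_analytic_on S g" "open S" "x \<in> S"
  shows "laplacian (\<lambda>x. a * f x + b * g x) x = a * laplacian f x + b * laplacian g x"
proof -
  have "(dir_deriv e ^^ 2) (\<lambda>x. a * f x + b * g x) x = a * (dir_deriv e ^^ 2) f x + b * (dir_deriv e ^^ 2) g x" for e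
  proof -
    have "dir_deriv e (dir_deriv e (\<lambda>x. a * f x + b * g x)) x = dir_deriv e (\<lambda>x. a * dir_deriv e f x + b * dir_deriv e g x) x"
      using assms by (intro dir_deriv_cong[OF assms(3,4)] dir_deriv_linear_combination) auto
    also have "\<dots> = a * dir_deriv e (dir_deriv e f) x + b * dir_deriv e (dir_deriv e g) x"
      using assms by (intro dir_deriv_linear_combination real_analytic_on_dir_deriv)
    finally show ?thesis by (simp add: numeral_2_eq_2)
  qed
  then show ?thesis unfolding laplacian_eq_dir_deriv by (simp add: sum.distrib sum_distrib_left)
qed

lemma hausdorff_finite_Union_le:
  "finite I \<Longrightarrow> hausdorff d (\<Union>i\<in>I. A i) \<le> (\<Sum>i\<in>I. hausdorff d (A i))"
proof (induction I rule: finite_induct)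
  case (insert i I)
  have "hausdorff d (\<Union>i\<in>insert i I. A i) \<le> hausdorff d (A i) + hausdorff d (\<Union>i\<in>I. A i)"
    using hausdorff_Un by simp
  also have "\<dots> \<le> hausdorff d (A i) + (\<Sum>i\<in>I. hausdorff d (A i))" by (rule add_left_mono[OF insert.IH])
  finally show ?case using insert by simp
qed (simp add: hausdorff_empty)

text \<open>Points outside the tube have distance more than R0 from a nonempty
  \<open>\<Gamma>\<close>, so no point of \<open>\<Gamma>\<close> is a limit of them; for empty
  \<open>\<Gamma>\<close> there is nothing to avoid.\<close>

lemma inner_domain_subset:
  assumes "R0 > 0" "\<Gamma> \<subseteq> frontier \<Omega>"
  shows "inner_domain \<Omega> \<Gamma> R0 \<subseteq> closure \<Omega> - \<Gamma>"
proof
  fix x assume x: "x \<in> inner_domain \<Omega> \<Gamma> R0"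
  then have "x \<in> closure \<Omega>" unfolding inner_domain_def using closure_mono[of "\<Omega> - tube \<Omega> \<Gamma> R0" \<Omega>] by auto
  moreover have "x \<notin> \<Gamma>"
  proof
    assume xG: "x \<in> \<Gamma>"
    obtain y where y: "y \<in> \<Omega> - tube \<Omega> \<Gamma> R0" "dist y x < R0"
      using x assms(1) unfolding inner_domain_def closure_approachable by blast
    have "infdist y \<Gamma> \<le> R0" using infdist_le[OF xG, of y] y(2) by simp
    then have "y \<in> tube \<Omega> \<Gamma> R0" using xG y(1) closure_subset[of \<Omega>] by (auto simp: tube_def)
    with y show False by simp
  qed
  ultimately show "x \<in> closure \<Omega> - \<Gamma>" by simp
qed

text \<open>The ball may leave \<open>\<Omega>\<close>, where the equation for \<open>u\<close>
  gives no information. It holds for \<open>U\<close> on the part inside \<open>\<Omega>\<close> and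
  extends to the ball by the identity theorem. Conversely, if \<open>U\<close> vanished on the ball,
  it would vanish on the connected set \<open>\<Omega>\<close>, against \<open>u\<close> being
  nonzero.\<close>

lemma frequency_ball_of_extension:
  assumes \<Omega>: "open \<Omega>" "connected \<Omega>" and \<Gamma>: "\<Gamma> \<subseteq> frontier \<Omega>" and R0: "R0 > 0" and K: "K \<ge> 0" and lam: "lam > 0"
    and u: "eigenfunction \<Omega> a1 a2 lam u" and ext: "analytic_extension \<Omega> \<Gamma> u W U"
    and x0: "x0 \<in> inner_domain \<Omega> \<Gamma> R0" and ball: "ball x0 (R0 / 2) \<subseteq> W"
    and freq: "\<And>r. 0 < r \<Longrightarrow> r < R0 / 2 \<Longrightarrow> frequency lam U (x0, 0) r \<le> K * sqrt lam"
  shows "frequency_ball (R0 / 2) K lam U x0"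
proof
  let ?B = "ball x0 (R0 / 2)"
  have W: "real_analytic_on W U" "closure \<Omega> - \<Gamma> \<subseteq> W" "\<And>x. x \<in> closure \<Omega> - \<Gamma> \<Longrightarrow> U x = u x"
    using ext by (auto simp: analytic_extension_def)
  have "\<Gamma> \<inter> \<Omega> = {}" using \<Gamma> \<Omega>(1) frontier_disjoint_eq[of \<Omega>] by blast
  then have "\<Omega> \<subseteq> closure \<Omega> - \<Gamma>" using closure_subset[of \<Omega>] by blast
  then have \<Omega>W: "\<Omega> \<subseteq> W" and Uu: "\<And>x. x \<in> \<Omega> \<Longrightarrow> U x = u x" using W by auto
  note aB = real_analytic_on_subset[OF W(1) ball] and a\<Omega> = real_analytic_on_subset[OF W(1) \<Omega>W]
  have "x0 \<in> closure \<Omega>" using inner_domain_subset[OF R0 \<Gamma>] x0 by blast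
  then have "x0 \<in> ?B \<inter> closure \<Omega>" using R0 by simp
  then have "?B \<inter> closure \<Omega> \<noteq> {}" by blast
  then have meet: "\<Omega> \<inter> ?B \<noteq> {}"
    using open_Int_closure_eq_empty[OF open_ball, of x0 "R0 / 2" \<Omega>] by (simp add: Int_commute[of \<Omega>])
  have bi: "laplacian (laplacian U) x - lam\<^sup>2 * U x = 0" if "x \<in> ?B" for x
  proof (rule real_analytic_on_identity[OF _ open_ball connected_ball \<Omega>(1) meet _ that])
    have "real_analytic_on ?B (\<lambda>x. laplacian (laplacian U) x + (- lam\<^sup>2) * U x)"
      by (intro real_analytic_on_add real_analytic_on_cmult real_analytic_on_laplacian aB)
    then show "real_analytic_on ?B (\<lambda>x. laplacian (laplacian U) x - lam\<^sup>2 * U x)" by simp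
    fix y assume "y \<in> \<Omega> \<inter> ?B"
    then have y: "y \<in> \<Omega>" by simp
    have "laplacian (laplacian U) y = laplacian (laplacian u) y"
      by (intro laplacian_cong[OF \<Omega>(1)] y Uu)
    then show "laplacian (laplacian U) y - lam\<^sup>2 * U y = 0" using u y Uu[OF y] by (simp add: eigenfunction_def)
  qed
  let ?V = "\<lambda>x. laplacian U x - lam * U x"
  have V: "?V = (\<lambda>x. 1 * laplacian U x + (- lam) * U x)" by (auto simp: fun_eq_iff)
  show "eig_pair lam ?B U ?V"
    unfolding eig_pair_def
  proof (intro conjI ballI open_ball aB)
    have "real_analytic_on ?B (\<lambda>x. laplacian U x + (- lam) * U x)"
      by (intro real_analytic_on_add real_analytic_on_cmult real_analytic_on_laplacian aB)
    then show "real_analytic_on ?B ?V" by simp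
    fix x assume x: "x \<in> ?B"
    show "laplacian U x = lam * U x + ?V x" by simp
    have "laplacian ?V x = 1 * laplacian (laplacian U) x + (- lam) * laplacian U x"
      unfolding V by (rule laplacian_linear_combination[OF real_analytic_on_laplacian[OF aB] aB open_ball x])
    then show "laplacian ?V x = - lam * ?V x" using bi[OF x] by (simp add: power2_eq_square algebra_simps)
  qed
  show "\<exists>x\<in>?B. U x \<noteq> 0"
  proof (rule ccontr)
    assume "\<not> ?thesis"
    then have zero: "U x = 0" if "x \<in> ?B \<inter> \<Omega>" for x using that by blast
    have "?B \<inter> \<Omega> \<noteq> {}" using meet by (simp add: Int_commute)
    then have "U x = 0" if "x \<in> \<Omega>" for x
      using real_analytic_on_identity[OF a\<Omega> \<Omega> open_ball _ zero that] by blast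
    then show False using u Uu by (auto simp: eigenfunction_def)
  qed
qed (use R0 K lam freq in auto)

theorem theorem4p8:
  fixes \<Omega> \<Gamma> :: "(real^'n) set"
    and a1 a2 :: "('n \<Rightarrow> nat) \<Rightarrow> real^'n \<Rightarrow> real"
    and R0 :: real
  assumes "CARD('n) \<ge> 2"
    and "open \<Omega>" and "connected \<Omega>" and "\<Omega> \<noteq> {}" and "bounded \<Omega>"
    and "boundary_of_class smooth_on \<Omega> (frontier \<Omega>)"
    and "admissible_singular_set \<Omega> \<Gamma>"
    and "boundary_of_class real_analytic_on \<Omega> (frontier \<Omega> - \<Gamma>)"
    and "admissible_coefficients \<Omega> \<Gamma> a1"
    and "admissible_coefficients \<Omega> \<Gamma> a2"
    and "frequency_radius \<Omega> \<Gamma> a1 a2 R0"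
  shows "\<exists>C>0. \<forall>lam>0. \<forall>u. eigenfunction \<Omega> a1 a2 lam u \<longrightarrow>
           hausdorff (CARD('n) - 1) {x \<in> inner_domain \<Omega> \<Gamma> R0. u x = 0} \<le> ennreal (C * sqrt lam)"
proof -
  have R0: "R0 > 0" using assms(11) by (simp add: frequency_radius_def)
  have \<Gamma>: "\<Gamma> \<subseteq> frontier \<Omega>" using assms(7) unfolding admissible_singular_set_def by blast
  obtain K where K: "K > 0" and freq: "\<forall>lam>0. \<forall>u. eigenfunction \<Omega> a1 a2 lam u \<longrightarrow>
        (\<exists>W U. analytic_extension \<Omega> \<Gamma> u W U \<and>
           (\<forall>x\<in>inner_domain \<Omega> \<Gamma> R0. ball x (R0 / 2) \<subseteq> W \<and>
              (\<forall>r. 0 < r \<and> r < R0 / 2 \<longrightarrow> frequency lam U (x, 0) r \<le> K * sqrt lam)))"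
    using assms(11) unfolding frequency_radius_def by blast
  define r0 where "r0 = R0 / 2"
  have r0: "r0 > 0" using R0 by (simp add: r0_def)
  have ext: "\<exists>U. (\<forall>x\<in>inner_domain \<Omega> \<Gamma> R0. U x = u x \<and> frequency_ball r0 K lam U x)"
    if lam: "lam > 0" and u: "eigenfunction \<Omega> a1 a2 lam u" for lam u
  proof -
    obtain W U where WU: "analytic_extension \<Omega> \<Gamma> u W U"
      "\<forall>x\<in>inner_domain \<Omega> \<Gamma> R0. ball x (R0 / 2) \<subseteq> W \<and>
              (\<forall>r. 0 < r \<and> r < R0 / 2 \<longrightarrow> frequency lam U (x, 0) r \<le> K * sqrt lam)"
      by (rule exE[OF freq[rule_format, OF lam u]]) (elim exE conjE)
    have "frequency_ball r0 K lam U x" if x: "x \<in> inner_domain \<Omega> \<Gamma> R0" for x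
      unfolding r0_def using WU(2) x
      by (intro frequency_ball_of_extension[OF assms(2,3) \<Gamma> R0 less_imp_le[OF K] lam u WU(1) x]) auto
    moreover have "U x = u x" if "x \<in> inner_domain \<Omega> \<Gamma> R0" for x
      using WU(1) inner_domain_subset[OF R0 \<Gamma>] that by (auto simp: analytic_extension_def)
    ultimately show ?thesis by blast
  qed
  obtain C where C: "C \<ge> 0" "\<forall>lam (U :: real^'n \<Rightarrow> real) x0. frequency_ball r0 K lam U x0 \<longrightarrow>
    hausdorff (CARD('n) - 1) {x \<in> cball x0 (local_radius TYPE('n) r0). U x = 0} \<le> ennreal (C * (1 + sqrt lam))"
    using hausdorff_zero_set_local[OF r0 less_imp_le[OF K], where ?'n = 'n] by blast
  obtain lam0 where lam0: "lam0 > 0" "\<forall>lam (U :: real^'n \<Rightarrow> real) x0. frequency_ball r0 K lam U x0 \<longrightarrow> lam < lam0 \<longrightarrow> U x0 \<noteq> 0"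
    using center_nonzero_of_small_lam[OF r0 less_imp_le[OF K], where ?'n = 'n] by blast
  define \<rho> where "\<rho> = local_radius TYPE('n) r0"
  have \<rho>: "\<rho> > 0" using line_step(1)[OF r0, where ?'n = 'n] by (simp add: \<rho>_def local_radius_def)
  have "compact (inner_domain \<Omega> \<Gamma> R0)"
    unfolding inner_domain_def compact_closure using bounded_subset[OF assms(5)] by blast
  \<comment> \<open>The cover depends on the inner domain and the radius only, not on
    \<open>lam\<close> or \<open>u\<close>, so its cardinality may enter the constant.\<close>
  then obtain T where T: "T \<subseteq> inner_domain \<Omega> \<Gamma> R0" "finite T" "inner_domain \<Omega> \<Gamma> R0 \<subseteq> (\<Union>x\<in>T. ball x \<rho>)"
    by (rule compactE_image[where f = "\<lambda>x. ball x \<rho>" and C = "inner_domain \<Omega> \<Gamma> R0"]) (use \<rho> in auto)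
  \<comment> \<open>For lam \<ge> lam0 the summand 1 in the local bound is at most
    \<open>sqrt lam / sqrt lam0\<close>. The final + 1 makes the constant positive even when the
    cover is empty or \<open>C\<close> is 0.\<close>
  define D where "D = real (card T) * C * (1 / sqrt lam0 + 1) + 1"
  have "D > 0" unfolding D_def using C(1) lam0(1) by (intro add_nonneg_pos mult_nonneg_nonneg) auto
  moreover have "hausdorff (CARD('n) - 1) {x \<in> inner_domain \<Omega> \<Gamma> R0. u x = 0} \<le> ennreal (D * sqrt lam)"
    if lam: "lam > 0" and u: "eigenfunction \<Omega> a1 a2 lam u" for lam u
  proof -
    obtain U where U: "\<forall>x\<in>inner_domain \<Omega> \<Gamma> R0. U x = u x \<and> frequency_ball r0 K lam U x" by (rule exE[OF ext[OF lam u]])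
    show ?thesis
    proof (cases "lam < lam0")
      case True
      \<comment> \<open>Each point of the inner domain is the centre of a ball of its own, so
        nonvanishing at centres excludes all zeros.\<close>
      have "u x \<noteq> 0" if "x \<in> inner_domain \<Omega> \<Gamma> R0" for x
        using U[rule_format, OF that] lam0(2)[rule_format, OF _ True, of U x] by simp
      then have "{x \<in> inner_domain \<Omega> \<Gamma> R0. u x = 0} = {}" by blast
      then show ?thesis by (simp only: hausdorff_empty zero_le)
    next
      case False
      have "{x \<in> inner_domain \<Omega> \<Gamma> R0. u x = 0} \<subseteq> (\<Union>x0\<in>T. {x \<in> cball x0 \<rho>. U x = 0})"
      proof
        fix x assume x: "x \<in> {x \<in> inner_domain \<Omega> \<Gamma> R0. u x = 0}"
        then obtain x0 where "x0 \<in> T" "x \<in> ball x0 \<rho>" using T(3) by blast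
        moreover from this have "x \<in> {x \<in> cball x0 \<rho>. U x = 0}" using x U by simp
        ultimately show "x \<in> (\<Union>x0\<in>T. {x \<in> cball x0 \<rho>. U x = 0})" by blast
      qed
      then have "hausdorff (CARD('n) - 1) {x \<in> inner_domain \<Omega> \<Gamma> R0. u x = 0} \<le> hausdorff (CARD('n) - 1) (\<Union>x0\<in>T. {x \<in> cball x0 \<rho>. U x = 0})"
        by (rule hausdorff_mono)
      also have "\<dots> \<le> (\<Sum>x0\<in>T. hausdorff (CARD('n) - 1) {x \<in> cball x0 \<rho>. U x = 0})"
        by (rule hausdorff_finite_Union_le[OF T(2)])
      also have "\<dots> \<le> (\<Sum>x0\<in>T. ennreal (C * (1 + sqrt lam)))"
        unfolding \<rho>_def using U T(1) by (intro sum_mono C(2)[rule_format]) auto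
      also have "\<dots> = ennreal (real (card T) * (C * (1 + sqrt lam)))"
        using C(1) lam by (simp add: ennreal_mult' ennreal_of_nat_eq_real_of_nat)
      also have "\<dots> \<le> ennreal (D * sqrt lam)"
      proof (rule ennreal_leI)
        have "1 \<le> 1 / sqrt lam0 * sqrt lam" using False lam0(1) by simp
        then have "1 + sqrt lam \<le> (1 / sqrt lam0 + 1) * sqrt lam" by (simp add: distrib_right)
        then have "real (card T) * C * (1 + sqrt lam) \<le> real (card T) * C * ((1 / sqrt lam0 + 1) * sqrt lam)"
          using C(1) by (intro mult_left_mono) auto
        moreover have "D * sqrt lam = real (card T) * C * ((1 / sqrt lam0 + 1) * sqrt lam) + sqrt lam"
          by (simp add: D_def algebra_simps)
        ultimately show "real (card T) * (C * (1 + sqrt lam)) \<le> D * sqrt lam"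
          using real_sqrt_ge_zero[OF less_imp_le[OF lam]] unfolding mult.assoc by linarith
      qed
      finally show ?thesis .
    qed
  qed
  ultimately show ?thesis by blast
qed

end
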